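(* Let $\mathbb{F}$ be a field of characteristic different from $2$. Let $b$ be a non-degenerate symmetric bilinear form on a finite-dimensional vector space $V$ over $\mathbb{F}$, and let $u$ be a $b$-selfadjoint endomorphism of $V$. For $u$ to be the sum of two $b$-selfadjoint square-zero endomorphisms of $V$, it is necessary and sufficient that all the following conditions hold: (i) for every $p\in\mathrm{Irr}_0(\mathbb{F})$ and every integer $r\ge1$, the quadratic form attached to $(b,u)_{p,r}$ is skew-representable; (ii) for every $p\in\mathrm{Irr}(\mathbb{F})\setminus(\mathrm{Irr}_0(\mathbb{F})\cup\{t\})$ and every integer $k\ge1$, the symmetric bilinear forms $(b,u)_{p,k}$ and $(-1)^{1+(k-1)\deg p}\,\bigl((b,u)_{p^{\mathrm{op}},k}\bigr)^{\mathrm{op}}$ are equivalent over the field $\mathbb{F}[t]/(p)$; (iii) for every integer $k\ge0$, the non-degenerate symmetric bilinear form $(b,u)_{t,2k+1}$ Witt-simplifies $\underset{i>k}{\bot}\,(b,u)_{t,2i+1}$.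
   Context: $u$ is $b$-selfadjoint if $b(u(x),y)=b(x,u(y))$ for all $x,y$. $\mathrm{Irr}(\mathbb{F})$ is the set of monic irreducible polynomials of $\mathbb{F}[t]$, and $\mathrm{Irr}_0(\mathbb{F})=\mathrm{Irr}(\mathbb{F})\cap\mathbb{F}[t^2]$. For nonzero $p\in\mathbb{F}[t]$, $p^{\mathrm{op}}:=(-1)^{\deg p}p(-t)$. Quadratic invariants. Let $p\in\mathrm{Irr}(\mathbb{F})$ have degree $d$, $k\ge1$ and $\mathbb{L}:=\mathbb{F}[t]/(p)$. Let $e_p:\mathbb{L}\to\mathbb{F}$ be the $\mathbb{F}$-linear form with $e_p(\overline{1})=1$ and $e_p(\overline{t^i})=0$ for $1\le i\le d-1$. Set $V_{p,k}:=\mathrm{Ker}\,p(u)^k/\bigl(\mathrm{Ker}\,p(u)^{k-1}+(\mathrm{Ker}\,p(u)^k\cap\mathrm{Im}\,p(u))\bigr)$, an $\mathbb{L}$-vector space (the class of $t$ acting through $u$). The form $(x,y)\mapsto b(x,p(u)^{k-1}[y])$ induces a non-degenerate $\mathbb{F}$-bilinear form $B$ on $V_{p,k}$, and $(b,u)_{p,k}$ denotes the unique map $B^{\mathbb{L}}:V_{p,k}^2\to\mathbb{L}$ such that $B(x,\lambda y)=e_p(\lambda B^{\mathbb{L}}(x,y))$ for all $\lambda\in\mathbb{L}$ and all $x,y$; it is a non-degenerate symmetric $\mathbb{L}$-bilinear form. (For $p=t$ it is simply the form over $\mathbb{F}$ induced by $(x,y)\mapsto b(x,u^{k-1}(y))$.)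 Skew-representability. For $p\in\mathrm{Irr}_0(\mathbb{F})$, $\mathbb{L}=\mathbb{F}[t]/(p)$ carries the involution $x\mapsto x^\bullet$ taking the class of $r(t)$ to that of $r(-t)$. A quadratic form $Q$ on a finite-dimensional $\mathbb{L}$-vector space is skew-representable if there is a $Q$-orthogonal basis $(e_1,\dots,e_n)$ with $Q(e_i)^\bullet=-Q(e_i)$ for all $i$. The quadratic form attached to a symmetric bilinear form $C$ is $x\mapsto C(x,x)$. Opposite form. For $p\in\mathrm{Irr}(\mathbb{F})\setminus\mathrm{Irr}_0(\mathbb{F})$, let $\mathbb{L}=\mathbb{F}[t]/(p)$, $\mathbb{L}^{\mathrm{op}}=\mathbb{F}[t]/(p^{\mathrm{op}})$ and let $\varphi:\mathbb{L}^{\mathrm{op}}\to\mathbb{L}$ be the isomorphism taking the class of $q(t)$ to the class of $q(-t)$. For a bilinear form $C$ on an $\mathbb{L}^{\mathrm{op}}$-vector space $W$, $C^{\mathrm{op}}:=\varphi\circ C$ is the bilinear form on the $\mathbb{L}$-vector space having the same underlying abelian group as $W$ and scalar multiplication $\lambda\cdot x:=\varphi^{-1}(\lambda)x$. Witt-simplification. For a non-degenerate symmetric bilinear form $B$ over $\mathbb{F}$, $\nu(B)$ (Witt index) is the greatest dimension of a totally $B$-isotropic subspace and $\mathrm{rk}(B)$ is the dimension of its space; $B$ is the orthogonal sum of a hyperbolic form of rank $2\nu(B)$ and of a nonisotropic form, unique up to equivalence, called a nonisotropic part of $B$. $B$ Witt-simplifies $B'$ if every nonisotropic part of $B'$ is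 equivalent to a subform of $-B$ (restriction of $-B$ to a linear subspace); equivalently $\nu(B')+\nu(B'\bot B)\ge\mathrm{rk}(B')$. *)

theory Defs
  imports
    "HOL-Computational_Algebra.Polynomial_Factorial"
    "HOL-Algebra.QuotRing"
    "Jordan_Normal_Form.VS_Connect"
begin

text \<open>
  The base field is a type of class \<open>field\<close>, and \<open>V\<close> is a vector space on a type, as in
  \<open>HOL.Vector_Spaces\<close>. The residue fields \<open>\<bbbF>[t]/(p)\<close> and the quotient spaces built from \<open>V\<close>
  depend on values, so they are records of \<open>HOL-Algebra\<close>, whose elements are genuine cosets;
  bases, dimensions and linear maps between them are those of the AFP entry \<open>VectorSpace\<close>.
\<close>

section \<open>Bilinear forms and endomorphisms on the ambient space\<close>

definition bilinear_form ::
  "('a::field \<Rightarrow> 'v::ab_group_add \<Rightarrow> 'v) \<Rightarrow> ('v \<Rightarrow> 'v \<Rightarrow> 'a) \<Rightarrow> bool" where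
  "bilinear_form scale b \<longleftrightarrow>
     (\<forall>x. Vector_Spaces.linear scale (*) (\<lambda>y. b x y)) \<and>
     (\<forall>y. Vector_Spaces.linear scale (*) (\<lambda>x. b x y))"

definition symmetric_form :: "('v \<Rightarrow> 'v \<Rightarrow> 'a) \<Rightarrow> bool" where
  "symmetric_form b \<longleftrightarrow> (\<forall>x y. b x y = b y x)"

definition nondegenerate_form :: "('v::zero \<Rightarrow> 'v \<Rightarrow> 'a::zero) \<Rightarrow> bool" where
  "nondegenerate_form b \<longleftrightarrow> (\<forall>x. (\<forall>y. b x y = 0) \<longrightarrow> x = 0)"

definition selfadjoint :: "('v \<Rightarrow> 'v \<Rightarrow> 'a) \<Rightarrow> ('v \<Rightarrow> 'v) \<Rightarrow> bool" where
  "selfadjoint b u \<longleftrightarrow> (\<forall>x y. b (u x) y = b x (u y))"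

definition square_zero :: "('v::zero \<Rightarrow> 'v) \<Rightarrow> bool" where
  "square_zero u \<longleftrightarrow> (\<forall>x. u (u x) = 0)"

definition poly_endo ::
  "('a::field \<Rightarrow> 'v::ab_group_add \<Rightarrow> 'v) \<Rightarrow> 'a poly \<Rightarrow> ('v \<Rightarrow> 'v) \<Rightarrow> 'v \<Rightarrow> 'v" where
  "poly_endo scale q u x = (\<Sum>i\<le>degree q. scale (coeff q i) ((u ^^ i) x))"

section \<open>Irreducible polynomials and their residue fields\<close>

definition Irr :: "'a::field poly set" where
  "Irr = {p. lead_coeff p = 1 \<and> irreducible p}"

text \<open>The polynomial \<open>[:0, 0, 1:]\<close> is \<open>t\<^sup>2\<close>, so that the range below is \<open>\<bbbF>[t\<^sup>2]\<close>.\<close>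

definition Irr0 :: "'a::field poly set" where
  "Irr0 = Irr \<inter> range (\<lambda>q. pcompose q [:0, 0, 1:])"

definition neg_arg :: "'a::field poly \<Rightarrow> 'a poly" where
  "neg_arg q = pcompose q [:0, - 1:]"

definition op_poly :: "'a::field poly \<Rightarrow> 'a poly" where
  "op_poly p = Polynomial.smult ((- 1) ^ degree p) (neg_arg p)"

definition residue_field :: "'a::field poly \<Rightarrow> 'a poly set ring" where
  "residue_field p = class_ring Quot (PIdl\<^bsub>class_ring\<^esub> p)"

text \<open>
  The \<open>\<bbbF>\<close>-linear form \<open>e\<^sub>p\<close>: the coordinate on the class of \<open>1\<close> in the basis formed by the classes
  of \<open>1, t, \<dots>, t\<^sup>d\<^sup>-\<^sup>1\<close>, where \<open>d = deg p\<close>. The polynomial \<open>q mod p\<close> is the same for all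
  \<open>q\<close> in a class.
\<close>

definition residue_form :: "'a::field poly \<Rightarrow> 'a poly set \<Rightarrow> 'a" where
  "residue_form p L = the_elem ((\<lambda>q. coeff (q mod p) 0) ` L)"

text \<open>
  Elementwise substitution of \<open>-t\<close> for \<open>t\<close>. It sends the class of \<open>q(t)\<close> modulo \<open>p\<^sup>o\<^sup>p\<close> to the
  class of \<open>q(-t)\<close> modulo \<open>p\<close>, and so is the isomorphism \<open>\<phi>\<close> from \<open>\<bbbF>[t]/(p\<^sup>o\<^sup>p)\<close> to \<open>\<bbbF>[t]/(p)\<close>;
  for \<open>p\<close> in \<open>Irr0\<close>, where \<open>p\<^sup>o\<^sup>p = p\<close>, it is the involution \<open>x \<mapsto> x\<^sup>\<bullet>\<close>.
\<close>

definition residue_neg :: "'a::field poly set \<Rightarrow> 'a poly set" where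
  "residue_neg L = neg_arg ` L"

section \<open>Forms on vector spaces over a field of \<open>HOL-Algebra\<close>\<close>

definition forms_equivalent ::
  "('c, 'r) ring_scheme \<Rightarrow> ('c, 'm, 's) module_scheme \<Rightarrow> ('m \<Rightarrow> 'm \<Rightarrow> 'c)
     \<Rightarrow> ('c, 'n, 's2) module_scheme \<Rightarrow> ('n \<Rightarrow> 'n \<Rightarrow> 'c) \<Rightarrow> bool" where
  "forms_equivalent K M C N D \<longleftrightarrow>
     (\<exists>f \<in> LinearCombinations.module_hom K M N. bij_betw f (carrier M) (carrier N) \<and>
        (\<forall>x \<in> carrier M. \<forall>y \<in> carrier M. D (f x) (f y) = C x y))"

definition quadratic_form_of :: "('m \<Rightarrow> 'm \<Rightarrow> 'c) \<Rightarrow> 'm \<Rightarrow> 'c" where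
  "quadratic_form_of C x = C x x"

definition polar_form ::
  "('c, 'r) ring_scheme \<Rightarrow> ('c, 'm, 's) module_scheme \<Rightarrow> ('m \<Rightarrow> 'c) \<Rightarrow> 'm \<Rightarrow> 'm \<Rightarrow> 'c" where
  "polar_form K M Q x y = Q (x \<oplus>\<^bsub>M\<^esub> y) \<ominus>\<^bsub>K\<^esub> Q x \<ominus>\<^bsub>K\<^esub> Q y"

definition skew_representable ::
  "('c, 'r) ring_scheme \<Rightarrow> ('c \<Rightarrow> 'c) \<Rightarrow> ('c, 'm, 's) module_scheme \<Rightarrow> ('m \<Rightarrow> 'c) \<Rightarrow> bool" where
  "skew_representable K \<sigma> M Q \<longleftrightarrow>
     (\<exists>E. finite E \<and> vectorspace.basis K M E \<and>
        (\<forall>x \<in> E. \<forall>y \<in> E. x \<noteq> y \<longrightarrow> polar_form K M Q x y = \<zero>\<^bsub>K\<^esub>) \<and>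
        (\<forall>x \<in> E. \<sigma> (Q x) = \<ominus>\<^bsub>K\<^esub> Q x))"

abbreviation subspace_module ::
  "('c, 'm, 's) module_scheme \<Rightarrow> 'm set \<Rightarrow> ('c, 'm, 's) module_scheme" where
  "subspace_module M W \<equiv> M\<lparr>carrier := W\<rparr>"

definition totally_isotropic :: "('c, 'r) ring_scheme \<Rightarrow> ('m \<Rightarrow> 'm \<Rightarrow> 'c) \<Rightarrow> 'm set \<Rightarrow> bool" where
  "totally_isotropic K C W \<longleftrightarrow> (\<forall>x \<in> W. \<forall>y \<in> W. C x y = \<zero>\<^bsub>K\<^esub>)"

definition witt_index ::
  "('c, 'r) ring_scheme \<Rightarrow> ('c, 'm, 's) module_scheme \<Rightarrow> ('m \<Rightarrow> 'm \<Rightarrow> 'c) \<Rightarrow> nat" where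
  "witt_index K M C =
     Max {vectorspace.dim K (subspace_module M W) | W.
            VectorSpace.subspace K W M \<and> totally_isotropic K C W}"

definition nonisotropic ::
  "('c, 'r) ring_scheme \<Rightarrow> ('c, 'm, 's) module_scheme \<Rightarrow> ('m \<Rightarrow> 'm \<Rightarrow> 'c) \<Rightarrow> bool" where
  "nonisotropic K M C \<longleftrightarrow> (\<forall>x \<in> carrier M. C x x = \<zero>\<^bsub>K\<^esub> \<longrightarrow> x = \<zero>\<^bsub>M\<^esub>)"

text \<open>
  An orthogonal sum of \<open>n\<close> hyperbolic planes with hyperbolic pairs \<open>(e i, f i)\<close>. The relations
  force these \<open>2 n\<close> vectors to be linearly independent.
\<close>

definition hyperbolic ::
  "('c, 'r) ring_scheme \<Rightarrow> ('c, 'm, 's) module_scheme \<Rightarrow> ('m \<Rightarrow> 'm \<Rightarrow> 'c) \<Rightarrow> bool" where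
  "hyperbolic K M C \<longleftrightarrow>
     (\<exists>(n::nat) e f.
        e ` {..<n} \<union> f ` {..<n} \<subseteq> carrier M \<and>
        LinearCombinations.module.span K M (e ` {..<n} \<union> f ` {..<n}) = carrier M \<and>
        (\<forall>i<n. \<forall>j<n. C (e i) (e j) = \<zero>\<^bsub>K\<^esub> \<and> C (f i) (f j) = \<zero>\<^bsub>K\<^esub> \<and>
           C (e i) (f j) = (if i = j then \<one>\<^bsub>K\<^esub> else \<zero>\<^bsub>K\<^esub>) \<and>
           C (f j) (e i) = (if i = j then \<one>\<^bsub>K\<^esub> else \<zero>\<^bsub>K\<^esub>)))"

text \<open>The restriction of \<open>C\<close> to \<open>W\<close> is a nonisotropic part of \<open>C\<close>.\<close>

definition nonisotropic_part ::
  "('c, 'r) ring_scheme \<Rightarrow> ('c, 'm, 's) module_scheme \<Rightarrow> ('m \<Rightarrow> 'm \<Rightarrow> 'c) \<Rightarrow> 'm set \<Rightarrow> bool" where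
  "nonisotropic_part K M C W \<longleftrightarrow>
     VectorSpace.subspace K W M \<and> nonisotropic K (subspace_module M W) C \<and>
     (\<exists>H. VectorSpace.subspace K H M \<and> hyperbolic K (subspace_module M H) C \<and>
        vectorspace.dim K (subspace_module M H) = 2 * witt_index K M C \<and>
        H <+>\<^bsub>M\<^esub> W = carrier M \<and> H \<inter> W = {\<zero>\<^bsub>M\<^esub>} \<and>
        (\<forall>x \<in> H. \<forall>y \<in> W. C x y = \<zero>\<^bsub>K\<^esub>))"

definition witt_simplifies ::
  "('c, 'r) ring_scheme \<Rightarrow> ('c, 'm, 's) module_scheme \<Rightarrow> ('m \<Rightarrow> 'm \<Rightarrow> 'c)
     \<Rightarrow> ('c, 'n, 's2) module_scheme \<Rightarrow> ('n \<Rightarrow> 'n \<Rightarrow> 'c) \<Rightarrow> bool" where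
  "witt_simplifies K M C N D \<longleftrightarrow>
     (\<forall>W. nonisotropic_part K N D W \<longrightarrow>
        (\<exists>S. VectorSpace.subspace K S M \<and>
           forms_equivalent K (subspace_module N W) D
             (subspace_module M S) (\<lambda>x y. \<ominus>\<^bsub>K\<^esub> C x y)))"

text \<open>
  External orthogonal sums over a possibly infinite index set: families of finite support. In the
  form, only indices at which both arguments are nonzero can contribute.
\<close>

definition orthogonal_sum_space :: "'i set \<Rightarrow> ('i \<Rightarrow> ('c, 'm) module) \<Rightarrow> ('c, 'i \<Rightarrow> 'm) module" where
  "orthogonal_sum_space I M =
     \<lparr>carrier = {f \<in> (\<Pi>\<^sub>E i\<in>I. carrier (M i)). finite {i \<in> I. f i \<noteq> \<zero>\<^bsub>M i\<^esub>}},
      mult = undefined, one = undefined,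
      zero = (\<lambda>i\<in>I. \<zero>\<^bsub>M i\<^esub>),
      add = (\<lambda>f g. \<lambda>i\<in>I. f i \<oplus>\<^bsub>M i\<^esub> g i),
      smult = (\<lambda>a f. \<lambda>i\<in>I. a \<odot>\<^bsub>M i\<^esub> f i)\<rparr>"

definition orthogonal_sum_form ::
  "('c, 'r) ring_scheme \<Rightarrow> 'i set \<Rightarrow> ('i \<Rightarrow> ('c, 'm) module) \<Rightarrow> ('i \<Rightarrow> 'm \<Rightarrow> 'm \<Rightarrow> 'c)
     \<Rightarrow> ('i \<Rightarrow> 'm) \<Rightarrow> ('i \<Rightarrow> 'm) \<Rightarrow> 'c" where
  "orthogonal_sum_form K I M C f g =
     (\<Oplus>\<^bsub>K\<^esub>i \<in> {i \<in> I. f i \<noteq> \<zero>\<^bsub>M i\<^esub> \<and> g i \<noteq> \<zero>\<^bsub>M i\<^esub>}. C i (f i) (g i))"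

section \<open>Quadratic invariants of a selfadjoint endomorphism\<close>

definition primary_kernel ::
  "('a::field \<Rightarrow> 'v::ab_group_add \<Rightarrow> 'v) \<Rightarrow> ('v \<Rightarrow> 'v) \<Rightarrow> 'a poly \<Rightarrow> nat \<Rightarrow> 'v set" where
  "primary_kernel scale u p k = {x. (poly_endo scale p u ^^ k) x = 0}"

definition invariant_denominator ::
  "('a::field \<Rightarrow> 'v::ab_group_add \<Rightarrow> 'v) \<Rightarrow> ('v \<Rightarrow> 'v) \<Rightarrow> 'a poly \<Rightarrow> nat \<Rightarrow> 'v set" where
  "invariant_denominator scale u p k =
     {y + z | y z. y \<in> primary_kernel scale u p (k - 1) \<and>
                   z \<in> primary_kernel scale u p k \<inter> range (poly_endo scale p u)}"

text \<open>
  The quotient \<open>A/N\<close> with a prescribed scalar multiplication; the fields \<open>mult\<close> and \<open>one\<close> of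
  the record play no role for modules.
\<close>

definition quotient_space ::
  "'v::ab_group_add set \<Rightarrow> 'v set \<Rightarrow> ('c \<Rightarrow> 'v set \<Rightarrow> 'v set) \<Rightarrow> ('c, 'v set) module" where
  "quotient_space A N act =
     \<lparr>carrier = (\<lambda>x. {x + n | n. n \<in> N}) ` A,
      mult = undefined, one = undefined,
      zero = N,
      add = (\<lambda>X Y. {x + y | x y. x \<in> X \<and> y \<in> Y}),
      smult = act\<rparr>"

text \<open>\<open>V\<^sub>p\<^sub>,\<^sub>k\<close> as a vector space over \<open>\<bbbF>\<close>, with the form \<open>B\<close> induced by \<open>b(x, p(u)\<^sup>k\<^sup>-\<^sup>1 y)\<close>.\<close>

definition base_space ::
  "('a::field \<Rightarrow> 'v::ab_group_add \<Rightarrow> 'v) \<Rightarrow> ('v \<Rightarrow> 'v) \<Rightarrow> 'a poly \<Rightarrow> nat \<Rightarrow> ('a, 'v set) module" where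
  "base_space scale u p k =
     (let N = invariant_denominator scale u p k in
      quotient_space (primary_kernel scale u p k) N
        (\<lambda>a X. {scale a x + n | x n. x \<in> X \<and> n \<in> N}))"

definition base_form ::
  "('a::field \<Rightarrow> 'v::ab_group_add \<Rightarrow> 'v) \<Rightarrow> ('v \<Rightarrow> 'v \<Rightarrow> 'a) \<Rightarrow> ('v \<Rightarrow> 'v)
     \<Rightarrow> 'a poly \<Rightarrow> nat \<Rightarrow> 'v set \<Rightarrow> 'v set \<Rightarrow> 'a" where
  "base_form scale b u p k X Y =
     the_elem {b x ((poly_endo scale p u ^^ (k - 1)) y) | x y. x \<in> X \<and> y \<in> Y}"

text \<open>
  \<open>V\<^sub>p\<^sub>,\<^sub>k\<close> as a vector space over \<open>\<bbbF>[t]/(p)\<close>: the class of \<open>q\<close> acts through \<open>q(u)\<close>.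
\<close>

definition invariant_space ::
  "('a::field \<Rightarrow> 'v::ab_group_add \<Rightarrow> 'v) \<Rightarrow> ('v \<Rightarrow> 'v) \<Rightarrow> 'a poly \<Rightarrow> nat
     \<Rightarrow> ('a poly set, 'v set) module" where
  "invariant_space scale u p k =
     (let N = invariant_denominator scale u p k in
      quotient_space (primary_kernel scale u p k) N
        (\<lambda>L X. {poly_endo scale q u x + n | q x n. q \<in> L \<and> x \<in> X \<and> n \<in> N}))"

text \<open>
  The form \<open>(b,u)\<^sub>p\<^sub>,\<^sub>k\<close>. Its defining condition involves each pair \<open>(X, Y)\<close> separately, so the
  unique map satisfying it is described pointwise.
\<close>

definition invariant_form ::
  "('a::field \<Rightarrow> 'v::ab_group_add \<Rightarrow> 'v) \<Rightarrow> ('v \<Rightarrow> 'v \<Rightarrow> 'a) \<Rightarrow> ('v \<Rightarrow> 'v)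
     \<Rightarrow> 'a poly \<Rightarrow> nat \<Rightarrow> 'v set \<Rightarrow> 'v set \<Rightarrow> 'a poly set" where
  "invariant_form scale b u p k X Y =
     (THE c. c \<in> carrier (residue_field p) \<and>
        (\<forall>l \<in> carrier (residue_field p).
           base_form scale b u p k X (l \<odot>\<^bsub>invariant_space scale u p k\<^esub> Y)
             = residue_form p (l \<otimes>\<^bsub>residue_field p\<^esub> c)))"

text \<open>Transport along \<open>\<phi>\<close> of a space over \<open>\<bbbF>[t]/(p\<^sup>o\<^sup>p)\<close> and of a form on it, to \<open>\<bbbF>[t]/(p)\<close>.\<close>

definition op_space ::
  "'a::field poly \<Rightarrow> ('a poly set, 'm) module \<Rightarrow> ('a poly set, 'm) module" where
  "op_space p M =
     M\<lparr>smult := (\<lambda>l x. inv_into (carrier (residue_field (op_poly p))) residue_neg l \<odot>\<^bsub>M\<^esub> x)\<rparr>"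

definition op_form :: "('m \<Rightarrow> 'm \<Rightarrow> 'a::field poly set) \<Rightarrow> 'm \<Rightarrow> 'm \<Rightarrow> 'a poly set" where
  "op_form C x y = residue_neg (C x y)"

definition sign_scaled ::
  "('c, 'r) ring_scheme \<Rightarrow> nat \<Rightarrow> ('m \<Rightarrow> 'm \<Rightarrow> 'c) \<Rightarrow> 'm \<Rightarrow> 'm \<Rightarrow> 'c" where
  "sign_scaled K n C x y = ((\<ominus>\<^bsub>K\<^esub> \<one>\<^bsub>K\<^esub>) [^]\<^bsub>K\<^esub> n) \<otimes>\<^bsub>K\<^esub> C x y"

end

theory Submission
  imports Defs
begin

text \<open>
  A decomposition \<open>u = v + w\<close> amounts to a selfadjoint \<open>z = v - w\<close> with \<open>z u = - u z\<close> and \<open>z\<^sup>2 = - u\<^sup>2\<close>.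

  Necessity. On the primary components with \<open>p \<noteq> t\<close> the map \<open>u\<close> is invertible, and \<open>u\<^sup>-\<^sup>1 z\<close> is a
  skew-selfadjoint involution that anticommutes with \<open>u\<close>. It exchanges the components of \<open>p\<close> and
  \<open>p\<^sup>o\<^sup>p\<close>, which gives (ii); when \<open>p = p\<^sup>o\<^sup>p\<close>, its fixed vectors contain an orthogonal basis as in (i).
  For \<open>p = t\<close>, the maps \<open>v\<close> and \<open>w\<close> provide totally isotropic subspaces for the forms \<open>b(x, u\<^sup>2\<^sup>k y)\<close>
  and \<open>b(x, u\<^sup>2\<^sup>k\<^sup>+\<^sup>2 y)\<close>, and (iii) follows by counting dimensions.

  Sufficiency. Orthogonal bases of the \<open>V\<^sub>p\<^sub>,\<^sub>k\<close> lift to an orthogonal decomposition of \<open>V\<close> into cyclic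
  subspaces, whose generators can be normalized because the units congruent to \<open>1\<close> are squares. Then
  \<open>z\<close> is written explicitly on these subspaces or on sums of two of them: under (iii), the generators
  for \<open>t\<^sup>2\<^sup>k\<^sup>+\<^sup>1\<close> fall into hyperbolic pairs, vectors matched with opposite ones for \<open>t\<^sup>2\<^sup>k\<^sup>+\<^sup>3\<close>, and vectors
  to be matched with opposite ones for \<open>t\<^sup>2\<^sup>k\<^sup>-\<^sup>1\<close>.
\<close>

text \<open>The spaces V_{p,k} are quotients and the sum in (iii) is infinite, so the argument runs
  on vectors of V with the degenerate forms b(x, q(u) y): classes become representatives, and an
  equality in the residue field becomes a family of equalities in F, one for each test polynomial q,
  because (q, c) -> e_p(q c) is nondegenerate. The sign in (ii) has two sources: -1 from the
  skew-adjointness of u^-1 z, and (-1)^((k-1) deg p) from moving that map across p(u)^(k-1), which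
  becomes p(-u)^(k-1). For p = t there is no inverse of u, and parity decides. The same change of
  sign lets a cyclic space of even length carry a \<open>z\<close> by itself and forbids it for odd
  lengths above 1; in the construction such a space is paired with one of opposite value whose
  length is equal or differs by 2. This is why (iii) concerns odd indices and compares each level
  with those above it. The obstacle in its necessity is that v and w do not respect the levels, so
  an embedding has to be extracted from dimension counts.\<close>

hide_const (open) VectorSpace.subspace

section \<open>Linear algebra relative to a subspace\<close>

context finite_dimensional_vector_space
begin

abbreviation lin :: "('b \<Rightarrow> 'b) \<Rightarrow> bool" where
  "lin f \<equiv> Vector_Spaces.linear scale scale f"

definition ssum :: "'b set \<Rightarrow> 'b set \<Rightarrow> 'b set" where
  "ssum A B = {x + y | x y. x \<in> A \<and> y \<in> B}"

lemma ssumI: "x \<in> A \<Longrightarrow> y \<in> B \<Longrightarrow> x + y \<in> ssum A B" by (auto simp: ssum_def)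

lemma subspace_ssum: "subspace A \<Longrightarrow> subspace B \<Longrightarrow> subspace (ssum A B)" unfolding ssum_def by (rule subspace_sums)

lemma ssum_left: "subspace B \<Longrightarrow> A \<subseteq> ssum A B" unfolding ssum_def using subspace_0 by force

lemma ssum_right: "subspace A \<Longrightarrow> B \<subseteq> ssum A B" unfolding ssum_def using subspace_0 by force

lemma ssum_subset: "subspace C \<Longrightarrow> A \<subseteq> C \<Longrightarrow> B \<subseteq> C \<Longrightarrow> ssum A B \<subseteq> C" unfolding ssum_def using subspace_add by blast

lemma linE:
  assumes "lin f"
  shows lin_add: "f (x + y) = f x + f y" and lin_scale: "f (scale a x) = scale a (f x)"
    and lin_0: "f 0 = 0" and lin_diff: "f (x - y) = f x - f y" and lin_neg: "f (- x) = - f x"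
    and lin_sum: "f (sum g I) = (\<Sum>i\<in>I. f (g i))"
proof -
  interpret Vector_Spaces.linear scale scale f by fact
  show "f (x + y) = f x + f y" by (rule add)
  show "f (scale a x) = scale a (f x)" by (rule scale)
  show "f 0 = 0" by (rule zero)
  show "f (x - y) = f x - f y" by (rule diff)
  show "f (- x) = - f x" by (rule neg)
  show "f (sum g I) = (\<Sum>i\<in>I. f (g i))" by (rule sum)
qed

lemma linI:
  assumes "\<And>x y. f (x + y) = f x + f y" "\<And>a x. f (scale a x) = scale a (f x)"
  shows "lin f" unfolding Vector_Spaces.linear_iff using assms vector_space_axioms by auto

lemma subspace_image: "lin f \<Longrightarrow> subspace S \<Longrightarrow> subspace (f ` S)"
proof -
  assume f: "lin f" and S: "subspace S"
  show ?thesis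
  proof (rule subspaceI)
    show "0 \<in> f ` S" using lin_0[OF f] subspace_0[OF S] by force
  next
    fix x y assume "x \<in> f ` S" "y \<in> f ` S"
    then show "x + y \<in> f ` S" by (auto simp: lin_add[OF f, symmetric] intro!: imageI subspace_add[OF S])
  next
    fix a x assume "x \<in> f ` S"
    then show "scale a x \<in> f ` S" by (auto simp: lin_scale[OF f, symmetric] intro!: imageI subspace_scale[OF S])
  qed
qed

lemma subspace_ker: "lin f \<Longrightarrow> subspace S \<Longrightarrow> subspace {x \<in> S. f x = 0}"
  by (rule subspaceI) (auto simp: lin_0 lin_add lin_scale subspace_0 subspace_add subspace_scale)

lemma complement_exists:
  assumes K: "subspace K" and S: "subspace S" and KS: "K \<subseteq> S"
  obtains C where "subspace C" "C \<subseteq> S" "K \<inter> C = {0}" "ssum K C = S" "dim K + dim C = dim S"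
proof -
  obtain B where B: "B \<subseteq> K" "independent B" "K \<subseteq> span B" "card B = dim K" using basis_exists[of K] by blast
  obtain B' where B': "B \<subseteq> B'" "B' \<subseteq> S" "independent B'" "S \<subseteq> span B'"
    using maximal_independent_subset_extend[of B S] B KS by blast
  let ?C = "span (B' - B)"
  have fin: "finite B'" using B'(3) finiteI_independent by blast
  have sB: "span B = K" using B K span_subspace by blast
  have sB': "span B' = S" using B' S span_subspace by blast
  have 1: "K \<inter> ?C = {0}"
  proof -
    { fix x assume x: "x \<in> span B" "x \<in> ?C"
      \<comment> \<open>A common vector has the same representation over \<open>B'\<close>, over
        \<open>B\<close> and over \<open>B' - B\<close>, so all its coordinates vanish.\<close>
      have "representation B' x = representation B x" using representation_extend[OF B'(3) x(1) B'(1)] .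
      moreover have "representation B' x = representation (B' - B) x"
        using representation_extend[OF B'(3) x(2)] by blast
      ultimately have z: "representation B' x v = 0" for v
        using representation_ne_zero[of B x v] representation_ne_zero[of "B' - B" x v] by fastforce
      have "x \<in> span B'" using x(1) B'(1) span_mono by blast
      from sum_nonzero_representation_eq[OF B'(3) this] have "x = 0" using z by simp }
    then show ?thesis using sB subspace_0[OF K] span_zero by blast
  qed
  have 2: "ssum K ?C = S"
  proof -
    have "span (B \<union> (B' - B)) = ssum K ?C" unfolding span_Un ssum_def sB by blast
    then show ?thesis using B'(1) sB' by (simp add: Un_absorb1)
  qed
  have 3: "dim K + dim ?C = dim S"
  proof -
    have "dim ?C = card (B' - B)" using dim_span_eq_card_independent[of "B' - B"] independent_mono[OF B'(3)] by blast
    moreover have "dim S = card B'" using dim_span_eq_card_independent[OF B'(3)] sB' by simp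
    moreover have "card (B' - B) + card B = card B'"
      using fin B'(1) by (metis add.commute card_Diff_subset card_mono finite_subset le_add_diff_inverse)
    ultimately show ?thesis using B(4) by simp
  qed
  show ?thesis using that[of ?C] 1 2 3 sB' span_mono[of "B' - B" B'] by auto
qed

lemma independent_Un_disjoint:
  assumes B: "subspace B" and BB: "independent BB" "BB \<subseteq> B"
    and AA: "independent AA" "span AA \<inter> B = {0}"
  shows "independent (BB \<union> AA)"
proof -
  have "finite AA" using AA finiteI_independent by blast
  then show ?thesis using AA
  proof (induct AA)
    case empty then show ?case using BB by simp
  next
    case (insert a AA)
    have ind: "independent AA" "a \<notin> span AA" using insert independent_insert[of a AA] by auto
    have "span AA \<subseteq> span (insert a AA)" by (rule span_mono) auto
    then have d: "span AA \<inter> B = {0}" using insert.prems(2) span_zero subspace_0[OF B] by blast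
    have "a \<notin> span (BB \<union> AA)"
    proof
      assume "a \<in> span (BB \<union> AA)"
      then obtain x y where xy: "a = x + y" "x \<in> span BB" "y \<in> span AA" unfolding span_Un by blast
      have "x \<in> B" using xy(2) BB(2) B span_minimal by blast
      moreover have "x \<in> span (insert a AA)"
      proof -
        have "x = a - y" using xy(1) by simp
        moreover have "y \<in> span (insert a AA)" using xy(3) span_mono[of AA "insert a AA"] by blast
        ultimately show ?thesis using span_diff span_base by blast
      qed
      ultimately have "x = 0" using insert.prems(2) by blast
      then show False using xy ind(2) by simp
    qed
    then show ?case using independent_insertI[of a "BB \<union> AA"] insert.hyps(3)[OF ind(1) d] by simp
  qed
qed

lemma dim_direct_sum:
  assumes A: "subspace A" and B: "subspace B" and AB: "A \<inter> B = {0}"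
  shows "dim (ssum A B) = dim A + dim B"
proof -
  obtain BB where BB: "BB \<subseteq> B" "independent BB" "B \<subseteq> span BB" "card BB = dim B" using basis_exists[of B] by blast
  obtain AA where AA: "AA \<subseteq> A" "independent AA" "A \<subseteq> span AA" "card AA = dim A" using basis_exists[of A] by blast
  have sA: "span AA = A" and sB: "span BB = B" using AA BB A B span_subspace by blast+
  have ind: "independent (BB \<union> AA)" by (rule independent_Un_disjoint[OF B]) (use AA BB sA AB in auto)
  have "BB \<inter> AA = {}"
  proof -
    have "BB \<inter> AA \<subseteq> {0}" using AA BB AB by blast
    moreover have "0 \<notin> AA" using AA(2) dependent_zero by blast
    ultimately show ?thesis by blast
  qed
  then have "card (BB \<union> AA) = dim A + dim B" using AA BB finiteI_independent by (simp add: card_Un_disjoint)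
  moreover have "span (BB \<union> AA) = ssum A B" unfolding span_Un ssum_def sA sB using add.commute by blast
  ultimately show ?thesis using dim_span_eq_card_independent[OF ind] by simp
qed

text \<open>A complement \<open>C\<close> of the intersection in \<open>A\<close> turns the sum into
  the direct sum of \<open>C\<close> and \<open>B\<close>.\<close>

lemma dim_ssum_Int:
  assumes A: "subspace A" and B: "subspace B"
  shows "dim (ssum A B) + dim (A \<inter> B) = dim A + dim B"
proof -
  have I: "subspace (A \<inter> B)" using A B by (rule subspace_inter)
  obtain C where C: "subspace C" "C \<subseteq> A" "(A \<inter> B) \<inter> C = {0}" "ssum (A \<inter> B) C = A"
      "dim (A \<inter> B) + dim C = dim A" using complement_exists[OF I A] by blast
  have "C \<inter> B = {0}" using C by blast
  then have "dim (ssum C B) = dim C + dim B" using dim_direct_sum[OF C(1) B] by blast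
  moreover have "ssum C B = ssum A B"
  proof
    show "ssum C B \<subseteq> ssum A B" using C(2) unfolding ssum_def by blast
    show "ssum A B \<subseteq> ssum C B"
    proof
      fix z assume "z \<in> ssum A B"
      then obtain a y where z: "z = a + y" "a \<in> A" "y \<in> B" unfolding ssum_def by blast
      from z(2) C(4) obtain i c where "a = i + c" "i \<in> B" "c \<in> C" unfolding ssum_def by blast
      then have "z = c + (i + y)" "i + y \<in> B" using z B subspace_add by (auto simp: algebra_simps)
      then show "z \<in> ssum C B" using \<open>c \<in> C\<close> unfolding ssum_def by blast
    qed
  qed
  ultimately show ?thesis using C(5) by simp
qed

lemma dim_image_inj:
  assumes "lin f" "inj_on f (span S)"
  shows "dim (f ` S) = dim S"
proof -
  interpret finite_dimensional_vector_space_pair_1 scale Basis scale by unfold_locales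
  show ?thesis using dim_image_eq assms by blast
qed

lemma rank_nullity:
  assumes f: "lin f" and S: "subspace S"
  shows "dim (f ` S) + dim {x \<in> S. f x = 0} = dim S"
proof -
  let ?K = "{x \<in> S. f x = 0}"
  obtain C where C: "subspace C" "C \<subseteq> S" "?K \<inter> C = {0}" "ssum ?K C = S" "dim ?K + dim C = dim S"
    using complement_exists[OF subspace_ker[OF f S] S] by blast
  have "inj_on f (span C)"
  proof (rule inj_onI)
    fix x y assume "x \<in> span C" "y \<in> span C" and e: "f x = f y"
    then have "x \<in> C" "y \<in> C" using C(1) by (metis span_eq_iff)+
    then have 1: "x - y \<in> C" using C(1) subspace_diff by blast
    moreover have "x - y \<in> ?K" using e lin_diff[OF f] 1 C(2) by auto
    ultimately have "x - y = 0" using C(3) by blast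
    then show "x = y" by simp
  qed
  then have "dim (f ` C) = dim C" using f dim_image_inj by blast
  moreover have "f ` C = f ` S"
  proof
    show "f ` C \<subseteq> f ` S" using C(2) by blast
    show "f ` S \<subseteq> f ` C"
    proof
      fix z assume "z \<in> f ` S"
      then obtain s where s: "z = f s" "s \<in> S" by blast
      with C(4) obtain k c where "s = k + c" "f k = 0" "c \<in> C" unfolding ssum_def by blast
      then show "z \<in> f ` C" using s lin_add[OF f] by auto
    qed
  qed
  ultimately show ?thesis using C(5) by simp
qed

text \<open>Maps built by choosing representatives are linear only on \<open>S\<close>. Keeping
  their values on a basis of \<open>S\<close> gives a map that is linear everywhere.\<close>

lemma extend_linear:
  assumes S: "subspace S"
    and add: "\<And>x y. x \<in> S \<Longrightarrow> y \<in> S \<Longrightarrow> f (x + y) = f x + f y"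
    and sc: "\<And>a x. x \<in> S \<Longrightarrow> f (scale a x) = scale a (f x)"
  obtains g where "lin g" "\<And>x. x \<in> S \<Longrightarrow> g x = f x"
proof -
  have vp: "vector_space_pair scale scale" by unfold_locales
  obtain B where B: "B \<subseteq> S" "independent B" "S \<subseteq> span B" "card B = dim S" by (rule basis_exists[of S])
  obtain g where g: "lin g" "\<And>x. x \<in> B \<Longrightarrow> g x = f x"
    using vector_space_pair.linear_independent_extend[OF vp B(2), of f] by blast
  have "x \<in> S \<and> g x = f x" if "x \<in> span B" for x using that
  proof (induct rule: span_induct_alt)
    case base
    have "f 0 = 0" using sc[of 0 0] subspace_0[OF S] by simp
    then show ?case using lin_0[OF g(1)] subspace_0[OF S] by simp
  next
    case (step c x y)
    then have x: "x \<in> S" using B by blast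
    then have "scale c x \<in> S" using S subspace_scale by blast
    then show ?case using step x g sc[of x c] add[of "scale c x" y] S by (simp add: lin_add lin_scale subspace_add)
  qed
  then show ?thesis using that[of g] g(1) B(3) by blast
qed

section \<open>Orthogonality\<close>

text \<open>Forms are not assumed to be nondegenerate here: the forms \<open>b(x, u\<^sup>m y)\<close> are not.\<close>

definition perp :: "('b \<Rightarrow> 'b \<Rightarrow> 'a) \<Rightarrow> 'b set \<Rightarrow> 'b set \<Rightarrow> 'b set" where
  "perp c X A = {y \<in> X. \<forall>x\<in>A. c x y = 0}"

lemma bilinD:
  assumes "bilinear_form scale c"
  shows bil_add_left: "c (x + y) z = c x z + c y z"
    and bil_add_right: "c x (y + z) = c x y + c x z"
    and bil_scale_left: "c (scale a x) y = a * c x y"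
    and bil_scale_right: "c x (scale a y) = a * c x y"
    and bil_0_left: "c 0 x = 0" and bil_0_right: "c x 0 = 0"
    and bil_diff_left: "c (x - y) z = c x z - c y z"
    and bil_diff_right: "c x (y - z) = c x y - c x z"
    and bil_neg_left: "c (- x) y = - c x y" and bil_neg_right: "c x (- y) = - c x y"
    and bil_sum_left: "c (sum g I) y = (\<Sum>i\<in>I. c (g i) y)"
    and bil_sum_right: "c y (sum g I) = (\<Sum>i\<in>I. c y (g i))"
proof -
  have r: "Vector_Spaces.linear scale (*) (\<lambda>y. c x y)" and l: "Vector_Spaces.linear scale (*) (\<lambda>x. c x y)" for x y
    using assms unfolding bilinear_form_def by auto
  interpret L: Vector_Spaces.linear scale "(*)" "\<lambda>x. c x z" by (rule l)
  interpret R: Vector_Spaces.linear scale "(*)" "\<lambda>y. c x y" by (rule r)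
  interpret L': Vector_Spaces.linear scale "(*)" "\<lambda>x. c x y" by (rule l)
  interpret L'': Vector_Spaces.linear scale "(*)" "\<lambda>z. c z x" by (rule l)
  interpret R': Vector_Spaces.linear scale "(*)" "\<lambda>z. c y z" by (rule r)
  show "c (x + y) z = c x z + c y z" by (rule L.add)
  show "c x (y + z) = c x y + c x z" by (rule R.add)
  show "c (scale a x) y = a * c x y" by (rule L'.scale)
  show "c x (scale a y) = a * c x y" by (rule R.scale)
  show "c 0 x = 0" by (rule L''.zero)
  show "c x 0 = 0" by (rule R.zero)
  show "c (x - y) z = c x z - c y z" by (rule L.diff)
  show "c x (y - z) = c x y - c x z" by (rule R.diff)
  show "c (- x) y = - c x y" by (rule L'.neg)
  show "c x (- y) = - c x y" by (rule R.neg)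
  show "c (sum g I) y = (\<Sum>i\<in>I. c (g i) y)" by (rule L'.sum)
  show "c y (sum g I) = (\<Sum>i\<in>I. c y (g i))" by (rule R'.sum)
qed

lemma bilinI:
  assumes "\<And>x y z. c (x + y) z = c x z + c y z" "\<And>x y z. c x (y + z) = c x y + c x z"
    "\<And>a x y. c (scale a x) y = a * c x y" "\<And>a x y. c x (scale a y) = a * c x y"
  shows "bilinear_form scale c"
proof -
  have v: "vector_space ((*) :: 'a \<Rightarrow> 'a \<Rightarrow> 'a)" by unfold_locales (auto simp: algebra_simps)
  show ?thesis unfolding bilinear_form_def Vector_Spaces.linear_iff using assms v vector_space_axioms by auto
qed

lemmas bil = bil_add_left bil_add_right bil_scale_left bil_scale_right bil_0_left bil_0_right
  bil_diff_left bil_diff_right bil_neg_left bil_neg_right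

lemma subspace_perp: "bilinear_form scale c \<Longrightarrow> subspace X \<Longrightarrow> subspace (perp c X A)"
  by (rule subspaceI) (auto simp: perp_def bil subspace_0 subspace_add subspace_scale)

lemma perp_subset: "perp c X A \<subseteq> X" by (auto simp: perp_def)

lemma perp_antimono: "A \<subseteq> B \<Longrightarrow> perp c X B \<subseteq> perp c X A" by (auto simp: perp_def)

lemma perp_span:
  assumes "bilinear_form scale c" shows "perp c X (span E) = perp c X E"
proof
  show "perp c X (span E) \<subseteq> perp c X E" by (rule perp_antimono) (rule span_superset)
  show "perp c X E \<subseteq> perp c X (span E)"
  proof
    fix y assume y: "y \<in> perp c X E"
    have "c x y = 0" if "x \<in> span E" for x using that
      by (induct rule: span_induct_alt) (use y in \<open>auto simp: perp_def bil[OF assms]\<close>)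
    then show "y \<in> perp c X (span E)" using y by (auto simp: perp_def)
  qed
qed

lemma dim_functional_kernel:
  assumes c: "bilinear_form scale c" and X: "subspace X"
  shows "dim X \<le> dim {y \<in> X. c e y = 0} + 1"
proof (cases "\<forall>y\<in>X. c e y = 0")
  case True
  then have "{y \<in> X. c e y = 0} = X" by blast
  then show ?thesis by simp
next
  case False
  then obtain v where v: "v \<in> X" "c e v \<noteq> 0" by blast
  have v0: "v \<noteq> 0" using v bil[OF c] by metis
  \<comment> \<open>Multiplying a fixed nonzero vector makes the functional an endomorphism of rank
    at most 1, to which \<open>rank_nullity\<close> applies.\<close>
  let ?f = "\<lambda>y. scale (c e y) v"
  have f: "lin ?f" by (rule linI) (auto simp: bil[OF c] algebra_simps)
  have "?f ` X \<subseteq> span {v}" using span_scale span_base by blast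
  then have "dim (?f ` X) \<le> 1" using dim_le_card[of "?f ` X" "{v}"] by simp
  moreover have "{y \<in> X. ?f y = 0} = {y \<in> X. c e y = 0}" using v0 by auto
  ultimately show ?thesis using rank_nullity[OF f X] by simp
qed

lemma codim_perp_finite:
  assumes c: "bilinear_form scale c" and X: "subspace X" and "finite E"
  shows "dim X \<le> dim (perp c X E) + card E" using \<open>finite E\<close>
proof induct
  case empty then show ?case by (simp add: perp_def)
next
  case (insert e E)
  have "perp c X (insert e E) = {y \<in> perp c X E. c e y = 0}" by (auto simp: perp_def)
  then show ?case using dim_functional_kernel[OF c subspace_perp[OF c X], of E e] insert by simp
qed

lemma codim_perp:
  assumes c: "bilinear_form scale c" and X: "subspace X" and A: "subspace A"
  shows "dim X \<le> dim (perp c X A) + dim A"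
proof -
  obtain B where B: "B \<subseteq> A" "independent B" "A \<subseteq> span B" "card B = dim A" using basis_exists[of A] by blast
  have "span B = A" using B A span_subspace by blast
  then show ?thesis using codim_perp_finite[OF c X, of B] perp_span[OF c, of X B] B finiteI_independent by auto
qed

text \<open>Counting equations bounds the codimension in both directions. A complement of the
  radical part in \<open>A\<close> has the same orthogonal as \<open>A\<close>; conversely, the
  vectors of \<open>A\<close> orthogonal to a complement of that orthogonal in \<open>X\<close> are
  orthogonal to all of \<open>X\<close>.\<close>

lemma dim_perp:
  assumes c: "bilinear_form scale c" and s: "symmetric_form c"
    and X: "subspace X" and A: "subspace A" and AX: "A \<subseteq> X"
  shows "dim (perp c X A) + dim A = dim X + dim (A \<inter> perp c X X)"
proof -
  let ?R = "A \<inter> perp c X X"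
  have R: "subspace ?R" using A subspace_perp[OF c X] subspace_inter by blast
  have Y: "subspace (perp c X A)" using subspace_perp[OF c X] .
  obtain A' where A': "subspace A'" "A' \<subseteq> A" "?R \<inter> A' = {0}" "ssum ?R A' = A" "dim ?R + dim A' = dim A"
    using complement_exists[OF R A] by blast
  have e: "perp c X A = perp c X A'"
  proof
    show "perp c X A \<subseteq> perp c X A'" using A' by (intro perp_antimono)
    show "perp c X A' \<subseteq> perp c X A"
    proof
      fix y assume y: "y \<in> perp c X A'"
      { fix x assume "x \<in> A"
        then obtain r a where x: "x = r + a" "r \<in> ?R" "a \<in> A'" using A'(4) unfolding ssum_def by blast
        have "c y r = 0" using x(2) y by (auto simp: perp_def)
        then have "c r y = 0" using s by (simp add: symmetric_form_def)
        then have "c x y = 0" using x y by (auto simp: perp_def bil[OF c]) }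
      then show "y \<in> perp c X A" using y by (auto simp: perp_def)
    qed
  qed
  have 1: "dim X \<le> dim (perp c X A) + dim A'" using codim_perp[OF c X A'(1)] e by simp
  obtain Y' where Y': "subspace Y'" "Y' \<subseteq> X" "perp c X A \<inter> Y' = {0}" "ssum (perp c X A) Y' = X"
      "dim (perp c X A) + dim Y' = dim X" using complement_exists[OF Y X perp_subset] by blast
  have "perp c A Y' \<subseteq> ?R"
  proof
    fix a assume a: "a \<in> perp c A Y'"
    { fix x assume "x \<in> X"
      then obtain p y where x: "x = p + y" "p \<in> perp c X A" "y \<in> Y'" using Y'(4) unfolding ssum_def by blast
      have "c a p = 0" using x(2) a by (auto simp: perp_def)
      then have "c p a = 0" using s by (simp add: symmetric_form_def)
      then have "c x a = 0" using x a by (auto simp: perp_def bil[OF c]) }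
    then show "a \<in> ?R" using a AX by (auto simp: perp_def)
  qed
  then have "dim (perp c A Y') \<le> dim ?R" by (rule dim_subset)
  then have "dim A \<le> dim ?R + dim Y'" using codim_perp[OF c A Y'(1)] by simp
  then show ?thesis using 1 Y'(5) A'(5) by linarith
qed

lemma perp_perp:
  assumes c: "bilinear_form scale c" and s: "symmetric_form c"
    and X: "subspace X" and A: "subspace A" and AX: "A \<subseteq> X"
  shows "perp c X (perp c X A) = ssum A (perp c X X)"
proof -
  let ?R = "perp c X X" and ?P = "perp c X A"
  have R: "subspace ?R" and P: "subspace ?P" using subspace_perp[OF c X] by auto
  have RP: "?R \<subseteq> ?P" using AX by (rule perp_antimono)
  have sub: "ssum A ?R \<subseteq> perp c X ?P"
  proof (rule ssum_subset[OF subspace_perp[OF c X]])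
    show "A \<subseteq> perp c X ?P" using AX s by (auto simp: perp_def symmetric_form_def)
    show "?R \<subseteq> perp c X ?P" by (rule perp_antimono) (rule perp_subset)
  qed
  have "dim (perp c X ?P) + dim ?P = dim X + dim ?R"
    using dim_perp[OF c s X P perp_subset] RP by (simp add: Int_absorb1)
  moreover have "dim ?P + dim A = dim X + dim (A \<inter> ?R)" by (rule dim_perp[OF c s X A AX])
  moreover have "dim (ssum A ?R) + dim (A \<inter> ?R) = dim A + dim ?R" by (rule dim_ssum_Int[OF A R])
  ultimately have "dim (perp c X ?P) \<le> dim (ssum A ?R)" by linarith
  then show ?thesis using subspace_dim_equal[OF subspace_ssum[OF A R] subspace_perp[OF c X] sub] by simp
qed

definition iso :: "('b \<Rightarrow> 'b \<Rightarrow> 'a) \<Rightarrow> 'b set \<Rightarrow> bool" where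
  "iso c A \<longleftrightarrow> (\<forall>x\<in>A. \<forall>y\<in>A. c x y = 0)"

text \<open>Keeping only the vectors of \<open>U\<close> orthogonal to \<open>L\<close> costs at
  most \<open>dim L - dim (U \<inter> L)\<close>, because \<open>U\<close> is already orthogonal to
  \<open>U \<inter> L\<close>; adding \<open>L\<close> gives as much back.\<close>

lemma iso_extend:
  assumes c: "bilinear_form scale c" and s: "symmetric_form c"
    and U: "subspace U" "iso c U" and L: "subspace L" "iso c L"
  shows "iso c (ssum (perp c U L) L)" "dim U \<le> dim (ssum (perp c U L) L)"
proof -
  have sy: "c x y = c y x" for x y using s by (simp add: symmetric_form_def)
  show "iso c (ssum (perp c U L) L)" unfolding iso_def
  proof (intro ballI)
    fix x y assume "x \<in> ssum (perp c U L) L" "y \<in> ssum (perp c U L) L"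
    then obtain a l a' l' where "x = a + l" "y = a' + l'" "a \<in> perp c U L" "a' \<in> perp c U L" "l \<in> L" "l' \<in> L"
      unfolding ssum_def by blast
    then show "c x y = 0" using U(2) L(2) sy[of a l'] by (auto simp: bil[OF c] perp_def iso_def)
  qed
  have P: "subspace (perp c U L)" using subspace_perp[OF c U(1)] .
  have UL: "subspace (U \<inter> L)" using U L subspace_inter by blast
  obtain L' where L': "subspace L'" "L' \<subseteq> L" "(U \<inter> L) \<inter> L' = {0}" "ssum (U \<inter> L) L' = L"
     "dim (U \<inter> L) + dim L' = dim L" using complement_exists[OF UL L(1)] by blast
  have "perp c U L' \<subseteq> perp c U L"
  proof
    fix y assume y: "y \<in> perp c U L'"
    { fix x assume "x \<in> L"
      then obtain r a where x: "x = r + a" "r \<in> U" "a \<in> L'" using L'(4) unfolding ssum_def by blast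
      then have "c x y = 0" using y U(2) by (auto simp: perp_def bil[OF c] iso_def) }
    then show "y \<in> perp c U L" using y by (auto simp: perp_def)
  qed
  then have "dim (perp c U L') \<le> dim (perp c U L)" by (rule dim_subset)
  moreover have "dim U \<le> dim (perp c U L') + dim L'" by (rule codim_perp[OF c U(1) L'(1)])
  moreover have "perp c U L \<inter> L = U \<inter> L" using L(2) by (auto simp: perp_def iso_def)
  moreover have "dim (ssum (perp c U L) L) + dim (perp c U L \<inter> L) = dim (perp c U L) + dim L"
    by (rule dim_ssum_Int[OF P L(1)])
  ultimately show "dim U \<le> dim (ssum (perp c U L) L)" using L'(5) by simp
qed

text \<open>Under the last hypothesis the extension of \<open>iso_extend\<close> stays inside
  \<open>L\<close>. This is how a maximal totally isotropic subspace is shown to have greatest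
  dimension.\<close>

lemma iso_dim_le:
  assumes "bilinear_form scale c" "symmetric_form c"
    and "subspace U" "iso c U" and "subspace L" "iso c L" "perp c U L \<subseteq> L"
  shows "dim U \<le> dim L"
proof -
  have "ssum (perp c U L) L \<subseteq> L" using assms ssum_subset by blast
  then show ?thesis using iso_extend(2)[OF assms(1-6)] dim_subset le_trans by blast
qed

lemma nondeg_decompose:
  assumes c: "bilinear_form scale c" and s: "symmetric_form c"
    and C: "subspace C" "perp c C C = {0}"
  obtains z where "z \<in> C" "\<And>x. x \<in> C \<Longrightarrow> c x (y - z) = 0"
proof -
  let ?P = "perp c UNIV C"
  have P: "subspace ?P" using subspace_perp[OF c] subspace_UNIV by blast
  have i: "C \<inter> ?P = {0}" using C(2) by (auto simp: perp_def)
  have "dim (ssum C ?P) = dim C + dim ?P" using dim_direct_sum[OF C(1) P i] .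
  moreover have "dim (UNIV::'b set) \<le> dim ?P + dim C" by (rule codim_perp[OF c subspace_UNIV C(1)])
  ultimately have "ssum C ?P = UNIV" using subspace_dim_equal[OF subspace_ssum[OF C(1) P] subspace_UNIV] by simp
  then obtain z p where "y = z + p" "z \<in> C" "p \<in> ?P" unfolding ssum_def by blast
  then show ?thesis using that[of z] by (auto simp: perp_def)
qed

text \<open>The kernel of \<open>f\<close> in \<open>C\<close> is its own biorthogonal, so some
  \<open>p\<close> is orthogonal to it but not to a vector \<open>y\<close> with
  \<open>f y \<noteq> 0\<close>; a multiple of \<open>p\<close> represents \<open>f\<close>.
  Linearity is asked on \<open>C\<close> only, since \<open>normalize\<close> uses a functional
  defined by choice.\<close>

lemma riesz:
  assumes c: "bilinear_form scale c" and s: "symmetric_form c"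
    and C: "subspace C" "perp c C C = {0}"
    and add: "\<And>x y. x \<in> C \<Longrightarrow> y \<in> C \<Longrightarrow> f (x + y) = f x + f y"
    and sc: "\<And>a x. x \<in> C \<Longrightarrow> f (scale a x) = a * f x"
  obtains z where "z \<in> C" "\<And>x. x \<in> C \<Longrightarrow> f x = c z x"
proof (cases "\<forall>x\<in>C. f x = 0")
  case True
  then show ?thesis using that[of 0] subspace_0[OF C(1)] by (auto simp: bil[OF c])
next
  case False
  then obtain y where y: "y \<in> C" "f y \<noteq> 0" by blast
  let ?C0 = "{x \<in> C. f x = 0}"
  have f0: "f 0 = 0" using sc[of 0 0] subspace_0[OF C(1)] by simp
  have C0: "subspace ?C0"
    by (rule subspaceI) (use C(1) in \<open>auto simp: f0 add sc subspace_0 subspace_add subspace_scale\<close>)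
  have "perp c C (perp c C ?C0) = ssum ?C0 {0}" using perp_perp[OF c s C(1) C0] C(2) by auto
  also have "\<dots> = ?C0" by (auto simp: ssum_def)
  finally have "y \<notin> perp c C (perp c C ?C0)" using y by blast
  then obtain p where p: "p \<in> C" "\<And>x. x \<in> ?C0 \<Longrightarrow> c x p = 0" "c p y \<noteq> 0" using y(1) by (auto simp: perp_def)
  let ?z = "scale (f y / c p y) p"
  have "f x = c ?z x" if x: "x \<in> C" for x
  proof -
    let ?x0 = "x - scale (f x / f y) y"
    have x': "scale (- (f x / f y)) y \<in> C" using y C(1) subspace_scale by blast
    have "f ?x0 = f (x + scale (- (f x / f y)) y)" by simp
    also have "\<dots> = 0" unfolding add[OF x x'] sc[OF y(1)] using y(2) by simp
    finally have "?x0 \<in> ?C0" using x y C(1) subspace_scale subspace_diff by blast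
    then have "c ?x0 p = 0" by (rule p(2))
    then have "c p ?x0 = 0" using s by (simp add: symmetric_form_def)
    then show ?thesis using y(2) p(3) by (simp add: bil[OF c] field_simps)
  qed
  then show ?thesis using that[of ?z] p(1) C(1) subspace_scale by blast
qed

end

section \<open>Polynomials in a selfadjoint endomorphism\<close>

lemma neg_arg_simps:
  "neg_arg (p + q) = neg_arg p + neg_arg q" "neg_arg (p * q) = neg_arg p * neg_arg q"
  "neg_arg (p - q) = neg_arg p - neg_arg q" "neg_arg (- q) = - neg_arg q"
  "neg_arg 0 = 0" "neg_arg 1 = 1" "neg_arg (neg_arg p) = p" "neg_arg (p ^ n) = neg_arg p ^ n"
  "neg_arg [:0, 1:] = - [:0, 1:]" "neg_arg (Polynomial.smult a p) = Polynomial.smult a (neg_arg p)"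
  "neg_arg [:a:] = [:a:]"
proof -
  show "neg_arg (neg_arg p) = p" by (induct p) (simp_all add: neg_arg_def pcompose_pCons pcompose_uminus)
  show "neg_arg (p ^ n) = neg_arg p ^ n" by (induct n) (simp_all add: neg_arg_def pcompose_mult pcompose_1)
qed (simp_all add: neg_arg_def pcompose_add pcompose_mult pcompose_diff pcompose_uminus pcompose_1
     pcompose_smult pcompose_pCons)

lemma degree_neg_arg [simp]: "degree (neg_arg q) = degree q" for q :: "'a::field poly"
  by (simp add: neg_arg_def degree_pcompose)

lemma neg_arg_dvd_iff: "neg_arg p dvd neg_arg q \<longleftrightarrow> p dvd q" for p :: "'a::field poly"
proof -
  have *: "p dvd q \<Longrightarrow> neg_arg p dvd neg_arg q" for p q :: "'a poly" by (auto simp: neg_arg_simps elim!: dvdE)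
  show ?thesis using *[of p q] *[of "neg_arg p" "neg_arg q"] by (auto simp: neg_arg_simps)
qed

locale selfadjoint_endo = finite_dimensional_vector_space scale Basis
  for scale :: "'a::field \<Rightarrow> 'v::ab_group_add \<Rightarrow> 'v" (infixr "*s" 75) and Basis :: "'v set" +
  fixes b :: "'v \<Rightarrow> 'v \<Rightarrow> 'a" and u :: "'v \<Rightarrow> 'v"
  assumes two: "(2::'a) \<noteq> 0"
    and b: "bilinear_form scale b" and sym: "symmetric_form b" and nd: "nondegenerate_form b"
    and u: "Vector_Spaces.linear scale scale u" and sa: "selfadjoint b u"
begin

abbreviation P :: "'a poly \<Rightarrow> 'v \<Rightarrow> 'v" where
  "P q \<equiv> poly_endo scale q u"

abbreviation T :: "'a poly" where "T \<equiv> [:0, 1:]"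

lemmas bl = bil[OF b]

lemma b_sym: "b x y = b y x" using sym by (simp add: symmetric_form_def)

lemma b_sa: "b (u x) y = b x (u y)" using sa by (simp add: selfadjoint_def)

lemmas u_lin = linE[OF u]

lemma P_sum:
  assumes "degree q \<le> n"
  shows "P q x = (\<Sum>i\<le>n. coeff q i *s ((u ^^ i) x))" unfolding poly_endo_def
  by (rule sum.mono_neutral_left) (use assms in \<open>auto simp: coeff_eq_0\<close>)

lemma funpow_lin: "lin f \<Longrightarrow> lin (f ^^ n)"
proof (induct n)
  case 0 then show ?case by (intro linI) auto
next
  case (Suc n) then show ?case by (intro linI) (auto simp: lin_add lin_scale)
qed

lemma P_lin: "lin (P q)" by (rule linI) (auto simp: poly_endo_def linE[OF funpow_lin[OF u]] sum.distrib[symmetric]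
      scale_right_distrib scale_sum_right mult.commute)

lemmas P_linE = linE[OF P_lin]

lemma P_add: "P (p + q) x = P p x + P q x"
proof -
  let ?n = "max (degree p) (degree q)"
  have "degree (p + q) \<le> ?n" by (rule degree_add_le_max)
  note s = P_sum[of p ?n x, OF max.cobounded1] P_sum[of q ?n x, OF max.cobounded2] P_sum[OF this, of x]
  show ?thesis unfolding s by (simp add: sum.distrib scale_left_distrib)
qed

lemma P_0 [simp]: "P 0 x = 0" by (simp add: poly_endo_def)

lemma P_const [simp]: "P [:a:] x = a *s x" by (simp add: poly_endo_def)

lemma P_pCons: "P (pCons a q) x = a *s x + P q (u x)"
proof -
  have "P (pCons a q) x = (\<Sum>i\<le>Suc (degree q). coeff (pCons a q) i *s ((u ^^ i) x))"
    by (rule P_sum) (rule degree_pCons_le)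
  also have "\<dots> = a *s x + (\<Sum>i\<le>degree q. coeff q i *s ((u ^^ Suc i) x))" by (subst sum.atMost_Suc_shift) simp
  also have "\<dots> = a *s x + P q (u x)" by (simp add: poly_endo_def funpow_swap1)
  finally show ?thesis .
qed

lemma P_1 [simp]: "P 1 x = x" by (simp add: one_pCons)

lemma P_T [simp]: "P T x = u x" by (simp add: P_pCons)

lemma P_commute_lin:
  assumes "lin f" "\<And>x. f (u x) = u (f x)"
  shows "f (P q x) = P q (f x)" by (induct q arbitrary: x) (auto simp: P_pCons linE[OF assms(1)] assms(2) P_linE)

lemma P_u: "P q (u x) = u (P q x)" using P_commute_lin[OF u] by simp

lemma P_smult: "P (Polynomial.smult a q) x = a *s P q x"
  by (induct q arbitrary: x) (auto simp: P_pCons scale_right_distrib)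

lemma P_uminus: "P (- q) x = - P q x" using P_smult[of "-1" q x] by simp

lemma P_diff: "P (p - q) x = P p x - P q x" using P_add[of p "- q" x] by (simp add: P_uminus)

lemma P_mult: "P (p * q) x = P p (P q x)"
proof (induct p arbitrary: x)
  case (pCons a p)
  have "pCons a p * q = Polynomial.smult a q + pCons 0 (p * q)" by (simp add: mult_pCons_left)
  then show ?case by (simp add: P_add P_smult P_pCons pCons P_u)
qed simp

lemma P_power: "P (q ^ n) x = (P q ^^ n) x" by (induct n) (auto simp: P_mult)

lemma P_commute: "P p (P q x) = P q (P p x)" by (metis P_mult mult.commute)

lemma b_P: "b (P q x) y = b x (P q y)" by (induct q arbitrary: x y) (auto simp: P_pCons bl b_sa P_u)

lemma b_P_mult: "b (P p x) (P q y) = b x (P (p * q) y)" by (simp add: b_P P_mult)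

lemma P_anticommute:
  assumes w: "lin w" and a: "\<And>x. w (u x) = - u (w x)"
  shows "w (P q x) = P (neg_arg q) (w x)"
proof (induct q arbitrary: x)
  case (pCons c q)
  have "neg_arg (pCons c q) = [:c:] + (- T) * neg_arg q" by (simp add: neg_arg_def pcompose_pCons)
  then have "P (neg_arg (pCons c q)) (w x) = c *s w x - u (P (neg_arg q) (w x))"
    by (simp only: P_add P_mult P_const P_uminus P_T) simp
  then show ?case by (simp add: P_pCons linE[OF w] pCons a P_linE P_u)
qed (simp add: neg_arg_simps linE[OF w])

definition stable :: "'v set \<Rightarrow> bool" where
  "stable S \<longleftrightarrow> (\<forall>x\<in>S. u x \<in> S)"

lemma P_stable: "subspace S \<Longrightarrow> stable S \<Longrightarrow> x \<in> S \<Longrightarrow> P q x \<in> S"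
  by (induct q arbitrary: x) (auto simp: P_pCons stable_def subspace_0 subspace_add subspace_scale)

definition nondeg_on :: "'v set \<Rightarrow> bool" where
  "nondeg_on S \<longleftrightarrow> (\<forall>x\<in>S. (\<forall>y\<in>S. b x y = 0) \<longrightarrow> x = 0)"

lemma nondeg_onD: "nondeg_on S \<Longrightarrow> x \<in> S \<Longrightarrow> (\<And>y. y \<in> S \<Longrightarrow> b x y = 0) \<Longrightarrow> x = 0" by (auto simp: nondeg_on_def)

lemma nondeg_on_perp: "subspace S \<Longrightarrow> nondeg_on S \<Longrightarrow> perp b S S = {0}"
  using b_sym subspace_0 by (fastforce simp: perp_def nondeg_on_def bl)

lemma nondeg_UNIV: "nondeg_on UNIV" using nd by (auto simp: nondeg_on_def nondegenerate_form_def)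

lemma nondeg_on_decompose:
  assumes "subspace C" "nondeg_on C"
  obtains z where "z \<in> C" "\<And>x. x \<in> C \<Longrightarrow> b x (y - z) = 0"
  using nondeg_decompose[OF b sym assms(1) nondeg_on_perp[OF assms], of y] by blast

definition proj :: "'v set \<Rightarrow> 'v \<Rightarrow> 'v" where
  "proj C y = (THE z. z \<in> C \<and> (\<forall>x\<in>C. b x (y - z) = 0))"

lemma proj_eqI:
  assumes C: "subspace C" "nondeg_on C" and z: "z \<in> C" "\<And>x. x \<in> C \<Longrightarrow> b x (y - z) = 0"
  shows "proj C y = z" unfolding proj_def
proof (rule the_equality)
  show "z \<in> C \<and> (\<forall>x\<in>C. b x (y - z) = 0)" using z by blast
next
  fix w assume w: "w \<in> C \<and> (\<forall>x\<in>C. b x (y - w) = 0)"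
  then have "w - z \<in> C" using z C subspace_diff by blast
  moreover have "b (w - z) x = 0" if "x \<in> C" for x using w z that b_sym[of _ x] by (auto simp: bl)
  ultimately have "w - z = 0" using C(2) by (auto simp: nondeg_on_def)
  then show "w = z" by simp
qed

lemma proj_props:
  assumes C: "subspace C" "nondeg_on C"
  shows proj_in: "proj C y \<in> C" and proj_orth: "x \<in> C \<Longrightarrow> b x (y - proj C y) = 0"
    and proj_id: "x \<in> C \<Longrightarrow> proj C x = x" and proj_lin: "lin (proj C)"
    and proj_perp: "(\<And>x. x \<in> C \<Longrightarrow> b x y = 0) \<Longrightarrow> proj C y = 0"
proof -
  have *: "proj C y \<in> C \<and> (\<forall>x\<in>C. b x (y - proj C y) = 0)" for y
  proof -
    obtain z where z: "z \<in> C" "\<And>x. x \<in> C \<Longrightarrow> b x (y - z) = 0" using nondeg_on_decompose[OF C, of y] by blast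
    then show ?thesis using proj_eqI[OF C z] by simp
  qed
  then show "proj C y \<in> C" "x \<in> C \<Longrightarrow> b x (y - proj C y) = 0" for x by auto
  show "x \<in> C \<Longrightarrow> proj C x = x" by (rule proj_eqI[OF C]) (auto simp: bl)
  show "(\<And>x. x \<in> C \<Longrightarrow> b x y = 0) \<Longrightarrow> proj C y = 0" by (rule proj_eqI[OF C]) (auto simp: subspace_0[OF C(1)])
  show "lin (proj C)"
  proof (rule linI)
    fix x y show "proj C (x + y) = proj C x + proj C y"
    proof (rule proj_eqI[OF C])
      show "proj C x + proj C y \<in> C" using * C subspace_add by blast
      fix c assume "c \<in> C"
      then have "b c (x - proj C x) = 0" "b c (y - proj C y) = 0" using * by blast+
      then show "b c (x + y - (proj C x + proj C y)) = 0" by (simp add: bl)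
    qed
  next
    fix a x show "proj C (a *s x) = a *s proj C x"
    proof (rule proj_eqI[OF C])
      show "a *s proj C x \<in> C" using * C subspace_scale by blast
      fix c assume "c \<in> C"
      then have "b c (x - proj C x) = 0" using * by blast
      then show "b c (a *s x - a *s proj C x) = 0" by (simp add: bl)
    qed
  qed
qed

lemma proj_P:
  assumes C: "subspace C" "nondeg_on C" "stable C"
  shows "proj C (P q y) = P q (proj C y)"
proof (rule proj_eqI[OF C(1,2)])
  show "P q (proj C y) \<in> C" using P_stable C proj_in by blast
  fix x assume x: "x \<in> C"
  have "b x (P q y - P q (proj C y)) = b (P q x) (y - proj C y)" by (simp add: b_P P_linE)
  also have "\<dots> = 0" using proj_orth[OF C(1,2)] P_stable[OF C(1,3) x] by blast
  finally show "b x (P q y - P q (proj C y)) = 0" .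
qed

lemma proj_u: "subspace C \<Longrightarrow> nondeg_on C \<Longrightarrow> stable C \<Longrightarrow> proj C (u y) = u (proj C y)" using proj_P[of C T y] by simp

definition orth :: "'v set \<Rightarrow> 'v set \<Rightarrow> bool" where
  "orth A B \<longleftrightarrow> (\<forall>x\<in>A. \<forall>y\<in>B. b x y = 0)"

lemma orth_sym: "orth A B \<Longrightarrow> orth B A" unfolding orth_def using b_sym by metis

lemma nondeg_on_ssum:
  assumes A: "subspace A" "nondeg_on A" and B: "subspace B" "nondeg_on B" and AB: "orth A B"
  shows "nondeg_on (ssum A B)" unfolding nondeg_on_def
proof (intro ballI impI)
  fix x assume "x \<in> ssum A B" and h: "\<forall>y\<in>ssum A B. b x y = 0"
  then obtain a c where x: "x = a + c" "a \<in> A" "c \<in> B" by (auto simp: ssum_def)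
  have "b a y = 0" if "y \<in> A" for y
  proof -
    have "b x y = 0" using h that ssum_left[OF B(1)] by blast
    then show ?thesis using x AB that by (auto simp: bl orth_def b_sym[of c])
  qed
  then have "a = 0" using A x by (auto simp: nondeg_on_def)
  moreover have "b c y = 0" if "y \<in> B" for y
  proof -
    have "b x y = 0" using h that ssum_right[OF A(1)] by blast
    then show ?thesis using x AB that by (auto simp: bl orth_def)
  qed
  then have "c = 0" using B x by (auto simp: nondeg_on_def)
  ultimately show "x = 0" using x by simp
qed

lemma stable_ssum: "stable A \<Longrightarrow> stable B \<Longrightarrow> stable (ssum A B)" by (fastforce simp: stable_def ssum_def u_lin)

lemma orth_ssum: "orth A C \<Longrightarrow> orth B C \<Longrightarrow> orth (ssum A B) C" by (auto simp: orth_def ssum_def bl)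

text \<open>
  With \<open>z = v - w\<close>, a decomposition \<open>u = v + w\<close> into square-zero maps is the same as a selfadjoint \<open>z\<close>
  with \<open>z u = - u z\<close> and \<open>z\<^sup>2 = - u\<^sup>2\<close>; \<open>good S\<close> provides such a \<open>z\<close> on \<open>S\<close>, extended by \<open>0\<close>.
\<close>

definition good :: "'v set \<Rightarrow> bool" where
  "good S \<longleftrightarrow> subspace S \<and> stable S \<and> nondeg_on S \<and>
     (\<exists>z. lin z \<and> range z \<subseteq> S \<and> selfadjoint b z \<and> (\<forall>x. z (u x) = - u (z x)) \<and>
          (\<forall>x\<in>S. z (z x) = - u (u x)))"

text \<open>A map given on \<open>S\<close> is composed with the orthogonal projection, so that it
  vanishes on the orthogonal of \<open>S\<close>. The composite stays selfadjoint because it takes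
  its values in \<open>S\<close>, and it anticommutes with \<open>u\<close> because the projection
  commutes with \<open>u\<close>.\<close>

lemma good_intro:
  assumes S: "subspace S" "stable S" "nondeg_on S"
    and f: "\<And>x. x \<in> S \<Longrightarrow> f x \<in> S" "\<And>x y. x \<in> S \<Longrightarrow> y \<in> S \<Longrightarrow> f (x + y) = f x + f y"
      "\<And>a x. x \<in> S \<Longrightarrow> f (a *s x) = a *s f x"
    and fsa: "\<And>x y. x \<in> S \<Longrightarrow> y \<in> S \<Longrightarrow> b (f x) y = b x (f y)"
    and fu: "\<And>x. x \<in> S \<Longrightarrow> f (u x) = - u (f x)"
    and ff: "\<And>x. x \<in> S \<Longrightarrow> f (f x) = - u (u x)"
  shows "good S"
proof -
  let ?z = "\<lambda>x. f (proj S x)"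
  note pr = proj_props[OF S(1,3)]
  have z: "lin ?z" using f pr by (intro linI) (auto simp: lin_add lin_scale)
  have b1: "b (?z x) y = b (?z x) (proj S y)" for x y using pr(2)[OF f(1)[OF pr(1)], of x y] by (simp add: bl)
  have "selfadjoint b ?z" unfolding selfadjoint_def using b1 fsa pr(1) by (metis b_sym)
  moreover have "?z (u x) = - u (?z x)" for x using proj_u[OF S(1,3,2)] fu pr(1) by simp
  moreover have "?z (?z x) = - u (u x)" if "x \<in> S" for x using that ff f(1) pr(3) by simp
  moreover have "range ?z \<subseteq> S" using f(1) pr(1) by blast
  ultimately show ?thesis unfolding good_def using S z by blast
qed

lemma goodE:
  assumes "good S"
  obtains z where "lin z" "\<And>x. z x \<in> S" "selfadjoint b z" "\<And>x. z (u x) = - u (z x)"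
    "\<And>x. x \<in> S \<Longrightarrow> z (z x) = - u (u x)"
proof -
  from assms have "\<exists>z. lin z \<and> range z \<subseteq> S \<and> selfadjoint b z \<and> (\<forall>x. z (u x) = - u (z x)) \<and>
          (\<forall>x\<in>S. z (z x) = - u (u x))" by (simp add: good_def)
  then obtain z where z: "lin z \<and> range z \<subseteq> S \<and> selfadjoint b z \<and> (\<forall>x. z (u x) = - u (z x)) \<and>
          (\<forall>x\<in>S. z (z x) = - u (u x))" ..
  show ?thesis by (rule that[of z]) (use z in auto)
qed

lemma good_zero: "good {0}" by (rule good_intro[where f = "\<lambda>x. 0"])
     (auto simp: stable_def nondeg_on_def u_lin bl)

lemma good_ssum:
  assumes A: "good A" and B: "good B" and AB: "orth A B"
  shows "good (ssum A B)"
proof -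
  from A have A': "subspace A" "stable A" "nondeg_on A" by (auto simp: good_def)
  from B have B': "subspace B" "stable B" "nondeg_on B" by (auto simp: good_def)
  from A obtain z where z: "lin z" "\<And>x. z x \<in> A" "selfadjoint b z" "\<And>x. z (u x) = - u (z x)"
    "\<And>x. x \<in> A \<Longrightarrow> z (z x) = - u (u x)" by (elim goodE) (rule that)
  from B obtain w where w: "lin w" "\<And>x. w x \<in> B" "selfadjoint b w" "\<And>x. w (u x) = - u (w x)"
    "\<And>x. x \<in> B \<Longrightarrow> w (w x) = - u (u x)" by (elim goodE) (rule that)
  \<comment> \<open>Since \<open>z\<close> takes its values in the nondegenerate \<open>A\<close>,
    it is tested against \<open>A\<close>, and selfadjointness turns this into a pairing of
    \<open>B\<close> with \<open>A\<close>.\<close>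
  have zB: "z y = 0" if y: "y \<in> B" for y
  proof -
    have "b (z y) x = 0" if "x \<in> A" for x
    proof -
      have "b (z y) x = b y (z x)" using z(3) by (simp add: selfadjoint_def)
      then show ?thesis using AB y z(2)[of x] b_sym[of y] by (auto simp: orth_def)
    qed
    moreover have "z y \<in> A" using z(2) by auto
    ultimately show ?thesis by (intro nondeg_onD[OF A'(3)])
  qed
  have wA: "w y = 0" if y: "y \<in> A" for y
  proof -
    have "b (w y) x = 0" if "x \<in> B" for x
    proof -
      have "b (w y) x = b y (w x)" using w(3) by (simp add: selfadjoint_def)
      then show ?thesis using AB y w(2) by (auto simp: orth_def)
    qed
    moreover have "w y \<in> B" using w(2) by auto
    ultimately show ?thesis by (intro nondeg_onD[OF B'(3)])
  qed
  let ?f = "\<lambda>x. z x + w x"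
  show ?thesis
  proof (rule good_intro[where f = ?f])
    show "subspace (ssum A B)" by (rule subspace_ssum[OF A'(1) B'(1)])
    show "stable (ssum A B)" by (rule stable_ssum[OF A'(2) B'(2)])
    show "nondeg_on (ssum A B)" by (rule nondeg_on_ssum[OF A'(1,3) B'(1,3) AB])
    show "?f x \<in> ssum A B" for x using z(2) w(2) by (auto simp: ssum_def)
    show "?f (x + y) = ?f x + ?f y" for x y by (simp add: lin_add[OF z(1)] lin_add[OF w(1)])
    show "?f (a *s x) = a *s ?f x" for a x by (simp add: lin_scale[OF z(1)] lin_scale[OF w(1)] scale_right_distrib)
    show "b (?f x) y = b x (?f y)" for x y using z(3) w(3) by (simp add: selfadjoint_def bl)
    show "?f (u x) = - u (?f x)" for x by (simp add: z(4) w(4) u_lin)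
    fix x assume "x \<in> ssum A B"
    then obtain a c where x: "x = a + c" "a \<in> A" "c \<in> B" by (auto simp: ssum_def)
    have "z a \<in> A" "w c \<in> B" using z(2) w(2) by auto
    then show "?f (?f x) = - u (u x)" using x by (simp add: linE[OF z(1)] linE[OF w(1)] zB wA z(5) w(5) u_lin)
  qed
qed

lemma good_sum:
  assumes "finite I" "\<And>i. i \<in> I \<Longrightarrow> good (F i)"
    "\<And>i j. i \<in> I \<Longrightarrow> j \<in> I \<Longrightarrow> i \<noteq> j \<Longrightarrow> orth (F i) (F j)"
  shows "good {\<Sum>i\<in>I. g i | g. \<forall>i\<in>I. g i \<in> F i}" using assms
proof (induct I)
  case empty
  then show ?case using good_zero by simp
next
  case (insert i I)
  have e: "{\<Sum>j\<in>insert i I. g j | g. \<forall>j\<in>insert i I. g j \<in> F j} =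
      ssum (F i) {\<Sum>j\<in>I. g j | g. \<forall>j\<in>I. g j \<in> F j}" (is "?L = ?R")
  proof
    show "?L \<subseteq> ?R" using insert(1,2) by (auto simp: ssum_def)
    show "?R \<subseteq> ?L"
    proof
      fix x assume "x \<in> ?R"
      then obtain a g where x: "x = a + (\<Sum>j\<in>I. g j)" "a \<in> F i" "\<forall>j\<in>I. g j \<in> F j" by (auto simp: ssum_def)
      let ?g = "g(i := a)"
      have "(\<Sum>j\<in>I. ?g j) = (\<Sum>j\<in>I. g j)" by (rule sum.cong) (use insert(2) in auto)
      then have "x = (\<Sum>j\<in>insert i I. ?g j)" using x insert(1,2) by simp
      then show "x \<in> ?L" using x insert(2) by (intro CollectI exI[of _ ?g]) auto
    qed
  qed
  have "orth (F i) {\<Sum>j\<in>I. g j | g. \<forall>j\<in>I. g j \<in> F j}" unfolding orth_def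
  proof (intro ballI)
    fix x y assume x: "x \<in> F i" and "y \<in> {\<Sum>j\<in>I. g j | g. \<forall>j\<in>I. g j \<in> F j}"
    then obtain g where g: "y = (\<Sum>j\<in>I. g j)" "\<forall>j\<in>I. g j \<in> F j" by blast
    have "b x (g j) = 0" if "j \<in> I" for j using insert(5)[of i j] insert(2) that g x by (auto simp: orth_def)
    then show "b x y = 0" using g by (simp add: bil_sum_right[OF b])
  qed
  then show ?case unfolding e using insert by (intro good_ssum) auto
qed

lemma good_UNIV_iff:
  "good UNIV \<longleftrightarrow> (\<exists>v w. lin v \<and> selfadjoint b v \<and> square_zero v \<and>
            lin w \<and> selfadjoint b w \<and> square_zero w \<and> (\<forall>x. u x = v x + w x))"
  (is "_ = ?R")
proof
  assume "good UNIV"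
  then obtain z where z: "lin z" "selfadjoint b z" "\<And>x. z (u x) = - u (z x)"
    "\<And>x. z (z x) = - u (u x)" by (elim goodE) simp
  let ?v = "\<lambda>x. (1/2) *s (u x + z x)" and ?w = "\<lambda>x. (1/2) *s (u x - z x)"
  have l: "lin ?v" "lin ?w"
    by (rule linI; simp add: u_lin linE[OF z(1)] algebra_simps scale_right_distrib scale_right_diff_distrib)+
  have s: "selfadjoint b ?v" "selfadjoint b ?w" using z(2) sa by (auto simp: selfadjoint_def bl)
  have q: "square_zero ?v" "square_zero ?w"
    by (simp_all add: square_zero_def u_lin linE[OF z(1)] z(3,4) algebra_simps scale_right_distrib scale_right_diff_distrib)
  have "?v x + ?w x = u x" for x
  proof -
    have "?v x + ?w x = (1/2) *s (u x + u x)" by (simp add: scale_right_distrib[symmetric])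
    also have "\<dots> = (1/2 + 1/2) *s u x" by (simp only: scale_right_distrib scale_left_distrib)
    also have "(1/2 + 1/2 :: 'a) = 1" using two by (simp add: field_simps)
    finally show ?thesis by simp
  qed
  then show ?R using l s q by (intro exI[of _ ?v] exI[of _ ?w]) auto
next
  assume ?R
  then obtain v w where v: "lin v" "selfadjoint b v" "\<And>x. v (v x) = 0"
    and w: "lin w" "selfadjoint b w" "\<And>x. w (w x) = 0" and uvw: "\<And>x. u x = v x + w x"
    unfolding square_zero_def by blast
  show "good UNIV"
  proof (rule good_intro[where f = "\<lambda>x. v x - w x"])
    show "nondeg_on UNIV" by (rule nondeg_UNIV)
  qed (use v(2) w(2) in \<open>auto simp: stable_def uvw linE[OF v(1)] linE[OF w(1)] v(3) w(3)
        selfadjoint_def bl algebra_simps scale_right_diff_distrib\<close>)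
qed

end

section \<open>Cyclic subspaces\<close>

text \<open>A nonzero polynomial \<open>d\<close> of least degree in the ideal of \<open>h\<close>
  and \<open>p\<close> divides both, hence is a unit. Multiplying such relations raises
  \<open>p\<close> to a power.\<close>

lemma irreducible_bezout:
  fixes p h :: "'a::field poly"
  assumes p: "irreducible p" and h: "\<not> p dvd h"
  obtains r s where "r * h + s * p ^ n = 1"
proof -
  define J where "J = {r * h + s * p | r s. r * h + s * p \<noteq> 0}"
  have "p \<noteq> 0" using p by auto
  have pJ: "p \<in> J" unfolding J_def using \<open>p \<noteq> 0\<close> by (intro CollectI exI[of _ 0] exI[of _ 1]) simp
  define d where "d = arg_min degree (\<lambda>d. d \<in> J)"
  have dJ: "d \<in> J" unfolding d_def by (rule arg_min_natI[of "\<lambda>d. d \<in> J", OF pJ])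
  have dmin: "degree d \<le> degree e" if "e \<in> J" for e unfolding d_def by (rule arg_min_nat_le[of "\<lambda>d. d \<in> J", OF that])
  from dJ obtain r0 s0 where d: "d = r0 * h + s0 * p" "d \<noteq> 0" by (auto simp: J_def)
  have dd: "d dvd r * h + s * p" for r s
  proof (rule ccontr)
    let ?e = "r * h + s * p"
    assume n: "\<not> d dvd ?e"
    then have m: "?e mod d \<noteq> 0" by (simp add: dvd_eq_mod_eq_0)
    define k where "k = ?e div d"
    have "?e mod d = ?e - k * d" unfolding k_def by (simp add: minus_div_mult_eq_mod)
    also have "k * d = k * (r0 * h + s0 * p)" by (simp only: d(1))
    also have "?e - k * (r0 * h + s0 * p) = (r - k * r0) * h + (s - k * s0) * p" by (simp add: algebra_simps)
    finally have "?e mod d = (r - k * r0) * h + (s - k * s0) * p" .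
    then have "?e mod d \<in> J" using m unfolding J_def
      by (intro CollectI exI[of _ "r - k * r0"] exI[of _ "s - k * s0"]) simp
    then have "degree d \<le> degree (?e mod d)" by (rule dmin)
    moreover have "degree (?e mod d) < degree d \<or> ?e mod d = 0" using degree_mod_less[OF d(2), of ?e] by auto
    ultimately show False using m by simp
  qed
  have "d dvd p" "d dvd h" using dd[of 0 1] dd[of 1 0] by auto
  from \<open>d dvd p\<close> obtain e where e: "p = d * e" by (auto elim: dvdE)
  have "\<not> e dvd 1"
  proof
    assume "e dvd 1"
    then have "p dvd d" using e by (metis dvd_refl mult_1_right mult_dvd_mono unit_imp_dvd is_unit_mult_iff dvd_mult_unit_iff)
    then show False using \<open>d dvd h\<close> h dvd_trans by blast
  qed
  then have "d dvd 1" using p e by (auto simp: irreducible_def)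
  then obtain f where f: "1 = d * f" by (auto elim: dvdE)
  then have one: "(f * r0) * h + (f * s0) * p = 1" unfolding d(1) by (simp add: algebra_simps)
  have "\<exists>r s. r * h + s * p ^ n = 1"
  proof (induct n)
    case 0 then show ?case by (intro exI[of _ 0] exI[of _ 1]) simp
  next
    case (Suc n)
    then obtain r s where rs: "r * h + s * p ^ n = 1" by blast
    have "1 = (r * h + s * p ^ n) * ((f * r0) * h + (f * s0) * p)" using rs one by simp
    also have "\<dots> = (r * ((f * r0) * h + (f * s0) * p) + s * p ^ n * (f * r0)) * h + (s * f * s0) * p ^ Suc n"
      by (simp add: algebra_simps)
    finally show ?case by metis
  qed
  then show ?thesis using that by blast
qed

lemma irreducible_power_factor:
  fixes p h :: "'a::field poly"
  assumes p: "irreducible p" and "\<not> p ^ n dvd h"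
  obtains j h' where "j < n" "h = p ^ j * h'" "\<not> p dvd h'"
proof -
  have "\<exists>j h'. j < n \<and> h = p ^ j * h' \<and> \<not> p dvd h'" using assms(2)
  proof (induct n arbitrary: h)
    case (Suc n)
    show ?case
    proof (cases "p dvd h")
      case True
      then obtain g where g: "h = p * g" by (auto elim: dvdE)
      then have "\<not> p ^ n dvd g" using Suc.prems by (auto intro: mult_dvd_mono)
      then obtain j h' where "j < n" "g = p ^ j * h'" "\<not> p dvd h'" using Suc.hyps by blast
      then show ?thesis using g by (intro exI[of _ "Suc j"] exI[of _ h']) (simp add: algebra_simps)
    next
      case False
      then show ?thesis by (intro exI[of _ 0] exI[of _ h]) simp
    qed
  qed simp
  then show ?thesis using that by blast
qed

text \<open>Hensel lifting. The correction \<open>p ^ Suc n * k\<close> changes \<open>g * g\<close>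
  by \<open>- 2 * g * k * p ^ Suc n\<close> up to higher order; \<open>2 * k\<close> is the present
  error divided by \<open>p ^ Suc n\<close>, and \<open>g\<close> is congruent to 1 modulo
  \<open>p\<close>.\<close>

lemma sqrt_mod_power:
  fixes p c :: "'a::field poly"
  assumes two: "(2::'a) \<noteq> 0" and c: "p dvd c - 1"
  shows "\<exists>g. p dvd g - 1 \<and> p ^ Suc n dvd g * g - c"
proof (induct n)
  case 0
  have "p dvd 1 - c" using c by (metis dvd_diff_commute)
  then show ?case by (intro exI[of _ 1]) simp
next
  case (Suc n)
  let ?q = "p ^ Suc n"
  from Suc obtain g where g: "p dvd g - 1" "?q dvd g * g - c" by blast
  from g(2) obtain r where r: "g * g - c = ?q * r" by (rule dvdE)
  define k where "k = Polynomial.smult (1/2) r"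
  have k: "r = k + k" using two by (simp add: k_def smult_add_left[symmetric])
  let ?g = "g - ?q * k"
  have "?g * ?g - c = (g * g - c) - (g * ?q * k + g * ?q * k) + ?q * ?q * k * k" by (simp add: algebra_simps)
  also have "\<dots> = ?q * ((k + k) * (1 - g) + ?q * k * k)" unfolding r k by (simp add: algebra_simps)
  finally have e: "?g * ?g - c = ?q * ((k + k) * (1 - g) + ?q * k * k)" .
  have "p dvd (k + k) * (1 - g)" using g(1) by (metis dvd_diff_commute dvd_mult)
  then have "p dvd (k + k) * (1 - g) + ?q * k * k" by (intro dvd_add) auto
  then have "?q * p dvd ?g * ?g - c" unfolding e by (rule mult_dvd_mono[OF dvd_refl])
  moreover have "p dvd ?g - 1"
  proof -
    have "p dvd (g - 1) - ?q * k" by (rule dvd_diff[OF g(1)]) auto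
    then show ?thesis by (simp add: algebra_simps)
  qed
  ultimately show ?case by (intro exI[of _ ?g]) (simp add: mult.commute)
qed

context selfadjoint_endo
begin

definition cyc :: "'v \<Rightarrow> 'v set" where
  "cyc x = range (\<lambda>q. P q x)"

lemma subspace_cyc: "subspace (cyc x)"
proof (rule subspaceI)
  show "0 \<in> cyc x" unfolding cyc_def using P_0 by (metis rangeI)
  show "y + z \<in> cyc x" if "y \<in> cyc x" "z \<in> cyc x" for y z using that by (auto simp: cyc_def P_add[symmetric])
  show "a *s y \<in> cyc x" if "y \<in> cyc x" for a y using that by (auto simp: cyc_def P_smult[symmetric])
qed

lemma P_in_cyc: "P q x \<in> cyc x" by (simp add: cyc_def)

lemma P_cyc: "y \<in> cyc x \<Longrightarrow> P q y \<in> cyc x" by (auto simp: cyc_def P_mult[symmetric])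

lemma self_in_cyc: "x \<in> cyc x" using P_in_cyc[of 1 x] by simp

lemma stable_cyc: "stable (cyc x)" unfolding stable_def using P_cyc[of _ x T] by simp

lemma cyc_subset: "subspace S \<Longrightarrow> stable S \<Longrightarrow> x \<in> S \<Longrightarrow> cyc x \<subseteq> S" by (auto simp: cyc_def P_stable)

text \<open>The second condition on \<open>x\<close> forces \<open>P (p ^ (n - 1)) x\<close> to be
  nonzero. A polynomial exactly divisible by \<open>p ^ j\<close> with \<open>j < n\<close> agrees
  with \<open>p ^ j\<close> up to a unit modulo \<open>p ^ n\<close>; if it killed \<open>x\<close>,
  so would \<open>p ^ (n - 1)\<close>.\<close>

lemma annihilator:
  assumes p: "irreducible p" and x: "P (p ^ n) x = 0" "b x (P (p ^ (n - 1) * q) x) \<noteq> 0"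
  shows "P h x = 0 \<longleftrightarrow> p ^ n dvd h"
proof
  assume "p ^ n dvd h"
  then show "P h x = 0" using x(1) by (auto elim!: dvdE simp: P_mult P_commute[of "p ^ n"] P_linE)
next
  assume h: "P h x = 0"
  show "p ^ n dvd h"
  proof (rule ccontr)
    assume "\<not> p ^ n dvd h"
    then obtain j h' where j: "j < n" "h = p ^ j * h'" "\<not> p dvd h'" using irreducible_power_factor[OF p] by blast
    obtain r s where rs: "r * h' + s * p ^ n = 1" using irreducible_bezout[OF p j(3)] by blast
    have "p ^ j = p ^ j * (r * h' + s * p ^ n)" using rs by simp
    also have "\<dots> = r * h + p ^ j * s * p ^ n" unfolding j(2) by (simp add: algebra_simps)
    finally have "P (p ^ j) x = P (r * h + p ^ j * s * p ^ n) x" by simp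
    then have "P (p ^ j) x = 0" using h x(1) by (simp add: P_add P_mult P_linE)
    moreover have "p ^ (n - 1) * q = (p ^ (n - 1 - j) * q) * p ^ j"
      using j(1) by (simp add: power_add[symmetric] algebra_simps)
    ultimately have "P (p ^ (n - 1) * q) x = 0" by (simp only: P_mult P_linE)
    then show False using x(2) by (simp add: bl)
  qed
qed

text \<open>Every nonzero \<open>c\<close> in the cyclic space has a multiple equal to
  \<open>P (p ^ (n - 1) * q) x\<close>, again because the cofactor of the power of \<open>p\<close>
  is a unit modulo \<open>p ^ n\<close>; and this vector pairs nontrivially with
  \<open>x\<close>.\<close>

lemma nondeg_cyc:
  assumes p: "irreducible p" and x: "P (p ^ n) x = 0" "b x (P (p ^ (n - 1) * q) x) \<noteq> 0"
  shows "nondeg_on (cyc x)" unfolding nondeg_on_def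
proof (intro ballI impI)
  fix c assume "c \<in> cyc x" and c0: "\<forall>y\<in>cyc x. b c y = 0"
  then obtain h where h: "c = P h x" by (auto simp: cyc_def)
  show "c = 0"
  proof (rule ccontr)
    assume "c \<noteq> 0"
    then have "\<not> p ^ n dvd h" using annihilator[OF p x] h by simp
    then obtain j h' where j: "j < n" "h = p ^ j * h'" "\<not> p dvd h'" using irreducible_power_factor[OF p] by blast
    obtain r s where rs: "r * h' + s * p ^ n = 1" using irreducible_bezout[OF p j(3)] by blast
    have "p ^ (n - 1) * q = (p ^ (n - 1 - j) * q) * (p ^ j * (r * h' + s * p ^ n))"
      using j(1) rs by (simp add: power_add[symmetric] algebra_simps)
    also have "\<dots> = h * (p ^ (n - 1 - j) * q * r) + p ^ (n - 1 - j) * q * p ^ j * s * p ^ n"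
      unfolding j(2) by (simp add: algebra_simps)
    finally have "P (p ^ (n - 1) * q) x = P h (P (p ^ (n - 1 - j) * q * r) x)"
      using x(1) by (simp add: P_add P_mult P_linE)
    then have "b x (P (p ^ (n - 1) * q) x) = b c (P (p ^ (n - 1 - j) * q * r) x)" by (simp add: h b_P)
    then show False using x(2) c0 P_in_cyc by simp
  qed
qed

text \<open>
  The functional \<open>h \<mapsto> b(x, h(u) x)\<close> determines the isometry class of the cyclic space of \<open>x\<close>. It can be
  prescribed once its restriction to the socle is right: the quotient of two such functionals is a
  unit congruent to \<open>1\<close>, hence a square.
\<close>

lemma normalize:
  assumes p: "irreducible p" and k: "k \<ge> 1"
    and x: "P (p ^ k) x = 0" "b x (P (p ^ (k - 1) * q) x) \<noteq> 0"
    and psi_add: "\<And>g h. psi (g + h) = psi g + psi h"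
    and psi_smult: "\<And>a h. psi (Polynomial.smult a h) = a * psi h"
    and psi_0: "\<And>h. psi (p ^ k * h) = 0"
    and psi_x: "\<And>h. psi (p ^ (k - 1) * h) = b x (P (p ^ (k - 1) * h) x)"
  obtains g where "cyc (P g x) = cyc x" "\<And>h. b (P g x) (P h (P g x)) = psi h" "p dvd g - 1"
proof -
  note ann = annihilator[OF p x] and ndc = nondeg_cyc[OF p x]
  \<comment> \<open>The functional on polynomials is read as one on the cyclic space;
    \<open>psi_0\<close> removes the dependence on the polynomial chosen.\<close>
  define f where "f y = psi (SOME h. P h x = y)" for y
  have f: "f (P h x) = psi h" for h
  proof -
    let ?h = "SOME h'. P h' x = P h x"
    have "P ?h x = P h x" by (rule someI[of _ h]) simp
    then have "P (?h - h) x = 0" by (simp add: P_diff)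
    then have "p ^ k dvd ?h - h" using ann by simp
    then obtain r where "?h - h = p ^ k * r" by (rule dvdE)
    then have "?h = h + p ^ k * r" by (simp add: algebra_simps)
    then have "psi ?h = psi h" by (simp only: psi_add psi_0) simp
    then show ?thesis by (simp add: f_def)
  qed
  obtain z where z: "z \<in> cyc x" "\<And>y. y \<in> cyc x \<Longrightarrow> f y = b z y"
  proof (rule riesz[OF b sym subspace_cyc nondeg_on_perp[OF subspace_cyc ndc], of f])
    fix y z assume "y \<in> cyc x" "z \<in> cyc x"
    then obtain g h where "y = P g x" "z = P h x" by (auto simp: cyc_def)
    then show "f (y + z) = f y + f z" by (simp only: P_add[symmetric] f psi_add)
  next
    fix a y assume "y \<in> cyc x"
    then obtain g where "y = P g x" by (auto simp: cyc_def)
    then show "f (a *s y) = a * f y" by (simp only: P_smult[symmetric] f psi_smult)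
  qed blast
  from z(1) obtain c where c: "z = P c x" by (auto simp: cyc_def)
  have psi: "psi h = b x (P (c * h) x)" for h using z(2)[OF P_in_cyc, of h] f c by (simp add: b_P P_mult)
  \<comment> \<open>By \<open>psi_x\<close> the two functionals agree on multiples of
    \<open>p ^ (k - 1)\<close>, which forces their quotient \<open>c\<close> to be 1 modulo
    \<open>p\<close>.\<close>
  have "P ((c - 1) * p ^ (k - 1)) x = 0"
  proof (rule nondeg_onD[OF ndc P_in_cyc])
    fix y assume "y \<in> cyc x"
    then obtain h where y: "y = P h x" by (auto simp: cyc_def)
    have "b (P ((c - 1) * p ^ (k - 1)) x) y = b x (P (c * (p ^ (k - 1) * h) - p ^ (k - 1) * h) x)"
      unfolding y b_P_mult by (simp add: algebra_simps)
    also have "\<dots> = psi (p ^ (k - 1) * h) - b x (P (p ^ (k - 1) * h) x)" by (simp add: P_diff bl psi)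
    finally show "b (P ((c - 1) * p ^ (k - 1)) x) y = 0" using psi_x by simp
  qed
  then have "p ^ k dvd (c - 1) * p ^ (k - 1)" using ann by simp
  then have "p * p ^ (k - 1) dvd (c - 1) * p ^ (k - 1)" using k by (simp add: power_eq_if)
  moreover have "p ^ (k - 1) \<noteq> 0" using p by auto
  ultimately have "p dvd c - 1" by (simp only: dvd_mult_cancel_right) simp
  \<comment> \<open>Replacing \<open>x\<close> by \<open>P g x\<close> multiplies its functional by
    \<open>g * g\<close>, so a square root of \<open>c\<close> modulo \<open>p ^ k\<close> is
    wanted.\<close>
  then obtain g where g: "p dvd g - 1" "p ^ Suc (k - 1) dvd g * g - c" using sqrt_mod_power[OF two] by blast
  have "p ^ k dvd g * g - c" using g(2) k by simp
  then obtain r where r: "g * g - c = p ^ k * r" by (rule dvdE)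
  then have gg: "g * g = c + p ^ k * r" by (simp add: algebra_simps)
  have 1: "b (P g x) (P h (P g x)) = psi h" for h
  proof -
    have "b (P g x) (P h (P g x)) = b x (P ((g * g) * h) x)"
      by (simp only: b_P P_mult[symmetric] mult.assoc mult.commute[of h] mult.left_commute)
    also have "(g * g) * h = c * h + (r * h) * p ^ k" unfolding gg by (simp add: algebra_simps)
    also have "b x (P (c * h + (r * h) * p ^ k) x) = psi h" by (simp add: P_add P_mult x(1) P_linE psi)
    finally show ?thesis .
  qed
  have ng: "\<not> p dvd g"
  proof
    assume "p dvd g"
    then have "p dvd g - (g - 1)" using g(1) dvd_diff by blast
    then have "p dvd 1" by simp
    then show False using p by (simp add: irreducible_def)
  qed
  obtain r' s where rs: "r' * g + s * p ^ k = 1" using irreducible_bezout[OF p ng] by blast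
  have "P (r' * g + s * p ^ k) x = x" using rs by simp
  then have xg: "P r' (P g x) = x" by (simp add: P_add P_mult x(1) P_linE)
  have 2: "cyc (P g x) = cyc x"
  proof
    show "cyc (P g x) \<subseteq> cyc x" by (rule cyc_subset[OF subspace_cyc stable_cyc P_in_cyc])
    have "x \<in> cyc (P g x)" using P_in_cyc[of r' "P g x"] xg by simp
    then show "cyc x \<subseteq> cyc (P g x)" by (rule cyc_subset[OF subspace_cyc stable_cyc])
  qed
  show ?thesis by (rule that[OF 2 1 g(1)])
qed

text \<open>
  The map \<open>h(u) X + g(u) Y \<mapsto> h(-u) s\<^sub>1(u) Y + g(-u) s\<^sub>2(u) X\<close> is the wanted \<open>z\<close>. It is used with
  \<open>s\<^sub>1 = s\<^sub>2 = t\<close>, and with \<open>s\<^sub>1 = 1\<close>, \<open>s\<^sub>2 = - t\<^sup>2\<close> for nilpotent cyclic spaces whose dimensions differ by \<open>2\<close>.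
\<close>

lemma good_swap:
  assumes ndS: "nondeg_on (ssum (cyc X) (cyc Y))"
    and wd: "\<And>h g. P h X + P g Y = 0 \<Longrightarrow> P (neg_arg h * s1) Y + P (neg_arg g * s2) X = 0"
    and XY: "\<And>r. b X (P (neg_arg r * s2) X) = b Y (P (r * s1) Y)"
    and m: "\<And>r. b X (P (neg_arg r * s1) Y) = b X (P (r * s1) Y)"
           "\<And>r. b X (P (neg_arg r * s2) Y) = b X (P (r * s2) Y)"
    and s: "neg_arg s1 * s2 = - (T * T)" "neg_arg s2 * s1 = - (T * T)"
  shows "good (ssum (cyc X) (cyc Y))"
proof -
  let ?S = "ssum (cyc X) (cyc Y)"
  have SI: "P h X + P g Y \<in> ?S" for h g by (rule ssumI[OF P_in_cyc P_in_cyc])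
  have SE: "\<exists>h g. x = P h X + P g Y" if "x \<in> ?S" for x using that by (auto simp: ssum_def cyc_def)
  \<comment> \<open>A vector may be written in several ways as \<open>P h X + P g Y\<close>; one
    pair is chosen, and \<open>wd\<close> makes the value of \<open>f\<close> independent of the
    choice.\<close>
  define hg where "hg x = (SOME hg. x = P (fst hg) X + P (snd hg) Y)" for x
  define f where "f x = P (neg_arg (fst (hg x)) * s1) Y + P (neg_arg (snd (hg x)) * s2) X" for x
  have f: "f (P h X + P g Y) = P (neg_arg h * s1) Y + P (neg_arg g * s2) X" for h g
  proof -
    let ?x = "P h X + P g Y"
    have "?x = P (fst (hg ?x)) X + P (snd (hg ?x)) Y" unfolding hg_def by (rule someI[of _ "(h, g)"]) simp
    then have "P (fst (hg ?x) - h) X + P (snd (hg ?x) - g) Y = 0" by (simp add: P_diff algebra_simps)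
    from wd[OF this] show ?thesis by (simp add: f_def neg_arg_simps left_diff_distrib P_diff algebra_simps)
  qed
  show ?thesis
  proof (rule good_intro[where f = f])
    show "subspace ?S" by (rule subspace_ssum[OF subspace_cyc subspace_cyc])
    show "stable ?S" by (rule stable_ssum[OF stable_cyc stable_cyc])
    show "nondeg_on ?S" by (rule ndS)
  next
    fix x assume "x \<in> ?S"
    then obtain h g where x: "x = P h X + P g Y" using SE by blast
    show "f x \<in> ?S" unfolding x f using SI[of "neg_arg g * s2" "neg_arg h * s1"] by (simp add: add.commute)
    show "f (a *s x) = a *s f x" for a
    proof -
      have "a *s x = P (Polynomial.smult a h) X + P (Polynomial.smult a g) Y"
        by (simp add: x P_smult scale_right_distrib)
      then show ?thesis unfolding x by (simp only: f) (simp add: neg_arg_simps P_smult scale_right_distrib)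
    qed
    show "f (u x) = - u (f x)"
    proof -
      have "u x = P (T * h) X + P (T * g) Y" by (simp only: x P_mult P_T u_lin)
      then have "f (u x) = P (neg_arg (T * h) * s1) Y + P (neg_arg (T * g) * s2) X" by (simp only: f)
      also have "\<dots> = P (- T * (neg_arg h * s1)) Y + P (- T * (neg_arg g * s2)) X"
        by (simp only: neg_arg_simps mult.assoc)
      also have "\<dots> = - u (f x)" unfolding x f by (simp only: P_mult P_uminus P_T u_lin minus_add_distrib)
      finally show ?thesis .
    qed
    show "f (f x) = - u (u x)"
    proof -
      \<comment> \<open>Each application of \<open>f\<close> substitutes \<open>-t\<close>, so two
        of them restore the polynomials and leave only the product of one flipped factor with the
        other; \<open>s\<close> asks that it be \<open>- (T * T)\<close>.\<close>
      have e1: "neg_arg (neg_arg g * s2) * s1 = - (T * T) * g" by (simp only: neg_arg_simps s(2)[symmetric] mult_ac)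
      have e2: "neg_arg (neg_arg h * s1) * s2 = - (T * T) * h" by (simp only: neg_arg_simps s(1)[symmetric] mult_ac)
      have "f x = P (neg_arg g * s2) X + P (neg_arg h * s1) Y" unfolding x f by (rule add.commute)
      then have "f (f x) = f (P (neg_arg g * s2) X + P (neg_arg h * s1) Y)" by (simp only:)
      also have "\<dots> = P (- (T * T) * g) Y + P (- (T * T) * h) X" by (simp only: f e1 e2)
      also have "\<dots> = - u (u x)" unfolding x by (simp only: P_mult P_uminus P_T u_lin minus_add_distrib add.commute)
      finally show ?thesis .
    qed
    fix y assume "y \<in> ?S"
    then obtain h' g' where y: "y = P h' X + P g' Y" using SE by blast
    show "f (x + y) = f x + f y"
    proof -
      have "x + y = P (h + h') X + P (g + g') Y" by (simp add: x y P_add)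
      then show ?thesis unfolding x y by (simp only: f) (simp add: neg_arg_simps distrib_right P_add)
    qed
    have sY: "b Y (P r X) = b X (P r Y)" for r by (metis b_sym b_P)
    have "b (f x) y = b Y (P ((neg_arg h * g') * s1) Y) + b X (P ((neg_arg g * h') * s2) X)
        + b X (P ((neg_arg h * h') * s1) Y) + b X (P ((neg_arg g * g') * s2) Y)"
      unfolding x y f by (simp add: bl b_P_mult sY mult_ac)
    also have "b Y (P ((neg_arg h * g') * s1) Y) = b X (P ((h * neg_arg g') * s2) X)"
      using XY[of "neg_arg h * g'"] by (simp add: neg_arg_simps)
    also have "b X (P ((neg_arg g * h') * s2) X) = b Y (P ((g * neg_arg h') * s1) Y)"
      using XY[of "g * neg_arg h'"] by (simp add: neg_arg_simps)
    also have "b X (P ((neg_arg h * h') * s1) Y) = b X (P ((h * neg_arg h') * s1) Y)"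
      using m(1)[of "h * neg_arg h'"] by (simp add: neg_arg_simps)
    also have "b X (P ((neg_arg g * g') * s2) Y) = b X (P ((g * neg_arg g') * s2) Y)"
      using m(2)[of "g * neg_arg g'"] by (simp add: neg_arg_simps)
    finally show "b (f x) y = b x (f y)" unfolding x y f by (simp add: bl b_P_mult sY mult_ac)
  qed
qed

text \<open>Orthogonality makes the mixed pairings in \<open>good_swap\<close> trivial and splits a
  relation \<open>P h X + P g Y = 0\<close> in two. Condition \<open>XY\<close> carries an
  annihilator of one generator to the other, which is the well-definedness.\<close>

lemma good_pair:
  assumes nX: "nondeg_on (cyc X)" and nY: "nondeg_on (cyc Y)" and o: "orth (cyc X) (cyc Y)"
    and XY: "\<And>r. b X (P (neg_arg r * s2) X) = b Y (P (r * s1) Y)"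
    and s: "neg_arg s1 * s2 = - (T * T)" "neg_arg s2 * s1 = - (T * T)"
  shows "good (ssum (cyc X) (cyc Y))"
proof (rule good_swap[where ?s1.0 = s1 and ?s2.0 = s2])
  show "nondeg_on (ssum (cyc X) (cyc Y))" by (rule nondeg_on_ssum[OF subspace_cyc nX subspace_cyc nY o])
  have o': "b X (P q Y) = 0" for q using o self_in_cyc P_in_cyc by (auto simp: orth_def)
  show "b X (P (neg_arg r * s1) Y) = b X (P (r * s1) Y)" "b X (P (neg_arg r * s2) Y) = b X (P (r * s2) Y)" for r
    using o' by simp_all
  fix h g assume e: "P h X + P g Y = 0"
  have hX: "P h X = 0"
  proof (rule nondeg_onD[OF nX P_in_cyc])
    fix y assume y: "y \<in> cyc X"
    have "P h X = - P g Y" using e by (simp add: eq_neg_iff_add_eq_0)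
    then show "b (P h X) y = 0" using o y P_in_cyc by (auto simp: orth_def bl b_sym[of "P g Y"])
  qed
  then have gY: "P g Y = 0" using e by simp
  have "P (neg_arg h * s1) Y = 0"
  proof (rule nondeg_onD[OF nY P_in_cyc])
    fix y assume "y \<in> cyc Y"
    then obtain q where y: "y = P q Y" by (auto simp: cyc_def)
    have "b (P (neg_arg h * s1) Y) y = b Y (P ((neg_arg h * q) * s1) Y)" unfolding y b_P_mult by (simp only: mult_ac)
    also have "\<dots> = b X (P ((neg_arg q * s2) * h) X)" unfolding XY[symmetric] by (simp only: neg_arg_simps mult_ac)
    also have "\<dots> = 0" by (simp add: P_mult hX P_linE bl)
    finally show "b (P (neg_arg h * s1) Y) y = 0" .
  qed
  moreover have "P (neg_arg g * s2) X = 0"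
  proof (rule nondeg_onD[OF nX P_in_cyc])
    fix y assume "y \<in> cyc X"
    then obtain q where y: "y = P q X" by (auto simp: cyc_def)
    have "b (P (neg_arg g * s2) X) y = b X (P (neg_arg (g * neg_arg q) * s2) X)"
      unfolding y b_P_mult by (simp only: neg_arg_simps mult_ac)
    also have "\<dots> = b Y (P ((neg_arg q * s1) * g) Y)" unfolding XY by (simp only: mult_ac)
    also have "\<dots> = 0" by (simp add: P_mult gY P_linE bl)
    finally show "b (P (neg_arg g * s2) X) y = 0" .
  qed
  ultimately show "P (neg_arg h * s1) Y + P (neg_arg g * s2) X = 0" by simp
qed (use XY s in simp_all)

text \<open>The case \<open>X = Y\<close> of \<open>good_swap\<close>. The condition says that
  \<open>b X (P h X)\<close> vanishes for the even polynomials \<open>h\<close> without constant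
  term.\<close>

lemma good_single:
  assumes nX: "nondeg_on (cyc X)"
    and XX: "\<And>r. b X (P (neg_arg r * T) X) = b X (P (r * T) X)"
  shows "good (cyc X)"
proof -
  have e: "ssum (cyc X) (cyc X) = cyc X"
  proof
    show "ssum (cyc X) (cyc X) \<subseteq> cyc X" by (rule ssum_subset[OF subspace_cyc]) auto
    show "cyc X \<subseteq> ssum (cyc X) (cyc X)" by (rule ssum_left[OF subspace_cyc])
  qed
  have "good (ssum (cyc X) (cyc X))"
  proof (rule good_swap[where ?s1.0 = T and ?s2.0 = T])
    show "nondeg_on (ssum (cyc X) (cyc X))" using nX e by simp
    show "neg_arg T * T = - (T * T)" by (simp only: neg_arg_simps mult_minus_left)
    then show "neg_arg T * T = - (T * T)" .
    fix h g assume "P h X + P g X = 0"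
    then have z: "P (h + g) X = 0" by (simp add: P_add)
    have "P (neg_arg (h + g) * T) X = 0"
    proof (rule nondeg_onD[OF nX P_in_cyc])
      fix y assume "y \<in> cyc X"
      then obtain q where y: "y = P q X" by (auto simp: cyc_def)
      have "b (P (neg_arg (h + g) * T) X) y = b X (P (neg_arg ((h + g) * neg_arg q) * T) X)"
        unfolding y b_P_mult by (simp only: neg_arg_simps mult_ac)
      also have "\<dots> = b X (P ((neg_arg q * T) * (h + g)) X)" unfolding XX by (simp only: mult_ac)
      also have "\<dots> = 0" unfolding P_mult by (simp only: z P_linE bl)
      finally show "b (P (neg_arg (h + g) * T) X) y = 0" .
    qed
    then show "P (neg_arg h * T) X + P (neg_arg g * T) X = 0" by (simp only: neg_arg_simps distrib_right P_add)
  qed (use XX in simp_all)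
  then show ?thesis by (simp only: e)
qed

lemma perp_image:
  assumes S: "subspace S" "nondeg_on S" and f: "lin f" "\<And>x. x \<in> S \<Longrightarrow> f x \<in> S"
    and g: "lin g" "\<And>x. x \<in> S \<Longrightarrow> g x \<in> S" and fg: "\<And>x y. x \<in> S \<Longrightarrow> y \<in> S \<Longrightarrow> b (f x) y = b x (g y)"
  shows "perp b S (f ` S) = {x \<in> S. g x = 0}" and "perp b S {x \<in> S. g x = 0} = f ` S"
proof -
  show 1: "perp b S (f ` S) = {x \<in> S. g x = 0}"
  proof
    show "perp b S (f ` S) \<subseteq> {x \<in> S. g x = 0}"
    proof
      fix x assume x: "x \<in> perp b S (f ` S)"
      then have xS: "x \<in> S" by (simp add: perp_def)
      have "b (g x) y = 0" if y: "y \<in> S" for y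
      proof -
        have "b (g x) y = b (f y) x" using fg[OF y xS] b_sym by simp
        then show ?thesis using x y by (simp add: perp_def)
      qed
      then have "g x = 0" by (rule nondeg_onD[OF S(2) g(2)[OF xS]])
      then show "x \<in> {x \<in> S. g x = 0}" using xS by simp
    qed
    show "{x \<in> S. g x = 0} \<subseteq> perp b S (f ` S)" using fg by (auto simp: perp_def bl)
  qed
  have "perp b S (perp b S (f ` S)) = ssum (f ` S) {0}"
    using perp_perp[OF b sym S(1) subspace_image[OF f(1) S(1)]] nondeg_on_perp[OF S] f(2) by auto
  also have "\<dots> = f ` S" by (auto simp: ssum_def)
  finally show "perp b S {x \<in> S. g x = 0} = f ` S" using 1 by simp
qed

text \<open>For \<open>S = UNIV\<close> this is the denominator of V_{p,k}. The version relative to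
  \<open>S\<close> serves \<open>lift_decomposition\<close>, where the space shrinks at each
  step.\<close>

definition Nk :: "'v set \<Rightarrow> 'a poly \<Rightarrow> nat \<Rightarrow> 'v set" where
  "Nk S p k = {y + z | y z. y \<in> S \<and> P (p ^ (k - 1)) y = 0 \<and> z \<in> P p ` S \<and> P (p ^ k) z = 0}"

lemma Nk_kernel: "x \<in> Nk S p k \<Longrightarrow> k \<ge> 1 \<Longrightarrow> P (p ^ k) x = 0"
proof -
  assume "x \<in> Nk S p k" and k: "k \<ge> 1"
  then obtain y z where x: "x = y + z" "P (p ^ (k - 1)) y = 0" "P (p ^ k) z = 0" by (auto simp: Nk_def)
  have "p ^ k = p * p ^ (k - 1)" using k by (simp add: power_eq_if)
  then have "P (p ^ k) y = 0" using x(2) by (simp only: P_mult P_linE)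
  then show ?thesis using x by (simp add: P_linE)
qed

lemma subspace_Nk: "subspace S \<Longrightarrow> subspace (Nk S p k)"
proof -
  assume S: "subspace S"
  have "Nk S p k = ssum {y \<in> S. P (p ^ (k - 1)) y = 0} {z \<in> P p ` S. P (p ^ k) z = 0}" by (auto simp: Nk_def ssum_def)
  then show ?thesis using S by (simp add: subspace_ssum subspace_ker subspace_image P_lin)
qed

lemma Nk_P:
  assumes S: "subspace S" "stable S" and x: "x \<in> Nk S p k"
  shows "P q x \<in> Nk S p k"
proof -
  from x obtain y s where y: "x = y + P p s" "y \<in> S" "s \<in> S" "P (p ^ (k - 1)) y = 0" "P (p ^ k) (P p s) = 0"
    by (auto simp: Nk_def)
  have "P q x = P q y + P p (P q s)" unfolding y(1) by (simp add: P_linE P_commute[of q p])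
  moreover have "P (p ^ (k - 1)) (P q y) = 0" "P (p ^ k) (P p (P q s)) = 0"
    using y(4,5) by (simp_all add: P_commute[of _ q] P_linE)
  ultimately show ?thesis unfolding Nk_def using P_stable[OF S] y(2,3) by blast
qed

text \<open>Makes the forms \<open>b x (P (p ^ (k - 1) * q) y)\<close> well defined on V_{p,k}: one
  summand of \<open>x\<close> is killed by \<open>p ^ (k - 1)\<close>, and the other supplies the
  missing factor \<open>p\<close> that kills \<open>y\<close>.\<close>

lemma Nk_orth:
  assumes x: "x \<in> Nk UNIV p k" and y: "P (p ^ k) y = 0" and k: "k \<ge> 1"
  shows "b x (P (p ^ (k - 1) * q) y) = 0"
proof -
  from x obtain v s where x: "x = v + P p s" "P (p ^ (k - 1)) v = 0" by (auto simp: Nk_def)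
  have "b v (P (p ^ (k - 1) * q) y) = b (P (p ^ (k - 1)) v) (P q y)" by (simp add: b_P P_mult)
  moreover have e: "p * p ^ (k - 1) = p ^ k" using k by (simp add: power_eq_if)
  have "b (P p s) (P (p ^ (k - 1) * q) y) = b s (P (q * (p * p ^ (k - 1))) y)" by (simp only: b_P_mult mult_ac)
  then have "b (P p s) (P (p ^ (k - 1) * q) y) = 0" using y unfolding e by (simp add: P_mult P_linE bl)
  ultimately show ?thesis using x y by (simp add: bl P_mult P_linE)
qed

text \<open>Nondegeneracy of the induced form. The image of \<open>P (p ^ k)\<close> is the
  orthogonal of its kernel, so \<open>P (p ^ (k - 1)) y\<close> equals some
  \<open>P (p ^ k) s\<close>, and \<open>y - P p s\<close> lies in the smaller kernel.\<close>

lemma Nk_nondeg: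
  assumes y: "P (p ^ k) y = 0" and k: "k \<ge> 1"
    and h: "\<And>z. P (p ^ k) z = 0 \<Longrightarrow> b y (P (p ^ (k - 1)) z) = 0"
  shows "y \<in> Nk UNIV p k"
proof -
  have "P (p ^ (k - 1)) y \<in> perp b UNIV {x \<in> UNIV. P (p ^ k) x = 0}"
    using h by (auto simp: perp_def b_P b_sym[of _ "P _ y"])
  also have "\<dots> = range (P (p ^ k))"
    by (rule perp_image(2)[OF subspace_UNIV nondeg_UNIV P_lin _ P_lin]) (auto simp: b_P)
  finally obtain s where s: "P (p ^ (k - 1)) y = P (p ^ k) s" by blast
  have e: "p ^ (k - 1) * p = p ^ k" using k by (simp add: power_eq_if mult.commute)
  have "P (p ^ (k - 1)) (y - P p s) = P (p ^ (k - 1)) y - P (p ^ (k - 1) * p) s" by (simp only: P_linE P_mult)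
  then have 1: "P (p ^ (k - 1)) (y - P p s) = 0" using s e by simp
  have "P (p ^ k) (P p s) = P p (P (p ^ (k - 1)) y)" using s by (simp add: P_commute)
  also have "\<dots> = P (p ^ k) y" using e by (metis P_mult mult.commute)
  finally have 2: "P (p ^ k) (P p s) = 0" using y by simp
  have "y = (y - P p s) + P p s" by simp
  then show ?thesis unfolding Nk_def using 1 2 by blast
qed

text \<open>
  Lifts an orthogonal basis of the quotients \<open>V\<^sub>p\<^sub>,\<^sub>k\<close> to an orthogonal decomposition of the space
  itself, by projecting orthogonally to the cyclic subspaces already found.
\<close>

lemma lift_decomposition:
  assumes "finite I" and p: "irreducible p"
    and "subspace S" "stable S" "nondeg_on S" "\<exists>n. \<forall>x\<in>S. P (p ^ n) x = 0"
    and "\<And>i. i \<in> I \<Longrightarrow> X i \<in> S \<and> K i \<ge> 1 \<and> P (p ^ K i) (X i) = 0 \<and>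
           (\<exists>q. b (X i) (P (p ^ (K i - 1) * q) (X i)) \<noteq> 0)"
    and "\<And>i j q. i \<in> I \<Longrightarrow> j \<in> I \<Longrightarrow> i \<noteq> j \<Longrightarrow> K i = K j \<Longrightarrow> b (X i) (P (p ^ (K i - 1) * q) (X j)) = 0"
    and "\<And>k y. k \<ge> 1 \<Longrightarrow> y \<in> S \<Longrightarrow> P (p ^ k) y = 0 \<Longrightarrow>
           \<exists>c. y - (\<Sum>i\<in>{i\<in>I. K i = k}. P (c i) (X i)) \<in> Nk S p k"
  shows "\<exists>X'. (\<forall>i\<in>I. X' i \<in> S \<and> P (p ^ K i) (X' i) = 0 \<and>
             (\<forall>q. b (X' i) (P (p ^ (K i - 1) * q) (X' i)) = b (X i) (P (p ^ (K i - 1) * q) (X i)))) \<and>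
           (\<forall>i\<in>I. \<forall>j\<in>I. i \<noteq> j \<longrightarrow> orth (cyc (X' i)) (cyc (X' j))) \<and>
           (\<forall>s\<in>S. \<exists>c. s = (\<Sum>i\<in>I. P (c i) (X' i)))" using assms(1,3-)
proof (induct I arbitrary: S X)
  case (empty S X)
  \<comment> \<open>With no generators, every kernel in \<open>S\<close> is contained in its
    denominator. At the least exponent \<open>n\<close> that kills \<open>S\<close> this would mean
    that \<open>p ^ (n - 1)\<close> already kills \<open>S\<close>, unless \<open>n = 0\<close> and
    \<open>S\<close> is zero.\<close>
  define n where "n = (LEAST n. \<forall>x\<in>S. P (p ^ n) x = 0)"
  have n: "\<forall>x\<in>S. P (p ^ n) x = 0" unfolding n_def by (rule LeastI_ex[OF empty(4)])
  have "n = 0"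
  proof (rule ccontr)
    assume n0: "n \<noteq> 0"
    have "P (p ^ (n - 1)) x = 0" if x: "x \<in> S" for x
    proof -
      have "x \<in> Nk S p n" using empty(7)[of n x] n0 x n by auto
      then obtain y s where y: "x = y + P p s" "P (p ^ (n - 1)) y = 0" "s \<in> S" by (auto simp: Nk_def)
      have "p ^ (n - 1) * p = p ^ n" using n0 by (simp add: power_eq_if mult.commute)
      then have "P (p ^ (n - 1)) (P p s) = P (p ^ n) s" by (metis P_mult)
      then show ?thesis using y n by (simp add: P_linE)
    qed
    then have "n \<le> n - 1" unfolding n_def by (intro Least_le) blast
    then show False using n0 by simp
  qed
  then show ?case using n by auto
next
  case (insert i0 I S X)
  note S = insert(4-6)
  let ?x = "X i0" and ?n = "K i0"
  define C where "C = cyc ?x"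
  obtain q0 where x: "?x \<in> S" "?n \<ge> 1" "P (p ^ ?n) ?x = 0" "b ?x (P (p ^ (?n - 1) * q0) ?x) \<noteq> 0"
    using insert(8)[of i0] by blast
  note ann = annihilator[OF p x(3,4)]
  have C: "subspace C" "nondeg_on C" "stable C"
    unfolding C_def by (rule subspace_cyc nondeg_cyc[OF p x(3,4)] stable_cyc)+
  have CS: "C \<subseteq> S" unfolding C_def by (rule cyc_subset[OF S(1,2) x(1)])
  note pr = proj_props[OF C(1,2)] and prP = proj_P[OF C]
  \<comment> \<open>The remaining generators are replaced by their components orthogonal to the
    cyclic space \<open>C\<close>.\<close>
  define r where "r y = y - proj C y" for y
  have r_lin: "lin r" unfolding r_def by (rule linI) (auto simp: linE[OF pr(4)] scale_right_diff_distrib)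
  have rP: "r (P q y) = P q (r y)" for q y by (simp add: r_def prP P_linE)
  have rC: "b c (r y) = 0" if "c \<in> C" for c y using pr(2)[OF that] by (simp add: r_def)
  have rC0: "r c = 0" if "c \<in> C" for c using pr(3)[OF that] by (simp add: r_def)
  define S' where "S' = perp b S C"
  have rS: "r y \<in> S'" if "y \<in> S" for y
  proof -
    have "r y \<in> S" unfolding r_def by (rule subspace_diff[OF S(1) that]) (use pr(1) CS in blast)
    then show ?thesis using rC by (auto simp: S'_def perp_def)
  qed
  have rS': "r y = y" if "y \<in> S'" for y using that pr(5)[of y] by (auto simp: S'_def perp_def r_def)
  have S'S: "S' \<subseteq> S" by (auto simp: S'_def perp_def)
  have S': "subspace S'" unfolding S'_def by (rule subspace_perp[OF b S(1)])
  have S'2: "stable S'" using S(2) C(3) by (auto simp: S'_def perp_def stable_def b_sa[symmetric])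
  have S'3: "nondeg_on S'" unfolding nondeg_on_def
  proof (intro ballI impI)
    fix y assume y: "y \<in> S'" and h: "\<forall>z\<in>S'. b y z = 0"
    show "y = 0"
    proof (rule nondeg_onD[OF S(3)])
      show "y \<in> S" using y S'S by blast
      fix s assume s: "s \<in> S"
      have "b y (r s) = 0" using h rS[OF s] by blast
      moreover have "b y (proj C s) = 0" using y pr(1) by (simp add: S'_def perp_def b_sym[of y])
      ultimately show "b y s = 0" by (simp add: r_def bl)
    qed
  qed
  have projker: "P (p ^ (?n - 1)) (proj C y) = 0" if "\<And>q. b ?x (P (p ^ (?n - 1) * q) y) = 0" for y
  proof (rule nondeg_onD[OF C(2)])
    show "P (p ^ (?n - 1)) (proj C y) \<in> C" using pr(1) P_cyc unfolding C_def by blast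
    fix c assume "c \<in> C"
    then obtain q where c: "c = P q ?x" by (auto simp: C_def cyc_def)
    have "b (P (p ^ (?n - 1)) (proj C y)) c = b (P (p ^ (?n - 1) * q) ?x) (proj C y)"
      unfolding c by (metis b_P_mult b_sym b_P mult.commute)
    also have "\<dots> = b (P (p ^ (?n - 1) * q) ?x) y"
      using rC[of "P (p ^ (?n - 1) * q) ?x" y] P_in_cyc by (simp add: r_def bl C_def)
    also have "\<dots> = 0" using that by (simp add: b_P)
    finally show "b (P (p ^ (?n - 1)) (proj C y)) c = 0" .
  qed
  \<comment> \<open>Inside \<open>C\<close> these pairings of level \<open>k\<close> vanish. For
    \<open>k\<close> below the exponent, a vector killed by \<open>p ^ k\<close> is a multiple of
    \<open>p ^ (?n - k)\<close>; above it, \<open>p ^ (k - 1)\<close> kills \<open>C\<close>; at the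
    exponent itself this is the last hypothesis.\<close>
  have Z: "b c (P (p ^ (k - 1) * q) c') = 0"
    if c: "c \<in> C" "c' \<in> C" "P (p ^ k) c = 0" "P (p ^ k) c' = 0" "k \<ge> 1"
      "k = ?n \<Longrightarrow> P (p ^ (?n - 1)) c = 0" for c c' k q
  proof -
    consider "k < ?n" | "k = ?n" | "k > ?n" by linarith
    then show ?thesis
    proof cases
      case 1
      from c(1) obtain h where h: "c = P h ?x" by (auto simp: C_def cyc_def)
      have "p ^ ?n dvd p ^ k * h" using c(3) h ann by (simp add: P_mult[symmetric])
      moreover have "p ^ ?n = p ^ k * p ^ (?n - k)" using 1 by (simp add: power_add[symmetric])
      moreover have "p ^ k \<noteq> 0" using p by auto
      ultimately have "p ^ (?n - k) dvd h" by (metis dvd_mult_cancel_left)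
      then obtain h' where h': "h = p ^ (?n - k) * h'" by (rule dvdE)
      have "p ^ (?n - k) * p ^ (k - 1) = p ^ (?n - 1 - k) * p ^ k" using 1 c(5) by (simp add: power_add[symmetric])
      then have "h * (p ^ (k - 1) * q) = (h' * q * p ^ (?n - 1 - k)) * p ^ k"
        unfolding h' by (metis (no_types, lifting) mult.assoc mult.commute)
      then have "P (h * (p ^ (k - 1) * q)) c' = 0" using c(4) by (simp only: P_mult P_linE)
      then show ?thesis unfolding h b_P P_mult[symmetric] by (simp add: bl)
    next
      case 2
      have "b c (P (p ^ (k - 1) * q) c') = b (P (p ^ (k - 1)) c) (P q c')" by (simp add: b_P P_mult)
      then show ?thesis using c(6) 2 by (simp add: bl)
    next
      case 3
      from c(2) obtain h where h: "c' = P h ?x" by (auto simp: C_def cyc_def)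
      have "p ^ (k - 1) = p ^ (k - 1 - ?n) * p ^ ?n" using 3 by (simp add: power_add[symmetric])
      then have "p ^ (k - 1) * q * h = (p ^ (k - 1 - ?n) * q * h) * p ^ ?n" by (simp add: mult_ac)
      then have "P (p ^ (k - 1) * q) c' = 0" using x(3) unfolding h by (metis P_mult P_linE(3))
      then show ?thesis by (simp add: bl)
    qed
  qed
  \<comment> \<open>Consequently the projection changes no pairing of the remaining generators at
    their level.\<close>
  have E: "b (r y) (P (p ^ (k - 1) * q) (r y')) = b y (P (p ^ (k - 1) * q) y')"
    if y: "P (p ^ k) y = 0" "P (p ^ k) y' = 0" "k \<ge> 1"
      "k = ?n \<Longrightarrow> (\<And>q. b ?x (P (p ^ (?n - 1) * q) y) = 0)" for y y' k q
  proof -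
    let ?Q = "p ^ (k - 1) * q"
    have s: "y = proj C y + r y" "y' = proj C y' + r y'" by (auto simp: r_def)
    have "b y (P ?Q y') = b (proj C y + r y) (P ?Q (proj C y' + r y'))" using s by simp
    also have "\<dots> = b (proj C y) (P ?Q (proj C y')) + b (proj C y) (r (P ?Q y'))
        + b (P ?Q (proj C y')) (r y) + b (r y) (P ?Q (r y'))" by (simp only: P_linE bl rP b_sym[of "r y"] add_ac)
    also have "b (proj C y) (r (P ?Q y')) = 0" by (rule rC[OF pr(1)])
    also have "b (P ?Q (proj C y')) (r y) = 0" by (rule rC) (use pr(1) P_cyc in \<open>auto simp: C_def\<close>)
    also have "b (proj C y) (P ?Q (proj C y')) = 0"
    proof (rule Z[OF pr(1) pr(1) _ _ y(3)])
      show "P (p ^ k) (proj C y) = 0" "P (p ^ k) (proj C y') = 0"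
        using y(1,2) prP[symmetric] by (simp_all add: linE[OF pr(4)])
      show "P (p ^ (?n - 1)) (proj C y) = 0" if "k = ?n" using y(4)[OF that] projker by blast
    qed
    finally show ?thesis by simp
  qed
  have E': "b (r (X j)) (P (p ^ (K j - 1) * q) (r (X i))) = b (X j) (P (p ^ (K j - 1) * q) (X i))"
    if "i \<in> I" "j \<in> I" "K i = K j" for i j q
  proof (rule E)
    show "P (p ^ K j) (X j) = 0" "P (p ^ K j) (X i) = 0" "K j \<ge> 1" using insert(8)[of j] insert(8)[of i] that by auto
    show "b ?x (P (p ^ (?n - 1) * q) (X j)) = 0" if "K j = ?n" for q
      using insert(9)[of i0 j q] that \<open>j \<in> I\<close> insert(2) by auto
  qed
  have "\<exists>X'. (\<forall>i\<in>I. X' i \<in> S' \<and> P (p ^ K i) (X' i) = 0 \<and>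
             (\<forall>q. b (X' i) (P (p ^ (K i - 1) * q) (X' i)) = b (r (X i)) (P (p ^ (K i - 1) * q) (r (X i))))) \<and>
           (\<forall>i\<in>I. \<forall>j\<in>I. i \<noteq> j \<longrightarrow> orth (cyc (X' i)) (cyc (X' j))) \<and>
           (\<forall>s\<in>S'. \<exists>c. s = (\<Sum>i\<in>I. P (c i) (X' i)))"
  proof (rule insert(3)[OF S' S'2 S'3])
    show "\<exists>n. \<forall>x\<in>S'. P (p ^ n) x = 0" using insert(7) S'S by blast
  next
    fix i assume i: "i \<in> I"
    then have Xi: "X i \<in> S" "1 \<le> K i" "P (p ^ K i) (X i) = 0"
      "\<exists>q. b (X i) (P (p ^ (K i - 1) * q) (X i)) \<noteq> 0" using insert(8)[of i] by auto
    show "r (X i) \<in> S' \<and> 1 \<le> K i \<and> P (p ^ K i) (r (X i)) = 0 \<and>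
        (\<exists>q. b (r (X i)) (P (p ^ (K i - 1) * q) (r (X i))) \<noteq> 0)"
      using Xi E'[OF i i] by (auto simp: rS rP[symmetric] linE[OF r_lin])
  next
    fix i j q assume "i \<in> I" "j \<in> I" "i \<noteq> j" "K i = K j"
    then show "b (r (X i)) (P (p ^ (K i - 1) * q) (r (X j))) = 0" using E'[of j i q] insert(9)[of i j q] by simp
  next
    fix k y assume k: "k \<ge> 1" and y: "y \<in> S'" "P (p ^ k) y = 0"
    obtain c where c: "y - (\<Sum>i\<in>{i\<in>insert i0 I. K i = k}. P (c i) (X i)) \<in> Nk S p k"
      using insert(10)[OF k _ y(2)] y(1) S'S by blast
    then obtain y1 s where ys: "y - (\<Sum>i\<in>{i\<in>insert i0 I. K i = k}. P (c i) (X i)) = y1 + P p s"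
      "y1 \<in> S" "s \<in> S" "P (p ^ (k - 1)) y1 = 0" "P (p ^ k) (P p s) = 0" by (auto simp: Nk_def)
    have "r (\<Sum>i\<in>{i\<in>insert i0 I. K i = k}. P (c i) (X i)) = (\<Sum>i\<in>{i\<in>insert i0 I. K i = k}. P (c i) (r (X i)))"
      by (simp add: linE[OF r_lin] rP)
    also have "\<dots> = (\<Sum>i\<in>{i\<in>I. K i = k}. P (c i) (r (X i)))" by (rule sum.mono_neutral_right)
         (use insert(1,2) rC0[of ?x] self_in_cyc in \<open>auto simp: C_def P_linE\<close>)
    finally have "y - (\<Sum>i\<in>{i\<in>I. K i = k}. P (c i) (r (X i))) = r (y1 + P p s)"
      using rS'[OF y(1)] unfolding ys(1)[symmetric] by (simp add: linE[OF r_lin])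
    also have "\<dots> = r y1 + P p (r s)" by (simp add: linE[OF r_lin] rP)
    also have "\<dots> \<in> Nk S' p k"
    proof -
      have "P (p ^ (k - 1)) (r y1) = 0" using ys(4) by (simp add: rP[symmetric] linE[OF r_lin])
      moreover have "P (p ^ k) (P p (r s)) = r (P (p ^ k) (P p s))" by (simp add: rP)
      then have "P (p ^ k) (P p (r s)) = 0" using ys(5) by (simp add: linE[OF r_lin])
      ultimately show ?thesis unfolding Nk_def using rS ys(2,3) by blast
    qed
    finally show "\<exists>c. y - (\<Sum>i\<in>{i\<in>I. K i = k}. P (c i) (r (X i))) \<in> Nk S' p k" by blast
  qed
  then obtain X' where XX: "(\<forall>i\<in>I. X' i \<in> S' \<and> P (p ^ K i) (X' i) = 0 \<and>
             (\<forall>q. b (X' i) (P (p ^ (K i - 1) * q) (X' i)) = b (r (X i)) (P (p ^ (K i - 1) * q) (r (X i))))) \<and>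
           (\<forall>i\<in>I. \<forall>j\<in>I. i \<noteq> j \<longrightarrow> orth (cyc (X' i)) (cyc (X' j))) \<and>
           (\<forall>s\<in>S'. \<exists>c. s = (\<Sum>i\<in>I. P (c i) (X' i)))" ..
  note X' = bspec[OF conjunct1[OF XX]] bspec[OF bspec[OF conjunct1[OF conjunct2[OF XX]]], THEN mp]
    bspec[OF conjunct2[OF conjunct2[OF XX]]]
  let ?X = "X'(i0 := ?x)"
  have o: "orth (cyc ?x) (cyc (X' i))" if "i \<in> I" for i
  proof -
    have "cyc (X' i) \<subseteq> S'" using cyc_subset[OF S' S'2] X'(1)[OF that] by blast
    then show ?thesis by (auto simp: orth_def S'_def perp_def C_def)
  qed
  show ?case
  proof (intro exI[of _ ?X] conjI ballI impI)
    fix i assume i: "i \<in> insert i0 I"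
    show "?X i \<in> S" using X'(1)[of i] i x(1) S'S by auto
    show "P (p ^ K i) (?X i) = 0" using X'(1)[of i] i x(3) by auto
    show "\<forall>q. b (?X i) (P (p ^ (K i - 1) * q) (?X i)) = b (X i) (P (p ^ (K i - 1) * q) (X i))"
      using X'(1)[of i] i E'[of i i] by auto
    fix j assume "j \<in> insert i0 I" "i \<noteq> j"
    then consider "i = i0" "j \<in> I" "j \<noteq> i0" | "j = i0" "i \<in> I" "i \<noteq> i0" | "i \<in> I" "j \<in> I" "i \<noteq> i0" "j \<noteq> i0" "i \<noteq> j"
      using i insert(2) by blast
    then show "orth (cyc (?X i)) (cyc (?X j))"
    proof cases
      case 1 then show ?thesis using o[of j] by simp
    next
      case 2 then show ?thesis using orth_sym[OF o[of i]] by simp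
    next
      case 3 then show ?thesis using X'(2)[of i j] by simp
    qed
  next
    fix s assume s: "s \<in> S"
    obtain c where c: "r s = (\<Sum>i\<in>I. P (c i) (X' i))" using X'(3)[OF rS[OF s]] by blast
    obtain h where h: "proj C s = P h ?x" using pr(1)[of s] by (auto simp: C_def cyc_def)
    have "(\<Sum>i\<in>insert i0 I. P ((c(i0 := h)) i) (?X i)) = P h ?x + (\<Sum>i\<in>I. P ((c(i0 := h)) i) (?X i))"
      using insert(1,2) by simp
    also have "(\<Sum>i\<in>I. P ((c(i0 := h)) i) (?X i)) = (\<Sum>i\<in>I. P (c i) (X' i))" by (rule sum.cong) (use insert(2) in auto)
    also have "P h ?x + (\<Sum>i\<in>I. P (c i) (X' i)) = s" unfolding c[symmetric] h[symmetric] by (simp add: r_def)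
    finally have "s = (\<Sum>i\<in>insert i0 I. P ((c(i0 := h)) i) (?X i))" ..
    then show "\<exists>c. s = (\<Sum>i\<in>insert i0 I. P (c i) (?X i))" by blast
  qed
qed

section \<open>Orthogonal bases of the invariants\<close>

text \<open>Representatives of an orthogonal basis of V_{p,k} for the form with values in the
  residue field. That form vanishes on a pair exactly when \<open>b\<close> vanishes for all test
  polynomials \<open>q\<close>; linear independence follows from orthogonality and nonzero
  values.\<close>

definition obasis :: "'a poly \<Rightarrow> nat \<Rightarrow> 'v set \<Rightarrow> bool" where
  "obasis p k E \<longleftrightarrow> finite E \<and>
     (\<forall>e\<in>E. P (p ^ k) e = 0 \<and> (\<exists>q. b e (P (p ^ (k - 1) * q) e) \<noteq> 0)) \<and>
     (\<forall>e\<in>E. \<forall>e'\<in>E. e \<noteq> e' \<longrightarrow> (\<forall>q. b e (P (p ^ (k - 1) * q) e') = 0)) \<and>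
     (\<forall>y. P (p ^ k) y = 0 \<longrightarrow> (\<exists>c. y - (\<Sum>e\<in>E. P (c e) e) \<in> Nk UNIV p k))"

text \<open>Gram-Schmidt with all vectors taken from \<open>G\<close>, which is not supposed stable
  under the residue field: the necessity of (i) takes the vectors fixed by an involution.
  \<open>gen\<close> says that the orthogonal of the vectors found is still generated by vectors of
  \<open>G\<close>. An orthogonal set of greatest size then spans.\<close>

lemma obasis_exists:
  assumes p: "irreducible p" and k: "k \<ge> 1"
    and G: "\<And>g. g \<in> G \<Longrightarrow> P (p ^ k) g = 0" "\<And>g h. g \<in> G \<Longrightarrow> h \<in> G \<Longrightarrow> g + h \<in> G"
    and gen: "\<And>E y. E \<subseteq> G \<Longrightarrow> P (p ^ k) y = 0 \<Longrightarrow> (\<And>e q. e \<in> E \<Longrightarrow> b e (P (p ^ (k - 1) * q) y) = 0) \<Longrightarrow>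
       \<exists>g1\<in>G. \<exists>g2\<in>G. \<exists>r1 r2. y = P r1 g1 + P r2 g2 \<and>
         (\<forall>e\<in>E. \<forall>q. b e (P (p ^ (k - 1) * q) g1) = 0 \<and> b e (P (p ^ (k - 1) * q) g2) = 0)"
  shows "\<exists>E\<subseteq>G. obasis p k E"
proof -
  define Q where "Q = (\<lambda>E. E \<subseteq> G \<and> finite E \<and> (\<forall>e\<in>E. \<exists>q. b e (P (p ^ (k - 1) * q) e) \<noteq> 0) \<and>
     (\<forall>e\<in>E. \<forall>e'\<in>E. e \<noteq> e' \<longrightarrow> (\<forall>q. b e (P (p ^ (k - 1) * q) e') = 0)))"
  have bound: "card E \<le> dimension" if E: "Q E" for E
  proof -
    have "independent E"
    proof (rule independent_if_scalars_zero)
      show "finite E" using E by (simp add: Q_def)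
      fix f e assume s: "(\<Sum>x\<in>E. f x *s x) = 0" and e: "e \<in> E"
      obtain q where q: "b e (P (p ^ (k - 1) * q) e) \<noteq> 0" using E e by (auto simp: Q_def)
      have "0 = b e (P (p ^ (k - 1) * q) (\<Sum>x\<in>E. f x *s x))" by (simp add: s P_linE bl)
      also have "\<dots> = (\<Sum>x\<in>E. f x * b e (P (p ^ (k - 1) * q) x))" by (simp add: P_linE bl bil_sum_right[OF b])
      also have "\<dots> = (\<Sum>x\<in>{e}. f x * b e (P (p ^ (k - 1) * q) x))"
        by (rule sum.mono_neutral_right) (use E e in \<open>auto simp: Q_def\<close>)
      finally show "f e = 0" using q by simp
    qed
    then show ?thesis using independent_card_le_dim[of E UNIV] dim_UNIV by (simp add: dimension_def)
  qed
  have "Q {}" by (simp add: Q_def)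
  then obtain E where E: "Q E" and max: "\<And>F. Q F \<Longrightarrow> card F \<le> card E"
    using ex_has_greatest_nat[of Q "{}" card "Suc dimension"] bound by (metis less_Suc_eq_le)
  have EG: "E \<subseteq> G" "finite E" using E by (auto simp: Q_def)
  have Ek: "P (p ^ k) e = 0" "\<exists>q. b e (P (p ^ (k - 1) * q) e) \<noteq> 0" if "e \<in> E" for e
    using that E G by (auto simp: Q_def)
  have Eo: "b e (P (p ^ (k - 1) * q) e') = 0" if "e \<in> E" "e' \<in> E" "e \<noteq> e'" for e e' q
    using that E by (auto simp: Q_def)
  \<comment> \<open>Subtracting its projections to the cyclic spaces makes \<open>y\<close>
    orthogonal to \<open>E\<close> for the form of level \<open>k\<close>.\<close>
  have reduce: "\<exists>c. \<forall>e\<in>E. \<forall>q. b e (P (p ^ (k - 1) * q) (y - (\<Sum>e\<in>E. P (c e) e))) = 0"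
    if y: "P (p ^ k) y = 0" for y
  proof -
    have "\<exists>c. \<forall>q. b e (P (p ^ (k - 1) * q) (y - P c e)) = 0" if e: "e \<in> E" for e
    proof -
      obtain q0 where q0: "b e (P (p ^ (k - 1) * q0) e) \<noteq> 0" using Ek(2)[OF e] by blast
      obtain z where z: "z \<in> cyc e" "\<And>x. x \<in> cyc e \<Longrightarrow> b x (y - z) = 0"
        using nondeg_on_decompose[OF subspace_cyc nondeg_cyc[OF p Ek(1)[OF e] q0], of y] by blast
      then obtain c where "z = P c e" by (auto simp: cyc_def)
      then have "b e (P (p ^ (k - 1) * q) (y - P c e)) = 0" for q
        using z(2)[OF P_in_cyc, of "p ^ (k - 1) * q"] by (simp add: b_P)
      then show ?thesis by blast
    qed
    then obtain c where c: "\<And>e q. e \<in> E \<Longrightarrow> b e (P (p ^ (k - 1) * q) (y - P (c e) e)) = 0" by metis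
    have "b e (P (p ^ (k - 1) * q) (y - (\<Sum>e\<in>E. P (c e) e))) = 0" if e: "e \<in> E" for e q
    proof -
      have "(\<Sum>e'\<in>E. b e (P (p ^ (k - 1) * q) (P (c e') e'))) = (\<Sum>e'\<in>{e}. b e (P (p ^ (k - 1) * q) (P (c e') e')))"
        by (rule sum.mono_neutral_right)
           (use EG e Eo in \<open>auto simp: P_mult[symmetric] mult.assoc\<close>)
      then have "b e (P (p ^ (k - 1) * q) (\<Sum>e\<in>E. P (c e) e)) = b e (P (p ^ (k - 1) * q) (P (c e) e))"
        by (simp add: P_linE bil_sum_right[OF b])
      then show ?thesis using c[OF e, of q] by (simp add: P_linE bl)
    qed
    then show ?thesis by blast
  qed
  have span: "\<exists>c. y - (\<Sum>e\<in>E. P (c e) e) \<in> Nk UNIV p k" if y: "P (p ^ k) y = 0" for y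
  proof (rule ccontr)
    assume neg: "\<not> ?thesis"
    obtain c where c: "\<And>e q. e \<in> E \<Longrightarrow> b e (P (p ^ (k - 1) * q) (y - (\<Sum>e\<in>E. P (c e) e))) = 0"
      using reduce[OF y] by blast
    define y0 where "y0 = y - (\<Sum>e\<in>E. P (c e) e)"
    have kerP: "P (p ^ k) (P q e) = 0" if "e \<in> E" for q e using Ek(1)[OF that] by (simp add: P_commute[of _ q] P_linE)
    have y0: "P (p ^ k) y0 = 0" using y kerP by (simp add: y0_def P_linE)
    have "y0 \<notin> Nk UNIV p k" using neg y0_def by blast
    then obtain z where z: "P (p ^ k) z = 0" "b y0 (P (p ^ (k - 1)) z) \<noteq> 0" using Nk_nondeg[OF y0 k] by blast
    obtain d where d: "\<And>e q. e \<in> E \<Longrightarrow> b e (P (p ^ (k - 1) * q) (z - (\<Sum>e\<in>E. P (d e) e))) = 0"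
      using reduce[OF z(1)] by blast
    define z0 where "z0 = z - (\<Sum>e\<in>E. P (d e) e)"
    have z0: "P (p ^ k) z0 = 0" using z(1) kerP by (simp add: z0_def P_linE)
    have "b y0 (P (p ^ (k - 1)) (P q e)) = 0" if "e \<in> E" for e q
      using c[OF that, of q] unfolding y0_def[symmetric] by (metis P_mult b_P b_sym)
    then have "b y0 (P (p ^ (k - 1)) z0) = b y0 (P (p ^ (k - 1)) z)"
      by (simp add: z0_def P_linE bl bil_sum_right[OF b])
    then have nz: "b y0 (P (p ^ (k - 1)) z0) \<noteq> 0" using z by simp
    have "\<exists>g1\<in>G. \<exists>g2\<in>G. \<exists>r1 r2. y0 = P r1 g1 + P r2 g2 \<and>
         (\<forall>e\<in>E. \<forall>q. b e (P (p ^ (k - 1) * q) g1) = 0 \<and> b e (P (p ^ (k - 1) * q) g2) = 0)"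
      by (rule gen[OF EG(1) y0]) (unfold y0_def, rule c)
    then obtain g1 g2 r1 r2 where g: "g1 \<in> G" "g2 \<in> G" "y0 = P r1 g1 + P r2 g2 \<and>
         (\<forall>e\<in>E. \<forall>q. b e (P (p ^ (k - 1) * q) g1) = 0 \<and> b e (P (p ^ (k - 1) * q) g2) = 0)"
      by (elim bexE exE) (rule that)
    have "\<exists>g1\<in>G. \<exists>g2\<in>G. \<exists>r1 r2. z0 = P r1 g1 + P r2 g2 \<and>
         (\<forall>e\<in>E. \<forall>q. b e (P (p ^ (k - 1) * q) g1) = 0 \<and> b e (P (p ^ (k - 1) * q) g2) = 0)"
      by (rule gen[OF EG(1) z0]) (unfold z0_def, rule d)
    then obtain h1 h2 s1 s2 where h: "h1 \<in> G" "h2 \<in> G" "z0 = P s1 h1 + P s2 h2 \<and>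
         (\<forall>e\<in>E. \<forall>q. b e (P (p ^ (k - 1) * q) h1) = 0 \<and> b e (P (p ^ (k - 1) * q) h2) = 0)"
      by (elim bexE exE) (rule that)
    have ex: "\<exists>g\<in>{g1,g2}. \<exists>h\<in>{h1,h2}. \<exists>q. b g (P (p ^ (k - 1) * q) h) \<noteq> 0"
    proof (rule ccontr)
      assume "\<not> ?thesis"
      then have no: "b g (P (p ^ (k - 1) * q) h) = 0" if "g \<in> {g1,g2}" "h \<in> {h1,h2}" for g h q using that by blast
      have "b (P r g) (P (p ^ (k - 1)) (P s h)) = 0" if "g \<in> {g1,g2}" "h \<in> {h1,h2}" for g h r s
        using no[OF that, of "r * s"] by (simp add: b_P P_mult P_commute)
      then have "b y0 (P (p ^ (k - 1)) z0) = 0" unfolding conjunct1[OF g(3)] conjunct1[OF h(3)] by (simp add: P_linE bl)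
      then show False using nz by simp
    qed
    define O' where "O' = (\<lambda>x. x \<in> G \<and> (\<forall>e\<in>E. \<forall>q. b e (P (p ^ (k - 1) * q) x) = 0))"
    obtain g h q where gh: "O' g" "O' h" "b g (P (p ^ (k - 1) * q) h) \<noteq> 0"
    proof -
      have "O' g1" "O' g2" "O' h1" "O' h2" using g h unfolding O'_def by auto
      then show ?thesis using ex that by blast
    qed
    \<comment> \<open>Polarization: if \<open>g\<close> and \<open>h\<close> pair nontrivially, then
      one of \<open>g\<close>, \<open>h\<close>, \<open>g + h\<close> has nonzero value and may be
      added to \<open>E\<close>.\<close>
    let ?B = "\<lambda>x y. b x (P (p ^ (k - 1) * q) y)"
    have "?B (g + h) (g + h) = ?B g g + ?B h h + (?B g h + ?B h g)" by (simp add: P_linE bl)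
    also have "?B h g = ?B g h" by (metis b_P b_sym)
    also have "?B g h + ?B g h = 2 * ?B g h" by simp
    finally have "?B (g + h) (g + h) = ?B g g + ?B h h + 2 * ?B g h" .
    moreover have "2 * ?B g h \<noteq> 0" using gh(3) two by simp
    ultimately have "?B g g \<noteq> 0 \<or> ?B h h \<noteq> 0 \<or> ?B (g + h) (g + h) \<noteq> 0" by fastforce
    moreover have "O' (g + h)" using gh G(2) unfolding O'_def by (simp add: P_linE bl)
    ultimately obtain x where x: "O' x" "?B x x \<noteq> 0" using gh by blast
    have xE: "x \<notin> E" using x unfolding O'_def by blast
    have sE: "b x (P (p ^ (k - 1) * q) e) = 0" if "e \<in> E" for e q
      using x(1) that unfolding O'_def by (metis b_P b_sym)
    have "Q (insert x E)" using E x sE unfolding Q_def O'_def by auto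
    then have "card (insert x E) \<le> card E" by (rule max)
    then show False using xE EG by simp
  qed
  have "obasis p k E" unfolding obasis_def using EG Ek Eo span by blast
  then show ?thesis using EG by blast
qed

lemma obasis_exists':
  assumes "irreducible p" "k \<ge> 1"
  obtains E where "obasis p k E"
proof -
  have "\<exists>E\<subseteq>{y. P (p ^ k) y = 0}. obasis p k E"
  proof (rule obasis_exists[OF assms])
    fix E y assume "P (p ^ k) y = 0" "\<And>e q. e \<in> E \<Longrightarrow> b e (P (p ^ (k - 1) * q) y) = 0"
    then show "\<exists>g1\<in>{y. P (p ^ k) y = 0}. \<exists>g2\<in>{y. P (p ^ k) y = 0}. \<exists>r1 r2. y = P r1 g1 + P r2 g2 \<and>
         (\<forall>e\<in>E. \<forall>q. b e (P (p ^ (k - 1) * q) g1) = 0 \<and> b e (P (p ^ (k - 1) * q) g2) = 0)"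
      by (intro bexI[of _ y] bexI[of _ 0] exI[of _ 1]) (auto simp: P_linE bl)
  qed (auto simp: P_linE)
  then show ?thesis using that by blast
qed

end

section \<open>Opposite polynomials and divisibility by irreducible polynomials\<close>

lemma op_poly_op_poly: "op_poly (op_poly p) = p" for p :: "'a::field poly"
proof -
  have "(- 1 :: 'a) ^ degree p * (- 1) ^ degree p = 1" by (simp flip: power_add)
  then show ?thesis by (simp add: op_poly_def neg_arg_simps)
qed

lemma neg_arg_eq_op_poly: "neg_arg p = Polynomial.smult ((- 1) ^ degree p) (op_poly p)" for p :: "'a::field poly"
proof -
  have "(- 1 :: 'a) ^ degree p * (- 1) ^ degree p = 1" by (simp flip: power_add)
  then show ?thesis by (simp add: op_poly_def)
qed

lemma irreducible_neg_arg: "irreducible (neg_arg p) \<longleftrightarrow> irreducible p" for p :: "'a::field poly"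
proof -
  have *: "irreducible (neg_arg p)" if "irreducible p" for p :: "'a poly"
  proof (rule irreducibleI)
    show "neg_arg p \<noteq> 0" using that by (metis irreducible_def neg_arg_simps(5,7))
    show "\<not> neg_arg p dvd 1" using that neg_arg_dvd_iff[of p 1] by (auto simp: neg_arg_simps irreducible_def)
    fix a b assume "neg_arg p = a * b"
    then have "p = neg_arg a * neg_arg b" by (metis neg_arg_simps(2,7))
    then have "neg_arg a dvd 1 \<or> neg_arg b dvd 1" using that by (auto simp: irreducible_def)
    then show "a dvd 1 \<or> b dvd 1" using neg_arg_dvd_iff[of a 1] neg_arg_dvd_iff[of b 1] by (auto simp: neg_arg_simps)
  qed
  show ?thesis using *[of p] *[of "neg_arg p"] by (auto simp: neg_arg_simps)
qed

lemma irreducible_smult: "a \<noteq> 0 \<Longrightarrow> irreducible (Polynomial.smult a p) \<longleftrightarrow> irreducible p" for p :: "'a::field poly"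
proof -
  assume a: "a \<noteq> 0"
  have "[:a:] dvd 1" using a by (simp add: is_unit_const_poly_iff dvd_field_iff)
  then show ?thesis using irreducible_mult_unit_left[of "[:a:]" p] by simp
qed

lemma op_poly_Irr: "p \<in> Irr \<Longrightarrow> op_poly p \<in> Irr" for p :: "'a::field poly"
proof -
  assume p: "p \<in> Irr"
  have "lead_coeff (neg_arg p) = (- 1) ^ degree p * lead_coeff p"
    unfolding neg_arg_def by (subst lead_coeff_comp) auto
  moreover have "(- 1 :: 'a) ^ degree p * (- 1) ^ degree p = 1" by (simp flip: power_add)
  ultimately have "lead_coeff (op_poly p) = 1" using p by (simp add: op_poly_def Irr_def)
  moreover have "irreducible (op_poly p)"
    using p by (simp add: op_poly_def Irr_def irreducible_smult irreducible_neg_arg)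
  ultimately show ?thesis by (simp add: Irr_def)
qed

lemma Irr_dvd_imp_eq: "p \<in> Irr \<Longrightarrow> q \<in> Irr \<Longrightarrow> p dvd q \<Longrightarrow> p = q" for p q :: "'a::field poly"
proof -
  assume p: "p \<in> Irr" and q: "q \<in> Irr" and "p dvd q"
  then obtain c where c: "q = p * c" by (auto elim: dvdE)
  then have "p dvd 1 \<or> c dvd 1" using q by (auto simp: Irr_def irreducible_def)
  moreover have "\<not> p dvd 1" using p by (auto simp: Irr_def irreducible_def)
  ultimately obtain a where a: "c = [:a:]" by (auto simp: is_unit_poly_iff)
  have "lead_coeff q = lead_coeff p * a" unfolding c a lead_coeff_mult by simp
  then have "a = 1" using p q by (simp add: Irr_def)
  then show ?thesis using c a by simp
qed

lemma irreducible_not_dvd_power: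
  fixes p q :: "'a::field poly"
  assumes p: "irreducible p" and q: "\<not> p dvd q"
  shows "\<not> p dvd q ^ n"
proof (induct n)
  case 0 then show ?case using p by (auto simp: irreducible_def)
next
  case (Suc n)
  show ?case
  proof
    assume d: "p dvd q ^ Suc n"
    obtain r s where rs: "r * q + s * p ^ 1 = 1" using irreducible_bezout[OF p q] by blast
    have "q ^ n = (r * q + s * p ^ 1) * q ^ n" unfolding rs by simp
    also have "\<dots> = r * q ^ Suc n + (s * q ^ n) * p" by (simp add: algebra_simps)
    finally have "p dvd q ^ n" using d by (metis dvd_add dvd_mult dvd_triv_right)
    then show False using Suc by blast
  qed
qed

context selfadjoint_endo
begin

section \<open>Primary components\<close>

text \<open>The primary component of \<open>p\<close>; by \<open>in_prim\<close> the exponent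
  \<open>dimension\<close> serves for all \<open>p\<close>.\<close>

definition prim :: "'a poly \<Rightarrow> 'v set" where
  "prim p = {x. P (p ^ dimension) x = 0}"

lemma dim_le_dimension: "dim A \<le> dimension" by (rule dim_subset_UNIV)

lemma subspace_ker_P: "subspace {x. P q x = 0}" using subspace_ker[OF P_lin subspace_UNIV] by simp

text \<open>Up to the least exponent that kills \<open>x\<close>, the kernels of the powers of
  \<open>P p\<close> increase strictly, so this exponent is at most
  \<open>dimension\<close>.\<close>

lemma in_prim: "P (p ^ k) x = 0 \<Longrightarrow> x \<in> prim p"
proof (rule ccontr)
  assume x: "P (p ^ k) x = 0" and n: "x \<notin> prim p"
  define n where "n = (LEAST n. P (p ^ n) x = 0)"
  have n0: "P (p ^ n) x = 0" unfolding n_def by (rule LeastI[of "\<lambda>n. P (p ^ n) x = 0" k, OF x])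
  have nl: "P (p ^ m) x \<noteq> 0" if "m < n" for m using that not_less_Least unfolding n_def by blast
  have "dimension < n"
  proof (rule ccontr)
    assume "\<not> dimension < n"
    then have "p ^ dimension = p ^ (dimension - n) * p ^ n" by (simp flip: power_add)
    then have "P (p ^ dimension) x = 0" using n0 by (simp only: P_mult P_linE)
    then show False using n by (simp add: prim_def)
  qed
  have "j \<le> dim {y. P (p ^ j) y = 0}" if "j \<le> n" for j using that
  proof (induct j)
    case (Suc j)
    have "{y. P (p ^ j) y = 0} \<subset> {y. P (p ^ Suc j) y = 0}"
    proof
      show "{y. P (p ^ j) y = 0} \<subseteq> {y. P (p ^ Suc j) y = 0}" by (auto simp: P_mult P_linE)
      let ?z = "P (p ^ (n - Suc j)) x"
      have i: "Suc j + (n - Suc j) = n" "j + (n - Suc j) = n - 1" using Suc.prems by simp_all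
      have "P (p ^ Suc j) ?z = P (p ^ n) x" "P (p ^ j) ?z = P (p ^ (n - 1)) x"
        unfolding P_mult[symmetric] power_add[symmetric] i by (rule refl)+
      then have "P (p ^ Suc j) ?z = 0" "P (p ^ j) ?z \<noteq> 0" using n0 nl[of "n - 1"] Suc.prems by auto
      then show "{y. P (p ^ j) y = 0} \<noteq> {y. P (p ^ Suc j) y = 0}" by blast
    qed
    then have "span {y. P (p ^ j) y = 0} \<subset> span {y. P (p ^ Suc j) y = 0}" using subspace_ker_P span_eq_iff by metis
    then have "dim {y. P (p ^ j) y = 0} < dim {y. P (p ^ Suc j) y = 0}" by (rule dim_psubset)
    then show ?case using Suc by simp
  qed simp
  then have "n \<le> dimension" using dim_le_dimension le_trans by blast
  then show False using \<open>dimension < n\<close> by simp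
qed

lemma subspace_prim: "subspace (prim p)" unfolding prim_def by (rule subspace_ker_P)

lemma stable_prim: "stable (prim p)" by (auto simp: stable_def prim_def P_u u_lin)

text \<open>The orthogonal of the kernel of \<open>P (p ^ dimension)\<close> is its image, and
  kernel and image meet only in 0 because the kernels no longer grow.\<close>

lemma nondeg_prim: "nondeg_on (prim p)" unfolding nondeg_on_def
proof (intro ballI impI)
  fix x assume x: "x \<in> prim p" and h: "\<forall>y\<in>prim p. b x y = 0"
  let ?f = "P (p ^ dimension)"
  have "x \<in> perp b UNIV {y \<in> UNIV. ?f y = 0}" using h by (auto simp: perp_def prim_def b_sym)
  also have "\<dots> = range ?f" by (rule perp_image(2)[OF subspace_UNIV nondeg_UNIV P_lin _ P_lin]) (auto simp: b_P)
  finally obtain s where s: "x = ?f s" by blast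
  then have "P (p ^ (dimension + dimension)) s = 0" using x by (simp add: prim_def power_add P_mult)
  then have "s \<in> prim p" by (rule in_prim)
  then show "x = 0" using s by (simp add: prim_def)
qed

text \<open>On \<open>prim p\<close> the map \<open>P (q ^ dimension)\<close> is invertible, and it
  kills \<open>prim q\<close>.\<close>

lemma orth_prim:
  assumes p: "irreducible p" and q: "\<not> p dvd q"
  shows "orth (prim p) (prim q)" unfolding orth_def
proof (intro ballI)
  fix x y assume x: "x \<in> prim p" and y: "y \<in> prim q"
  obtain r s where rs: "r * q ^ dimension + s * p ^ dimension = 1"
    using irreducible_bezout[OF p irreducible_not_dvd_power[OF p q]] by blast
  have "x = P (r * q ^ dimension + s * p ^ dimension) x" unfolding rs by simp
  also have "\<dots> = P (q ^ dimension) (P r x)" using x by (simp add: P_add P_mult prim_def P_linE P_commute[of r])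
  finally have "b x y = b (P r x) (P (q ^ dimension) y)" by (metis b_P)
  then show "b x y = 0" using y by (simp add: prim_def bl)
qed

text \<open>Otherwise the vectors \<open>P q x\<close> with \<open>degree q < n\<close> would form a
  space of dimension at least \<open>n\<close> for every \<open>n\<close>.\<close>

lemma annihilator_exists: "\<exists>h. h \<noteq> 0 \<and> P h x = 0"
proof (rule ccontr)
  assume n: "\<nexists>h. h \<noteq> 0 \<and> P h x = 0"
  define W where "W n = {P q x | q. q = 0 \<or> degree q < n}" for n
  have W: "subspace (W n)" for n
  proof (rule subspaceI)
    show "0 \<in> W n" unfolding W_def by (intro CollectI exI[of _ 0]) simp
  next
    fix y z assume "y \<in> W n" "z \<in> W n"
    then obtain q r where "y = P q x" "z = P r x" "q = 0 \<or> degree q < n" "r = 0 \<or> degree r < n" by (auto simp: W_def)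
    then show "y + z \<in> W n" unfolding W_def
      by (intro CollectI exI[of _ "q + r"]) (auto simp: P_add intro: degree_add_less)
  next
    fix a y assume "y \<in> W n"
    then obtain q where "y = P q x" "q = 0 \<or> degree q < n" by (auto simp: W_def)
    then show "a *s y \<in> W n" unfolding W_def by (intro CollectI exI[of _ "Polynomial.smult a q"]) (auto simp: P_smult)
  qed
  have "n \<le> dim (W n)" for n
  proof (induct n)
    case (Suc n)
    have "W n \<subset> W (Suc n)"
    proof
      show "W n \<subseteq> W (Suc n)" unfolding W_def by (auto intro: less_SucI)
      have d: "degree (T ^ n) = n" by (simp add: degree_power_eq)
      then have "P (T ^ n) x \<in> W (Suc n)" unfolding W_def by (intro CollectI exI[of _ "T ^ n"]) simp
      moreover have "P (T ^ n) x \<notin> W n"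
      proof
        assume "P (T ^ n) x \<in> W n"
        then obtain q where q: "P (T ^ n) x = P q x" "q = 0 \<or> degree q < n" by (auto simp: W_def)
        then have "P (T ^ n - q) x = 0" by (simp add: P_diff)
        then have "T ^ n - q = 0" using n by blast
        then have "T ^ n = q" by simp
        then show False using q(2) d by auto
      qed
      ultimately show "W n \<noteq> W (Suc n)" by blast
    qed
    then have "span (W n) \<subset> span (W (Suc n))" using W span_eq_iff by metis
    then have "dim (W n) < dim (W (Suc n))" by (rule dim_psubset)
    then show ?case using Suc by simp
  qed simp
  then have "Suc dimension \<le> dim (W (Suc dimension))" by blast
  then show False using dim_le_dimension[of "W (Suc dimension)"] by simp
qed

text \<open>Among the nonzero polynomials that kill some nonzero vector of \<open>S\<close>, one of
  least degree is irreducible: in a factorization, either the right factor kills the same vector, or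
  the left factor kills its image.\<close>

lemma eigen_exists:
  assumes S: "subspace S" "stable S" "x \<in> S" "x \<noteq> 0"
  obtains p y where "p \<in> Irr" "y \<in> S" "y \<noteq> 0" "P p y = 0"
proof -
  define Q where "Q h \<longleftrightarrow> h \<noteq> 0 \<and> (\<exists>y\<in>S. y \<noteq> 0 \<and> P h y = 0)" for h
  obtain h0 where "Q h0" using annihilator_exists[of x] S unfolding Q_def by blast
  define h where "h = arg_min degree Q"
  have h: "Q h" unfolding h_def by (rule arg_min_natI[of Q, OF \<open>Q h0\<close>])
  have hmin: "degree h \<le> degree g" if "Q g" for g unfolding h_def by (rule arg_min_nat_le[of Q, OF that])
  from h obtain y where y: "h \<noteq> 0" "y \<in> S" "y \<noteq> 0" "P h y = 0" unfolding Q_def by blast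
  have irr: "irreducible h"
  proof (rule irreducibleI)
    show "h \<noteq> 0" by fact
    show "\<not> h dvd 1" using y by (auto simp: is_unit_poly_iff)
    fix f g assume fg: "h = f * g"
    have nz: "f \<noteq> 0" "g \<noteq> 0" using y fg by auto
    have d: "degree h = degree f + degree g" using nz fg by (simp add: degree_mult_eq)
    show "f dvd 1 \<or> g dvd 1"
    proof (cases "P g y = 0")
      case True
      then have "degree h \<le> degree g" using hmin[of g] nz y unfolding Q_def by blast
      then have "degree f = 0" using d by simp
      then show ?thesis using nz by (metis is_unit_iff_degree)
    next
      case False
      then have "Q f" unfolding Q_def using nz y fg P_stable[OF S(1,2)] by (metis P_mult)
      then have "degree h \<le> degree f" by (rule hmin)
      then have "degree g = 0" using d by simp
      then show ?thesis using nz by (metis is_unit_iff_degree)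
    qed
  qed
  let ?p = "Polynomial.smult (inverse (lead_coeff h)) h"
  have "?p \<in> Irr" unfolding Irr_def using irr y(1) by (simp add: irreducible_smult)
  moreover have "P ?p y = 0" using y by (simp add: P_smult)
  ultimately show ?thesis using that y by blast
qed

lemma ssum_self: "subspace A \<Longrightarrow> ssum A A = A" using ssum_subset[of A A A] ssum_left[of A A] by blast

text \<open>Takes a good subspace \<open>S\<close> of greatest dimension among those that, for each
  \<open>p\<close>, contain the components of \<open>p\<close> and its opposite or are orthogonal to
  both. If \<open>S\<close> were proper, its stable orthogonal would contain a nonzero vector killed
  by some \<open>p\<close>, and the components of \<open>p\<close> and its opposite could be
  added.\<close>

lemma good_UNIV_if_primary:
  assumes "\<And>p. p \<in> Irr \<Longrightarrow> good (ssum (prim p) (prim (op_poly p)))"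
  shows "good UNIV"
proof -
  define Q where "Q S \<longleftrightarrow> good S \<and> (\<forall>p\<in>Irr. (prim p \<subseteq> S \<and> prim (op_poly p) \<subseteq> S) \<or>
      (orth (prim p) S \<and> orth (prim (op_poly p)) S))" for S
  have "Q {0}" unfolding Q_def using good_zero by (auto simp: orth_def bl)
  then obtain S where S: "Q S" and max: "\<And>S'. Q S' \<Longrightarrow> dim S' \<le> dim S"
    using ex_has_greatest_nat[of Q "{0}" dim "Suc dimension"] dim_le_dimension by (metis less_Suc_eq_le)
  have gS: "good S" "subspace S" "stable S" "nondeg_on S" using S by (auto simp: Q_def good_def)
  have "S = UNIV"
  proof (rule ccontr)
    assume "S \<noteq> UNIV"
    then obtain y where "y \<notin> S" by blast
    obtain z where z: "z \<in> S" "\<And>x. x \<in> S \<Longrightarrow> b x (y - z) = 0" using nondeg_on_decompose[OF gS(2,4), of y] by blast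
    let ?T = "perp b UNIV S"
    have T: "subspace ?T" by (rule subspace_perp[OF b subspace_UNIV])
    have T2: "stable ?T" using gS(3) by (auto simp: stable_def perp_def b_sa[symmetric])
    have "y - z \<in> ?T" "y - z \<noteq> 0" using z \<open>y \<notin> S\<close> by (auto simp: perp_def)
    then obtain p x where p: "p \<in> Irr" "x \<in> ?T" "x \<noteq> 0" "P p x = 0" using eigen_exists[OF T T2] by blast
    have xp: "x \<in> prim p" using in_prim[of p 1 x] p by simp
    have xS: "x \<notin> S"
    proof
      assume x: "x \<in> S"
      have "x = 0" by (rule nondeg_onD[OF gS(4) x]) (use p(2) in \<open>auto simp: perp_def b_sym[of x]\<close>)
      then show False using p by simp
    qed
    let ?A = "prim p" and ?B = "prim (op_poly p)"
    \<comment> \<open>As \<open>x\<close> lies in \<open>prim p\<close> but not in \<open>S\<close>,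
      the first alternative in \<open>Q\<close> fails.\<close>
    have o: "orth ?A S" "orth ?B S" using S p(1) xp xS unfolding Q_def by blast+
    have A: "subspace ?A" "subspace ?B" by (rule subspace_prim)+
    let ?S = "ssum (ssum ?A ?B) S"
    have g: "good ?S" by (rule good_ssum[OF assms[OF p(1)] gS(1) orth_ssum[OF o]])
    have sub: "?A \<subseteq> ?S" "?B \<subseteq> ?S" "S \<subseteq> ?S"
      using ssum_left[OF gS(2), of "ssum ?A ?B"] ssum_left[OF A(2), of ?A] ssum_right[OF A(1), of ?B]
        ssum_right[OF subspace_ssum[OF A], of S] by blast+
    have "Q ?S" unfolding Q_def
    proof (intro conjI ballI)
      show "good ?S" by (rule g)
      fix q :: "'a poly" assume q: "q \<in> Irr"
      show "(prim q \<subseteq> ?S \<and> prim (op_poly q) \<subseteq> ?S) \<or> (orth (prim q) ?S \<and> orth (prim (op_poly q)) ?S)"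
      proof (cases "q = p \<or> q = op_poly p")
        case True
        then show ?thesis using sub op_poly_op_poly[of p] by auto
      next
        case False
        have nd: "\<not> r dvd s" if "r \<in> {q, op_poly q}" "s \<in> {p, op_poly p}" for r s
        proof
          assume "r dvd s"
          then have "r = s" using that op_poly_Irr p(1) q Irr_dvd_imp_eq by blast
          then show False using that False op_poly_op_poly by (metis empty_iff insert_iff)
        qed
        have irr: "irreducible r" if "r \<in> {q, op_poly q}" for r using that q op_poly_Irr[OF q] by (auto simp: Irr_def)
        have o1: "orth (prim r) (ssum ?A ?B)" if "r \<in> {q, op_poly q}" for r
          using orth_ssum[OF orth_sym orth_sym] orth_prim[OF irr[OF that] nd[OF that]] orth_sym by simp
        show ?thesis
        proof (cases "prim q \<subseteq> S \<and> prim (op_poly q) \<subseteq> S")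
          case True then show ?thesis using sub(3) by blast
        next
          case False
          then have "orth (prim r) S" if "r \<in> {q, op_poly q}" for r using S q that unfolding Q_def by blast
          then have "orth (prim r) ?S" if "r \<in> {q, op_poly q}" for r
            using orth_ssum[OF orth_sym[OF o1[OF that]] orth_sym] that orth_sym by metis
          then show ?thesis by simp
        qed
      qed
    qed
    then have "dim ?S \<le> dim S" by (rule max)
    then have "S = ?S" using subspace_dim_equal[OF gS(2) subspace_ssum[OF subspace_ssum[OF A] gS(2)] sub(3)] by blast
    then show False using sub(1) xp xS by blast
  qed
  then show ?thesis using gS(1) by simp
qed

lemma Nk_prim:
  assumes "k \<ge> 1" shows "Nk UNIV p k \<subseteq> Nk (prim p) p k"
proof
  fix x assume "x \<in> Nk UNIV p k"
  then obtain y s where x: "x = y + P p s" "P (p ^ (k - 1)) y = 0" "P (p ^ k) (P p s) = 0" by (auto simp: Nk_def)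
  have "P (p ^ Suc k) s = 0" using x(3) by (metis P_mult power_Suc2)
  then have "s \<in> prim p" by (rule in_prim)
  moreover have "y \<in> prim p" using x(2) by (rule in_prim)
  ultimately show "x \<in> Nk (prim p) p k" unfolding Nk_def using x by blast
qed

text \<open>Generators tagged with their level. The bound gives finiteness and excludes nothing: a
  vector of level \<open>k\<close> is not killed by \<open>p ^ (k - 1)\<close>, so \<open>k\<close>
  is at most \<open>dimension\<close> (\<open>idx_iff\<close>).\<close>

definition idx :: "(nat \<Rightarrow> 'v set) \<Rightarrow> (nat \<times> 'v) set" where
  "idx E = {(k, e). 1 \<le> k \<and> k \<le> dimension \<and> e \<in> E k}"

lemma idx_iff:
  assumes p: "\<And>k. k \<ge> 1 \<Longrightarrow> obasis p k (E k)"
  shows "(k, e) \<in> idx E \<longleftrightarrow> 1 \<le> k \<and> e \<in> E k"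
proof -
  have "k \<le> dimension" if ke: "1 \<le> k" "e \<in> E k"
  proof (rule ccontr)
    assume "\<not> k \<le> dimension"
    then have e: "p ^ (k - 1) = p ^ (k - 1 - dimension) * p ^ dimension" by (simp flip: power_add)
    obtain q where q: "P (p ^ k) e = 0" "b e (P (p ^ (k - 1) * q) e) \<noteq> 0" using p[OF ke(1)] ke(2)
      unfolding obasis_def by blast
    have "P (p ^ dimension) e = 0" using in_prim[OF q(1)] by (simp add: prim_def)
    then have "P (p ^ (k - 1)) e = 0" unfolding e by (simp add: P_mult P_linE)
    then have "P (p ^ (k - 1) * q) e = 0" by (simp add: P_mult P_linE P_commute[of _ q])
    then show False using q by (simp add: bl)
  qed
  then show ?thesis by (auto simp: idx_def)
qed

lemma finite_idx: "(\<And>k. k \<ge> 1 \<Longrightarrow> obasis p k (E k)) \<Longrightarrow> finite (idx E)"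
proof -
  assume p: "\<And>k. k \<ge> 1 \<Longrightarrow> obasis p k (E k)"
  have "idx E \<subseteq> Sigma {1..dimension} E" by (auto simp: idx_def)
  then show ?thesis by (rule finite_subset) (use p in \<open>auto simp: obasis_def\<close>)
qed

text \<open>\<open>X (k, e)\<close> is tied to \<open>e\<close> only through the values on multiples
  of \<open>p ^ (k - 1)\<close>, that is, through the value of the invariant at the class of
  \<open>e\<close>. The other values can be prescribed later by \<open>normalize\<close>.\<close>

definition lifts :: "'a poly \<Rightarrow> (nat \<Rightarrow> 'v set) \<Rightarrow> (nat \<times> 'v \<Rightarrow> 'v) \<Rightarrow> bool" where
  "lifts p E X \<longleftrightarrow>
     (\<forall>k e. (k, e) \<in> idx E \<longrightarrow> P (p ^ k) (X (k, e)) = 0 \<and>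
        (\<forall>q. b (X (k, e)) (P (p ^ (k - 1) * q) (X (k, e))) = b e (P (p ^ (k - 1) * q) e))) \<and>
     (\<forall>i\<in>idx E. \<forall>j\<in>idx E. i \<noteq> j \<longrightarrow> orth (cyc (X i)) (cyc (X j))) \<and>
     prim p = {\<Sum>i\<in>idx E. g i | g. \<forall>i\<in>idx E. g i \<in> cyc (X i)}"

lemma liftsD:
  assumes "lifts p E X"
  shows "(k, e) \<in> idx E \<Longrightarrow> P (p ^ k) (X (k, e)) = 0"
    "(k, e) \<in> idx E \<Longrightarrow>
       b (X (k, e)) (P (p ^ (k - 1) * q) (X (k, e))) = b e (P (p ^ (k - 1) * q) e)"
    "i \<in> idx E \<Longrightarrow> j \<in> idx E \<Longrightarrow> i \<noteq> j \<Longrightarrow> orth (cyc (X i)) (cyc (X j))"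
    "prim p = {\<Sum>i\<in>idx E. g i | g. \<forall>i\<in>idx E. g i \<in> cyc (X i)}" using assms by (auto simp: lifts_def)

lemma primary_lift:
  assumes p: "irreducible p" and E: "\<And>k. k \<ge> 1 \<Longrightarrow> obasis p k (E k)"
  shows "\<exists>X. lifts p E X"
proof -
  note ii = idx_iff[of p E, OF E]
  have ob: "P (p ^ k) e = 0" "\<exists>q. b e (P (p ^ (k - 1) * q) e) \<noteq> 0" if "(k, e) \<in> idx E" for k e
    using E[of k] that ii by (auto simp: obasis_def)
  have oo: "b e (P (p ^ (k - 1) * q) e') = 0" if "(k, e) \<in> idx E" "(k, e') \<in> idx E" "e \<noteq> e'" for k e e' q
    using E[of k] that ii by (auto simp: obasis_def)
  have "\<exists>X'. (\<forall>i\<in>idx E. X' i \<in> prim p \<and> P (p ^ fst i) (X' i) = 0 \<and>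
             (\<forall>q. b (X' i) (P (p ^ (fst i - 1) * q) (X' i)) = b (snd i) (P (p ^ (fst i - 1) * q) (snd i)))) \<and>
           (\<forall>i\<in>idx E. \<forall>j\<in>idx E. i \<noteq> j \<longrightarrow> orth (cyc (X' i)) (cyc (X' j))) \<and>
           (\<forall>s\<in>prim p. \<exists>c. s = (\<Sum>i\<in>idx E. P (c i) (X' i)))"
  proof (rule lift_decomposition[OF finite_idx[OF E] p subspace_prim stable_prim nondeg_prim])
    show "\<exists>n. \<forall>x\<in>prim p. P (p ^ n) x = 0" by (auto simp: prim_def)
    fix i assume i: "i \<in> idx E"
    then obtain k e where ke: "i = (k, e)" "(k, e) \<in> idx E" by (cases i) auto
    then show "snd i \<in> prim p \<and> 1 \<le> fst i \<and> P (p ^ fst i) (snd i) = 0 \<and>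
        (\<exists>q. b (snd i) (P (p ^ (fst i - 1) * q) (snd i)) \<noteq> 0)"
      using ob[OF ke(2)] in_prim[OF ob(1)[OF ke(2)]] ii by auto
  next
    fix i j q assume "i \<in> idx E" "j \<in> idx E" "i \<noteq> j" "fst i = fst j"
    then show "b (snd i) (P (p ^ (fst i - 1) * q) (snd j)) = 0"
      using oo[of "fst i" "snd i" "snd j" q] by (cases i, cases j) auto
  next
    fix k y assume k: "k \<ge> 1" and y: "P (p ^ k) y = 0"
    obtain c where c: "y - (\<Sum>e\<in>E k. P (c e) e) \<in> Nk UNIV p k" using E[OF k] y unfolding obasis_def by blast
    have "{i \<in> idx E. fst i = k} = Pair k ` E k" using ii k by force
    then have "(\<Sum>i\<in>{i\<in>idx E. fst i = k}. P (c (snd i)) (snd i)) = (\<Sum>e\<in>E k. P (c e) e)"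
      by (simp add: sum.reindex inj_on_def)
    then have "y - (\<Sum>i\<in>{i\<in>idx E. fst i = k}. P (c (snd i)) (snd i)) \<in> Nk (prim p) p k" using c Nk_prim[OF k] by auto
    then show "\<exists>c. y - (\<Sum>i\<in>{i\<in>idx E. fst i = k}. P (c i) (snd i)) \<in> Nk (prim p) p k"
      by (intro exI[of _ "\<lambda>i. c (snd i)"])
  qed
  then obtain X where XX: "(\<forall>i\<in>idx E. X i \<in> prim p \<and> P (p ^ fst i) (X i) = 0 \<and>
             (\<forall>q. b (X i) (P (p ^ (fst i - 1) * q) (X i)) = b (snd i) (P (p ^ (fst i - 1) * q) (snd i)))) \<and>
           (\<forall>i\<in>idx E. \<forall>j\<in>idx E. i \<noteq> j \<longrightarrow> orth (cyc (X i)) (cyc (X j))) \<and>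
           (\<forall>s\<in>prim p. \<exists>c. s = (\<Sum>i\<in>idx E. P (c i) (X i)))" ..
  note X = bspec[OF conjunct1[OF XX]] bspec[OF bspec[OF conjunct1[OF conjunct2[OF XX]]], THEN mp]
    bspec[OF conjunct2[OF conjunct2[OF XX]]]
  have "lifts p E X" unfolding lifts_def
  proof (intro conjI)
    show "prim p = {\<Sum>i\<in>idx E. g i | g. \<forall>i\<in>idx E. g i \<in> cyc (X i)}"
    proof
      show "prim p \<subseteq> {\<Sum>i\<in>idx E. g i | g. \<forall>i\<in>idx E. g i \<in> cyc (X i)}"
      proof
        fix s assume "s \<in> prim p"
        then obtain c where "s = (\<Sum>i\<in>idx E. P (c i) (X i))" using X(3) by blast
        then show "s \<in> {\<Sum>i\<in>idx E. g i | g. \<forall>i\<in>idx E. g i \<in> cyc (X i)}"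
          using P_in_cyc by (intro CollectI exI[of _ "\<lambda>i. P (c i) (X i)"]) blast
      qed
      have "g i \<in> prim p" if "i \<in> idx E" "g i \<in> cyc (X i)" for g i
        using cyc_subset[OF subspace_prim stable_prim, of "X i" p] X(1)[OF that(1)] that(2) by blast
      then show "{\<Sum>i\<in>idx E. g i | g. \<forall>i\<in>idx E. g i \<in> cyc (X i)} \<subseteq> prim p"
        by (auto intro!: subspace_sum[OF subspace_prim])
    qed
  qed (use X(1,2) in fastforce)+
  then show ?thesis by blast
qed

text \<open>\<open>psi\<close> is the odd part of the functional of \<open>x\<close>; by
  \<open>odd\<close> it agrees with that functional on the socle, so \<open>x\<close> can be
  normalized to have it. An odd functional satisfies the condition of
  \<open>good_single\<close>.\<close>

lemma good_single':
  assumes p: "irreducible p" and k: "k \<ge> 1" and pe: "p ^ k dvd neg_arg (p ^ k)"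
    and x: "P (p ^ k) x = 0" "b x (P (p ^ (k - 1) * q) x) \<noteq> 0"
    and odd: "\<And>h. b x (P (neg_arg (p ^ (k - 1) * h)) x) = - b x (P (p ^ (k - 1) * h) x)"
  shows "good (cyc x)"
proof -
  define psi where "psi h = (b x (P h x) - b x (P (neg_arg h) x)) / 2" for h
  have half: "(a + a) / 2 = a" for a :: 'a
  proof -
    have "(a + a) / 2 = (2 * a) / 2" by (simp only: mult_2)
    then show ?thesis using two by simp
  qed
  have neg: "psi (neg_arg h) = - psi h" for h by (simp add: psi_def neg_arg_simps minus_divide_left)
  have "\<exists>g. cyc (P g x) = cyc x \<and> (\<forall>h. b (P g x) (P h (P g x)) = psi h)"
  proof (rule normalize[OF p k x, of psi])
    show "psi (g + h) = psi g + psi h" for g h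
      by (simp add: psi_def neg_arg_simps P_add bl add_divide_distrib[symmetric])
    show "psi (Polynomial.smult a h) = a * psi h" for a h
      by (simp add: psi_def neg_arg_simps P_smult bl right_diff_distrib)
    show "psi (p ^ k * h) = 0" for h
    proof -
      obtain r where r: "neg_arg (p ^ k) = p ^ k * r" using pe by (rule dvdE)
      have "P (p ^ k * h) x = 0" "P (neg_arg (p ^ k * h)) x = 0"
        unfolding neg_arg_simps(2) r using x(1) by (simp_all add: P_mult P_commute[of "p ^ k"] P_linE)
      then show ?thesis by (simp add: psi_def bl)
    qed
    show "psi (p ^ (k - 1) * h) = b x (P (p ^ (k - 1) * h) x)" for h
      unfolding psi_def odd by (simp only: diff_minus_eq_add half)
  qed blast
  then obtain g where g: "cyc (P g x) = cyc x" "\<And>h. b (P g x) (P h (P g x)) = psi h" by blast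
  have "good (cyc (P g x))"
  proof (rule good_single)
    show "nondeg_on (cyc (P g x))" unfolding g(1) by (rule nondeg_cyc[OF p x])
    fix r
    have "neg_arg (r * T) = - (neg_arg r * T)" by (simp only: neg_arg_simps mult_minus_right)
    then have "psi (- (neg_arg r * T)) = - psi (r * T)" by (metis neg)
    moreover have "psi (- h) = - psi h" for h by (simp add: psi_def neg_arg_simps P_uminus bl minus_divide_left)
    ultimately have "psi (neg_arg r * T) = psi (r * T)" by (metis neg_equal_iff_equal)
    then show "b (P g x) (P (neg_arg r * T) (P g x)) = b (P g x) (P (r * T) (P g x))" unfolding g(2) .
  qed
  then show ?thesis unfolding g(1) .
qed

text \<open>Only \<open>y\<close> is normalized. Condition \<open>XY\<close> of
  \<open>good_pair\<close> determines its functional on the multiples of \<open>s1\<close> from that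
  of \<open>x\<close>, and \<open>psi\<close> extends this with the factor \<open>s3\<close>.
  Assumption \<open>pp\<close> makes \<open>psi\<close> vanish on the annihilator of
  \<open>y\<close>, and \<open>xy\<close> is agreement on the socle.\<close>

lemma good_pair':
  assumes p: "irreducible p" and p': "irreducible p'" and k: "k' \<ge> 1"
    and x: "P (p ^ k) x = 0" "b x (P (p ^ (k - 1) * q) x) \<noteq> 0"
    and y: "P (p' ^ k') y = 0" "b y (P (p' ^ (k' - 1) * q') y) \<noteq> 0"
    and o: "orth (cyc x) (cyc y)"
    and s: "neg_arg s1 * s3 = s2" "neg_arg s1 * s2 = - (T * T)" "neg_arg s2 * s1 = - (T * T)"
    and pp: "p ^ k dvd neg_arg (p' ^ k') * s3"
    and xy: "\<And>h. b y (P (p' ^ (k' - 1) * h) y) = b x (P (neg_arg (p' ^ (k' - 1) * h) * s3) x)"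
  shows "good (ssum (cyc x) (cyc y))"
proof -
  define psi where "psi h = b x (P (neg_arg h * s3) x)" for h
  have "\<exists>g. cyc (P g y) = cyc y \<and> (\<forall>h. b (P g y) (P h (P g y)) = psi h)"
  proof (rule normalize[OF p' k y, of psi])
    show "psi (g + h) = psi g + psi h" for g h by (simp add: psi_def neg_arg_simps distrib_right P_add bl)
    show "psi (Polynomial.smult a h) = a * psi h" for a h by (simp add: psi_def neg_arg_simps P_smult bl)
    show "psi (p' ^ k' * h) = 0" for h
    proof -
      obtain r where r: "neg_arg (p' ^ k') * s3 = p ^ k * r" using pp by (rule dvdE)
      have "neg_arg (p' ^ k' * h) * s3 = neg_arg h * (neg_arg (p' ^ k') * s3)"
        by (simp only: neg_arg_simps(2) mult_ac)
      also have "\<dots> = (neg_arg h * r) * p ^ k" unfolding r by (simp only: mult_ac)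
      finally have "neg_arg (p' ^ k' * h) * s3 = (neg_arg h * r) * p ^ k" .
      then show ?thesis using x(1) by (simp add: psi_def P_mult P_linE bl)
    qed
    show "psi (p' ^ (k' - 1) * h) = b y (P (p' ^ (k' - 1) * h) y)" for h unfolding psi_def by (rule xy[symmetric])
  qed blast
  then obtain g where g: "cyc (P g y) = cyc y" "\<And>h. b (P g y) (P h (P g y)) = psi h" by blast
  have "good (ssum (cyc x) (cyc (P g y)))"
  proof (rule good_pair[where ?s1.0 = s1 and ?s2.0 = s2])
    show "nondeg_on (cyc x)" by (rule nondeg_cyc[OF p x])
    show "nondeg_on (cyc (P g y))" unfolding g(1) by (rule nondeg_cyc[OF p' y])
    show "orth (cyc x) (cyc (P g y))" unfolding g(1) by (rule o)
    fix r show "b x (P (neg_arg r * s2) x) = b (P g y) (P (r * s1) (P g y))"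
      unfolding g(2) psi_def s(1)[symmetric] by (simp only: neg_arg_simps mult.assoc)
  qed (use s in simp_all)
  then show ?thesis unfolding g(1) .
qed

lemma good_partition:
  assumes I: "finite I" and o: "\<And>i j. i \<in> I \<Longrightarrow> j \<in> I \<Longrightarrow> i \<noteq> j \<Longrightarrow> orth (F i) (F j)"
    and AA: "\<Union>AA = I" "\<And>A B. A \<in> AA \<Longrightarrow> B \<in> AA \<Longrightarrow> A \<noteq> B \<Longrightarrow> A \<inter> B = {}"
    and g: "\<And>A. A \<in> AA \<Longrightarrow> good {\<Sum>i\<in>A. g i | g. \<forall>i\<in>A. g i \<in> F i}"
  shows "good {\<Sum>i\<in>I. g i | g. \<forall>i\<in>I. g i \<in> F i}"
proof -
  have fA: "finite AA" "\<And>A. A \<in> AA \<Longrightarrow> finite A" using I AA(1) by (metis finite_UnionD, metis Union_upper finite_subset)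
  have "good {\<Sum>A\<in>AA. G A | G. \<forall>A\<in>AA. G A \<in> {\<Sum>i\<in>A. g i | g. \<forall>i\<in>A. g i \<in> F i}}"
  proof (rule good_sum[OF fA(1) g])
    fix A B assume AB: "A \<in> AA" "B \<in> AA" "A \<noteq> B"
    have "b (\<Sum>i\<in>A. g i) (\<Sum>j\<in>B. h j) = 0" if "\<forall>i\<in>A. g i \<in> F i" "\<forall>i\<in>B. h i \<in> F i" for g h
    proof -
      have "b (g i) (h j) = 0" if ij: "i \<in> A" "j \<in> B" for i j
      proof -
        have "i \<noteq> j" using ij AA(2)[OF AB] by auto
        moreover have "i \<in> I" "j \<in> I" using ij AB AA(1) by auto
        ultimately have "orth (F i) (F j)" using o by blast
        then show ?thesis using \<open>\<forall>i\<in>A. g i \<in> F i\<close> \<open>\<forall>i\<in>B. h i \<in> F i\<close> ij by (auto simp: orth_def)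
      qed
      then show ?thesis by (simp add: bil_sum_left[OF b] bil_sum_right[OF b])
    qed
    then show "orth {\<Sum>i\<in>A. g i | g. \<forall>i\<in>A. g i \<in> F i} {\<Sum>i\<in>B. g i | g. \<forall>i\<in>B. g i \<in> F i}" unfolding orth_def by blast
  qed
  moreover have "{\<Sum>A\<in>AA. G A | G. \<forall>A\<in>AA. G A \<in> {\<Sum>i\<in>A. g i | g. \<forall>i\<in>A. g i \<in> F i}} =
      {\<Sum>i\<in>I. g i | g. \<forall>i\<in>I. g i \<in> F i}" (is "?L = ?R")
  proof
    have su: "(\<Sum>i\<in>I. g i) = (\<Sum>A\<in>AA. \<Sum>i\<in>A. g i)" for g using sum.Union_disjoint[of AA g] AA fA by auto
    show "?R \<subseteq> ?L"
    proof
      fix x assume "x \<in> ?R"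
      then obtain g where x: "x = (\<Sum>i\<in>I. g i)" "\<forall>i\<in>I. g i \<in> F i" by blast
      then have "\<forall>A\<in>AA. (\<Sum>i\<in>A. g i) \<in> {\<Sum>i\<in>A. g i | g. \<forall>i\<in>A. g i \<in> F i}" using AA(1) by blast
      then show "x \<in> ?L" unfolding x(1) su by (intro CollectI exI[of _ "\<lambda>A. \<Sum>i\<in>A. g i"]) blast
    qed
    show "?L \<subseteq> ?R"
    proof
      fix x assume "x \<in> ?L"
      then obtain G where x: "x = (\<Sum>A\<in>AA. G A)" "\<forall>A\<in>AA. G A \<in> {\<Sum>i\<in>A. g i | g. \<forall>i\<in>A. g i \<in> F i}" by blast
      then have "\<forall>A\<in>AA. \<exists>g. G A = (\<Sum>i\<in>A. g i) \<and> (\<forall>i\<in>A. g i \<in> F i)" by blast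
      then obtain g where g: "\<And>A. A \<in> AA \<Longrightarrow> G A = (\<Sum>i\<in>A. g A i)" "\<And>A i. A \<in> AA \<Longrightarrow> i \<in> A \<Longrightarrow> g A i \<in> F i" by metis
      define h where "h i = g (THE A. A \<in> AA \<and> i \<in> A) i" for i
      have the: "(THE A. A \<in> AA \<and> i \<in> A) = A" if "A \<in> AA" "i \<in> A" for A i
        using that AA(2) by (intro the_equality) auto
      have h: "h i = g A i" if "A \<in> AA" "i \<in> A" for A i using the[OF that] by (simp add: h_def)
      have "x = (\<Sum>A\<in>AA. \<Sum>i\<in>A. h i)" unfolding x(1) using g(1) h by (intro sum.cong) auto
      then have "x = (\<Sum>i\<in>I. h i)" unfolding su[of h] .
      moreover have "\<forall>i\<in>I. h i \<in> F i" using AA(1) g(2) h by (metis UnionE)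
      ultimately show "x \<in> ?R" by blast
    qed
  qed
  ultimately show ?thesis by simp
qed

lemma sum_singleton_set: "{\<Sum>j\<in>{i}. g j | g. \<forall>j\<in>{i}. g j \<in> F j} = F i" by (auto intro: exI[of _ "\<lambda>_. _"])

lemma sum_pair_set: "i \<noteq> j \<Longrightarrow> {\<Sum>k\<in>{i, j}. g k | g. \<forall>k\<in>{i, j}. g k \<in> F k} = ssum (F i) (F j)"
proof -
  assume ij: "i \<noteq> j"
  show ?thesis
  proof
    show "{\<Sum>k\<in>{i, j}. g k | g. \<forall>k\<in>{i, j}. g k \<in> F k} \<subseteq> ssum (F i) (F j)" using ij by (auto simp: ssum_def)
    show "ssum (F i) (F j) \<subseteq> {\<Sum>k\<in>{i, j}. g k | g. \<forall>k\<in>{i, j}. g k \<in> F k}"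
    proof
      fix x assume "x \<in> ssum (F i) (F j)"
      then obtain y z where "x = y + z" "y \<in> F i" "z \<in> F j" by (auto simp: ssum_def)
      then show "x \<in> {\<Sum>k\<in>{i, j}. g k | g. \<forall>k\<in>{i, j}. g k \<in> F k}"
        using ij by (intro CollectI exI[of _ "\<lambda>k. if k = i then y else z"]) auto
    qed
  qed
qed

section \<open>Primary components from skew or matched generators\<close>

lemma good_prim_skew:
  assumes p: "irreducible p" and np: "neg_arg p = p"
    and E: "\<And>k. k \<ge> 1 \<Longrightarrow> \<exists>E. obasis p k E \<and>
       (\<forall>e\<in>E. \<forall>h. b e (P (p ^ (k - 1) * neg_arg h) e) = - b e (P (p ^ (k - 1) * h) e))"
  shows "good (prim p)"
proof -
  obtain E where E: "\<And>k. k \<ge> 1 \<Longrightarrow> obasis p k (E k)"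
    "\<And>k e h. k \<ge> 1 \<Longrightarrow> e \<in> E k \<Longrightarrow> b e (P (p ^ (k - 1) * neg_arg h) e) = - b e (P (p ^ (k - 1) * h) e)" using E by metis
  note ii = idx_iff[of p E, OF E(1)]
  obtain X where "lifts p E X" using primary_lift[OF p E(1)] by blast
  note X = liftsD[OF this]
  have "good (cyc (X i))" if i: "i \<in> idx E" for i
  proof -
    obtain k e where ke: "i = (k, e)" "k \<ge> 1" "e \<in> E k" using i ii by (cases i) auto
    obtain q where q: "b e (P (p ^ (k - 1) * q) e) \<noteq> 0" using E(1)[OF ke(2)] ke(3) by (auto simp: obasis_def)
    show ?thesis
    proof (rule good_single'[OF p ke(2)])
      show "p ^ k dvd neg_arg (p ^ k)" by (simp add: neg_arg_simps np)
      show "P (p ^ k) (X i) = 0" using X(1) i ke(1) by simp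
      show "b (X i) (P (p ^ (k - 1) * q) (X i)) \<noteq> 0" using X(2)[of k e q] i ke(1) q by simp
      fix h
      have "neg_arg (p ^ (k - 1) * h) = p ^ (k - 1) * neg_arg h" by (simp add: neg_arg_simps np)
      then show "b (X i) (P (neg_arg (p ^ (k - 1) * h)) (X i)) = - b (X i) (P (p ^ (k - 1) * h) (X i))"
        using X(2)[of k e] i ke(1) E(2)[OF ke(2,3), of h] by simp
    qed
  qed
  then show ?thesis unfolding X(4) by (intro good_sum[OF finite_idx[OF E(1)] _ X(3)])
qed

lemma good_prim_pair:
  assumes p: "irreducible p" and np: "neg_arg p = Polynomial.smult a p'" "a \<noteq> 0" and pp': "\<not> p dvd p'"
    and EF: "\<And>k. k \<ge> 1 \<Longrightarrow> \<exists>E f. obasis p k E \<and> inj_on f E \<and> obasis p' k (f ` E) \<and>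
       (\<forall>e\<in>E. \<forall>h. b (f e) (P (p' ^ (k - 1) * h) (f e)) = - b e (P (neg_arg (p' ^ (k - 1) * h)) e))"
  shows "good (ssum (prim p) (prim p'))"
proof -
  have p': "irreducible p'" using p np irreducible_neg_arg[of p] irreducible_smult[OF np(2), of p'] by simp
  have np': "p dvd neg_arg p'"
  proof -
    have "p = Polynomial.smult a (neg_arg p')" using np(1) by (metis neg_arg_simps(7,10))
    then have "neg_arg p' = Polynomial.smult (inverse a) p" using np(2) by (metis smult_smult left_inverse smult_1_left)
    then show ?thesis by (simp add: dvd_smult)
  qed
  obtain E f where E: "\<And>k. k \<ge> 1 \<Longrightarrow> obasis p k (E k)" "\<And>k. k \<ge> 1 \<Longrightarrow> inj_on (f k) (E k)"
    "\<And>k. k \<ge> 1 \<Longrightarrow> obasis p' k (f k ` E k)"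
    "\<And>k e h. k \<ge> 1 \<Longrightarrow> e \<in> E k \<Longrightarrow>
       b (f k e) (P (p' ^ (k - 1) * h) (f k e)) = - b e (P (neg_arg (p' ^ (k - 1) * h)) e)" using EF by metis
  define F where "F k = f k ` E k" for k
  have F: "\<And>k. k \<ge> 1 \<Longrightarrow> obasis p' k (F k)" using E(3) by (simp add: F_def)
  note ii = idx_iff[of p E, OF E(1)] and jj = idx_iff[of p' F, OF F]
  obtain X where "lifts p E X" using primary_lift[OF p E(1)] by blast
  note X = liftsD[OF this]
  obtain Y where "lifts p' F Y" using primary_lift[OF p' F] by blast
  note Y = liftsD[OF this]
  define m where "m = (\<lambda>(k, e). (k, f k e))"
  have m: "bij_betw m (idx E) (idx F)"
  proof (rule bij_betw_imageI)
    show "inj_on m (idx E)" using E(2) ii by (auto simp: m_def inj_on_def)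
    show "m ` idx E = idx F"
    proof
      show "m ` idx E \<subseteq> idx F" using ii jj by (auto simp: m_def F_def)
      show "idx F \<subseteq> m ` idx E"
      proof
        fix j assume "j \<in> idx F"
        then obtain k e where "j = (k, f k e)" "(k, e) \<in> idx E" using ii jj by (cases j) (auto simp: F_def)
        then show "j \<in> m ` idx E" by (force simp: m_def)
      qed
    qed
  qed
  have oXY: "orth (cyc (X i)) (cyc (Y j))" if "i \<in> idx E" "j \<in> idx F" for i j
  proof -
    have "X i \<in> prim p" using in_prim[OF X(1)] that(1) by (cases i) auto
    moreover have "Y j \<in> prim p'" using in_prim[OF Y(1)] that(2) by (cases j) auto
    ultimately have "cyc (X i) \<subseteq> prim p" "cyc (Y j) \<subseteq> prim p'" using cyc_subset[OF subspace_prim stable_prim] by auto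
    then show ?thesis using orth_prim[OF p pp'] by (auto simp: orth_def)
  qed
  let ?F = "\<lambda>i. ssum (cyc (X i)) (cyc (Y (m i)))"
  have mF: "m i \<in> idx F" if "i \<in> idx E" for i using m that by (auto simp: bij_betw_def)
  have "good (?F i)" if i: "i \<in> idx E" for i
  proof -
    obtain k e where ke: "i = (k, e)" "k \<ge> 1" "e \<in> E k" using i ii by (cases i) auto
    have mi: "m i = (k, f k e)" by (simp add: m_def ke(1))
    obtain q where q: "b e (P (p ^ (k - 1) * q) e) \<noteq> 0" using E(1)[OF ke(2)] ke(3) by (auto simp: obasis_def)
    obtain q' where q': "b (f k e) (P (p' ^ (k - 1) * q') (f k e)) \<noteq> 0"
      using E(3)[OF ke(2)] ke(3) by (auto simp: obasis_def)
    show ?thesis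
    \<comment> \<open>With \<open>s1 = s2 = T\<close>, the factor \<open>s3\<close> must be -1
      because the substitution of \<open>-t\<close> changes the sign of \<open>T\<close>; this is
      the minus sign in the matching of values.\<close>
    proof (rule good_pair'[OF p p' ke(2), where ?s1.0 = T and ?s2.0 = T and ?s3.0 = "-1"])
      show "P (p ^ k) (X i) = 0" using X(1) i ke(1) by simp
      show "b (X i) (P (p ^ (k - 1) * q) (X i)) \<noteq> 0" using X(2)[of k e q] i ke(1) q by simp
      show "P (p' ^ k) (Y (m i)) = 0" using Y(1) mF[OF i] mi by simp
      show "b (Y (m i)) (P (p' ^ (k - 1) * q') (Y (m i))) \<noteq> 0" using Y(2)[of k "f k e" q'] mF[OF i] mi q' by simp
      show "orth (cyc (X i)) (cyc (Y (m i)))" by (rule oXY[OF i mF[OF i]])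
      show "neg_arg T * - 1 = T" by (simp only: neg_arg_simps mult_minus1_right minus_minus)
      show "neg_arg T * T = - (T * T)" by (simp only: neg_arg_simps mult_minus_left)
      then show "neg_arg T * T = - (T * T)" .
      show "p ^ k dvd neg_arg (p' ^ k) * - 1" using np' by (simp add: neg_arg_simps dvd_power_same)
      fix h
      obtain r where r: "neg_arg p' = p * r" using np' by (rule dvdE)
      have "neg_arg (p' ^ (k - 1) * h) = p ^ (k - 1) * (r ^ (k - 1) * neg_arg h)"
        by (simp add: neg_arg_simps r power_mult_distrib)
      then have "b (X i) (P (neg_arg (p' ^ (k - 1) * h)) (X i)) = b e (P (neg_arg (p' ^ (k - 1) * h)) e)"
        using X(2)[of k e] i ke(1) by simp
      moreover have "b (Y (m i)) (P (p' ^ (k - 1) * h) (Y (m i))) = b (f k e) (P (p' ^ (k - 1) * h) (f k e))"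
        using Y(2)[of k "f k e"] mF[OF i] mi by simp
      ultimately show "b (Y (m i)) (P (p' ^ (k - 1) * h) (Y (m i))) =
          b (X i) (P (neg_arg (p' ^ (k - 1) * h) * - 1) (X i))"
        using E(4)[OF ke(2,3), of h] by (simp add: P_uminus bl)
    qed
  qed
  moreover have "orth (?F i) (?F j)" if ij: "i \<in> idx E" "j \<in> idx E" "i \<noteq> j" for i j
  proof -
    have "m i \<noteq> m j" using m ij by (auto simp: bij_betw_def inj_on_def)
    then have o: "orth (cyc (X i)) (cyc (X j))" "orth (cyc (X i)) (cyc (Y (m j)))"
       "orth (cyc (Y (m i))) (cyc (X j))" "orth (cyc (Y (m i))) (cyc (Y (m j)))"
      using X(3) Y(3) oXY ij mF orth_sym by auto
    show ?thesis by (rule orth_ssum[OF orth_sym[OF orth_ssum] orth_sym[OF orth_ssum]]; rule orth_sym; rule o)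
  qed
  ultimately have "good {\<Sum>i\<in>idx E. g i | g. \<forall>i\<in>idx E. g i \<in> ?F i}" by (intro good_sum[OF finite_idx[OF E(1)]])
  moreover have "{\<Sum>i\<in>idx E. g i | g. \<forall>i\<in>idx E. g i \<in> ?F i} = ssum (prim p) (prim p')" (is "?L = ?R")
  proof
    show "?L \<subseteq> ?R"
    proof
      fix x assume "x \<in> ?L"
      then obtain g where g: "x = (\<Sum>i\<in>idx E. g i)" "\<forall>i\<in>idx E. g i \<in> ?F i" by blast
      have "X i \<in> prim p" "Y (m i) \<in> prim p'" if "i \<in> idx E" for i
        using in_prim[OF X(1)] in_prim[OF Y(1)] mF[OF that] that by (cases i; cases "m i"; auto)+
      then have "g i \<in> ?R" if "i \<in> idx E" for i
        using g(2) that cyc_subset[OF subspace_prim stable_prim] unfolding ssum_def by blast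
      then show "x \<in> ?R" unfolding g(1) by (intro subspace_sum[OF subspace_ssum[OF subspace_prim subspace_prim]])
    qed
    show "?R \<subseteq> ?L"
    proof
      fix x assume "x \<in> ?R"
      then obtain y z where x: "x = y + z" "y \<in> prim p" "z \<in> prim p'" unfolding ssum_def by blast
      from x(2) obtain g where g: "y = (\<Sum>i\<in>idx E. g i)" "\<forall>i\<in>idx E. g i \<in> cyc (X i)" unfolding X(4) by blast
      from x(3) obtain h where h: "z = (\<Sum>i\<in>idx F. h i)" "\<forall>i\<in>idx F. h i \<in> cyc (Y i)" unfolding Y(4) by blast
      have "z = (\<Sum>i\<in>idx E. h (m i))" unfolding h(1) by (rule sum.reindex_bij_betw[OF m, symmetric])
      then have "x = (\<Sum>i\<in>idx E. g i + h (m i))" using x(1) g(1) by (simp add: sum.distrib)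
      moreover have "\<forall>i\<in>idx E. g i + h (m i) \<in> ?F i" using g(2) h(2) mF ssumI by blast
      ultimately show "x \<in> ?L" by (intro CollectI exI[of _ "\<lambda>i. g i + h (m i)"]) blast
    qed
  qed
  ultimately show ?thesis by simp
qed

declare mult_pCons_left [simp del] mult_pCons_right [simp del]

section \<open>The nilpotent part: necessity\<close>

text \<open>For \<open>q = T ^ (k - 1)\<close>, on the kernel of \<open>T ^ k\<close>, this form
  induces (b,u)_{t,k}. On a stable nondegenerate \<open>S\<close> its radical is the kernel of
  \<open>P q\<close> (\<open>cq_rad\<close>).\<close>

definition cq :: "'a poly \<Rightarrow> 'v \<Rightarrow> 'v \<Rightarrow> 'a" where
  "cq q x y = b x (P q y)"

lemma cq_bil: "bilinear_form scale (cq q)" by (rule bilinI) (simp_all add: cq_def bl P_linE)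

lemma cq_comm: "cq q x y = cq q y x" unfolding cq_def by (metis b_P b_sym)

lemma cq_sym: "symmetric_form (cq q)" unfolding symmetric_form_def using cq_comm by blast

lemmas cql = bil[OF cq_bil]

lemma cq_rad:
  assumes S: "subspace S" "stable S" "nondeg_on S"
  shows "perp (cq q) S S = {x \<in> S. P q x = 0}"
proof
  show "perp (cq q) S S \<subseteq> {x \<in> S. P q x = 0}"
  proof
    fix y assume y: "y \<in> perp (cq q) S S"
    then have yS: "y \<in> S" by (simp add: perp_def)
    have "P q y = 0" by (rule nondeg_onD[OF S(3) P_stable[OF S(1,2) yS]])
         (use y in \<open>simp add: perp_def cq_def b_sym[of "P q y"]\<close>)
    then show "y \<in> {x \<in> S. P q x = 0}" using yS by simp
  qed
  show "{x \<in> S. P q x = 0} \<subseteq> perp (cq q) S S" by (auto simp: perp_def cq_def bl)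
qed

lemma dim_nondeg_perp:
  assumes S: "subspace S" "nondeg_on S" and A: "subspace A" "A \<subseteq> S"
  shows "dim (perp b S A) + dim A = dim S"
proof -
  have "A \<inter> {0} = {0}" using subspace_0[OF A(1)] by blast
  then show ?thesis using dim_perp[OF b sym S(1) A] nondeg_on_perp[OF S] by simp
qed

text \<open>
  Two totally isotropic subspaces, for \<open>b(x, q(u) y)\<close> and for \<open>b(x, q(u) u\<^sup>2 y)\<close>; together they are
  large enough for the Witt-index inequality.
\<close>

lemma isotropic_pair:
  assumes S: "subspace S" "nondeg_on S"
    and v: "lin v" "selfadjoint b v" "\<And>x. v (v x) = 0" "\<And>x. x \<in> S \<Longrightarrow> v x \<in> S"
    and w: "lin w" "selfadjoint b w" "\<And>x. w (w x) = 0" "\<And>x. x \<in> S \<Longrightarrow> w x \<in> S"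
    and uvw: "\<And>x. u x = v x + w x"
    and qv: "\<And>x. v (P q x) = P q (v x)" and qw: "\<And>x. w (P q x) = P q (w x)"
  obtains U X where "subspace U" "U \<subseteq> S" "iso (cq q) U" "subspace X" "X \<subseteq> S" "iso (cq (q * (T * T))) X"
    "dim (P (q * T) ` S) \<le> dim (P q ` U) + dim (P (q * (T * T)) ` X)"
proof -
  have St: "stable S" using v(4) w(4) S(1) by (auto simp: stable_def uvw subspace_add)
  have PS: "P r x \<in> S" if "x \<in> S" for r x by (rule P_stable[OF S(1) St that])
  have vsa: "b (v x) y = b x (v y)" for x y using v(2) by (simp add: selfadjoint_def)
  have wsa: "b (w x) y = b x (w y)" for x y using w(2) by (simp add: selfadjoint_def)
  let ?f1 = "\<lambda>x. P q (v x)" and ?f2 = "\<lambda>x. P q (w x)"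
  let ?f3 = "\<lambda>x. P q (v (w x))" and ?f4 = "\<lambda>x. P q (w (v x))"
  note vl = linE[OF v(1)] and wl = linE[OF w(1)]
  have l: "lin ?f1" "lin ?f2" "lin ?f3" "lin ?f4" by (rule linI; simp add: P_linE vl wl)+
  have fS: "?f1 x \<in> S" "?f2 x \<in> S" "?f3 x \<in> S" "?f4 x \<in> S" if "x \<in> S" for x using that v(4) w(4) PS by auto
  have a1: "b (?f1 x) y = b x (?f1 y)" for x y by (simp add: b_P vsa qv)
  have a2: "b (?f2 x) y = b x (?f2 y)" for x y by (simp add: b_P wsa qw)
  have a3: "b (?f3 x) y = b x (?f4 y)" for x y by (simp add: b_P vsa wsa qv qw)
  have a4: "b (?f4 x) y = b x (?f3 y)" for x y by (simp add: b_P vsa wsa qv qw)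
  have u1: "P (q * T) x = ?f1 x + ?f2 x" for x by (simp only: P_mult P_T uvw P_linE)
  have u2: "P (q * (T * T)) x = ?f3 x + ?f4 x" for x by (simp only: P_mult P_T uvw P_linE vl wl v(3) w(3)) simp
  define A where "A = ?f1 ` S"
  define C where "C = ?f2 ` S"
  have A: "subspace A" "A \<subseteq> S" unfolding A_def using subspace_image[OF l(1) S(1)] fS by auto
  have C: "subspace C" "C \<subseteq> S" unfolding C_def using subspace_image[OF l(2) S(1)] fS by auto
  define B where "B = {y \<in> C. v y = 0}"
  have B: "subspace B" unfolding B_def by (rule subspace_ker[OF v(1) C(1)])
  \<comment> \<open>The image of \<open>v\<close> is totally isotropic since \<open>v\<close>
    squares to 0 and commutes with \<open>P q\<close>; the vectors \<open>w t\<close> are orthogonal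
    to each other for the same reason, and the condition \<open>P q (v (w t)) = 0\<close> makes them
    orthogonal to the image of \<open>v\<close>.\<close>
  define U where "U = ssum (v ` S) {y \<in> w ` S. P q (v y) = 0}"
  have vS: "subspace (v ` S)" "v ` S \<subseteq> S" using subspace_image[OF v(1) S(1)] v(4) by auto
  have wS: "subspace {y \<in> w ` S. P q (v y) = 0}" using subspace_ker[OF l(1) subspace_image[OF w(1) S(1)]] .
  have U: "subspace U" unfolding U_def by (rule subspace_ssum[OF vS(1) wS])
  have US: "U \<subseteq> S" unfolding U_def by (rule ssum_subset[OF S(1)]) (use v(4) w(4) in auto)
  have isoU: "iso (cq q) U" unfolding iso_def
  proof (intro ballI)
    fix x y assume "x \<in> U" "y \<in> U"
    then obtain s s' t t' where e: "x = v s + w t" "y = v s' + w t'" "P q (v (w t)) = 0" "P q (v (w t')) = 0"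
      unfolding U_def ssum_def by blast
    have "b (v s) (P q (v s')) = 0" "b (w t) (P q (w t')) = 0" by (simp_all add: vsa wsa qv qw v(3) w(3) P_linE bl)
    moreover have "b (v s) (P q (w t')) = 0" using e(4) by (simp add: vsa qv bl)
    moreover have "b (w t) (P q (v s')) = b (P q (v (w t))) s'" by (simp add: b_P vsa qv)
    ultimately show "cq q x y = 0" using e by (simp add: cq_def bl P_linE)
  qed
  have QU: "P q ` U = ssum A B"
  proof
    show "P q ` U \<subseteq> ssum A B" unfolding U_def ssum_def A_def B_def C_def using qv by (fastforce simp: P_linE)
    show "ssum A B \<subseteq> P q ` U"
    proof
      fix x assume "x \<in> ssum A B"
      then obtain s t where e: "x = P q (v s) + P q (w t)" "s \<in> S" "t \<in> S" "v (P q (w t)) = 0"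
        unfolding ssum_def A_def B_def C_def by blast
      then have "v s + w t \<in> U" unfolding U_def by (intro ssumI) (auto simp: qv)
      moreover have "x = P q (v s + w t)" using e by (simp add: P_linE)
      ultimately show "x \<in> P q ` U" by blast
    qed
  qed
  have dU: "dim (P q ` U) + dim (A \<inter> C) = dim A + dim B"
  proof -
    have "A \<inter> B = A \<inter> C" unfolding A_def B_def by (auto simp: qv v(3) P_linE)
    then show ?thesis using dim_ssum_Int[OF A(1) B] QU by simp
  qed
  have "v ` C = ?f3 ` S" unfolding C_def image_image qv ..
  then have dB: "dim (?f3 ` S) + dim B = dim C" using rank_nullity[OF v(1) C(1)] B_def by simp
  define Y where "Y = ssum A C"
  have Y: "subspace Y" "Y \<subseteq> S" unfolding Y_def using subspace_ssum[OF A(1) C(1)] ssum_subset[OF S(1) A(2) C(2)] .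
  have dY: "dim Y + dim (A \<inter> C) = dim A + dim C" unfolding Y_def by (rule dim_ssum_Int[OF A(1) C(1)])
  define K where "K = {x \<in> S. P (q * T) x = 0}"
  have K: "subspace K" unfolding K_def by (rule subspace_ker[OF P_lin S(1)])
  have pA: "perp b S A = {x \<in> S. ?f1 x = 0}" unfolding A_def by (rule perp_image(1)[OF S l(1) fS(1) l(1) fS(1) a1])
  have pC: "perp b S C = {x \<in> S. ?f2 x = 0}" unfolding C_def by (rule perp_image(1)[OF S l(2) fS(2) l(2) fS(2) a2])
  have pY: "perp b S Y = {x \<in> K. ?f1 x = 0}"
  proof -
    have "perp b S Y = perp b S A \<inter> perp b S C"
    proof
      show "perp b S Y \<subseteq> perp b S A \<inter> perp b S C"
        unfolding Y_def using perp_antimono[OF ssum_left[OF C(1)]] perp_antimono[OF ssum_right[OF A(1)]] by blast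
      show "perp b S A \<inter> perp b S C \<subseteq> perp b S Y" by (auto simp: Y_def ssum_def perp_def bl)
    qed
    moreover have "perp b S A \<inter> perp b S C = {x \<in> K. ?f1 x = 0}" unfolding pA pC K_def
    proof (rule Set.set_eqI)
      fix x
      show "(x \<in> {x \<in> S. ?f1 x = 0} \<inter> {x \<in> S. ?f2 x = 0}) =
          (x \<in> {x \<in> {x \<in> S. P (q * T) x = 0}. ?f1 x = 0})" using u1[of x] by (cases "?f1 x = 0") simp_all
    qed
    ultimately show ?thesis by simp
  qed
  have d1: "dim Y + dim {x \<in> K. ?f1 x = 0} = dim S" using dim_nondeg_perp[OF S Y] pY by simp
  have d2: "dim (P (q * T) ` S) + dim K = dim S" unfolding K_def by (rule rank_nullity[OF P_lin S(1)])
  have d3: "dim (?f1 ` K) + dim {x \<in> K. ?f1 x = 0} = dim K" by (rule rank_nullity[OF l(1) K])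
  \<comment> \<open>The form for \<open>q * (T * T)\<close> comes from the map
    \<open>?f3 + ?f4\<close>, whose two terms are adjoint to each other; so it vanishes on the
    kernel of either.\<close>
  define X where "X = {x \<in> S. ?f3 x = 0}"
  define X' where "X' = {x \<in> S. ?f4 x = 0}"
  have X: "subspace X" "subspace X'" unfolding X_def X'_def using subspace_ker[OF l(3) S(1)] subspace_ker[OF l(4) S(1)] .
  have XS: "X \<subseteq> S" "X' \<subseteq> S" by (auto simp: X_def X'_def)
  have isoX: "iso (cq (q * (T * T))) X" unfolding iso_def cq_def
  proof (intro ballI)
    fix x y assume "x \<in> X" "y \<in> X"
    then show "b x (P (q * (T * T)) y) = 0" unfolding u2 using a3[of x y, symmetric] by (simp add: X_def bl)
  qed
  have i4: "P (q * (T * T)) ` X = ?f4 ` X" by (rule image_cong) (auto simp: u2 X_def)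
  have d4: "dim (?f4 ` X) + dim (X \<inter> X') = dim X"
  proof -
    have "{x \<in> X. ?f4 x = 0} = X \<inter> X'" by (auto simp: X_def X'_def)
    then show ?thesis using rank_nullity[OF l(4) X(1)] by simp
  qed
  define Z where "Z = ssum X X'"
  have Z: "subspace Z" "Z \<subseteq> S" unfolding Z_def using subspace_ssum[OF X] ssum_subset[OF S(1) XS] .
  have d5: "dim Z + dim (X \<inter> X') = dim X + dim X'" unfolding Z_def by (rule dim_ssum_Int[OF X])
  have d6: "dim (?f4 ` S) + dim X' = dim S" unfolding X'_def by (rule rank_nullity[OF l(4) S(1)])
  have d7: "dim (?f3 ` S) + dim X = dim S" unfolding X_def by (rule rank_nullity[OF l(3) S(1)])
  have pX: "perp b S X = ?f4 ` S" unfolding X_def by (rule perp_image(2)[OF S l(4) fS(4) l(3) fS(3) a4])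
  have pX': "perp b S X' = ?f3 ` S" unfolding X'_def by (rule perp_image(2)[OF S l(3) fS(3) l(4) fS(4) a3])
  have d8: "dim (?f4 ` S) + dim X = dim S" using dim_nondeg_perp[OF S X(1) XS(1)] pX by simp
  have d9: "dim (perp b S Z) + dim Z = dim S" by (rule dim_nondeg_perp[OF S Z])
  \<comment> \<open>A vector orthogonal to \<open>X\<close> and \<open>X'\<close> is both
    \<open>P q (v (w x))\<close> and \<open>P q (w (v y))\<close>. Then
    \<open>?z = w x - v y\<close> has opposite images under \<open>?f1\<close> and
    \<open>?f2\<close>, so it lies in \<open>K\<close>.\<close>
  have "perp b S Z \<subseteq> ?f1 ` K"
  proof
    fix n assume n: "n \<in> perp b S Z"
    have "n \<in> perp b S X" "n \<in> perp b S X'"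
      using n perp_antimono[OF ssum_left[OF X(2), of X]] perp_antimono[OF ssum_right[OF X(1), of X']]
      unfolding Z_def by blast+
    then obtain x y where xy: "n = ?f4 y" "y \<in> S" "n = ?f3 x" "x \<in> S" unfolding pX pX' by blast
    let ?z = "w x - v y"
    have z: "?z \<in> S" using xy v(4) w(4) S(1) by (simp add: subspace_diff)
    have "?f1 ?z = n" "?f2 ?z = - n" using xy by (simp_all add: vl wl v(3) w(3) P_linE)
    then show "n \<in> ?f1 ` K" using z unfolding K_def u1 by force
  qed
  then have d10: "dim (perp b S Z) \<le> dim (?f1 ` K)" by (rule dim_subset)
  \<comment> \<open>Here dim q(u)U = dim Y - rank f3 and dim Y = rank (qT)(u) + dim f1(K), while dim
    f4(X) is rank f4 minus the dimension of the orthogonal of Z. The adjoint maps f3 and f4 have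
    equal rank, and \<open>d10\<close> compares the two remaining terms.\<close>
  have "dim (P (q * T) ` S) \<le> dim (P q ` U) + dim (P (q * (T * T)) ` X)"
    unfolding i4 using dU dB dY d1 d2 d3 d4 d5 d6 d7 d8 d9 d10 by linarith
  then show ?thesis using that[OF U US isoU X(1) XS(1) isoX] by blast
qed

text \<open>The sum of \<open>K\<close> and the image of \<open>u\<close> is its own biorthogonal.
  By the duality of kernels and images, a vector orthogonal to it is \<open>P (q * T) s\<close> with
  \<open>P (q * (T * T)) s = 0\<close>, and \<open>h\<close> says that \<open>y\<close> is
  orthogonal to all of these.\<close>

lemma kernel_split:
  assumes S: "subspace S" "stable S" "nondeg_on S" and y: "y \<in> S"
    and h: "\<And>x. x \<in> S \<Longrightarrow> P (q * (T * T)) x = 0 \<Longrightarrow> b (P (q * T) x) y = 0"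
  obtains k z where "k \<in> S" "P (q * T) k = 0" "z \<in> S" "y = k + u z"
proof -
  define K where "K = {x \<in> S. P (q * T) x = 0}"
  have K: "subspace K" "K \<subseteq> S" unfolding K_def using subspace_ker[OF P_lin S(1)] by auto
  have uS: "subspace (u ` S)" "u ` S \<subseteq> S" using subspace_image[OF u S(1)] S(2) by (auto simp: stable_def)
  have pK: "perp b S K = P (q * T) ` S"
    unfolding K_def by (rule perp_image(2)[OF S(1,3) P_lin _ P_lin]) (auto simp: b_P P_stable[OF S(1,2)])
  have pu: "perp b S (u ` S) = {x \<in> S. u x = 0}"
    by (rule perp_image(1)[OF S(1,3) u _ u]) (use S(2) in \<open>auto simp: b_sa stable_def\<close>)
  have "y \<in> perp b S (perp b S (ssum K (u ` S)))" unfolding perp_def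
  proof (intro CollectI conjI y ballI)
    fix x assume "x \<in> {y \<in> S. \<forall>x\<in>ssum K (u ` S). b x y = 0}"
    then have "x \<in> perp b S (ssum K (u ` S))" by (simp add: perp_def)
    then have "x \<in> perp b S K" "x \<in> perp b S (u ` S)"
      using perp_antimono[OF ssum_left[OF uS(1)]] perp_antimono[OF ssum_right[OF K(1)]] by blast+
    then obtain s where s: "x = P (q * T) s" "s \<in> S" "u x = 0" unfolding pK pu by blast
    have "P (q * (T * T)) s = u x" unfolding s(1) by (simp only: P_mult P_T P_u)
    then show "b x y = 0" using h[OF s(2)] s by simp
  qed
  also have "\<dots> = ssum K (u ` S)"
  proof -
    have "perp b S (perp b S (ssum K (u ` S))) = ssum (ssum K (u ` S)) {0}"
      using perp_perp[OF b sym S(1) subspace_ssum[OF K(1) uS(1)] ssum_subset[OF S(1) K(2) uS(2)]]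
        nondeg_on_perp[OF S(1,3)] by simp
    then show ?thesis by (simp add: ssum_def)
  qed
  finally show ?thesis using that unfolding ssum_def K_def by blast
qed

text \<open>Witnesses are chosen on a basis of \<open>W\<close> only, so that they can depend
  linearly on \<open>w\<close>.\<close>

lemma select_linear:
  assumes K: "subspace K" and G: "subspace G" and W: "subspace W"
    and h: "\<And>w. w \<in> W \<Longrightarrow> \<exists>k\<in>K. k + u w \<in> G"
  obtains f where "lin f" "\<And>w. w \<in> W \<Longrightarrow> f w \<in> K" "\<And>w. w \<in> W \<Longrightarrow> f w + u w \<in> G"
proof -
  obtain B where B: "B \<subseteq> W" "independent B" "W \<subseteq> span B" "card B = dim W" by (rule basis_exists[of W])
  obtain g where g: "\<And>w. w \<in> B \<Longrightarrow> g w \<in> K \<and> g w + u w \<in> G" using h B(1) by (metis subsetD)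
  have vp: "vector_space_pair scale scale" by unfold_locales
  obtain f where f: "lin f" "\<And>x. x \<in> B \<Longrightarrow> f x = g x"
    using vector_space_pair.linear_independent_extend[OF vp B(2), of g] by blast
  have "f w \<in> K \<and> f w + u w \<in> G" if "w \<in> span B" for w using that
  proof (induct rule: span_induct_alt)
    case base then show ?case by (simp add: linE[OF f(1)] u_lin subspace_0[OF K] subspace_0[OF G])
  next
    case (step a x y)
    have "f (a *s x + y) = a *s f x + f y" by (simp add: linE[OF f(1)])
    moreover have "f (a *s x + y) + u (a *s x + y) = a *s (f x + u x) + (f y + u y)"
      by (simp add: linE[OF f(1)] u_lin scale_right_distrib)
    ultimately show ?case using step g f(2)
      by (metis subspace_add[OF K] subspace_add[OF G] subspace_scale[OF K] subspace_scale[OF G])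
  qed
  then show ?thesis using that[OF f(1)] B(3) by blast
qed

text \<open>
  \<open>L\<^sub>2\<close> is a maximal totally isotropic subspace for \<open>b(x, q(u) u\<^sup>2 y)\<close>, with \<open>W\<close> as anisotropic part.
  Among the large enough totally isotropic subspaces for \<open>b(x, q(u) y)\<close> between \<open>L\<close> and its orthogonal,
  one chooses \<open>G\<close> so that its projection to \<open>W\<close> is as large as possible. Then \<open>G\<close> is the graph of an
  isometric embedding.
\<close>

lemma embedding:
  assumes S: "subspace S" "stable S" "nondeg_on S"
    and L2: "subspace L2" "L2 \<subseteq> S" "{x \<in> S. P (q * (T * T)) x = 0} \<subseteq> L2" "iso (cq (q * (T * T))) L2"
    and W: "subspace W" "W \<subseteq> S" "\<And>w. w \<in> W \<Longrightarrow> cq (q * (T * T)) w w = 0 \<Longrightarrow> w = 0"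
    and L2W: "perp (cq (q * (T * T))) S L2 = ssum L2 W"
    and U: "subspace U" "U \<subseteq> S" "iso (cq q) U"
    and X: "subspace X" "X \<subseteq> S" "iso (cq (q * (T * T))) X"
    and num: "dim (P (q * T) ` S) \<le> dim (P q ` U) + dim (P (q * (T * T)) ` X)"
  obtains f where "lin f" "\<And>w. w \<in> W \<Longrightarrow> f w \<in> S \<and> P (q * T) (f w) = 0"
    "\<And>w w'. w \<in> W \<Longrightarrow> w' \<in> W \<Longrightarrow> cq q (f w) (f w') = - cq (q * (T * T)) w w'"
proof -
  let ?c = "cq q" and ?d = "cq (q * (T * T))"
  have cc: "?c x y = ?c y x" "?d x y = ?d y x" for x y by (rule cq_comm)+
  \<comment> \<open>\<open>u\<close> carries \<open>?d\<close> to \<open>?c\<close>, and its image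
    is \<open>?c\<close>-orthogonal to \<open>K\<close>; these two facts relate the two forms
    throughout.\<close>
  have cu: "?c (u x) (u y) = ?d x y" for x y unfolding cq_def by (simp only: b_sa P_mult P_T P_u)
  have ck: "?c (u x) k = 0" if "P (q * T) k = 0" for x k
    using that by (simp only: cq_def b_sa P_mult P_T P_u[symmetric] bl)
  define R0 where "R0 = {x \<in> S. P q x = 0}"
  define K where "K = {x \<in> S. P (q * T) x = 0}"
  define R2 where "R2 = {x \<in> S. P (q * (T * T)) x = 0}"
  have R0: "subspace R0" and K: "subspace K" and R2: "subspace R2"
    unfolding R0_def K_def R2_def by (rule subspace_ker[OF P_lin S(1)])+
  have KR: "K \<subseteq> R2"
  proof
    fix x assume x: "x \<in> K"
    have "P (q * (T * T)) x = u (P (q * T) x)" by (simp only: P_mult P_T P_u)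
    then show "x \<in> R2" using x by (simp add: K_def R2_def u_lin)
  qed
  have R2L: "R2 \<subseteq> L2" using L2(3) by (simp add: R2_def)
  have rad: "perp ?c S S = R0" "perp ?d S S = R2" unfolding R0_def R2_def by (rule cq_rad[OF S])+
  have L2W0: "?d l w = 0" if "l \<in> L2" "w \<in> W" for l w
  proof -
    have "w \<in> perp ?d S L2" unfolding L2W using that(2) ssum_right[OF L2(1)] by blast
    then show ?thesis using that(1) by (simp add: perp_def)
  qed
  have "L2 \<inter> W = {0}" using L2(4) W(3) subspace_0[OF L2(1)] subspace_0[OF W(1)] unfolding iso_def by blast
  then have dLW: "dim (ssum L2 W) = dim L2 + dim W" by (rule dim_direct_sum[OF L2(1) W(1)])
  have d1: "dim L2 + dim W + dim L2 = dim S + dim R2"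
    using dim_perp[OF cq_bil cq_sym S(1) L2(1,2), of "q * (T * T)"] R2L
    unfolding L2W rad dLW by (simp add: Int_absorb1)
  \<comment> \<open>Because \<open>W\<close> is anisotropic, \<open>L2\<close> is a totally
    isotropic subspace of greatest dimension; this bounds \<open>X\<close> enlarged by the radical
    \<open>R2\<close>.\<close>
  have dX: "dim (P (q * (T * T)) ` X) + dim R2 \<le> dim L2"
  proof -
    let ?X = "ssum X R2"
    have sX: "subspace ?X" "?X \<subseteq> S" using subspace_ssum[OF X(1) R2] ssum_subset[OF S(1) X(2)] R2_def by auto
    have R2p: "?d x r = 0" if "r \<in> R2" for x r using that by (simp add: cq_def R2_def bl)
    have R2p': "?d r x = 0" if "r \<in> R2" for x r using R2p[OF that] cc(2) by metis
    have isoX: "iso ?d ?X" using X(3) unfolding iso_def ssum_def by (auto simp: cql R2p R2p')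
    have "dim ?X \<le> dim L2"
    proof (rule iso_dim_le[OF cq_bil cq_sym sX(1) isoX L2(1,4)])
      show "perp ?d ?X L2 \<subseteq> L2"
      proof
        fix t assume t: "t \<in> perp ?d ?X L2"
        then have "t \<in> perp ?d S L2" using sX(2) by (auto simp: perp_def)
        then obtain l w where lw: "t = l + w" "l \<in> L2" "w \<in> W" unfolding L2W ssum_def by blast
        have "?d t t = 0" using t isoX by (auto simp: perp_def iso_def)
        moreover have "?d t t = ?d w w" using lw L2W0 L2(4) cc(2)[of w l] by (simp add: cql iso_def)
        ultimately have "?d w w = 0" by simp
        then have "w = 0" by (rule W(3)[OF lw(3)])
        then show "t \<in> L2" using lw by simp
      qed
    qed
    moreover have "dim (P (q * (T * T)) ` ?X) + dim {x \<in> ?X. P (q * (T * T)) x = 0} = dim ?X"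
      by (rule rank_nullity[OF P_lin sX(1)])
    moreover have "{x \<in> ?X. P (q * (T * T)) x = 0} = R2"
      using sX(2) ssum_right[OF X(1), of R2] unfolding R2_def by auto
    moreover have "dim (P (q * (T * T)) ` X) \<le> dim (P (q * (T * T)) ` ?X)"
      by (rule dim_subset) (use ssum_left[OF R2, of X] in blast)
    ultimately show ?thesis by simp
  qed
  \<comment> \<open>The image of \<open>L2\<close> together with the radical of \<open>?c\<close>:
    the totally isotropic subspace of \<open>?c\<close> that corresponds to
    \<open>L2\<close>.\<close>
  define L where "L = ssum (u ` L2) R0"
  have uL2: "subspace (u ` L2)" "u ` L2 \<subseteq> S" using subspace_image[OF u L2(1)] L2(2) S(2) by (auto simp: stable_def)
  have L: "subspace L" "L \<subseteq> S" unfolding L_def using subspace_ssum[OF uL2(1) R0] ssum_subset[OF S(1) uL2(2)] R0_def by auto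
  have R0L: "R0 \<subseteq> L" unfolding L_def by (rule ssum_right[OF uL2(1)])
  have uL: "u l \<in> L" if "l \<in> L2" for l unfolding L_def using ssum_left[OF R0, of "u ` L2"] that by blast
  have R0p: "?c x r = 0" if "r \<in> R0" for x r using that by (simp add: cq_def R0_def bl)
  have R0p': "?c r x = 0" if "r \<in> R0" for x r using R0p[OF that] cc(1) by metis
  have isoL: "iso ?c L" using L2(4) unfolding iso_def L_def ssum_def by (auto simp: cql cu R0p R0p')
  have dL: "dim L + dim K = dim R0 + dim L2"
  proof -
    have "dim (P q ` L) + dim {x \<in> L. P q x = 0} = dim L" by (rule rank_nullity[OF P_lin L(1)])
    moreover have "{x \<in> L. P q x = 0} = R0" using R0L L(2) unfolding R0_def by auto
    moreover have "P q ` L = P (q * T) ` L2"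
    proof
      show "P q ` L \<subseteq> P (q * T) ` L2" unfolding L_def ssum_def R0_def by (auto simp: P_linE P_mult)
      show "P (q * T) ` L2 \<subseteq> P q ` L" using uL unfolding P_mult P_T by blast
    qed
    moreover have "dim (P (q * T) ` L2) + dim {x \<in> L2. P (q * T) x = 0} = dim L2"
      by (rule rank_nullity[OF P_lin L2(1)])
    moreover have "{x \<in> L2. P (q * T) x = 0} = K" using KR R2L L2(2) unfolding K_def by auto
    ultimately show ?thesis by simp
  qed
  let ?U = "ssum U R0"
  have sU: "subspace ?U" "?U \<subseteq> S" using subspace_ssum[OF U(1) R0] ssum_subset[OF S(1) U(2)] R0_def by auto
  have isoU: "iso ?c ?U" using U(3) unfolding iso_def ssum_def by (auto simp: cql R0p R0p')
  have dU: "dim (P q ` U) + dim R0 \<le> dim ?U"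
  proof -
    have "dim (P q ` ?U) + dim {x \<in> ?U. P q x = 0} = dim ?U" by (rule rank_nullity[OF P_lin sU(1)])
    moreover have "{x \<in> ?U. P q x = 0} = R0" using sU(2) ssum_right[OF U(1), of R0] unfolding R0_def by auto
    moreover have "dim (P q ` U) \<le> dim (P q ` ?U)" by (rule dim_subset) (use ssum_left[OF R0, of U] in blast)
    ultimately show ?thesis by simp
  qed
  have dK: "dim (P (q * T) ` S) + dim K = dim S" unfolding K_def by (rule rank_nullity[OF P_lin S(1)])
  \<comment> \<open>Modulo \<open>L\<close>, the orthogonal of \<open>L\<close> consists of sums of
    a vector of \<open>K\<close> and one of the image of \<open>W\<close> under
    \<open>u\<close>.\<close>
  have perpL: "\<exists>l\<in>L2. \<exists>k\<in>K. \<exists>w\<in>W. y = u l + (k + u w)" if y: "y \<in> perp ?c S L" for y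
  proof -
    have yS: "y \<in> S" using y by (simp add: perp_def)
    have yL: "?c (u l) y = 0" if "l \<in> L2" for l using y uL[OF that] by (simp add: perp_def)
    obtain k z where kz: "k \<in> S" "P (q * T) k = 0" "z \<in> S" "y = k + u z"
    proof (rule kernel_split[OF S yS])
      fix x assume "x \<in> S" "P (q * (T * T)) x = 0"
      then have "x \<in> L2" using L2(3) by blast
      then have "?c (u x) y = 0" by (rule yL)
      then show "b (P (q * T) x) y = 0" by (simp only: cq_def b_sa P_mult P_T b_P P_u)
    qed
    have "z \<in> perp ?d S L2" unfolding perp_def
    proof (intro CollectI conjI kz(3) ballI)
      fix l assume "l \<in> L2"
      then show "?d l z = 0" using yL[of l] ck[OF kz(2), of l] unfolding kz(4) by (simp add: cql cu)
    qed
    then obtain l w where "z = l + w" "l \<in> L2" "w \<in> W" unfolding L2W ssum_def by blast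
    moreover have "k \<in> K" using kz by (simp add: K_def)
    ultimately show ?thesis using kz(4) by (intro bexI[of _ l] bexI[of _ k] bexI[of _ w]) (auto simp: u_lin)
  qed
  define Pr where "Pr G = {w \<in> W. \<exists>k\<in>K. k + u w \<in> G}" for G
  define ok where "ok G \<longleftrightarrow> subspace G \<and> L \<subseteq> G \<and> G \<subseteq> perp ?c S L \<and> iso ?c G \<and> dim L + dim W \<le> dim G" for G
  have Pr: "subspace (Pr G)" if "subspace G" for G
  proof (rule subspaceI)
    show "0 \<in> Pr G" unfolding Pr_def using subspace_0[OF W(1)] subspace_0[OF K] subspace_0[OF that]
      by (auto intro!: bexI[of _ 0] simp: u_lin)
  next
    fix x y assume "x \<in> Pr G" "y \<in> Pr G"
    then obtain k k' where k: "x \<in> W" "y \<in> W" "k \<in> K" "k' \<in> K" "k + u x \<in> G" "k' + u y \<in> G" unfolding Pr_def by blast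
    have e: "(k + k') + u (x + y) = (k + u x) + (k' + u y)" by (simp add: u_lin)
    have "(k + k') + u (x + y) \<in> G" unfolding e by (rule subspace_add[OF that k(5,6)])
    moreover have "k + k' \<in> K" "x + y \<in> W" using k subspace_add[OF W(1)] subspace_add[OF K] by auto
    ultimately show "x + y \<in> Pr G" unfolding Pr_def by blast
  next
    fix a x assume "x \<in> Pr G"
    then obtain k where k: "x \<in> W" "k \<in> K" "k + u x \<in> G" unfolding Pr_def by blast
    have e: "a *s k + u (a *s x) = a *s (k + u x)" by (simp add: u_lin scale_right_distrib)
    have "a *s k + u (a *s x) \<in> G" unfolding e by (rule subspace_scale[OF that k(3)])
    moreover have "a *s k \<in> K" "a *s x \<in> W" using k subspace_scale[OF W(1)] subspace_scale[OF K] by auto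
    ultimately show "a *s x \<in> Pr G" unfolding Pr_def by blast
  qed
  have PrI: "\<exists>l\<in>L2. \<exists>k\<in>K. \<exists>w\<in>Pr G. y = u l + (k + u w)" if G: "subspace G" "L \<subseteq> G" "G \<subseteq> perp ?c S L" and y: "y \<in> G" for G y
  proof -
    obtain l k w where lkw: "l \<in> L2" "k \<in> K" "w \<in> W" "y = u l + (k + u w)" using perpL y G(3) by blast
    have "y - u l \<in> G" using y uL[OF lkw(1)] G(2) subspace_diff[OF G(1)] by blast
    then have "k + u w \<in> G" using lkw(4) by simp
    then have "w \<in> Pr G" using lkw unfolding Pr_def by blast
    then show ?thesis using lkw by blast
  qed
  have ok0: "ok (ssum (perp ?c ?U L) L)" unfolding ok_def
  proof (intro conjI)
    have sp: "subspace (perp ?c ?U L)" by (rule subspace_perp[OF cq_bil sU(1)])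
    show "subspace (ssum (perp ?c ?U L) L)" by (rule subspace_ssum[OF sp L(1)])
    show "L \<subseteq> ssum (perp ?c ?U L) L" by (rule ssum_right[OF sp])
    show "iso ?c (ssum (perp ?c ?U L) L)" by (rule iso_extend(1)[OF cq_bil cq_sym sU(1) isoU L(1) isoL])
    show "ssum (perp ?c ?U L) L \<subseteq> perp ?c S L"
      by (rule ssum_subset[OF subspace_perp[OF cq_bil S(1)]]) (use sU(2) L(2) isoL in \<open>auto simp: perp_def iso_def\<close>)
    have "dim ?U \<le> dim (ssum (perp ?c ?U L) L)" by (rule iso_extend(2)[OF cq_bil cq_sym sU(1) isoU L(1) isoL])
    \<comment> \<open>By \<open>d1\<close>, \<open>dL\<close> and \<open>dK\<close>, the sum
      \<open>dim L + dim W\<close> equals dim R0 + rank (qT)(u) + dim R2 - dim L2. Now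
      \<open>num\<close> bounds the rank, and \<open>dX\<close> and \<open>dU\<close> absorb the
      rest.\<close>
    then show "dim L + dim W \<le> dim (ssum (perp ?c ?U L) L)" using d1 dX dL dU dK num by linarith
  qed
  obtain G where G: "ok G" and Gmax: "\<And>G'. ok G' \<Longrightarrow> dim (Pr G') \<le> dim (Pr G)"
    using ex_has_greatest_nat[of ok _ "\<lambda>G. dim (Pr G)" "Suc dimension", OF ok0] dim_le_dimension
    by (metis less_Suc_eq_le)
  have G': "subspace G" "L \<subseteq> G" "G \<subseteq> perp ?c S L" "iso ?c G" "dim L + dim W \<le> dim G" using G by (auto simp: ok_def)
  have GS: "G \<subseteq> S" using G'(3) perp_subset by blast
  have PrW: "Pr G = W"
  proof (rule ccontr)
    assume n: "Pr G \<noteq> W"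
    have PW: "Pr G \<subseteq> W" by (auto simp: Pr_def)
    have dP: "dim (Pr G) < dim W"
    proof (rule ccontr)
      assume "\<not> ?thesis"
      then have "Pr G = W" using subspace_dim_equal[OF Pr[OF G'(1)] W(1) PW] by simp
      then show False using n by blast
    qed
    have "dim W \<le> dim (perp ?d W (Pr G)) + dim (Pr G)" by (rule codim_perp[OF cq_bil W(1) Pr[OF G'(1)]])
    then have "perp ?d W (Pr G) \<noteq> {0}" using dP by auto
    then obtain w0 where "w0 \<in> perp ?d W (Pr G)" and w0n: "w0 \<noteq> 0"
      using subspace_0[OF subspace_perp[OF cq_bil W(1)], of "q * (T * T)" "Pr G"] by blast
    then have w0: "w0 \<in> W" "w0 \<noteq> 0" "\<And>w. w \<in> Pr G \<Longrightarrow> ?d w w0 = 0" by (simp_all add: perp_def)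
    have w00: "?d w0 w0 \<noteq> 0" using w0 W(3) by blast
    have w0G: "?c (u w0) g = 0" if g: "g \<in> G" for g
    proof -
      obtain l k w where "l \<in> L2" "k \<in> K" "w \<in> Pr G" "g = u l + (k + u w)" using PrI[OF G'(1-3) g] by blast
      then show ?thesis using L2W0[of l w0] w0 cc(2)[of w0] ck[of k] by (simp add: cql cu K_def)
    qed
    \<comment> \<open>Otherwise \<open>G\<close> would be contained in the sum of \<open>L\<close>
      and a graph over \<open>Pr G\<close>, whose dimension is below
      \<open>dim L + dim W\<close>.\<close>
    have "\<exists>e\<in>G \<inter> K. e \<notin> L"
    proof (rule ccontr)
      assume "\<not> ?thesis"
      then have GK: "G \<inter> K \<subseteq> L" by blast
      obtain f where f: "lin f" "\<And>w. w \<in> Pr G \<Longrightarrow> f w \<in> K" "\<And>w. w \<in> Pr G \<Longrightarrow> f w + u w \<in> G"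
        by (rule select_linear[OF K G'(1) Pr[OF G'(1)]]) (auto simp: Pr_def)
      let ?h = "\<lambda>w. f w + u w"
      have lh: "lin ?h" by (rule linI) (auto simp: linE[OF f(1)] u_lin scale_right_distrib)
      have sh: "subspace (?h ` Pr G)" by (rule subspace_image[OF lh Pr[OF G'(1)]])
      have "G \<subseteq> ssum L (?h ` Pr G)"
      proof
        fix g assume g: "g \<in> G"
        obtain l k w where lkw: "l \<in> L2" "k \<in> K" "w \<in> Pr G" "g = u l + (k + u w)" using PrI[OF G'(1-3) g] by blast
        have "g - u l - ?h w \<in> G" using g uL[OF lkw(1)] G'(2) f(3)[OF lkw(3)] subspace_diff[OF G'(1)] by blast
        moreover have "g - u l - ?h w = k - f w" using lkw(4) by simp
        moreover have "k - f w \<in> K" using lkw f(2) subspace_diff[OF K] by blast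
        ultimately have "k - f w \<in> L" using GK by auto
        then have "u l + (k - f w) \<in> L" using uL[OF lkw(1)] subspace_add[OF L(1)] by blast
        moreover have "g = (u l + (k - f w)) + ?h w" using lkw(4) by simp
        ultimately show "g \<in> ssum L (?h ` Pr G)" using lkw(3) unfolding ssum_def by blast
      qed
      then have "dim G \<le> dim (ssum L (?h ` Pr G))" by (rule dim_subset)
      moreover have "dim (ssum L (?h ` Pr G)) \<le> dim L + dim (?h ` Pr G)" using dim_ssum_Int[OF L(1) sh] by linarith
      moreover have "dim (?h ` Pr G) \<le> dim (Pr G)" using rank_nullity[OF lh Pr[OF G'(1)]] by linarith
      ultimately show False using G'(5) dP by linarith
    qed
    then obtain e where e: "e \<in> G" "e \<in> K" "e \<notin> L" by blast
    have se: "subspace (span {e})" by (rule subspace_span)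
    have sLe: "subspace (ssum L (span {e}))" by (rule subspace_ssum[OF L(1) se])
    have "ssum L (span {e}) \<subseteq> G" by (rule ssum_subset[OF G'(1,2)]) (use e G'(1) span_minimal in auto)
    then obtain C where C: "subspace C" "C \<subseteq> G" "ssum L (span {e}) \<inter> C = {0}" "ssum (ssum L (span {e})) C = G"
      using complement_exists[OF sLe G'(1)] by blast
    define G0 where "G0 = ssum L C"
    have G0: "subspace G0" "L \<subseteq> G0" "G0 \<subseteq> G" unfolding G0_def
      using subspace_ssum[OF L(1) C(1)] ssum_left[OF C(1)] ssum_subset[OF G'(1,2) C(2)] by auto
    have eG0: "e \<notin> G0"
    proof
      assume "e \<in> G0"
      then obtain l c where lc: "e = l + c" "l \<in> L" "c \<in> C" unfolding G0_def ssum_def by blast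
      have "c = - l + e" using lc(1) by simp
      then have "c \<in> ssum L (span {e})" using lc(2) span_base[of e "{e}"] subspace_neg[OF L(1)] unfolding ssum_def by blast
      then have "c = 0" using C(3) lc(3) by blast
      then show False using lc e(3) by simp
    qed
    have Gdec: "\<exists>a g0. g0 \<in> G0 \<and> g = a *s e + g0" if "g \<in> G" for g
    proof -
      from that obtain l t c where "g = l + t + c" "l \<in> L" "t \<in> span {e}" "c \<in> C"
        unfolding C(4)[symmetric] ssum_def by blast
      moreover then obtain a where "t = a *s e" using span_singleton by auto
      ultimately show ?thesis unfolding G0_def by (intro exI[of _ a] exI[of _ "l + c"]) (auto intro: ssumI)
    qed
    have "perp ?c S (perp ?c S G0) = G0"
    proof -
      have "perp ?c S (perp ?c S G0) = ssum G0 R0"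
        using perp_perp[OF cq_bil cq_sym S(1) G0(1), of q] G0(3) GS rad(1) by auto
      also have "\<dots> = G0" using ssum_subset[OF G0(1), of G0 R0] ssum_left[OF R0, of G0] R0L G0(2) by blast
      finally show ?thesis .
    qed
    then have "e \<notin> perp ?c S (perp ?c S G0)" using eG0 by simp
    then obtain f1 where f1: "f1 \<in> perp ?c S G0" "?c f1 e \<noteq> 0" using e(1) GS by (auto simp: perp_def)
    define f2 where "f2 = (1 / ?c f1 e) *s f1"
    define f where "f = f2 - (?c f2 (u w0) / ?d w0 w0) *s u w0"
    have w0S: "u w0 \<in> S" using w0(1) W(2) S(2) by (auto simp: stable_def)
    have f1S: "f1 \<in> S" "\<And>g. g \<in> G0 \<Longrightarrow> ?c g f1 = 0" using f1(1) by (auto simp: perp_def)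
    have fS: "f \<in> S" unfolding f_def f2_def using f1S(1) w0S S(1) by (simp add: subspace_diff subspace_scale)
    have ce0: "?c (u w0) e = 0" "?c e (u w0) = 0" using w0G[OF e(1)] cc(1) by metis+
    have cg0: "?c g (u w0) = 0" if "g \<in> G0" for g using w0G[of g] that G0(3) cc(1) by (metis subsetD)
    have f: "?c f e = 1" "?c f (u w0) = 0" "\<And>g. g \<in> G0 \<Longrightarrow> ?c g f = 0"
      using f1(2) f1S(2) cg0 w00 ce0 by (simp_all add: f_def f2_def cql cu)
    have fe: "?c e f = 1" "?c (u w0) f = 0" using f cc(1) by metis+
    have ee: "?c e e = 0" "\<And>g. g \<in> G0 \<Longrightarrow> ?c g e = 0" "\<And>g. g \<in> G0 \<Longrightarrow> ?c e g = 0"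
      using G'(4) e(1) G0(3) by (auto simp: iso_def)
    \<comment> \<open>\<open>f\<close> is dual to \<open>e\<close> and orthogonal to
      \<open>G0\<close> and to \<open>u w0\<close>; the coefficient \<open>m\<close> makes
      \<open>e'\<close> isotropic. Replacing \<open>e\<close> by \<open>e'\<close> adds to the
      projection a vector that pairs nontrivially with \<open>w0\<close>, so the projection
      grows.\<close>
    define m where "m = - (?d w0 w0 + ?c f f) / 2"
    define e' where "e' = u w0 + m *s e + f"
    have m2: "m + m = - (?d w0 w0 + ?c f f)"
    proof -
      have "m + m = 2 * m" by (simp only: mult_2)
      then show ?thesis unfolding m_def using two by simp
    qed
    have e'e': "?c e' e' = 0"
    proof -
      have "?c e' e' = ?d w0 w0 + ?c f f + (m + m)" unfolding e'_def by (simp add: cql cu f fe ee ce0)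
      then show ?thesis unfolding m2 by simp
    qed
    have ge': "?c g e' = 0" if "g \<in> G0" for g unfolding e'_def using that cg0 f(3) ee(2) by (simp add: cql)
    have e'g: "?c e' g = 0" if "g \<in> G0" for g using ge'[OF that] cc(1) by metis
    have ee': "?c e e' = 1" unfolding e'_def by (simp add: cql ce0 ee fe)
    have e'S: "e' \<in> S" unfolding e'_def using w0S fS e(1) GS S(1) by (auto intro!: subspace_add subspace_scale)
    have e'G0: "e' \<notin> G0" using ee' ee(3)[of e'] by auto
    define G1 where "G1 = ssum (span {e'}) G0"
    have G1: "subspace G1" "G0 \<subseteq> G1" "e' \<in> G1" unfolding G1_def
      using subspace_ssum[OF subspace_span G0(1)] ssum_right[OF subspace_span, of G0 "{e'}"]
        ssum_left[OF G0(1), of "span {e'}"] span_base[of e' "{e'}"] by auto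
    have isoG0: "?c x y = 0" if "x \<in> G0" "y \<in> G0" for x y using G'(4) G0(3) that by (auto simp: iso_def)
    have "ok G1" unfolding ok_def
    proof (intro conjI)
      show "subspace G1" by fact
      show "L \<subseteq> G1" using G0(2) G1(2) by blast
      show "G1 \<subseteq> perp ?c S L" unfolding G1_def
      proof (rule ssum_subset[OF subspace_perp[OF cq_bil S(1)]])
        have "e' \<in> perp ?c S L" using e'S ge' G0(2) by (auto simp: perp_def)
        then show "span {e'} \<subseteq> perp ?c S L" using span_minimal[OF _ subspace_perp[OF cq_bil S(1)]] by simp
        show "G0 \<subseteq> perp ?c S L" using G0(3) G'(3) by blast
      qed
      show "iso ?c G1" unfolding iso_def
      proof (intro ballI)
        fix x y assume "x \<in> G1" "y \<in> G1"
        then obtain a g a' g' where "x = a *s e' + g" "y = a' *s e' + g'" "g \<in> G0" "g' \<in> G0"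
          unfolding G1_def ssum_def span_singleton by blast
        then show "?c x y = 0" by (simp add: cql e'e' ge' e'g isoG0)
      qed
      have "span {e'} \<inter> G0 = {0}"
      proof -
        have "a *s e' = 0" if "a *s e' \<in> G0" for a using ee(3)[OF that] ee' by (simp add: cql)
        then show ?thesis using subspace_0[OF G0(1)] span_zero[of "{e'}"] unfolding span_singleton by blast
      qed
      then have "dim G1 = dim (span {e'}) + dim G0" unfolding G1_def by (rule dim_direct_sum[OF subspace_span G0(1)])
      moreover have "e' \<noteq> 0" using e'G0 subspace_0[OF G0(1)] by auto
      then have "dim (span {e'}) = 1" by simp
      moreover have "G \<subseteq> ssum (span {e}) G0" using Gdec unfolding ssum_def span_singleton by blast
      then have "dim G \<le> dim (ssum (span {e}) G0)" by (rule dim_subset)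
      then have "dim G \<le> dim (span {e}) + dim G0" using dim_ssum_Int[OF se G0(1)] by linarith
      moreover have "dim (span {e}) \<le> 1" by simp
      ultimately show "dim L + dim W \<le> dim G1" using G'(5) by linarith
    qed
    have sub: "Pr G \<subseteq> Pr G1"
    proof
      fix w assume "w \<in> Pr G"
      then obtain k where k: "w \<in> W" "k \<in> K" "k + u w \<in> G" unfolding Pr_def by blast
      obtain a g0 where ag: "g0 \<in> G0" "k + u w = a *s e + g0" using Gdec[OF k(3)] by blast
      then have "(k - a *s e) + u w = g0" by (simp add: algebra_simps)
      moreover have "k - a *s e \<in> K" using k(2) e(2) subspace_diff[OF K] subspace_scale[OF K] by blast
      ultimately show "w \<in> Pr G1" using k(1) ag(1) G1(2) unfolding Pr_def by blast
    qed
    have "G1 \<subseteq> perp ?c S L" "L \<subseteq> G1" using \<open>ok G1\<close> by (auto simp: ok_def)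
    then obtain l k w' where w': "l \<in> L2" "k \<in> K" "w' \<in> Pr G1" "e' = u l + (k + u w')"
      using PrI[OF G1(1) _ _ G1(3)] by blast
    have "?c e' (u w0) = ?d w0 w0" unfolding e'_def using f(2) ce0 by (simp add: cql cu)
    moreover have "?c e' (u w0) = ?d w' w0"
      using w' L2W0[OF w'(1) w0(1)] ck[of k w0] cc(1)[of k "u w0"] unfolding w'(4) by (simp add: cql cu K_def)
    ultimately have "w' \<notin> Pr G" using w0(3) w00 by metis
    then have "span (Pr G) \<subset> span (Pr G1)" using sub w'(3) Pr[OF G'(1)] Pr[OF G1(1)] span_eq_iff by (metis psubsetI)
    then have "dim (Pr G) < dim (Pr G1)" by (rule dim_psubset)
    then show False using Gmax[OF \<open>ok G1\<close>] by simp
  qed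
  obtain f where f: "lin f" "\<And>w. w \<in> W \<Longrightarrow> f w \<in> K" "\<And>w. w \<in> W \<Longrightarrow> f w + u w \<in> G"
    by (rule select_linear[OF K G'(1) W(1)]) (use PrW in \<open>auto simp: Pr_def\<close>)
  show ?thesis
  proof (rule that[OF f(1)])
    show "f w \<in> S \<and> P (q * T) (f w) = 0" if "w \<in> W" for w using f(2)[OF that] by (simp add: K_def)
    fix w w' assume ww: "w \<in> W" "w' \<in> W"
    \<comment> \<open>The mixed terms vanish since \<open>K\<close> is orthogonal to the image of
      \<open>u\<close>, so the isotropy of \<open>G\<close> says that \<open>f\<close> changes the
      sign of the form.\<close>
    have "0 = ?c (f w + u w) (f w' + u w')" using G'(4) f(3) ww by (simp add: iso_def)
    also have "\<dots> = ?c (f w) (f w') + ?c (f w) (u w') + (?c (u w) (f w') + ?d w w')" by (simp add: cql cu)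
    also have "?c (u w) (f w') = 0" by (rule ck) (use f(2)[OF ww(2)] in \<open>simp add: K_def\<close>)
    also have "?c (f w) (u w') = 0" using ck[of "f w" w'] f(2)[OF ww(1)] cc(1) by (simp add: K_def)
    finally show "?c (f w) (f w') = - ?d w w'" by (simp add: eq_neg_iff_add_eq_0)
  qed
qed

text \<open>
  With the form \<open>b(x, u\<^sup>m y)\<close>, the quotient \<open>Dset/Rset\<close> is the orthogonal sum of the \<open>V\<^sub>t\<^sub>,\<^sub>m\<^sub>+\<^sub>2\<^sub>s\<^sub>+\<^sub>1\<close>,
  and \<open>Dset\<close> is the orthogonal of the totally isotropic \<open>Rset\<close> in the nilpotent part.
\<close>

definition Dset :: "nat \<Rightarrow> nat \<Rightarrow> 'v set" where
  "Dset m n = {\<Sum>s<n. P (T ^ s) (x s) | x. \<forall>s<n. P (T ^ (m + 2 * s + 1)) (x s) = 0}"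

definition Rset :: "nat \<Rightarrow> nat \<Rightarrow> 'v set" where
  "Rset m n = {\<Sum>s<n. P (T ^ s) (x s) | x. \<forall>s<n. P (T ^ (m + 2 * s)) (x s) = 0}"

section \<open>Recursion and orthogonality for \<open>Dset\<close> and \<open>Rset\<close>\<close>

lemma sum_shift_u: "(\<Sum>s<Suc n. P (T ^ s) (x s)) = x 0 + u (\<Sum>s<n. P (T ^ s) (x (Suc s)))"
  by (simp only: sum.lessThan_Suc_shift power_0 P_1 power_Suc P_mult P_T u_lin)

lemma Dset_Suc: "Dset m (Suc n) = ssum {x. P (T ^ (m + 1)) x = 0} (u ` Dset (m + 2) n)"
proof
  show "Dset m (Suc n) \<subseteq> ssum {x. P (T ^ (m + 1)) x = 0} (u ` Dset (m + 2) n)"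
  proof
    fix y assume "y \<in> Dset m (Suc n)"
    then obtain x where x: "y = (\<Sum>s<Suc n. P (T ^ s) (x s))" "\<forall>s<Suc n. P (T ^ (m + 2 * s + 1)) (x s) = 0"
      by (auto simp: Dset_def)
    have "(\<Sum>s<n. P (T ^ s) (x (Suc s))) \<in> Dset (m + 2) n"
      unfolding Dset_def using x(2) by (intro CollectI exI[of _ "\<lambda>s. x (Suc s)"]) auto
    moreover have "P (T ^ (m + 1)) (x 0) = 0" using x(2)[rule_format, of 0] by simp
    ultimately show "y \<in> ssum {x. P (T ^ (m + 1)) x = 0} (u ` Dset (m + 2) n)"
      unfolding x(1) sum_shift_u by (intro ssumI) auto
  qed
  show "ssum {x. P (T ^ (m + 1)) x = 0} (u ` Dset (m + 2) n) \<subseteq> Dset m (Suc n)"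
  proof
    fix y assume "y \<in> ssum {x. P (T ^ (m + 1)) x = 0} (u ` Dset (m + 2) n)"
    then obtain x0 x where x: "y = x0 + u (\<Sum>s<n. P (T ^ s) (x s))" "P (T ^ (m + 1)) x0 = 0"
      "\<forall>s<n. P (T ^ (m + 2 + 2 * s + 1)) (x s) = 0" by (auto simp: ssum_def Dset_def)
    let ?x = "\<lambda>s. case s of 0 \<Rightarrow> x0 | Suc s \<Rightarrow> x s"
    have "y = (\<Sum>s<Suc n. P (T ^ s) (?x s))" unfolding sum_shift_u using x(1) by simp
    moreover have "\<forall>s<Suc n. P (T ^ (m + 2 * s + 1)) (?x s) = 0" using x(2,3) by (auto split: nat.split)
    ultimately show "y \<in> Dset m (Suc n)" unfolding Dset_def by blast
  qed
qed

lemma Rset_Suc: "Rset m (Suc n) = ssum {x. P (T ^ m) x = 0} (u ` Rset (m + 2) n)"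
proof
  show "Rset m (Suc n) \<subseteq> ssum {x. P (T ^ m) x = 0} (u ` Rset (m + 2) n)"
  proof
    fix y assume "y \<in> Rset m (Suc n)"
    then obtain x where x: "y = (\<Sum>s<Suc n. P (T ^ s) (x s))" "\<forall>s<Suc n. P (T ^ (m + 2 * s)) (x s) = 0"
      by (auto simp: Rset_def)
    have "(\<Sum>s<n. P (T ^ s) (x (Suc s))) \<in> Rset (m + 2) n"
      unfolding Rset_def using x(2) by (intro CollectI exI[of _ "\<lambda>s. x (Suc s)"]) auto
    moreover have "P (T ^ m) (x 0) = 0" using x(2)[rule_format, of 0] by simp
    ultimately show "y \<in> ssum {x. P (T ^ m) x = 0} (u ` Rset (m + 2) n)"
      unfolding x(1) sum_shift_u by (intro ssumI) auto
  qed
  show "ssum {x. P (T ^ m) x = 0} (u ` Rset (m + 2) n) \<subseteq> Rset m (Suc n)"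
  proof
    fix y assume "y \<in> ssum {x. P (T ^ m) x = 0} (u ` Rset (m + 2) n)"
    then obtain x0 x where x: "y = x0 + u (\<Sum>s<n. P (T ^ s) (x s))" "P (T ^ m) x0 = 0"
      "\<forall>s<n. P (T ^ (m + 2 + 2 * s)) (x s) = 0" by (auto simp: ssum_def Rset_def)
    let ?x = "\<lambda>s. case s of 0 \<Rightarrow> x0 | Suc s \<Rightarrow> x s"
    have "y = (\<Sum>s<Suc n. P (T ^ s) (?x s))" unfolding sum_shift_u using x(1) by simp
    moreover have "\<forall>s<Suc n. P (T ^ (m + 2 * s)) (?x s) = 0" using x(2,3) by (auto split: nat.split)
    ultimately show "y \<in> Rset m (Suc n)" unfolding Rset_def by blast
  qed
qed

lemma Dset_0 [simp]: "Dset m 0 = {0}" and Rset_0 [simp]: "Rset m 0 = {0}" by (auto simp: Dset_def Rset_def)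

lemma subspace_Dset: "subspace (Dset m n)"
  by (induct n arbitrary: m) (auto simp: Dset_Suc subspace_single_0 intro!: subspace_ssum subspace_ker_P subspace_image u)

lemma subspace_Rset: "subspace (Rset m n)"
  by (induct n arbitrary: m) (auto simp: Rset_Suc subspace_single_0 intro!: subspace_ssum subspace_ker_P subspace_image u)

lemma Dset_prim: "Dset m n \<subseteq> prim T"
proof (induct n arbitrary: m)
  case 0 then show ?case using subspace_0[OF subspace_prim] by simp
next
  case (Suc n)
  show ?case unfolding Dset_Suc
  proof (rule ssum_subset[OF subspace_prim])
    show "{x. P (T ^ (m + 1)) x = 0} \<subseteq> prim T" using in_prim by blast
    show "u ` Dset (m + 2) n \<subseteq> prim T" using Suc[of "m + 2"] stable_prim unfolding stable_def by blast
  qed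
qed

lemma Rset_Dset: "Rset m n \<subseteq> Dset m n"
proof
  fix y assume "y \<in> Rset m n"
  then obtain x where x: "y = (\<Sum>s<n. P (T ^ s) (x s))" "\<forall>s<n. P (T ^ (m + 2 * s)) (x s) = 0" by (auto simp: Rset_def)
  then have "\<forall>s<n. P (T ^ (m + 2 * s + 1)) (x s) = 0" by (simp add: P_mult u_lin)
  then show "y \<in> Dset m n" unfolding Dset_def using x(1) by blast
qed

lemma Rset_ker: "n \<ge> 1 \<Longrightarrow> P (T ^ m) x = 0 \<Longrightarrow> x \<in> Rset m n"
  using ssum_left[OF subspace_image[OF u subspace_Rset], of "{x. P (T ^ m) x = 0}" "m + 2" "n - 1"]
    Rset_Suc[of m "n - 1"] by auto

lemma cq_T_u: "cq (T ^ m) (u x) (u y) = cq (T ^ (m + 2)) x y"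
proof -
  have "T ^ (m + 2) = T * (T ^ m * T)" by (simp only: power_add power2_eq_square mult_ac)
  then show ?thesis unfolding cq_def by (simp only: b_sa P_mult P_T)
qed

lemma cq_T_ker: "P (T ^ (m + 1)) k = 0 \<Longrightarrow> cq (T ^ m) (u x) k = 0"
  unfolding cq_def using b_sa[of x "P (T ^ m) k"] by (simp add: P_mult u_lin bl)

lemma Dset_Rset_orth: "x \<in> Dset m n \<Longrightarrow> y \<in> Rset m n \<Longrightarrow> cq (T ^ m) y x = 0"
proof (induct n arbitrary: m x y)
  case 0 then show ?case by (simp add: cql)
next
  case (Suc n)
  from Suc(2) obtain k d where x: "x = k + u d" "P (T ^ (m + 1)) k = 0" "d \<in> Dset (m + 2) n"
    unfolding Dset_Suc by (auto simp: ssum_def)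
  from Suc(3) obtain k' r where y: "y = k' + u r" "P (T ^ m) k' = 0" "r \<in> Rset (m + 2) n"
    unfolding Rset_Suc by (auto simp: ssum_def)
  have "cq (T ^ m) k' z = 0" for z using y(2) unfolding cq_comm[of _ k'] by (simp add: cq_def bl)
  moreover have "cq (T ^ m) (u r) (u d) = 0" using Suc(1)[OF x(3) y(3)] by (simp only: cq_T_u)
  ultimately show ?case using cq_T_ker[OF x(2), of r] unfolding x(1) y(1) by (simp add: cql)
qed

text \<open>Induction on \<open>n\<close>, peeling off the first term with
  \<open>kernel_split\<close> and returning from \<open>m + 2\<close> to \<open>m\<close> by
  \<open>u\<close>. The bound on \<open>m + 2 * n\<close> keeps \<open>m\<close> at least
  \<open>dimension\<close> when a single term is left, so that its kernel is all of
  \<open>prim T\<close>.\<close>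

lemma perp_Rset:
  assumes "m + 2 * n \<ge> dimension + 2" "n \<ge> 1"
  shows "perp (cq (T ^ m)) (prim T) (Rset m n) = Dset m n" using assms
proof (induct n arbitrary: m)
  case (Suc n)
  note S = subspace_prim[of T] stable_prim[of T] nondeg_prim[of T]
  have "y \<in> Dset m (Suc n)" if y: "y \<in> perp (cq (T ^ m)) (prim T) (Rset m (Suc n))" for y
  proof (cases "n = 0")
    case True
    have "T ^ (m + 1) = T ^ (m + 1 - dimension) * T ^ dimension" using Suc(2) True by (simp only: power_add[symmetric]) simp
    then have "P (T ^ (m + 1)) y = P (T ^ (m + 1 - dimension)) (P (T ^ dimension) y)" by (metis P_mult)
    then have "y \<in> {x. P (T ^ (m + 1)) x = 0}" using y by (simp add: perp_def prim_def P_linE)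
    then show ?thesis unfolding Dset_Suc by (rule subsetD[OF ssum_left[OF subspace_image[OF u subspace_Dset]]])
  next
    case False
    have IH: "perp (cq (T ^ (m + 2))) (prim T) (Rset (m + 2) n) = Dset (m + 2) n"
      by (rule Suc(1)) (use Suc(2) False in auto)
    have yS: "y \<in> prim T" using y by (simp add: perp_def)
    have uR: "cq (T ^ m) (u r) y = 0" if "r \<in> Rset (m + 2) n" for r
    proof -
      have "u r \<in> Rset m (Suc n)" unfolding Rset_Suc using ssum_right[OF subspace_ker_P] that by blast
      then show ?thesis using y by (simp add: perp_def)
    qed
    obtain k z where kz: "k \<in> prim T" "P (T ^ m * T) k = 0" "z \<in> prim T" "y = k + u z"
    proof (rule kernel_split[OF S yS])
      fix x assume x: "P (T ^ m * (T * T)) x = 0"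
      have "T ^ (m + 2) = T ^ m * (T * T)" by (simp only: power_add power2_eq_square)
      then have "P (T ^ (m + 2)) x = 0" using x by (simp only:)
      then have "x \<in> Rset (m + 2) n" using False by (intro Rset_ker) simp_all
      then have "cq (T ^ m) (u x) y = 0" by (rule uR)
      then show "b (P (T ^ m * T) x) y = 0" by (simp only: cq_def b_P P_mult P_T b_sa P_u)
    qed
    have k: "P (T ^ (m + 1)) k = 0" using kz(2) by (simp only: power_add power_one_right)
    have "z \<in> perp (cq (T ^ (m + 2))) (prim T) (Rset (m + 2) n)" unfolding perp_def
    proof (intro CollectI conjI kz(3) ballI)
      fix r assume "r \<in> Rset (m + 2) n"
      then show "cq (T ^ (m + 2)) r z = 0"
        using uR[of r] cq_T_ker[OF k, of r] unfolding kz(4) cq_T_u[symmetric] by (simp add: cql)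
    qed
    then show ?thesis unfolding Dset_Suc IH kz(4) using k by (intro ssumI) auto
  qed
  moreover have "Dset m (Suc n) \<subseteq> perp (cq (T ^ m)) (prim T) (Rset m (Suc n))"
    using Dset_prim Dset_Rset_orth by (auto simp: perp_def)
  ultimately show ?case by blast
qed simp

section \<open>The nilpotent part: sufficiency\<close>

text \<open>
  A pair \<open>(g, h)\<close> of orthogonal vectors with opposite nonzero values spans a hyperbolic plane.
\<close>

definition hyp :: "('v \<Rightarrow> 'v \<Rightarrow> 'a) \<Rightarrow> ('v \<times> 'v) set \<Rightarrow> bool" where
  "hyp c Q \<longleftrightarrow> finite Q \<and>
     (\<forall>p\<in>Q. c (fst p) (fst p) \<noteq> 0 \<and> c (snd p) (snd p) = - c (fst p) (fst p) \<and> c (fst p) (snd p) = 0) \<and>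
     (\<forall>p\<in>Q. \<forall>q\<in>Q. p \<noteq> q \<longrightarrow> (\<forall>x\<in>{fst p, snd p}. \<forall>y\<in>{fst q, snd q}. c x y = 0))"

definition vecs :: "('v \<times> 'v) set \<Rightarrow> 'v set" where
  "vecs Q = fst ` Q \<union> snd ` Q"

definition ortho :: "('v \<Rightarrow> 'v \<Rightarrow> 'a) \<Rightarrow> 'v set \<Rightarrow> bool" where
  "ortho c N \<longleftrightarrow> finite N \<and> (\<forall>x\<in>N. c x x \<noteq> 0) \<and> (\<forall>x\<in>N. \<forall>y\<in>N. x \<noteq> y \<longrightarrow> c x y = 0)"

lemma finite_vecs: "hyp c Q \<Longrightarrow> finite (vecs Q)" by (simp add: hyp_def vecs_def)

lemma vecs_nonzero: "hyp c Q \<Longrightarrow> x \<in> vecs Q \<Longrightarrow> c x x \<noteq> 0" by (auto simp: hyp_def vecs_def)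

lemma hyp_ortho:
  assumes Q: "hyp c Q" and s: "symmetric_form c"
  shows "ortho c (vecs Q)" unfolding ortho_def
proof (intro conjI ballI impI)
  show "finite (vecs Q)" using finite_vecs[OF Q] .
  show "c x x \<noteq> 0" if "x \<in> vecs Q" for x using vecs_nonzero[OF Q that] .
  fix x y assume "x \<in> vecs Q" "y \<in> vecs Q" and xy: "x \<noteq> y"
  then obtain p q where p: "p \<in> Q" "x \<in> {fst p, snd p}" and q: "q \<in> Q" "y \<in> {fst q, snd q}"
    unfolding vecs_def by blast
  show "c x y = 0"
  proof (cases "p = q")
    case True
    have "c (fst p) (snd p) = 0" "c (snd p) (fst p) = 0" using Q p(1) s unfolding hyp_def symmetric_form_def by metis+
    then show ?thesis using True p q xy by auto
  next
    case False then show ?thesis using Q p q unfolding hyp_def by blast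
  qed
qed

lemma ortho_Un:
  assumes "ortho c A" "ortho c B" "\<And>x y. x \<in> A \<Longrightarrow> y \<in> B \<Longrightarrow> c x y = 0" "symmetric_form c"
  shows "ortho c (A \<union> B)" using assms unfolding ortho_def symmetric_form_def by (metis Un_iff finite_Un)

lemma hyp_Un:
  assumes "hyp c A" "hyp c B" "\<And>x y. x \<in> vecs A \<Longrightarrow> y \<in> vecs B \<Longrightarrow> c x y = 0" "symmetric_form c"
  shows "hyp c (A \<union> B)" unfolding hyp_def
proof (intro conjI ballI impI)
  show "finite (A \<union> B)" using assms by (simp add: hyp_def)
next
  fix p assume "p \<in> A \<union> B"
  then show "c (fst p) (fst p) \<noteq> 0" "c (snd p) (snd p) = - c (fst p) (fst p)" "c (fst p) (snd p) = 0"
    using assms(1,2) by (auto simp: hyp_def)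
next
  fix p q x y assume pq: "p \<in> A \<union> B" "q \<in> A \<union> B" "p \<noteq> q" and xy: "x \<in> {fst p, snd p}" "y \<in> {fst q, snd q}"
  consider "p \<in> A" "q \<in> A" | "p \<in> B" "q \<in> B" | "p \<in> A" "q \<in> B" | "p \<in> B" "q \<in> A" using pq by blast
  then show "c x y = 0"
  proof cases
    case 1 then show ?thesis using assms(1) pq(3) xy unfolding hyp_def by blast
  next
    case 2 then show ?thesis using assms(2) pq(3) xy unfolding hyp_def by blast
  next
    case 3
    then have "x \<in> vecs A" "y \<in> vecs B" using xy by (auto simp: vecs_def)
    then show ?thesis by (rule assms(3))
  next
    case 4
    then have "x \<in> vecs B" "y \<in> vecs A" using xy by (auto simp: vecs_def)
    then have "c y x = 0" by (intro assms(3))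
    then show ?thesis using assms(4) by (simp add: symmetric_form_def)
  qed
qed

lemma vecs_Un: "vecs (A \<union> B) = vecs A \<union> vecs B" by (auto simp: vecs_def)

lemma ortho_expand:
  assumes c: "bilinear_form scale c" and N: "ortho c N" and w: "w \<in> span N"
  shows "w = (\<Sum>x\<in>N. (c x w / c x x) *s x)"
proof -
  have fin: "finite N" using N by (simp add: ortho_def)
  obtain a where a: "w = (\<Sum>x\<in>N. a x *s x)" using w span_finite[OF fin] by auto
  have "a x = c x w / c x x" if x: "x \<in> N" for x
  proof -
    have "c x w = (\<Sum>y\<in>N. a y * c x y)" unfolding a by (simp add: bil_sum_right[OF c] bil[OF c])
    also have "\<dots> = (\<Sum>y\<in>{x}. a y * c x y)" by (rule sum.mono_neutral_right) (use N x fin in \<open>auto simp: ortho_def\<close>)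
    finally show ?thesis using N x by (simp add: ortho_def)
  qed
  then show ?thesis unfolding a by (intro sum.cong) auto
qed

definition aniso :: "('v \<Rightarrow> 'v \<Rightarrow> 'a) \<Rightarrow> 'v set \<Rightarrow> bool" where
  "aniso c W \<longleftrightarrow> (\<forall>w\<in>W. c w w = 0 \<longrightarrow> w = 0)"

text \<open>Induction on the dimension. An isotropic vector outside the radical gives a hyperbolic
  plane that splits off. If there is none, any vector of nonzero value splits off, and no isotropic
  vector outside the radical can appear in what is left.\<close>

lemma witt_decomposition:
  assumes c: "bilinear_form scale c" and s: "symmetric_form c" and A: "subspace A"
  shows "\<exists>Q N. hyp c Q \<and> vecs Q \<subseteq> A \<and> ortho c N \<and> N \<subseteq> A \<and> (\<forall>x\<in>vecs Q. \<forall>y\<in>N. c x y = 0) \<and>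
    aniso c (span N) \<and> A \<subseteq> ssum (span (vecs Q \<union> N)) (perp c A A)" using A
proof (induct "dim A" arbitrary: A rule: less_induct)
  case less
  note A = less(2) and bc = bil[OF c]
  have sy: "c x y = c y x" for x y using s by (simp add: symmetric_form_def)
  have shrink: "dim A' < dim A" if "subspace A'" "A' \<subseteq> A" "x \<in> A" "x \<notin> A'" for A' x
  proof -
    have "span A' \<subset> span A" using that A span_eq_iff by (metis psubsetI)
    then show ?thesis by (rule dim_psubset)
  qed
  show ?case
  proof (cases "\<exists>x\<in>A. c x x = 0 \<and> x \<notin> perp c A A")
    case True
    then obtain x z where x: "x \<in> A" "c x x = 0" "z \<in> A" "c z x \<noteq> 0" unfolding perp_def by blast
    define y0 where "y0 = (1 / c z x) *s z"
    have y0: "y0 \<in> A" "c x y0 = 1" "c y0 x = 1" using x A sy[of x z] by (auto simp: y0_def bc subspace_scale)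
    define y where "y = y0 - (c y0 y0 / 2) *s x"
    have half: "a / 2 + a / 2 = a" for a :: 'a using two by (simp add: add_divide_distrib[symmetric])
    have y: "y \<in> A" "c x y = 1" "c y x = 1" using x y0 A by (auto simp: y_def bc subspace_diff subspace_scale)
    have "c y y = c y0 y0 - (c y0 y0 / 2 + c y0 y0 / 2)" unfolding y_def using x y0 by (simp add: bc)
    then have yy: "c y y = 0" by (simp only: half diff_self)
    \<comment> \<open>Turns the hyperbolic pair \<open>x\<close>, \<open>y\<close> into orthogonal
      vectors of values 1 and -1.\<close>
    define g where "g = x + (1/2) *s y"
    define h where "h = x - (1/2) *s y"
    have gh: "g \<in> A" "h \<in> A" using x y A by (auto simp: g_def h_def subspace_add subspace_diff subspace_scale)
    have h1: "1 / 2 + 1 / 2 = (1::'a)" by (rule half)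
    have cgg: "c g g = 1" "c h h = - 1" "c g h = 0" "c h g = 0" using x y yy h1 by (simp_all add: g_def h_def bc)
    define A' where "A' = {a \<in> A. c g a = 0 \<and> c h a = 0}"
    have A': "subspace A'" unfolding A'_def
      by (rule subspaceI) (use A in \<open>auto simp: bc subspace_0 subspace_add subspace_scale\<close>)
    have A'A: "A' \<subseteq> A" by (auto simp: A'_def)
    have "dim A' < dim A" by (rule shrink[OF A' A'A gh(1)]) (auto simp: A'_def cgg)
    then obtain Q N where QN: "hyp c Q" "vecs Q \<subseteq> A'" "ortho c N" "N \<subseteq> A'" "\<forall>x\<in>vecs Q. \<forall>y\<in>N. c x y = 0"
      "aniso c (span N)" "A' \<subseteq> ssum (span (vecs Q \<union> N)) (perp c A' A')" using less(1)[OF _ A'] by blast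
    have gA': "c g a = 0" "c h a = 0" if "a \<in> A'" for a using that by (auto simp: A'_def)
    let ?Q = "{(g, h)} \<union> Q"
    have hQ: "hyp c ?Q"
    proof (rule hyp_Un[OF _ QN(1) _ s])
      show "hyp c {(g, h)}" by (simp add: hyp_def cgg)
      show "c x y = 0" if "x \<in> vecs {(g, h)}" "y \<in> vecs Q" for x y using that QN(2) gA' by (auto simp: vecs_def)
    qed
    have vQ: "vecs ?Q = {g, h} \<union> vecs Q" by (auto simp: vecs_def)
    have dec: "\<exists>a'\<in>A'. a = (c g a *s g - c h a *s h) + a'" if "a \<in> A" for a
    proof -
      let ?a = "a - (c g a *s g - c h a *s h)"
      have "?a \<in> A" using that gh A by (simp add: subspace_diff subspace_scale)
      moreover have "c g ?a = 0" "c h ?a = 0" by (simp_all add: bc cgg)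
      ultimately show ?thesis by (intro bexI[of _ ?a]) (auto simp: A'_def)
    qed
    have rad: "perp c A' A' \<subseteq> perp c A A"
    proof
      fix r assume r: "r \<in> perp c A' A'"
      have rA': "r \<in> A'" using r by (simp add: perp_def)
      have "c a r = 0" if a: "a \<in> A" for a
      proof -
        obtain a' where a': "a' \<in> A'" "a = (c g a *s g - c h a *s h) + a'" using dec[OF a] by blast
        have "c ((c g a *s g - c h a *s h) + a') r = 0" using r a'(1) gA'[OF rA'] by (simp add: bc perp_def)
        then show ?thesis using a'(2) by simp
      qed
      then show "r \<in> perp c A A" using rA' A'A by (auto simp: perp_def)
    qed
    have "A \<subseteq> ssum (span (vecs ?Q \<union> N)) (perp c A A)"
    proof
      fix a assume "a \<in> A"
      then obtain a' where a': "a' \<in> A'" "a = (c g a *s g - c h a *s h) + a'" using dec by blast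
      from a'(1) QN(7) obtain t r where tr: "a' = t + r" "t \<in> span (vecs Q \<union> N)" "r \<in> perp c A' A'"
        unfolding ssum_def by blast
      have "t \<in> span (vecs ?Q \<union> N)" using tr(2) span_mono[of "vecs Q \<union> N" "vecs ?Q \<union> N"] vQ by blast
      moreover have "g \<in> span (vecs ?Q \<union> N)" "h \<in> span (vecs ?Q \<union> N)" using vQ by (auto intro: span_base)
      ultimately have "(c g a *s g - c h a *s h) + t \<in> span (vecs ?Q \<union> N)" by (intro span_add span_diff span_scale)
      then have "((c g a *s g - c h a *s h) + t) + r \<in> ssum (span (vecs ?Q \<union> N)) (perp c A A)"
        using tr(3) rad by (intro ssumI) auto
      moreover have "((c g a *s g - c h a *s h) + t) + r = a" using a'(2) tr(1) by (simp add: add.assoc)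
      ultimately show "a \<in> ssum (span (vecs ?Q \<union> N)) (perp c A A)" by simp
    qed
    moreover have "vecs ?Q \<subseteq> A" using vQ gh QN(2) A'A by auto
    moreover have "\<forall>x\<in>vecs ?Q. \<forall>y\<in>N. c x y = 0" using QN(4,5) gA' unfolding vQ by auto
    ultimately show ?thesis using hQ QN(3,4,6) A'A by (intro exI[of _ ?Q] exI[of _ N]) blast
  next
    case False
    then have an: "x \<in> perp c A A" if "x \<in> A" "c x x = 0" for x using that by blast
    show ?thesis
    proof (cases "A \<subseteq> perp c A A")
      case True
      have "A \<subseteq> ssum (span (vecs {} \<union> {})) (perp c A A)" using True by (auto simp: ssum_def vecs_def)
      then show ?thesis by (intro exI[of _ "{}"]) (auto simp: hyp_def vecs_def ortho_def aniso_def)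
    next
      case False
      then obtain x where x: "x \<in> A" "c x x \<noteq> 0" using an by blast
      define A' where "A' = {a \<in> A. c x a = 0}"
      have A': "subspace A'" unfolding A'_def
        by (rule subspaceI) (use A in \<open>auto simp: bc subspace_0 subspace_add subspace_scale\<close>)
      have A'A: "A' \<subseteq> A" by (auto simp: A'_def)
      have "dim A' < dim A" by (rule shrink[OF A' A'A x(1)]) (auto simp: A'_def x)
      then obtain Q N where QN: "hyp c Q" "vecs Q \<subseteq> A'" "ortho c N" "N \<subseteq> A'" "\<forall>x\<in>vecs Q. \<forall>y\<in>N. c x y = 0"
        "aniso c (span N)" "A' \<subseteq> ssum (span (vecs Q \<union> N)) (perp c A' A')" using less(1)[OF _ A'] by blast
      \<comment> \<open>The sum of the two vectors of a pair would be isotropic and outside the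
        radical, which this case excludes.\<close>
      have "Q = {}"
      proof (rule ccontr)
        assume "Q \<noteq> {}"
        then obtain p where p: "p \<in> Q" by blast
        let ?g = "fst p" and ?h = "snd p"
        have cp: "c ?g ?g \<noteq> 0" "c ?h ?h = - c ?g ?g" "c ?g ?h = 0" "c ?h ?g = 0" using QN(1) p sy[of ?h ?g]
          by (auto simp: hyp_def)
        have gA: "?g \<in> A" "?h \<in> A" using p QN(2) A'A by (auto simp: vecs_def)
        have "c (?g + ?h) (?g + ?h) = 0" using cp by (simp add: bc)
        then have "?g + ?h \<in> perp c A A" using an[of "?g + ?h"] gA A by (simp add: subspace_add)
        then have "c ?g (?g + ?h) = 0" using gA by (simp add: perp_def)
        then show False using cp by (simp add: bc)
      qed
      have xA': "c x a = 0" if "a \<in> A'" for a using that by (auto simp: A'_def)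
      have oN: "ortho c ({x} \<union> N)" by (rule ortho_Un[OF _ QN(3) _ s]) (use x QN(4) xA' in \<open>auto simp: ortho_def\<close>)
      have dec: "\<exists>a'\<in>A'. a = (c x a / c x x) *s x + a'" if "a \<in> A" for a
      proof -
        let ?a = "a - (c x a / c x x) *s x"
        have "?a \<in> A" using that x A by (simp add: subspace_diff subspace_scale)
        moreover have "c x ?a = 0" using x by (simp add: bc)
        ultimately show ?thesis by (intro bexI[of _ ?a]) (auto simp: A'_def)
      qed
      have rad: "perp c A' A' \<subseteq> perp c A A"
      proof
        fix r assume r: "r \<in> perp c A' A'"
        have rA': "r \<in> A'" using r by (simp add: perp_def)
        have "c a r = 0" if a: "a \<in> A" for a
        proof -
          obtain a' where a': "a' \<in> A'" "a = (c x a / c x x) *s x + a'" using dec[OF a] by blast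
          have "c ((c x a / c x x) *s x + a') r = 0" using r a'(1) xA'[OF rA'] by (simp add: bc perp_def)
          then show ?thesis using a'(2) by simp
        qed
        then show "r \<in> perp c A A" using rA' A'A by (auto simp: perp_def)
      qed
      have NA: "{x} \<union> N \<subseteq> A" using x QN(4) A'A by blast
      have "A \<subseteq> ssum (span (vecs {} \<union> ({x} \<union> N))) (perp c A A)"
      proof
        fix a assume "a \<in> A"
        then obtain a' where a': "a' \<in> A'" "a = (c x a / c x x) *s x + a'" using dec by blast
        from a'(1) QN(7) obtain t r where tr: "a' = t + r" "t \<in> span N" "r \<in> perp c A' A'"
          unfolding ssum_def \<open>Q = {}\<close> vecs_def by auto
        let ?E = "vecs {} \<union> ({x} \<union> N)"
        have "t \<in> span ?E" using tr(2) span_mono[of N ?E] by (auto simp: vecs_def)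
        moreover have "x \<in> span ?E" by (auto intro: span_base)
        ultimately have "(c x a / c x x) *s x + t \<in> span ?E" by (intro span_add span_scale)
        then have "((c x a / c x x) *s x + t) + r \<in> ssum (span ?E) (perp c A A)" using tr(3) rad by (intro ssumI) auto
        moreover have "((c x a / c x x) *s x + t) + r = a" using a'(2) tr(1) by (simp add: add.assoc)
        ultimately show "a \<in> ssum (span ?E) (perp c A A)" by simp
      qed
      moreover have "aniso c (span ({x} \<union> N))" unfolding aniso_def
      proof (intro ballI impI)
        fix w assume w: "w \<in> span ({x} \<union> N)" "c w w = 0"
        have "w \<in> A" using w(1) span_minimal[OF NA A] by blast
        then have "w \<in> perp c A A" using w(2) an by blast
        then have "c y w = 0" if "y \<in> {x} \<union> N" for y using that NA by (auto simp: perp_def)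
        then show "w = 0" using ortho_expand[OF c oN w(1)] by simp
      qed
      moreover have "hyp c {}" by (simp add: hyp_def)
      ultimately show ?thesis using oN NA by (intro exI[of _ "{}"] exI[of _ "{x} \<union> N"]) (auto simp: vecs_def)
    qed
  qed
qed

text \<open>A Witt decomposition, in representatives, of the orthogonal sum of the first
  \<open>n\<close> invariants V_{t,m+2s+1}, which is \<open>Dset m n\<close> modulo
  \<open>Rset m n\<close>: pairs \<open>Q\<close> for the hyperbolic part, \<open>N\<close> for the
  anisotropic one.\<close>

definition witt_split :: "nat \<Rightarrow> nat \<Rightarrow> 'v set \<Rightarrow> ('v \<times> 'v) set \<Rightarrow> bool" where
  "witt_split m n N Q \<longleftrightarrow> hyp (cq (T ^ m)) Q \<and> vecs Q \<subseteq> Dset m n \<and> ortho (cq (T ^ m)) N \<and> N \<subseteq> Dset m n \<and>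
     (\<forall>x\<in>vecs Q. \<forall>y\<in>N. cq (T ^ m) x y = 0) \<and> aniso (cq (T ^ m)) (span N) \<and>
     Dset m n \<subseteq> ssum (span (vecs Q \<union> N)) (Rset m n)"

text \<open>Condition (iii) of the theorem, in terms of subspaces of \<open>V\<close>.\<close>

definition witt_condition :: bool where
  "witt_condition \<longleftrightarrow> (\<forall>k n N Q. 2 * k + 2 * n \<ge> dimension \<longrightarrow> n \<ge> 1 \<longrightarrow> witt_split (2 * k + 2) n N Q \<longrightarrow>
     (\<exists>f. lin f \<and> (\<forall>w\<in>span N. P (T ^ (2 * k + 1)) (f w) = 0) \<and>
        (\<forall>w\<in>span N. \<forall>w'\<in>span N. cq (T ^ (2 * k)) (f w) (f w') = - cq (T ^ (2 * k + 2)) w w')))"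

text \<open>The residue field of \<open>T\<close> is the base field, so on the socle a polynomial
  acts by its constant coefficient.\<close>

lemma socle_const:
  assumes "P (T ^ k) x = 0" "k \<ge> 1"
  shows "P (T ^ (k - 1) * h) x = coeff h 0 *s P (T ^ (k - 1)) x"
proof -
  obtain a h' where h: "h = pCons a h'" by (cases h) auto
  have "h = [:a:] + T * h'" unfolding h by (simp add: mult_pCons_left)
  then have "T ^ (k - 1) * h = [:a:] * T ^ (k - 1) + h' * (T * T ^ (k - 1))" by (simp add: algebra_simps)
  also have "T * T ^ (k - 1) = T ^ k" using assms(2) by (simp add: power_eq_if)
  finally show ?thesis using assms(1) h by (simp only: P_add P_mult P_const P_linE) simp
qed

lemma coeff_neg_arg_0: "coeff (neg_arg h) 0 = coeff h 0"
  by (simp add: neg_arg_def poly_0_coeff_0[symmetric] poly_pcompose)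

lemma neg_arg_T_power: "neg_arg (T ^ k) = (if even k then T ^ k else - (T ^ k))"
  by (simp only: neg_arg_simps uminus_power_if)

lemma irreducible_T: "irreducible T" by (rule irreducible_linear_field_poly) simp

lemma obasis_T_I:
  assumes k: "k \<ge> 1" and E: "ortho (cq (T ^ (k - 1))) E" "\<And>e. e \<in> E \<Longrightarrow> P (T ^ k) e = 0"
    and sp: "\<And>y. P (T ^ k) y = 0 \<Longrightarrow> y \<in> ssum (span E) (Nk UNIV T k)"
  shows "obasis T k E" unfolding obasis_def
proof (intro conjI ballI impI allI)
  show fin: "finite E" using E by (simp add: ortho_def)
  show "P (T ^ k) e = 0" if "e \<in> E" for e by (rule E(2)[OF that])
  show "\<exists>q. b e (P (T ^ (k - 1) * q) e) \<noteq> 0" if "e \<in> E" for e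
    using E(1) that by (intro exI[of _ 1]) (simp add: ortho_def cq_def)
  show "b e (P (T ^ (k - 1) * q) e') = 0" if "e \<in> E" "e' \<in> E" "e \<noteq> e'" for e e' q
    using E(1) that unfolding socle_const[OF E(2)[OF that(2)] k] by (simp add: ortho_def cq_def bl)
  fix y assume "P (T ^ k) y = 0"
  then obtain t r where tr: "y = t + r" "t \<in> span E" "r \<in> Nk UNIV T k" using sp unfolding ssum_def by blast
  obtain a where a: "t = (\<Sum>e\<in>E. a e *s e)" using tr(2) span_finite[OF fin] by auto
  have "y - (\<Sum>e\<in>E. P [:a e:] e) = r" using tr(1) a by simp
  then show "\<exists>c. y - (\<Sum>e\<in>E. P (c e) e) \<in> Nk UNIV T k" using tr(3) by (intro exI[of _ "\<lambda>e. [:a e:]"]) simp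
qed

text \<open>\<open>N'\<close> is what the level above left over; \<open>f\<close> matches it with
  vectors of opposite value in \<open>M\<close>. The rest of the basis splits into the pairs
  \<open>Q\<close> and the vectors \<open>N\<close> passed on to the level below.\<close>

definition level :: "nat \<Rightarrow> ('v \<times> 'v) set \<Rightarrow> 'v set \<Rightarrow> 'v set \<Rightarrow> 'v set \<Rightarrow> ('v \<Rightarrow> 'v) \<Rightarrow> bool" where
  "level j Q M N N' f \<longleftrightarrow> obasis T (2 * j + 1) (vecs Q \<union> M \<union> N) \<and> hyp (cq (T ^ (2 * j))) Q \<and>
     vecs Q \<inter> M = {} \<and> vecs Q \<inter> N = {} \<and> M \<inter> N = {} \<and> bij_betw f N' M \<and>
     (\<forall>x\<in>N'. cq (T ^ (2 * j)) (f x) (f x) = - cq (T ^ (2 * j + 2)) x x)"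

lemma rad_ker:
  assumes k: "k \<ge> 1"
  shows "perp (cq (T ^ (k - 1))) {y. P (T ^ k) y = 0} {y. P (T ^ k) y = 0} \<subseteq> Nk UNIV T k"
proof
  fix y assume y: "y \<in> perp (cq (T ^ (k - 1))) {y. P (T ^ k) y = 0} {y. P (T ^ k) y = 0}"
  show "y \<in> Nk UNIV T k"
  proof (rule Nk_nondeg[OF _ k])
    show "P (T ^ k) y = 0" using y by (simp add: perp_def)
    fix z assume "P (T ^ k) z = 0"
    then have "cq (T ^ (k - 1)) z y = 0" using y by (simp add: perp_def)
    then show "b y (P (T ^ (k - 1)) z) = 0" using cq_comm by (simp add: cq_def)
  qed
qed

text \<open>The map of \<open>witt_condition\<close> places the anisotropic part of the higher
  levels, with opposite sign, in V_{t,2k+1}; its image gives \<open>M\<close>, and the orthogonal of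
  \<open>M\<close> is Witt-decomposed into \<open>Q\<close> and \<open>N\<close>. In the sum that
  includes level 2k+1, each \<open>x\<close> of \<open>N'\<close> forms a pair with
  \<open>f x\<close>, so \<open>N\<close> is again the whole anisotropic part.\<close>

lemma level_step:
  assumes witt_condition: witt_condition and n: "2 * k + 2 * n \<ge> dimension" "n \<ge> 1" and t: "witt_split (2 * k + 2) n N' Q'"
  shows "\<exists>Q M N f Q''. level k Q M N N' f \<and> witt_split (2 * k) (Suc n) N Q''"
proof -
  let ?c = "cq (T ^ (2 * k))" and ?d = "cq (T ^ (2 * k + 2))"
  note cs = cq_sym[of "T ^ (2 * k)"] and cb = cq_bil[of "T ^ (2 * k)"]
  have cc: "?c x y = ?c y x" "?d x y = ?d y x" for x y by (rule cq_comm)+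
  from t have t: "hyp ?d Q'" "vecs Q' \<subseteq> Dset (2 * k + 2) n" "ortho ?d N'" "N' \<subseteq> Dset (2 * k + 2) n"
     "\<forall>x\<in>vecs Q'. \<forall>y\<in>N'. ?d x y = 0" "aniso ?d (span N')"
     "Dset (2 * k + 2) n \<subseteq> ssum (span (vecs Q' \<union> N')) (Rset (2 * k + 2) n)" by (auto simp: witt_split_def)
  obtain f where f: "lin f" "\<And>w. w \<in> span N' \<Longrightarrow> P (T ^ (2 * k + 1)) (f w) = 0"
    "\<And>w w'. w \<in> span N' \<Longrightarrow> w' \<in> span N' \<Longrightarrow> ?c (f w) (f w') = - ?d w w'"
    using witt_condition[unfolded witt_condition_def, rule_format, OF n assms(4)] by blast
  have fN: "?c (f x) (f y) = - ?d x y" if "x \<in> N'" "y \<in> N'" for x y using f(3) that span_base by blast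
  have finj: "inj_on f N'"
  proof (rule inj_onI)
    fix x y assume xy: "x \<in> N'" "y \<in> N'" "f x = f y"
    show "x = y"
    proof (rule ccontr)
      assume "x \<noteq> y"
      then have "?d x y = 0" using t(3) xy by (simp add: ortho_def)
      then have "?c (f x) (f x) = 0" using fN[OF xy(1,2)] xy(3) by simp
      then show False using fN[OF xy(1,1)] t(3) xy(1) by (simp add: ortho_def)
    qed
  qed
  define M where "M = f ` N'"
  have oM: "ortho ?c M" using t(3) unfolding ortho_def M_def by (auto simp: fN)
  define A where "A = {y. P (T ^ (2 * k + 1)) y = 0}"
  have A: "subspace A" unfolding A_def by (rule subspace_ker_P)
  have MA: "M \<subseteq> A" unfolding M_def A_def using f(2) span_base by blast
  define A' where "A' = perp ?c A M"
  have A': "subspace A'" unfolding A'_def by (rule subspace_perp[OF cb A])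
  have A'A: "A' \<subseteq> A" by (auto simp: A'_def perp_def)
  obtain Q N where QN: "hyp ?c Q" "vecs Q \<subseteq> A'" "ortho ?c N" "N \<subseteq> A'" "\<forall>x\<in>vecs Q. \<forall>y\<in>N. ?c x y = 0"
    "aniso ?c (span N)" "A' \<subseteq> ssum (span (vecs Q \<union> N)) (perp ?c A' A')" using witt_decomposition[OF cb cs A'] by blast
  have MA': "?c x y = 0" if "x \<in> M" "y \<in> A'" for x y using that by (simp add: A'_def perp_def)
  have dec: "\<exists>s\<in>span M. \<exists>a'\<in>A'. a = s + a'" if a: "a \<in> A" for a
  proof -
    let ?s = "\<Sum>x\<in>M. (?c x a / ?c x x) *s x"
    have s: "?s \<in> span M" by (intro span_sum span_scale span_base)
    have sA: "?s \<in> A" using s span_minimal[OF MA A] by blast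
    have "?c x (a - ?s) = 0" if x: "x \<in> M" for x
    proof -
      have fin: "finite M" using oM by (simp add: ortho_def)
      have "?c x ?s = (\<Sum>y\<in>M. (?c y a / ?c y y) * ?c x y)" by (simp add: bil_sum_right[OF cb] cql)
      also have "\<dots> = (\<Sum>y\<in>{x}. (?c y a / ?c y y) * ?c x y)"
        by (rule sum.mono_neutral_right) (use oM x fin in \<open>auto simp: ortho_def\<close>)
      also have "\<dots> = ?c x a" using oM x by (simp add: ortho_def)
      finally show ?thesis by (simp add: cql)
    qed
    then have "a - ?s \<in> A'" using a sA subspace_diff[OF A] by (auto simp: A'_def perp_def)
    then show ?thesis using s by (intro bexI[of _ ?s] bexI[of _ "a - ?s"]) auto
  qed
  have rad: "perp ?c A' A' \<subseteq> Nk UNIV T (2 * k + 1)"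
  proof -
    have "perp ?c A' A' \<subseteq> perp ?c A A"
    proof
      fix r assume r: "r \<in> perp ?c A' A'"
      then have rA': "r \<in> A'" by (simp add: perp_def)
      have "r \<in> perp ?c UNIV M" using rA' by (auto simp: A'_def perp_def)
      then have rM: "?c s r = 0" if "s \<in> span M" for s using that perp_span[OF cb, of UNIV M] by (auto simp: perp_def)
      have "?c a r = 0" if "a \<in> A" for a using dec[OF that] rM r by (auto simp: cql perp_def)
      then show "r \<in> perp ?c A A" using rA' A'A by (auto simp: perp_def)
    qed
    also have "\<dots> \<subseteq> Nk UNIV T (2 * k + 1)" using rad_ker[of "2 * k + 1"] unfolding A_def by simp
    finally show ?thesis .
  qed
  let ?E = "vecs Q \<union> M \<union> N"
  have oE: "ortho ?c ?E"
  proof (rule ortho_Un[OF ortho_Un[OF hyp_ortho[OF QN(1) cs] oM] QN(3) _ cs])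
    show "?c x y = 0" if "x \<in> vecs Q" "y \<in> M" for x y using MA'[OF that(2)] that(1) QN(2) cc(1) by (metis subsetD)
    show "?c x y = 0" if "x \<in> vecs Q \<union> M" "y \<in> N" for x y using that MA' QN(4,5) by blast
  qed (rule cs)
  have EA: "?E \<subseteq> A" using QN(2,4) A'A MA by blast
  have spA: "A \<subseteq> ssum (span ?E) (Nk UNIV T (2 * k + 1))"
  proof
    fix a assume "a \<in> A"
    then obtain s a' where sa: "s \<in> span M" "a' \<in> A'" "a = s + a'" using dec by blast
    from sa(2) QN(7) obtain t r where tr: "a' = t + r" "t \<in> span (vecs Q \<union> N)" "r \<in> perp ?c A' A'"
      unfolding ssum_def by blast
    have "s \<in> span ?E" "t \<in> span ?E" using sa(1) tr(2) span_mono[of M ?E] span_mono[of "vecs Q \<union> N" ?E] by blast+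
    then have "(s + t) + r \<in> ssum (span ?E) (Nk UNIV T (2 * k + 1))" using rad tr(3) by (intro ssumI span_add) auto
    then show "a \<in> ssum (span ?E) (Nk UNIV T (2 * k + 1))" using sa(3) tr(1) by (simp add: add.assoc)
  qed
  have disj: "X \<inter> Y = {}" if "ortho ?c X" "\<And>x y. x \<in> X \<Longrightarrow> y \<in> Y \<Longrightarrow> ?c x y = 0" for X Y
    using that unfolding ortho_def by blast
  have lev: "level k Q M N N' f" unfolding level_def
  proof (intro conjI)
    show "obasis T (2 * k + 1) ?E" by (rule obasis_T_I) (use oE EA spA in \<open>auto simp: A_def\<close>)
    show "hyp ?c Q" by fact
    show "vecs Q \<inter> M = {}" using disj[OF oM, of "vecs Q"] MA' QN(2) by blast
    show "vecs Q \<inter> N = {}" by (rule disj[OF hyp_ortho[OF QN(1) cs]]) (use QN(5) in blast)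
    show "M \<inter> N = {}" by (rule disj[OF oM]) (use MA' QN(4) in blast)
    show "bij_betw f N' M" using finj by (simp add: M_def bij_betw_def)
    show "\<forall>x\<in>N'. ?c (f x) (f x) = - ?d x x" using fN by blast
  qed
  \<comment> \<open>Pairs of the higher levels are carried down by \<open>u\<close>; the new pairs
    \<open>QM\<close> cancel the old anisotropic part against its image.\<close>
  define Qu where "Qu = (\<lambda>p. (u (fst p), u (snd p))) ` Q'"
  define QM where "QM = (\<lambda>x. (u x, f x)) ` N'"
  have cu: "?c (u x) (u y) = ?d x y" for x y by (rule cq_T_u)
  have cA: "?c (u x) a = 0" "?c a (u x) = 0" if "a \<in> A" for x a
    using cq_T_ker[of "2 * k" a x] that cc(1) by (auto simp: A_def)
  have vQu: "vecs Qu = u ` vecs Q'" by (auto simp: Qu_def vecs_def image_Un image_image)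
  have vQM: "vecs QM = u ` N' \<union> M" by (simp add: QM_def vecs_def M_def image_image)
  have h1: "hyp ?c Qu" unfolding hyp_def
  proof (intro conjI ballI impI)
    show "finite Qu" using t(1) by (simp add: Qu_def hyp_def)
    fix p assume "p \<in> Qu"
    then obtain p0 where p0: "p0 \<in> Q'" "p = (u (fst p0), u (snd p0))" by (auto simp: Qu_def)
    then show "?c (fst p) (fst p) \<noteq> 0" "?c (snd p) (snd p) = - ?c (fst p) (fst p)" "?c (fst p) (snd p) = 0"
      using t(1) by (auto simp: hyp_def cu)
    fix q x y assume q: "q \<in> Qu" "p \<noteq> q" and xy: "x \<in> {fst p, snd p}" "y \<in> {fst q, snd q}"
    then obtain q0 where q0: "q0 \<in> Q'" "q = (u (fst q0), u (snd q0))" by (auto simp: Qu_def)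
    have "p0 \<noteq> q0" using q(2) p0 q0 by auto
    then have "\<forall>x\<in>{fst p0, snd p0}. \<forall>y\<in>{fst q0, snd q0}. ?d x y = 0" using t(1) p0(1) q0(1) unfolding hyp_def by blast
    then show "?c x y = 0" using xy p0(2) q0(2) by (auto simp: cu)
  qed
  have h2: "hyp ?c QM" unfolding hyp_def
  proof (intro conjI ballI impI)
    show "finite QM" using t(3) by (simp add: QM_def ortho_def)
    fix p assume "p \<in> QM"
    then obtain p0 where p0: "p0 \<in> N'" "p = (u p0, f p0)" by (auto simp: QM_def)
    have fA: "f p0 \<in> A" using p0(1) MA by (auto simp: M_def)
    show "?c (fst p) (fst p) \<noteq> 0" "?c (snd p) (snd p) = - ?c (fst p) (fst p)" "?c (fst p) (snd p) = 0"
      using t(3) p0 fN cA[OF fA] by (auto simp: ortho_def cu)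
    fix q x y assume q: "q \<in> QM" "p \<noteq> q" and xy: "x \<in> {fst p, snd p}" "y \<in> {fst q, snd q}"
    then obtain q0 where q0: "q0 \<in> N'" "q = (u q0, f q0)" by (auto simp: QM_def)
    have fA': "f q0 \<in> A" using q0(1) MA by (auto simp: M_def)
    have "p0 \<noteq> q0" using q(2) p0 q0 by auto
    then have "?d p0 q0 = 0" using t(3) p0(1) q0(1) unfolding ortho_def by blast
    then show "?c x y = 0" using xy p0 q0 fN[OF p0(1) q0(1)] cA[OF fA] cA[OF fA'] by (auto simp: cu)
  qed
  let ?Q = "Qu \<union> QM \<union> Q"
  have hQ: "hyp ?c ?Q"
  proof (rule hyp_Un[OF hyp_Un[OF h1 h2 _ cs] QN(1) _ cs])
    show "?c x y = 0" if "x \<in> vecs Qu" "y \<in> vecs QM" for x y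
      using that t(5) cA MA unfolding vQu vQM by (auto simp: cu)
    show "?c x y = 0" if "x \<in> vecs (Qu \<union> QM)" "y \<in> vecs Q" for x y
      using that cA MA' QN(2) A'A unfolding vecs_Un vQu vQM by blast
  qed
  have vQ: "vecs ?Q = u ` vecs Q' \<union> u ` N' \<union> M \<union> vecs Q" unfolding vecs_Un vQu vQM by blast
  have AD: "A \<subseteq> Dset (2 * k) (Suc n)"
    unfolding Dset_Suc A_def by (rule ssum_left[OF subspace_image[OF u subspace_Dset]])
  have uD: "u ` Dset (2 * k + 2) n \<subseteq> Dset (2 * k) (Suc n)" unfolding Dset_Suc by (rule ssum_right[OF subspace_ker_P])
  have uR: "u ` Rset (2 * k + 2) n \<subseteq> Rset (2 * k) (Suc n)" unfolding Rset_Suc by (rule ssum_right[OF subspace_ker_P])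
  have NkR: "Nk UNIV T (2 * k + 1) \<subseteq> Rset (2 * k) (Suc n)"
  proof
    fix y assume "y \<in> Nk UNIV T (2 * k + 1)"
    then obtain y1 s where ys: "y = y1 + u s" "P (T ^ (2 * k)) y1 = 0" "P (T ^ (2 * k + 1)) (u s) = 0"
      by (auto simp: Nk_def)
    have "T ^ (2 * k + 2) = T ^ (2 * k + 1) * T" by (simp add: mult_ac)
    then have "P (T ^ (2 * k + 2)) s = 0" using ys(3) by (simp only: P_mult P_T)
    then have "s \<in> Rset (2 * k + 2) n" using n(2) by (intro Rset_ker)
    then have "u s \<in> Rset (2 * k) (Suc n)" using uR by blast
    moreover have "y1 \<in> Rset (2 * k) (Suc n)" using ys(2) by (intro Rset_ker) auto
    ultimately show "y \<in> Rset (2 * k) (Suc n)" using ys(1) subspace_add[OF subspace_Rset] by blast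
  qed
  let ?F = "vecs ?Q \<union> N"
  have big: "subspace (ssum (span ?F) (Rset (2 * k) (Suc n)))" by (rule subspace_ssum[OF subspace_span subspace_Rset])
  have "witt_split (2 * k) (Suc n) N ?Q" unfolding witt_split_def
  proof (intro conjI)
    show "hyp ?c ?Q" by (rule hQ)
    show "vecs ?Q \<subseteq> Dset (2 * k) (Suc n)" unfolding vQ using t(2,4) uD MA AD QN(2) A'A by blast
    show "ortho ?c N" by fact
    show "N \<subseteq> Dset (2 * k) (Suc n)" using QN(4) A'A AD by blast
    show "\<forall>x\<in>vecs ?Q. \<forall>y\<in>N. ?c x y = 0" unfolding vQ using cA MA' QN(4,5) A'A by blast
    show "aniso ?c (span N)" by fact
    show "Dset (2 * k) (Suc n) \<subseteq> ssum (span ?F) (Rset (2 * k) (Suc n))" unfolding Dset_Suc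
    proof (rule ssum_subset[OF big])
      have "span ?E \<subseteq> span ?F" by (rule span_mono) (auto simp: vQ)
      then have "ssum (span ?E) (Nk UNIV T (2 * k + 1)) \<subseteq> ssum (span ?F) (Rset (2 * k) (Suc n))"
        using NkR unfolding ssum_def by blast
      then show "{x. P (T ^ (2 * k + 1)) x = 0} \<subseteq> ssum (span ?F) (Rset (2 * k) (Suc n))"
        using spA unfolding A_def by blast
      show "u ` Dset (2 * k + 2) n \<subseteq> ssum (span ?F) (Rset (2 * k) (Suc n))"
      proof
        fix y assume "y \<in> u ` Dset (2 * k + 2) n"
        then obtain d where d: "d \<in> Dset (2 * k + 2) n" "y = u d" by blast
        then obtain s r where sr: "d = s + r" "s \<in> span (vecs Q' \<union> N')" "r \<in> Rset (2 * k + 2) n"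
          using t(7) unfolding ssum_def by blast
        interpret ul: Vector_Spaces.linear scale scale u by (rule u)
        have "u s \<in> span (u ` (vecs Q' \<union> N'))" using sr(2) ul.span_image by blast
        moreover have "span (u ` (vecs Q' \<union> N')) \<subseteq> span ?F" by (rule span_mono) (auto simp: vQ)
        ultimately have "u s \<in> span ?F" by blast
        moreover have "u r \<in> Rset (2 * k) (Suc n)" using sr(3) uR by blast
        ultimately show "y \<in> ssum (span ?F) (Rset (2 * k) (Suc n))" using d(2) sr(1) ssumI by (simp add: u_lin)
      qed
    qed
  qed
  then show ?thesis using lev by blast
qed

text \<open>Descending induction from \<open>dimension\<close>, where all levels are empty. The
  number of terms \<open>dimension + 2 - k\<close> grows by one at each step and stays at least 2,
  which meets the side conditions of \<open>level_step\<close>.\<close>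

lemma levels_exist:
  assumes witt_condition: witt_condition and k: "k \<le> dimension"
  shows "\<exists>Q M N f. (\<forall>j\<ge>k. level j (Q j) (M j) (N j) (N (Suc j)) (f j)) \<and> (\<exists>Q'. witt_split (2 * k) (dimension + 2 - k) (N k) Q')"
  using k
proof (induct k rule: inc_induct)
  case base
  have o: "obasis T (2 * j + 1) {}" if "j \<ge> dimension" for j
  proof (rule obasis_T_I)
    fix y assume "P (T ^ (2 * j + 1)) y = 0"
    then have "y \<in> prim T" by (rule in_prim)
    then have "P (T ^ dimension) y = 0" by (simp only: prim_def mem_Collect_eq)
    moreover have "T ^ (2 * j) = T ^ (2 * j - dimension) * T ^ dimension" using that by (simp flip: power_add)
    ultimately have "P (T ^ (2 * j)) y = 0" by (simp only: P_mult P_linE)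
    then have "y \<in> Nk UNIV T (2 * j + 1)" unfolding Nk_def
      by (intro CollectI exI[of _ y] exI[of _ 0]) (auto simp: P_linE intro: range_eqI[of _ _ 0] u_lin(3)[symmetric])
    then show "y \<in> ssum (span {}) (Nk UNIV T (2 * j + 1))" by (simp add: ssum_def)
  qed (auto simp: ortho_def)
  have l: "level j {} {} {} {} id" if "j \<ge> dimension" for j using o[OF that] by (simp add: level_def vecs_def hyp_def)
  have ker: "P (T ^ (2 * dimension + i)) y = 0" if "y \<in> prim T" for y i
  proof -
    have "T ^ (2 * dimension + i) = T ^ (dimension + i) * T ^ dimension"
      unfolding power_add[symmetric] by (rule arg_cong[where f = "power T"]) simp
    then show ?thesis using that by (simp only: P_mult prim_def mem_Collect_eq P_linE)
  qed
  have "Dset (2 * dimension) 2 \<subseteq> Rset (2 * dimension) 2"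
  proof
    fix x assume "x \<in> Dset (2 * dimension) 2"
    then have "x \<in> prim T" using Dset_prim by blast
    then have "P (T ^ (2 * dimension)) x = 0" using ker[of x 0] by simp
    then show "x \<in> Rset (2 * dimension) 2" by (intro Rset_ker) auto
  qed
  then have "witt_split (2 * dimension) (dimension + 2 - dimension) {} {}"
    by (auto simp: witt_split_def hyp_def vecs_def ortho_def aniso_def ssum_def)
  then show ?case using l by (intro exI[of _ "\<lambda>_. {}"] exI[of _ "\<lambda>_. {}"] exI[of _ "\<lambda>_. {}"] exI[of _ "\<lambda>_. id"]) blast
next
  case (step k)
  then obtain Q M N f Q' where IH: "\<And>j. j \<ge> Suc k \<Longrightarrow> level j (Q j) (M j) (N j) (N (Suc j)) (f j)"
    "witt_split (2 * Suc k) (dimension + 2 - Suc k) (N (Suc k)) Q'" by blast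
  have e: "2 * Suc k = 2 * k + 2" "dimension + 2 - k = Suc (dimension + 2 - Suc k)" using step(2) by auto
  obtain Q0 M0 N0 f0 Q0' where l: "level k Q0 M0 N0 (N (Suc k)) f0" "witt_split (2 * k) (dimension + 2 - k) N0 Q0'"
    using level_step[OF witt_condition _ _ IH(2)[unfolded e(1)]] step(2) unfolding e(2) by fastforce
  have "level j ((Q(k := Q0)) j) ((M(k := M0)) j) ((N(k := N0)) j) ((N(k := N0)) (Suc j)) ((f(k := f0)) j)"
    if "j \<ge> k" for j using IH(1)[of j] l(1) that by (cases "j = k") auto
  moreover have "witt_split (2 * k) (dimension + 2 - k) ((N(k := N0)) k) Q0'" using l(2) by simp
  ultimately show ?case by blast
qed

text \<open>The blocks of a partition into singletons and pairs are coded by a relation, with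
  \<open>(i, i)\<close> for a singleton; \<open>r2\<close> says that distinct blocks are
  disjoint.\<close>

lemma good_matching:
  assumes I: "finite I" and o: "\<And>i j. i \<in> I \<Longrightarrow> j \<in> I \<Longrightarrow> i \<noteq> j \<Longrightarrow> orth (F i) (F j)"
    and r: "\<And>i j. (i, j) \<in> r \<Longrightarrow> i \<in> I \<and> j \<in> I" "\<And>i. i \<in> I \<Longrightarrow> \<exists>j. (i, j) \<in> r \<or> (j, i) \<in> r"
    and r2: "\<And>i j i' j'. (i, j) \<in> r \<Longrightarrow> (i', j') \<in> r \<Longrightarrow> i = i' \<or> i = j' \<or> j = i' \<or> j = j' \<Longrightarrow> i = i' \<and> j = j'"
    and g1: "\<And>i. (i, i) \<in> r \<Longrightarrow> good (F i)" and g2: "\<And>i j. (i, j) \<in> r \<Longrightarrow> i \<noteq> j \<Longrightarrow> good (ssum (F i) (F j))"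
  shows "good {\<Sum>i\<in>I. g i | g. \<forall>i\<in>I. g i \<in> F i}"
proof (rule good_partition[OF I o, where AA = "(\<lambda>(i, j). {i, j}) ` r"])
  show "\<Union>((\<lambda>(i, j). {i, j}) ` r) = I"
  proof
    show "\<Union>((\<lambda>(i, j). {i, j}) ` r) \<subseteq> I" using r(1) by blast
    show "I \<subseteq> \<Union>((\<lambda>(i, j). {i, j}) ` r)"
    proof
      fix i assume "i \<in> I"
      then obtain j where "(i, j) \<in> r \<or> (j, i) \<in> r" using r(2) by blast
      then show "i \<in> \<Union>((\<lambda>(i, j). {i, j}) ` r)" by force
    qed
  qed
next
  fix A B assume "A \<in> (\<lambda>(i, j). {i, j}) ` r" "B \<in> (\<lambda>(i, j). {i, j}) ` r" "A \<noteq> B"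
  then obtain i j i' j' where ij: "(i, j) \<in> r" "(i', j') \<in> r" "A = {i, j}" "B = {i', j'}" by auto
  show "A \<inter> B = {}"
  proof (rule ccontr)
    assume "A \<inter> B \<noteq> {}"
    then have "i = i' \<or> i = j' \<or> j = i' \<or> j = j'" using ij(3,4) by auto
    then have "i = i' \<and> j = j'" by (rule r2[OF ij(1,2)])
    then show False using ij(3,4) \<open>A \<noteq> B\<close> by simp
  qed
next
  fix A assume "A \<in> (\<lambda>(i, j). {i, j}) ` r"
  then obtain i j where ij: "(i, j) \<in> r" "A = {i, j}" by auto
  show "good {\<Sum>i\<in>A. g i | g. \<forall>i\<in>A. g i \<in> F i}"
  proof (cases "i = j")
    case True
    have "A = {i}" using ij(2) True by simp
    then show ?thesis using g1[of i] ij(1) True sum_singleton_set[of i F] by simp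
  next
    case False
    show ?thesis unfolding ij(2) sum_pair_set[OF False] by (rule g2[OF ij(1) False])
  qed
qed

text \<open>Generators of even exponent, and those of exponent 1 that remain in \<open>N 0\<close>,
  are good alone. All others come in pairs: those of \<open>Q\<close>, of equal exponent and
  opposite values, and those linked by \<open>f\<close>, whose exponents differ by 2.\<close>

lemma good_prim_T:
  assumes witt_condition: witt_condition
  shows "good (prim T)"
proof -
  obtain Q M N f where lv: "\<And>j. level j (Q j) (M j) (N j) (N (Suc j)) (f j)" using levels_exist[OF witt_condition le0] by auto
  \<comment> \<open>For even exponents any orthogonal basis will do; for odd ones it is the basis
    provided by the levels.\<close>
  define E where "E j = (if even j then (SOME E. obasis T j E) else
      vecs (Q (j div 2)) \<union> M (j div 2) \<union> N (j div 2))" for j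
  have Eodd: "E (2 * i + 1) = vecs (Q i) \<union> M i \<union> N i" for i by (simp add: E_def)
  have E: "obasis T j (E j)" if j: "j \<ge> 1" for j
  proof (cases "even j")
    case True
    obtain F where "obasis T j F" using obasis_exists'[OF irreducible_T j] by blast
    then show ?thesis unfolding E_def using True by (simp add: someI)
  next
    case False
    then obtain i where "j = 2 * i + 1" by (auto elim: oddE)
    then show ?thesis using lv[of i] Eodd by (simp add: level_def)
  qed
  note ii = idx_iff[of T E, OF E]
  obtain X where "lifts T E X" using primary_lift[OF irreducible_T E] by blast
  note X = liftsD[OF this]
  have hy: "hyp (cq (T ^ (2 * j))) (Q j)" "vecs (Q j) \<inter> M j = {}" "vecs (Q j) \<inter> N j = {}" "M j \<inter> N j = {}"
    "bij_betw (f j) (N (Suc j)) (M j)" "\<And>x. x \<in> N (Suc j) \<Longrightarrow> cq (T ^ (2 * j)) (f j x) (f j x) = - cq (T ^ (2 * j + 2)) x x" for j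
    using lv[of j] by (auto simp: level_def)
  define r where "r = {((j, e), (j, e)) | j e. j \<ge> 1 \<and> e \<in> E j \<and> even j} \<union> {((1, e), (1, e)) | e. e \<in> N 0} \<union>
    {((2 * i + 1, g), (2 * i + 1, h)) | i g h. (g, h) \<in> Q i} \<union>
    {((2 * i + 3, x), (2 * i + 1, f i x)) | i x. x \<in> N (Suc i)}"
  have rE: "(\<exists>j e. i = (j, e) \<and> i' = i \<and> j \<ge> 1 \<and> e \<in> E j \<and> even j) \<or> (\<exists>e. i = (1, e) \<and> i' = i \<and> e \<in> N 0) \<or>
     (\<exists>j g h. i = (2 * j + 1, g) \<and> i' = (2 * j + 1, h) \<and> (g, h) \<in> Q j) \<or>
     (\<exists>j x. i = (2 * j + 3, x) \<and> i' = (2 * j + 1, f j x) \<and> x \<in> N (Suc j))" if "(i, i') \<in> r" for i i'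
    using that unfolding r_def by (elim UnE CollectE exE conjE) auto
  have idxO: "(2 * j + 1, e) \<in> idx E" if "e \<in> vecs (Q j) \<union> M j \<union> N j" for j e
  proof -
    have "e \<in> E (2 * j + 1)" unfolding Eodd by (rule that)
    moreover have "1 \<le> 2 * j + 1" by simp
    ultimately show ?thesis using ii by blast
  qed
  have QE: "g \<in> vecs (Q l)" "h \<in> vecs (Q l)" if "(g, h) \<in> Q l" for g h l
    unfolding vecs_def using that image_eqI[of g fst "(g, h)" "Q l"] image_eqI[of h snd "(g, h)" "Q l"] by simp_all
  have inE: "(2 * j + 1, g) \<in> idx E" "(2 * j + 1, h) \<in> idx E" if "(g, h) \<in> Q j" for j g h
    by (rule idxO, use QE[OF that] in blast)+
  have inE': "(2 * j + 3, x) \<in> idx E" "(2 * j + 1, f j x) \<in> idx E" if "x \<in> N (Suc j)" for j x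
  proof -
    have e3: "2 * j + 3 = 2 * Suc j + 1" by simp
    show "(2 * j + 3, x) \<in> idx E" unfolding e3 by (rule idxO) (use that in blast)
    have "f j x \<in> M j" using hy(5)[of j] that by (auto simp: bij_betw_def)
    then show "(2 * j + 1, f j x) \<in> idx E" by (intro idxO) blast
  qed
  have kill: "P (T ^ k) (X (k, e)) = 0" and val: "b (X (k, e)) (P (T ^ (k - 1) * h) (X (k, e))) = coeff h 0 * cq (T ^ (k - 1)) e e"
    if i: "(k, e) \<in> idx E" for k e h
  proof -
    show k: "P (T ^ k) (X (k, e)) = 0" by (rule X(1)[OF i])
    have k: "k \<ge> 1" "P (T ^ k) e = 0" using i ii E[of k] by (auto simp: obasis_def)
    show "b (X (k, e)) (P (T ^ (k - 1) * h) (X (k, e))) = coeff h 0 * cq (T ^ (k - 1)) e e"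
      unfolding X(2)[OF i] socle_const[OF k(2,1)] by (simp add: cq_def bl)
  qed
  have kill': "P (T ^ fst i) (X i) = 0" if "i \<in> idx E" for i using kill[of "fst i" "snd i"] that by simp
  have nz: "cq (T ^ (k - 1)) e e \<noteq> 0" if i: "(k, e) \<in> idx E" for k e
  proof -
    have k: "k \<ge> 1" "P (T ^ k) e = 0" "\<exists>q. b e (P (T ^ (k - 1) * q) e) \<noteq> 0" using i ii E[of k] by (auto simp: obasis_def)
    then obtain q where "b e (P (T ^ (k - 1) * q) e) \<noteq> 0" by blast
    then show ?thesis unfolding socle_const[OF k(2,1)] by (auto simp: cq_def bl)
  qed
  have nz': "b (X i) (P (T ^ (fst i - 1) * 1) (X i)) \<noteq> 0" if "i \<in> idx E" for i
    using val[of "fst i" "snd i" 1] nz[of "fst i" "snd i"] that by simp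
  have "good {\<Sum>i\<in>idx E. g i | g. \<forall>i\<in>idx E. g i \<in> cyc (X i)}"
  proof (rule good_matching[OF finite_idx[OF E] X(3)])
    show "i \<in> idx E \<and> j \<in> idx E" if "(i, j) \<in> r" for i j using rE[OF that] ii inE inE' Eodd[of 0] by fastforce
  next
    fix i assume i: "i \<in> idx E"
    obtain j e where je: "i = (j, e)" "j \<ge> 1" "e \<in> E j" using i ii by (cases i) auto
    show "\<exists>j. (i, j) \<in> r \<or> (j, i) \<in> r"
    proof (cases "even j")
      case True
      then have "(i, i) \<in> r" using je unfolding r_def by simp
      then show ?thesis by blast
    next
      case False
      then obtain l where l: "j = 2 * l + 1" by (auto elim: oddE)
      have "e \<in> vecs (Q l) \<union> M l \<union> N l" using je(3) unfolding l Eodd .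
      then consider "e \<in> vecs (Q l)" | "e \<in> M l" | "e \<in> N l" "l = 0" | m where "e \<in> N l" "l = Suc m" by (cases l) auto
      then show ?thesis
      proof cases
        case 1
        then obtain p where "p \<in> Q l" "e = fst p \<or> e = snd p" by (auto simp: vecs_def)
        then have "(i, (j, snd p)) \<in> r \<or> ((j, fst p), i) \<in> r" unfolding r_def je(1) l by (cases p) auto
        then show ?thesis by blast
      next
        case 2
        then obtain x where "x \<in> N (Suc l)" "e = f l x" using hy(5)[of l] by (auto simp: bij_betw_def)
        then have "((2 * l + 3, x), i) \<in> r" unfolding r_def je(1) l by blast
        then show ?thesis by blast
      next
        case 3 then have "(i, i) \<in> r" unfolding r_def je(1) l by simp
        then show ?thesis by blast
      next
        case 4
        have "2 * l + 1 = 2 * m + 3" using 4 by simp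
        then have "(i, (2 * m + 1, f m e)) \<in> r" unfolding r_def je(1) l using 4 by blast
        then show ?thesis by blast
      qed
    qed
  next
    fix i i' assume ir: "(i, i') \<in> r" and ne: "i \<noteq> i'"
    from rE[OF ir] ne consider (Q) j g h where "i = (2 * j + 1, g)" "i' = (2 * j + 1, h)" "(g, h) \<in> Q j"
      | (N) j x where "i = (2 * j + 3, x)" "i' = (2 * j + 1, f j x)" "x \<in> N (Suc j)" by blast
    then show "good (ssum (cyc (X i)) (cyc (X i')))"
    proof cases
      case Q
      note ie = inE[OF Q(3), folded Q(1,2)]
      have "cq (T ^ (2 * j)) h h = - cq (T ^ (2 * j)) g g" using hy(1)[of j] Q(3) by (force simp: hyp_def)
      moreover have "b (X i) (P (T ^ (2 * j) * q) (X i)) = coeff q 0 * cq (T ^ (2 * j)) g g"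
        "b (X i') (P (T ^ (2 * j) * q) (X i')) = coeff q 0 * cq (T ^ (2 * j)) h h" for q
        using val[of "2 * j + 1" g] val[of "2 * j + 1" h] ie Q by auto
      moreover have "neg_arg (T ^ (2 * j) * q) * - 1 = - (T ^ (2 * j) * neg_arg q)" for q
        by (simp add: neg_arg_simps(2) neg_arg_T_power)
      ultimately have xy: "b (X i') (P (T ^ (2 * j + 1 - 1) * q) (X i')) = b (X i) (P (neg_arg (T ^ (2 * j + 1 - 1) * q) * - 1) (X i))" for q
        by (simp add: P_uminus bl coeff_neg_arg_0)
      show ?thesis
      proof (rule good_pair'[OF irreducible_T irreducible_T, where k = "2 * j + 1" and k' = "2 * j + 1" and ?s1.0 = T and ?s2.0 = T and ?s3.0 = "-1"])
        show "P (T ^ (2 * j + 1)) (X i) = 0" using kill'[OF ie(1)] unfolding Q(1) fst_conv .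
        show "P (T ^ (2 * j + 1)) (X i') = 0" using kill'[OF ie(2)] unfolding Q(2) fst_conv .
        show "b (X i) (P (T ^ (2 * j + 1 - 1) * 1) (X i)) \<noteq> 0" using nz'[OF ie(1)] unfolding Q(1) fst_conv .
        show "b (X i') (P (T ^ (2 * j + 1 - 1) * 1) (X i')) \<noteq> 0" using nz'[OF ie(2)] unfolding Q(2) fst_conv .
        show "orth (cyc (X i)) (cyc (X i'))" by (rule X(3)[OF ie ne])
        show "neg_arg T * - 1 = T" by (simp only: neg_arg_simps mult_minus1_right minus_minus)
        show "neg_arg T * T = - (T * T)" by (simp only: neg_arg_simps mult_minus_left)
        then show "neg_arg T * T = - (T * T)" .
        show "T ^ (2 * j + 1) dvd neg_arg (T ^ (2 * j + 1)) * - 1" unfolding neg_arg_T_power by simp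
      qed (use xy in simp_all)
    next
      case N
      note ie = inE'[OF N(3), folded N(1,2)]
      have v: "cq (T ^ (2 * j)) (f j x) (f j x) = - cq (T ^ (2 * j + 2)) x x" by (rule hy(6)[OF N(3)])
      have v1: "b (X i) (P (T ^ (2 * j + 2) * q) (X i)) = coeff q 0 * cq (T ^ (2 * j + 2)) x x"
        "b (X i') (P (T ^ (2 * j) * q) (X i')) = coeff q 0 * cq (T ^ (2 * j)) (f j x) (f j x)" for q
        using val[of "2 * j + 3" x] val[of "2 * j + 1" "f j x"] ie N by (auto simp: numeral_eq_Suc)
      have e: "neg_arg (T ^ (2 * j) * q) * - (T * T) = - (T ^ (2 * j + 2) * neg_arg q)" for q
        by (simp add: neg_arg_simps(2) neg_arg_T_power mult_ac)
      have xy: "b (X i') (P (T ^ (2 * j + 1 - 1) * q) (X i')) = b (X i) (P (neg_arg (T ^ (2 * j + 1 - 1) * q) * - (T * T)) (X i))" for q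
      proof -
        have "b (X i) (P (neg_arg (T ^ (2 * j) * q) * - (T * T)) (X i)) = - b (X i) (P (T ^ (2 * j + 2) * neg_arg q) (X i))"
          unfolding e P_uminus by (simp only: bl)
        also have "\<dots> = b (X i') (P (T ^ (2 * j) * q) (X i'))" unfolding v1 v coeff_neg_arg_0 by simp
        finally show ?thesis by simp
      qed
      show ?thesis
      \<comment> \<open>With \<open>s1 = 1\<close> and \<open>s2 = - (T * T)\<close> the longer
        cyclic space maps onto the shorter one, which maps back into it through \<open>u^2\<close>;
        this matches the exponents \<open>2 * j + 3\<close> and \<open>2 * j + 1\<close>.\<close>
      proof (rule good_pair'[OF irreducible_T irreducible_T, where k = "2 * j + 3" and k' = "2 * j + 1" and ?s1.0 = 1 and ?s2.0 = "- (T * T)" and ?s3.0 = "- (T * T)"])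
        show "P (T ^ (2 * j + 3)) (X i) = 0" using kill'[OF ie(1)] unfolding N(1) fst_conv .
        show "P (T ^ (2 * j + 1)) (X i') = 0" using kill'[OF ie(2)] unfolding N(2) fst_conv .
        show "b (X i) (P (T ^ (2 * j + 3 - 1) * 1) (X i)) \<noteq> 0" using nz'[OF ie(1)] unfolding N(1) fst_conv .
        show "b (X i') (P (T ^ (2 * j + 1 - 1) * 1) (X i')) \<noteq> 0" using nz'[OF ie(2)] unfolding N(2) fst_conv .
        show "orth (cyc (X i)) (cyc (X i'))" by (rule X(3)[OF ie ne])
        show "neg_arg 1 * - (T * T) = - (T * T)" by (simp only: neg_arg_simps mult_1_left)
        then show "neg_arg 1 * - (T * T) = - (T * T)" .
        show "neg_arg (- (T * T)) * 1 = - (T * T)" by (simp only: neg_arg_simps mult_1_right minus_mult_minus)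
        have "neg_arg (T ^ (2 * j + 1)) * - (T * T) = T ^ (2 * j + 1) * (T * T)" unfolding neg_arg_T_power by simp
        moreover have "T ^ (2 * j + 1) * (T * T) = T ^ (2 * j + 3)" by (simp add: numeral_eq_Suc mult_ac)
        ultimately show "T ^ (2 * j + 3) dvd neg_arg (T ^ (2 * j + 1)) * - (T * T)" by simp
      qed (use xy in simp_all)
    qed
  next
    fix i assume ir: "(i, i) \<in> r"
    have "(\<exists>j e. i = (j, e) \<and> j \<ge> 1 \<and> e \<in> E j \<and> even j) \<or> (\<exists>e. i = (1, e) \<and> e \<in> N 0)"
    proof -
      have "(h, h) \<notin> Q j" for h j using hy(1)[of j] by (force simp: hyp_def)
      then show ?thesis using rE[OF ir] by auto
    qed
    then consider (e) j e where "i = (j, e)" "j \<ge> 1" "e \<in> E j" "even j" | (o) e where "i = (1, e)" "e \<in> N 0" by blast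
    then show "good (cyc (X i))"
    proof cases
      case e
      have ie: "i \<in> idx E" using e ii by simp
      \<comment> \<open>For even \<open>j\<close> the power \<open>T ^ (j - 1)\<close> is odd, and
        this sign is what \<open>good_single'\<close> asks for.\<close>
      have n: "neg_arg (T ^ (j - 1) * q) = - (T ^ (j - 1) * neg_arg q)" for q
        using e(2,4) by (simp add: neg_arg_simps(2) neg_arg_T_power)
      show ?thesis
      proof (rule good_single'[OF irreducible_T e(2)])
        show "P (T ^ j) (X i) = 0" using kill'[OF ie] unfolding e(1) fst_conv .
        show "b (X i) (P (T ^ (j - 1) * 1) (X i)) \<noteq> 0" using nz'[OF ie] unfolding e(1) fst_conv .
        show "T ^ j dvd neg_arg (T ^ j)" using e(4) unfolding neg_arg_T_power by simp
        show "b (X i) (P (neg_arg (T ^ (j - 1) * h)) (X i)) = - b (X i) (P (T ^ (j - 1) * h) (X i))" for h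
          unfolding n P_uminus using val[of j e] ie e by (simp add: bl coeff_neg_arg_0)
      qed
    next
      case o
      have ie: "(1, e) \<in> idx E" using o ii Eodd[of 0] by simp
      have u0: "u (X i) = 0" using kill[OF ie] o by (simp add: power_one_right)
      show ?thesis
      proof (rule good_single)
        show "nondeg_on (cyc (X i))"
          by (rule nondeg_cyc[OF irreducible_T, of 1 "X i" 1]) (use kill[OF ie] nz'[OF ie] o in simp_all)
        show "b (X i) (P (neg_arg r * T) (X i)) = b (X i) (P (r * T) (X i))" for r by (simp add: P_mult u0 P_linE)
      qed
    qed
  next
    fix i j i' j' assume rr: "(i, j) \<in> r" "(i', j') \<in> r" and eq: "i = i' \<or> i = j' \<or> j = i' \<or> j = j'"
    have QQ: "p = p'" if "p \<in> Q l" "p' \<in> Q l" "fst p = fst p' \<or> fst p = snd p' \<or> snd p = fst p' \<or> snd p = snd p'" for p p' l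
    proof (rule ccontr)
      assume n: "p \<noteq> p'"
      have z: "\<forall>x\<in>{fst p, snd p}. \<forall>y\<in>{fst p', snd p'}. cq (T ^ (2 * l)) x y = 0"
        using hy(1)[of l] that n unfolding hyp_def by blast
      have "cq (T ^ (2 * l)) (fst p) (fst p) \<noteq> 0" "cq (T ^ (2 * l)) (snd p) (snd p) \<noteq> 0"
        using hy(1)[of l] that(1) by (auto simp: hyp_def)
      then show False using z that(3) by auto
    qed
    have fM: "f l x \<in> M l" if "x \<in> N (Suc l)" for l x using hy(5)[of l] that by (auto simp: bij_betw_def)
    have finj: "x = y" if "f l x = f l y" "x \<in> N (Suc l)" "y \<in> N (Suc l)" for l x y
      using hy(5)[of l] that by (auto simp: bij_betw_def inj_on_def)
    \<comment> \<open>The kind of a generator: 0 for even exponent, 1 in a pair of \<open>Q\<close>,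
      2 in some \<open>M\<close>, 3 in \<open>N 0\<close>, 4 in a higher \<open>N\<close>. It
      depends on the generator alone, so entries of \<open>r\<close> of different kinds share
      none.\<close>
    define ty where "ty = (\<lambda>(j, e). if even j then 0 else if e \<in> vecs (Q (j div 2)) then 1 else if e \<in> M (j div 2) then 2
       else if j = 1 then 3 else (4::nat))"
    have d3: "(2 * l + 3) div 2 = Suc l" for l :: nat by simp
    have t4: "ty (2 * l + 3, x) = 4" if "x \<in> N (Suc l)" for l x
    proof -
      have "x \<notin> vecs (Q (Suc l))" "x \<notin> M (Suc l)" using hy(3,4)[of "Suc l"] that by blast+
      then show ?thesis unfolding ty_def by (simp add: d3)
    qed
    have t2: "ty (2 * l + 1, f l x) = 2" if "x \<in> N (Suc l)" for l x
      using fM[OF that] hy(2)[of l] by (auto simp: ty_def)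
    have t1: "ty (2 * l + 1, g) = 1" "ty (2 * l + 1, h) = 1" if "(g, h) \<in> Q l" for g h l
      using QE[OF that] by (simp_all add: ty_def)
    have t3: "ty (1, e) = 3" if "e \<in> N 0" for e using that hy(3,4)[of 0] by (auto simp: ty_def)
    have t0: "ty (k, e) = 0" if "even k" for k e using that by (simp add: ty_def)
    define cl where "cl = (\<lambda>(i, j) t. (t = 0 \<or> t = 3) \<and> i = j \<and> ty i = t \<or> t = 1 \<and> ty i = 1 \<and> ty j = 1 \<and>
        (\<exists>l g h. i = (2 * l + 1, g) \<and> j = (2 * l + 1, h) \<and> (g, h) \<in> Q l) \<or>
      t = (2::nat) \<and> ty i = 4 \<and> ty j = 2 \<and> (\<exists>l x. i = (2 * l + 3, x) \<and> j = (2 * l + 1, f l x) \<and> x \<in> N (Suc l)))"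
    have cl: "\<exists>t. cl (i, j) t" if "(i, j) \<in> r" for i j
    proof -
      from rE[OF that] consider (a) k e where "i = (k, e)" "j = i" "even k" | (b) e where "i = (1, e)" "j = i" "e \<in> N 0"
        | (c) l g h where "i = (2 * l + 1, g)" "j = (2 * l + 1, h)" "(g, h) \<in> Q l"
        | (d) l x where "i = (2 * l + 3, x)" "j = (2 * l + 1, f l x)" "x \<in> N (Suc l)" by blast
      then show ?thesis
      proof cases
        case a then show ?thesis using t0[of k e] by (auto simp: cl_def)
      next
        case b then show ?thesis using t3[of e] by (auto simp: cl_def)
      next
        case c then show ?thesis using t1[OF c(3)] by (intro exI[of _ 1]) (auto simp: cl_def)
      next
        case d then show ?thesis using t4[OF d(3)] t2[OF d(3)] by (intro exI[of _ 2]) (auto simp: cl_def)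
      qed
    qed
    obtain t t' where tt: "cl (i, j) t" "cl (i', j') t'" using cl[OF rr(1)] cl[OF rr(2)] by blast
    have "t = t'" using tt eq unfolding cl_def by auto
    then consider "i = j" "i' = j'"
      | l g h l' g' h' where "i = (2 * l + 1, g)" "j = (2 * l + 1, h)" "(g, h) \<in> Q l" "i' = (2 * l' + 1, g')" "j' = (2 * l' + 1, h')" "(g', h') \<in> Q l'"
      | l x l' x' where "i = (2 * l + 3, x)" "j = (2 * l + 1, f l x)" "x \<in> N (Suc l)" "i' = (2 * l' + 3, x')" "j' = (2 * l' + 1, f l' x')" "x' \<in> N (Suc l')"
          "ty i = 4" "ty j' = 2" "ty i' = 4" "ty j = 2" using tt unfolding cl_def by auto
    then show "i = i' \<and> j = j'"
    proof cases
      case 1 then show ?thesis using eq by auto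
    next
      case 2
      have "l = l'" using eq 2 by auto
      then have "(g, h) = (g', h')" using QQ[of "(g, h)" l "(g', h')"] eq 2 by auto
      then show ?thesis using 2 \<open>l = l'\<close> by auto
    next
      case 3
      have "i \<noteq> j'" "j \<noteq> i'" using 3(7-10) by auto
      then have "i = i' \<or> j = j'" using eq by auto
      then have "l = l'" "x = x'" using 3 finj by auto
      then show ?thesis using 3 by auto
    qed
  qed
  then show ?thesis unfolding X(4) .
qed

end

section \<open>Residue fields\<close>

text \<open>The class of \<open>q\<close> in the residue field, written through divisibility;
  \<open>PIdl_coset\<close> identifies it with the coset of the ideal.\<close>

definition cls :: "'a::field poly \<Rightarrow> 'a poly \<Rightarrow> 'a poly set" where
  "cls p q = {r. p dvd r - q}"

lemma cls_eq_iff: "cls p q = cls p r \<longleftrightarrow> p dvd q - r" for p :: "'a::field poly"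
proof
  assume e: "cls p q = cls p r"
  have "q \<in> cls p q" by (simp add: cls_def)
  then have "q \<in> cls p r" unfolding e .
  then show "p dvd q - r" by (simp add: cls_def)
next
  assume d: "p dvd q - r"
  have "p dvd s - q \<longleftrightarrow> p dvd s - r" for s
  proof -
    have "s - r = (s - q) + (q - r)" by simp
    then show ?thesis using d dvd_add_left_iff by metis
  qed
  then show "cls p q = cls p r" by (simp add: cls_def)
qed

lemma self_in_cls: "q \<in> cls p q" by (simp add: cls_def)

lemma PIdl_coset: "PIdl\<^bsub>class_ring\<^esub> p +>\<^bsub>class_ring\<^esub> q = cls p q" for p :: "'a::field poly"
proof -
  have "(r \<in> PIdl\<^bsub>class_ring\<^esub> p +>\<^bsub>class_ring\<^esub> q) = (\<exists>x. r = x * p + q)" for r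
    by (auto simp: a_r_coset_def' cgenideal_def)
  moreover have "(\<exists>x. r = x * p + q) = (p dvd r - q)" for r by (auto simp: dvd_def algebra_simps)
  ultimately show ?thesis by (auto simp: cls_def)
qed

lemma PIdl_ideal: "ideal (PIdl\<^bsub>class_ring\<^esub> p) class_ring" for p :: "'a::field poly"
  by (rule cring.cgenideal_ideal[OF class_cring.is_cring]) simp

lemma residue_carrier: "carrier (residue_field p) = range (cls p)"
  by (auto simp: residue_field_def FactRing_def A_RCOSETS_def' PIdl_coset)

lemma cls_carrier [simp]: "cls p q \<in> carrier (residue_field p)" by (simp add: residue_carrier)

lemma residue_mult: "cls p q \<otimes>\<^bsub>residue_field p\<^esub> cls p r = cls p (q * r)"
  unfolding residue_field_def FactRing_def PIdl_coset[symmetric]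
  using ideal.rcoset_mult_add[OF PIdl_ideal[of p], of q r] by simp

lemma residue_add: "cls p q \<oplus>\<^bsub>residue_field p\<^esub> cls p r = cls p (q + r)"
proof -
  have "abelian_subgroup (PIdl\<^bsub>class_ring\<^esub> p) class_ring" using PIdl_ideal[of p]
    by (intro abelian_subgroupI3 ideal.axioms(1) abelian_group.intro)
       (auto simp: ideal_def ring_def abelian_group_def)
  from abelian_subgroup.a_rcos_sum[OF this, of q r] show ?thesis
    unfolding residue_field_def FactRing_def PIdl_coset[symmetric] by simp
qed

lemma residue_one: "\<one>\<^bsub>residue_field p\<^esub> = cls p 1"
  unfolding residue_field_def FactRing_def PIdl_coset[symmetric] by simp

lemma residue_zero: "\<zero>\<^bsub>residue_field p\<^esub> = cls p 0"
proof -
  have "PIdl\<^bsub>class_ring\<^esub> p = cls p 0" unfolding PIdl_coset[symmetric] by (auto simp: a_r_coset_def')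
  then show ?thesis unfolding residue_field_def FactRing_def by simp
qed

lemma residue_is_field:
  assumes p: "irreducible p" shows "field (residue_field p)"
proof -
  have c: "cring (residue_field p)"
    unfolding residue_field_def by (rule ideal.quotient_is_cring[OF PIdl_ideal class_cring.is_cring])
  show ?thesis
  proof (rule cring.cring_fieldI2[OF c])
    show "\<zero>\<^bsub>residue_field p\<^esub> \<noteq> \<one>\<^bsub>residue_field p\<^esub>"
      using p unfolding residue_zero residue_one cls_eq_iff by (auto simp: irreducible_def)
    fix a assume "a \<in> carrier (residue_field p)" "a \<noteq> \<zero>\<^bsub>residue_field p\<^esub>"
    then obtain q where q: "a = cls p q" "\<not> p dvd q" unfolding residue_carrier residue_zero
      by (metis cls_eq_iff diff_zero imageE)
    obtain r s where rs: "r * q + s * p ^ 1 = 1" using irreducible_bezout[OF p q(2)] by blast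
    have "q * r - 1 = - s * p" using rs by (simp add: algebra_simps)
    then have "cls p q \<otimes>\<^bsub>residue_field p\<^esub> cls p r = \<one>\<^bsub>residue_field p\<^esub>"
      unfolding residue_mult residue_one cls_eq_iff by simp
    then show "\<exists>b\<in>carrier (residue_field p). a \<otimes>\<^bsub>residue_field p\<^esub> b = \<one>\<^bsub>residue_field p\<^esub>"
      unfolding q(1) by (intro bexI[of _ "cls p r"]) auto
  qed
qed

lemma residue_uminus:
  assumes "irreducible p" shows "\<ominus>\<^bsub>residue_field p\<^esub> cls p q = cls p (- q)"
proof -
  interpret field "residue_field p" by (rule residue_is_field[OF assms])
  have "cls p (- q) \<oplus>\<^bsub>residue_field p\<^esub> cls p q = \<zero>\<^bsub>residue_field p\<^esub>" unfolding residue_add residue_zero by simp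
  then show ?thesis by (intro minus_equality) auto
qed

lemma residue_minus:
  assumes "irreducible p" shows "cls p q \<ominus>\<^bsub>residue_field p\<^esub> cls p r = cls p (q - r)"
  by (simp add: a_minus_def residue_uminus[OF assms] residue_add)

lemma residue_pow:
  assumes "irreducible p" shows "cls p q [^]\<^bsub>residue_field p\<^esub> (n::nat) = cls p (q ^ n)"
proof -
  interpret field "residue_field p" by (rule residue_is_field[OF assms])
  show ?thesis by (induct n) (auto simp: residue_one residue_mult mult.commute)
qed

lemma residue_form_cls: "residue_form p (cls p q) = coeff (q mod p) 0"
proof -
  have "(\<lambda>q. coeff (q mod p) 0) ` cls p q = {coeff (q mod p) 0}"
    using self_in_cls[of q p] by (auto simp: cls_def mod_eq_dvd_iff[symmetric])
  then show ?thesis by (simp add: residue_form_def)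
qed

lemma cls_op: "cls (op_poly p) q = cls (neg_arg p) q"
proof -
  have "op_poly p dvd r \<longleftrightarrow> neg_arg p dvd r" for r unfolding op_poly_def by (simp add: smult_dvd_iff)
  then show ?thesis by (simp add: cls_def)
qed

lemma residue_neg_cls: "residue_neg (cls p q) = cls (op_poly p) (neg_arg q)"
proof -
  have "(r \<in> neg_arg ` cls p q) = (p dvd neg_arg r - q)" for r
  proof
    assume "r \<in> neg_arg ` cls p q"
    then show "p dvd neg_arg r - q" by (auto simp: cls_def neg_arg_simps)
  next
    assume "p dvd neg_arg r - q"
    then show "r \<in> neg_arg ` cls p q" by (intro image_eqI[of _ _ "neg_arg r"]) (auto simp: cls_def neg_arg_simps)
  qed
  moreover have "(p dvd neg_arg r - q) = (neg_arg p dvd r - neg_arg q)" for r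
    using neg_arg_dvd_iff[of p "neg_arg r - q"] by (simp add: neg_arg_simps)
  ultimately show ?thesis unfolding cls_op by (auto simp: residue_neg_def cls_def)
qed

lemma Irr0_neg_arg:
  assumes "p \<in> Irr0" shows "neg_arg p = p" "op_poly p = p"
proof -
  from assms obtain q where q: "p = pcompose q [:0, 0, 1:]" by (auto simp: Irr0_def)
  show 1: "neg_arg p = p" unfolding neg_arg_def q by (simp add: pcompose_assoc[symmetric] pcompose_pCons)
  have "degree p = degree q * 2" unfolding q by (simp add: degree_pcompose)
  then show "op_poly p = p" by (simp add: op_poly_def 1)
qed

text \<open>Two coefficients are removed at a time: invariance under \<open>-t\<close> makes the odd
  one equal to its opposite, hence zero, and passes to the remaining polynomial.\<close>

lemma even_poly_is_pcompose:
  fixes p :: "'a::field poly"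
  assumes two: "(2::'a) \<noteq> 0" and p: "neg_arg p = p"
  shows "p \<in> range (\<lambda>q. pcompose q [:0, 0, 1:])" using p
proof (induct "degree p" arbitrary: p rule: less_induct)
  case less
  obtain a p1 where p1: "p = pCons a p1" by (cases p) auto
  obtain b q where q: "p1 = pCons b q" by (cases p1) auto
  have pe: "p = [:a:] + [:0, 1:] * ([:b:] + [:0, 1:] * q)" unfolding p1 q by simp
  have "neg_arg p = [:a:] - [:0, 1:] * ([:b:] - [:0, 1:] * neg_arg q)"
    unfolding pe by (simp only: neg_arg_simps) (simp add: algebra_simps)
  also have "\<dots> = pCons a (pCons (- b) (neg_arg q))" by simp
  finally have "pCons a (pCons (- b) (neg_arg q)) = pCons a (pCons b q)" using less(2) p1 q by simp
  then have b: "- b = b" and nq: "neg_arg q = q" by auto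
  have "b + b = 0" using b by (metis add.right_inverse)
  then have "2 * b = 0" by (simp only: mult_2)
  then have b0: "b = 0" using two by simp
  show ?case
  proof (cases "q = 0")
    case True
    then have "p = pcompose [:a:] [:0, 0, 1:]" using p1 q b0 by simp
    then show ?thesis by blast
  next
    case False
    then have "degree q < degree p" using p1 q by simp
    then obtain r where "q = pcompose r [:0, 0, 1:]" using less(1) nq by blast
    then have "p = pcompose (pCons a r) [:0, 0, 1:]" using p1 q b0 by (simp add: pcompose_pCons)
    then show ?thesis by blast
  qed
qed

text \<open>Divisibility would give \<open>p = op_poly p\<close>. In even degree this means
  \<open>neg_arg p = p\<close>, so that \<open>p\<close> is in \<open>Irr0\<close>; in odd degree
  the constant coefficient equals its opposite, so that \<open>[:0, 1:]\<close> divides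
  \<open>p\<close>.\<close>

lemma op_poly_not_dvd:
  fixes p :: "'a::field poly"
  assumes two: "(2::'a) \<noteq> 0" and p: "p \<in> Irr" "p \<notin> Irr0" "p \<noteq> [:0, 1:]"
  shows "\<not> p dvd op_poly p" "\<not> [:0, 1:] dvd p"
proof -
  have T: "[:0, 1:] \<in> (Irr :: 'a poly set)" by (simp add: Irr_def irreducible_linear_field_poly)
  show nT: "\<not> [:0, 1:] dvd p" using Irr_dvd_imp_eq[OF T p(1)] p(3) by blast
  show "\<not> p dvd op_poly p"
  proof
    assume "p dvd op_poly p"
    then have e: "p = op_poly p" by (rule Irr_dvd_imp_eq[OF p(1) op_poly_Irr[OF p(1)]])
    have n: "neg_arg p = Polynomial.smult ((- 1) ^ degree p) p" using neg_arg_eq_op_poly[of p] e by simp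
    show False
    proof (cases "even (degree p)")
      case True
      then have "neg_arg p = p" using n by simp
      then show False using even_poly_is_pcompose[OF two] p(1,2) by (simp add: Irr0_def)
    next
      case False
      then have "poly (neg_arg p) 0 = - poly p 0" using n by simp
      moreover have "poly (neg_arg p) 0 = poly p 0" by (simp add: neg_arg_def poly_pcompose)
      ultimately have "poly p 0 + poly p 0 = 0" by (metis add.right_inverse)
      then have "2 * poly p 0 = 0" by (simp only: mult_2)
      then have "poly p 0 = 0" using two by simp
      then have "[:- 0, 1:] dvd p" by (simp only: poly_eq_0_iff_dvd)
      then show False using nT by simp
    qed
  qed
qed

section \<open>Modules represented by a set of vectors\<close>

text \<open>
  The records of the statement are images of sets of vectors: \<open>\<phi>\<close> sends a vector to its class, and \<open>\<kappa>\<close>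
  a scalar or a polynomial to its class in the residue field.
\<close>

locale represented =
  fixes K :: "('c, 'z) ring_scheme" and M :: "('c, 'm, 'y) module_scheme"
    and \<kappa> :: "'r::comm_ring_1 \<Rightarrow> 'c" and A :: "'v::ab_group_add set"
    and act :: "'r \<Rightarrow> 'v \<Rightarrow> 'v" and \<phi> :: "'v \<Rightarrow> 'm"
  assumes K: "field K" and kcar: "carrier K = range \<kappa>"
    and k_add: "\<kappa> r \<oplus>\<^bsub>K\<^esub> \<kappa> s = \<kappa> (r + s)" and k_mult: "\<kappa> r \<otimes>\<^bsub>K\<^esub> \<kappa> s = \<kappa> (r * s)"
    and k_one: "\<one>\<^bsub>K\<^esub> = \<kappa> 1" and k_zero: "\<zero>\<^bsub>K\<^esub> = \<kappa> 0"
    and A_add: "x \<in> A \<Longrightarrow> y \<in> A \<Longrightarrow> x + y \<in> A" and A_0: "0 \<in> A" and A_act: "x \<in> A \<Longrightarrow> act r x \<in> A"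
    and act_add: "act r (x + y) = act r x + act r y" and act_add_left: "act (r + s) x = act r x + act s x"
    and act_mult: "act (r * s) x = act r (act s x)" and act_1: "act 1 x = x"
    and \<phi>_carrier: "carrier M = \<phi> ` A"
    and \<phi>_add: "x \<in> A \<Longrightarrow> y \<in> A \<Longrightarrow> \<phi> x \<oplus>\<^bsub>M\<^esub> \<phi> y = \<phi> (x + y)"
    and \<phi>_zero: "\<zero>\<^bsub>M\<^esub> = \<phi> 0"
    and \<phi>_smult: "x \<in> A \<Longrightarrow> \<kappa> r \<odot>\<^bsub>M\<^esub> \<phi> x = \<phi> (act r x)"
begin

lemma act_0_left: "act 0 x = 0" using act_add_left[of 0 0 x] by simp

lemma act_minus1: "act (- 1) x = - x"
  using act_add_left[of 1 "- 1" x] act_0_left[of x] by (simp add: act_1 eq_neg_iff_add_eq_0 add.commute)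

lemma A_neg: "x \<in> A \<Longrightarrow> - x \<in> A" using A_act[of x "- 1"] by (simp add: act_minus1)

lemma A_diff: "x \<in> A \<Longrightarrow> y \<in> A \<Longrightarrow> x - y \<in> A" using A_add[of x "- y"] A_neg by simp

lemma vs: "vectorspace K M"
proof -
  interpret K: field K by (rule K)
  have g: "abelian_group M"
  proof (rule abelian_groupI)
    fix x assume "x \<in> carrier M"
    then obtain a where a: "x = \<phi> a" "a \<in> A" by (auto simp: \<phi>_carrier)
    show "\<exists>y\<in>carrier M. y \<oplus>\<^bsub>M\<^esub> x = \<zero>\<^bsub>M\<^esub>"
      using a A_neg by (intro bexI[of _ "\<phi> (- a)"]) (auto simp: \<phi>_carrier \<phi>_add \<phi>_zero)
  qed (auto simp: \<phi>_carrier \<phi>_add \<phi>_zero A_add A_0 algebra_simps)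
  have "module K M"
  proof (rule moduleI[OF K.is_cring g])
    show "\<one>\<^bsub>K\<^esub> \<odot>\<^bsub>M\<^esub> x = x" if "x \<in> carrier M" for x using that by (auto simp: \<phi>_carrier k_one \<phi>_smult act_1)
  qed (auto simp: \<phi>_carrier kcar k_add k_mult \<phi>_add \<phi>_smult A_act A_add act_add act_add_left act_mult)
  then show ?thesis using K by (simp add: vectorspace_def)
qed

sublocale V: vectorspace K M by (rule vs)

lemma \<phi>_in: "x \<in> A \<Longrightarrow> \<phi> x \<in> carrier M" by (simp add: \<phi>_carrier)

lemma \<kappa>_in: "\<kappa> r \<in> carrier K" by (simp add: kcar)

lemma A_sum: "(\<And>i. i \<in> I \<Longrightarrow> x i \<in> A) \<Longrightarrow> sum x I \<in> A" by (induct I rule: infinite_finite_induct) (auto simp: A_0 A_add)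

lemma \<phi>_sum: "finite I \<Longrightarrow> (\<And>i. i \<in> I \<Longrightarrow> x i \<in> A) \<Longrightarrow> (\<Oplus>\<^bsub>M\<^esub>i\<in>I. \<phi> (x i)) = \<phi> (sum x I)"
proof (induct I rule: finite_induct)
  case empty then show ?case by (simp add: \<phi>_zero)
next
  case (insert i I)
  have "(\<Oplus>\<^bsub>M\<^esub>j\<in>insert i I. \<phi> (x j)) = \<phi> (x i) \<oplus>\<^bsub>M\<^esub> (\<Oplus>\<^bsub>M\<^esub>j\<in>I. \<phi> (x j))"
    by (rule V.finsum_insert) (use insert \<phi>_in in auto)
  then show ?case using insert by (simp add: \<phi>_add A_sum)
qed

lemma \<phi>_eq_iff: "x \<in> A \<Longrightarrow> y \<in> A \<Longrightarrow> \<phi> x = \<phi> y \<longleftrightarrow> \<phi> (x - y) = \<zero>\<^bsub>M\<^esub>"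
proof
  assume xy: "x \<in> A" "y \<in> A" and e: "\<phi> x = \<phi> y"
  have "\<phi> (x - y) = \<phi> x \<oplus>\<^bsub>M\<^esub> \<phi> (- y)" using xy A_neg by (simp add: \<phi>_add)
  also have "\<dots> = \<phi> y \<oplus>\<^bsub>M\<^esub> \<phi> (- y)" using e by simp
  also have "\<dots> = \<zero>\<^bsub>M\<^esub>" using xy A_neg by (simp add: \<phi>_add \<phi>_zero)
  finally show "\<phi> (x - y) = \<zero>\<^bsub>M\<^esub>" .
next
  assume xy: "x \<in> A" "y \<in> A" and e: "\<phi> (x - y) = \<zero>\<^bsub>M\<^esub>"
  have "\<phi> x = \<phi> (x - y) \<oplus>\<^bsub>M\<^esub> \<phi> y" using xy by (simp add: \<phi>_add A_diff)
  then show "\<phi> x = \<phi> y" using e xy \<phi>_in by simp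
qed

lemma lincomb_\<phi>:
  assumes E: "finite E" "E \<subseteq> A" "inj_on \<phi> E" and a: "\<And>e. e \<in> E \<Longrightarrow> a (\<phi> e) = \<kappa> (r e)"
  shows "V.lincomb a (\<phi> ` E) = \<phi> (\<Sum>e\<in>E. act (r e) e)"
proof -
  have "V.lincomb a (\<phi> ` E) = (\<Oplus>\<^bsub>M\<^esub>v\<in>\<phi> ` E. a v \<odot>\<^bsub>M\<^esub> v)" by (simp add: V.lincomb_def)
  also have "\<dots> = (\<Oplus>\<^bsub>M\<^esub>e\<in>E. a (\<phi> e) \<odot>\<^bsub>M\<^esub> \<phi> e)" by (rule V.add.finprod_reindex) (use E a \<phi>_in \<kappa>_in in auto)
  also have "\<dots> = (\<Oplus>\<^bsub>M\<^esub>e\<in>E. \<phi> (act (r e) e))"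
    by (rule V.finsum_cong') (use E a \<phi>_in A_act in \<open>auto simp: \<phi>_smult subset_iff\<close>)
  also have "\<dots> = \<phi> (\<Sum>e\<in>E. act (r e) e)" by (rule \<phi>_sum) (use E A_act in auto)
  finally show ?thesis .
qed

lemma basis_image:
  assumes E: "finite E" "E \<subseteq> A"
    and ind: "\<And>r. \<phi> (\<Sum>e\<in>E. act (r e) e) = \<zero>\<^bsub>M\<^esub> \<Longrightarrow> \<forall>e\<in>E. \<kappa> (r e) = \<zero>\<^bsub>K\<^esub>"
    and gen: "\<And>y. y \<in> A \<Longrightarrow> \<exists>r. \<phi> (y - (\<Sum>e\<in>E. act (r e) e)) = \<zero>\<^bsub>M\<^esub>"
  shows "inj_on \<phi> E" "V.basis (\<phi> ` E)"
proof -
  show inj: "inj_on \<phi> E"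
  proof (rule inj_onI, rule ccontr)
    fix e e' assume e: "e \<in> E" "e' \<in> E" "\<phi> e = \<phi> e'" "e \<noteq> e'"
    \<comment> \<open>Two elements of \<open>E\<close> in the same class would give a relation with
      coefficients 1 and -1.\<close>
    let ?r = "\<lambda>x. if x = e then 1 else if x = e' then - 1 else 0 :: 'r"
    have "(\<Sum>x\<in>E. act (?r x) x) = (\<Sum>x\<in>{e, e'}. act (?r x) x)"
      by (rule sum.mono_neutral_right) (use E e in \<open>auto simp: act_0_left\<close>)
    also have "\<dots> = e - e'" using e by (simp add: act_1 act_minus1)
    finally have "\<phi> (\<Sum>x\<in>E. act (?r x) x) = \<zero>\<^bsub>M\<^esub>" using e E \<phi>_eq_iff by (metis subsetD)
    then have "\<kappa> (?r e) = \<zero>\<^bsub>K\<^esub>" using ind[of ?r] e(1) by blast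
    then show False using k_one V.one_not_zero by simp
  qed
  have car: "\<phi> ` E \<subseteq> carrier M" using E \<phi>_in by auto
  have "V.lin_indpt (\<phi> ` E)"
  proof (rule V.finite_lin_indpt2[OF _ car])
    show "finite (\<phi> ` E)" using E by simp
    fix a assume a: "a \<in> \<phi> ` E \<rightarrow> carrier K" "V.lincomb a (\<phi> ` E) = \<zero>\<^bsub>M\<^esub>"
    have "\<forall>e. \<exists>r. e \<in> E \<longrightarrow> a (\<phi> e) = \<kappa> r" using a(1) kcar by (auto simp: Pi_def)
    then obtain r where r: "\<And>e. e \<in> E \<Longrightarrow> a (\<phi> e) = \<kappa> (r e)" by metis
    have "\<phi> (\<Sum>e\<in>E. act (r e) e) = \<zero>\<^bsub>M\<^esub>" using lincomb_\<phi>[OF E inj, of a r, OF r] a(2) by simp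
    then show "\<forall>v\<in>\<phi> ` E. a v = \<zero>\<^bsub>K\<^esub>" using ind r by auto
  qed
  moreover have "V.span (\<phi> ` E) = carrier M"
  proof
    show "V.span (\<phi> ` E) \<subseteq> carrier M" by (rule V.span_is_subset2[OF car])
    show "carrier M \<subseteq> V.span (\<phi> ` E)"
    proof
      fix x assume "x \<in> carrier M"
      then obtain y where y: "x = \<phi> y" "y \<in> A" by (auto simp: \<phi>_carrier)
      obtain r where r: "\<phi> (y - (\<Sum>e\<in>E. act (r e) e)) = \<zero>\<^bsub>M\<^esub>" using gen[OF y(2)] by blast
      have "(\<Sum>e\<in>E. act (r e) e) \<in> A" by (rule A_sum) (use E A_act in auto)
      then have "x = \<phi> (\<Sum>e\<in>E. act (r e) e)" using \<phi>_eq_iff y r by simp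
      also have "\<dots> = V.lincomb (\<lambda>v. \<kappa> (r (inv_into E \<phi> v))) (\<phi> ` E)"
        by (rule lincomb_\<phi>[symmetric]) (use E inj in auto)
      finally show "x \<in> V.span (\<phi> ` E)" unfolding V.span_def using E \<kappa>_in by blast
    qed
  qed
  ultimately show "V.basis (\<phi> ` E)" using car by (simp add: V.basis_def)
qed

lemma basis_preimage:
  assumes B: "finite B" "V.basis B"
  obtains E where "finite E" "E \<subseteq> A" "inj_on \<phi> E" "B = \<phi> ` E"
    "\<And>y. y \<in> A \<Longrightarrow> \<exists>r. \<phi> (y - (\<Sum>e\<in>E. act (r e) e)) = \<zero>\<^bsub>M\<^esub>" "\<And>e. e \<in> E \<Longrightarrow> \<phi> e \<noteq> \<zero>\<^bsub>M\<^esub>"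
proof -
  have Bc: "B \<subseteq> carrier M" "V.lin_indpt B" "V.span B = carrier M" using B(2) by (auto simp: V.basis_def)
  define s where "s = (\<lambda>v. SOME x. x \<in> A \<and> \<phi> x = v)"
  have s: "s v \<in> A \<and> \<phi> (s v) = v" if "v \<in> B" for v
  proof -
    have "v \<in> \<phi> ` A" using that Bc(1) unfolding \<phi>_carrier by blast
    then have "\<exists>x. x \<in> A \<and> \<phi> x = v" by blast
    then show ?thesis unfolding s_def by (rule someI_ex)
  qed
  let ?E = "s ` B"
  have fin: "finite ?E" using B by simp
  have EA: "?E \<subseteq> A" using s by blast
  have inj: "inj_on \<phi> ?E" using s by (auto simp: inj_on_def)
  have BE: "B = \<phi> ` ?E" using s by (force simp: image_image)
  have gen: "\<exists>r. \<phi> (y - (\<Sum>e\<in>?E. act (r e) e)) = \<zero>\<^bsub>M\<^esub>" if y: "y \<in> A" for y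
  proof -
    have "\<phi> y \<in> V.span B" using y Bc(3) \<phi>_in by simp
    then obtain a where a: "a \<in> B \<rightarrow> carrier K" "V.lincomb a B = \<phi> y" using V.finite_in_span[OF B(1) Bc(1)] by blast
    have "\<forall>e. \<exists>r. e \<in> ?E \<longrightarrow> a (\<phi> e) = \<kappa> r" using a(1) kcar s by (auto simp: Pi_def)
    then obtain r where r: "\<And>e. e \<in> ?E \<Longrightarrow> a (\<phi> e) = \<kappa> (r e)" by metis
    have "\<phi> y = \<phi> (\<Sum>e\<in>?E. act (r e) e)" using lincomb_\<phi>[OF fin EA inj, of a r, OF r] a(2) BE by simp
    moreover have "(\<Sum>e\<in>?E. act (r e) e) \<in> A" by (rule A_sum) (use EA A_act in auto)
    ultimately show ?thesis using \<phi>_eq_iff y by blast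
  qed
  have "carrier K \<noteq> {\<zero>\<^bsub>K\<^esub>}" using V.one_not_zero V.R.one_closed by blast
  then have "\<zero>\<^bsub>M\<^esub> \<notin> B" using V.zero_nin_lin_indpt[OF Bc(1,2)] by simp
  then have "\<phi> e \<noteq> \<zero>\<^bsub>M\<^esub>" if "e \<in> ?E" for e using that s by auto
  then show ?thesis using that fin EA inj BE gen by blast
qed

end

section \<open>Quotient spaces\<close>

definition coset :: "'v::ab_group_add set \<Rightarrow> 'v \<Rightarrow> 'v set" where
  "coset N x = {x + n | n. n \<in> N}"

lemma coset_mem: "y \<in> coset N x \<longleftrightarrow> y - x \<in> N" unfolding coset_def by (auto intro: exI[of _ "y - x"])

lemma self_in_coset: "0 \<in> N \<Longrightarrow> x \<in> coset N x" by (simp add: coset_mem)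

lemma coset_eq_iff:
  assumes N: "0 \<in> N" "\<And>x y. x \<in> N \<Longrightarrow> y \<in> N \<Longrightarrow> x + y \<in> N" "\<And>x. x \<in> N \<Longrightarrow> - x \<in> N"
  shows "coset N x = coset N y \<longleftrightarrow> x - y \<in> N"
proof
  assume "coset N x = coset N y"
  then have "x \<in> coset N y" using self_in_coset[OF N(1)] by blast
  then show "x - y \<in> N" by (simp add: coset_mem)
next
  assume xy: "x - y \<in> N"
  have "z - x \<in> N \<longleftrightarrow> z - y \<in> N" for z
  proof
    show "z - y \<in> N" if "z - x \<in> N" using N(2)[OF that xy] by simp
    show "z - x \<in> N" if "z - y \<in> N" using N(2)[OF that N(3)[OF xy]] by simp
  qed
  then show "coset N x = coset N y" by (auto simp: coset_mem)
qed

lemma coset_add: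
  assumes N: "0 \<in> N" "\<And>x y. x \<in> N \<Longrightarrow> y \<in> N \<Longrightarrow> x + y \<in> N"
  shows "{a + b | a b. a \<in> coset N x \<and> b \<in> coset N y} = coset N (x + y)"
proof
  show "{a + b | a b. a \<in> coset N x \<and> b \<in> coset N y} \<subseteq> coset N (x + y)"
    unfolding coset_def using N(2) by (force simp: algebra_simps)
  show "coset N (x + y) \<subseteq> {a + b | a b. a \<in> coset N x \<and> b \<in> coset N y}"
  proof
    fix z assume "z \<in> coset N (x + y)"
    then obtain n where n: "z = x + y + n" "n \<in> N" by (auto simp: coset_def)
    have "x + n \<in> coset N x" "y \<in> coset N y" using n N(1) by (auto simp: coset_mem)
    moreover have "z = (x + n) + y" using n by (simp add: algebra_simps)
    ultimately show "z \<in> {a + b | a b. a \<in> coset N x \<and> b \<in> coset N y}" by blast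
  qed
qed

section \<open>The linear form e_p on polynomials, as the constant coefficient modulo p\<close>

lemma e_cong: "p dvd a - b \<Longrightarrow> coeff (a mod p) 0 = coeff (b mod p) 0" for p :: "'a::field poly"
  by (simp add: mod_eq_dvd_iff[symmetric])

lemma e_add: "coeff ((a + b) mod p) 0 = coeff (a mod p) 0 + coeff (b mod p) 0" for p :: "'a::field poly"
  by (simp add: poly_mod_add_left)

lemma e_smult: "coeff (Polynomial.smult c a mod p) 0 = c * coeff (a mod p) 0" for p :: "'a::field poly"
  by (simp add: mod_smult_left)

lemma irreducible_degree: "irreducible p \<Longrightarrow> degree p > 0" for p :: "'a::field poly"
  by (metis gr0I irreducible_def is_unit_iff_degree)

text \<open>If \<open>p\<close> did not divide \<open>c\<close>, an inverse \<open>q\<close> of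
  \<open>c\<close> modulo \<open>p\<close> would give the value of e_p at 1, which is 1.\<close>

lemma e_nondeg:
  fixes p c :: "'a::field poly"
  assumes p: "irreducible p" and c: "\<And>q. coeff ((q * c) mod p) 0 = 0"
  shows "p dvd c"
proof (rule ccontr)
  assume "\<not> p dvd c"
  then obtain r s where rs: "r * c + s * p ^ 1 = 1" using irreducible_bezout[OF p] by blast
  have "p dvd r * c - 1" using rs by (metis add_diff_cancel_left' diff_add_eq_diff_diff_swap dvd_minus_iff dvd_triv_right minus_diff_eq power_one_right add.commute)
  then have "coeff ((r * c) mod p) 0 = coeff (1 mod p) 0" by (rule e_cong)
  moreover have "1 mod p = 1" using irreducible_degree[OF p] by (intro mod_poly_less) simp
  ultimately show False using c[of r] by simp
qed

text \<open>Substituting \<open>-t\<close> preserves degrees, so it commutes with reduction modulo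
  \<open>p\<close> and modulo its opposite; and it preserves constant coefficients.\<close>

lemma e_neg_arg:
  fixes p h :: "'a::field poly"
  assumes p: "irreducible p"
  shows "coeff (neg_arg h mod op_poly p) 0 = coeff (h mod p) 0"
proof -
  have "p dvd h - h mod p" by (simp add: dvd_minus_mod)
  then have "neg_arg p dvd neg_arg h - neg_arg (h mod p)" using neg_arg_dvd_iff[of p "h - h mod p"] by (simp add: neg_arg_simps)
  then have "op_poly p dvd neg_arg h - neg_arg (h mod p)" by (simp add: op_poly_def smult_dvd_iff)
  then have "coeff (neg_arg h mod op_poly p) 0 = coeff (neg_arg (h mod p) mod op_poly p) 0" by (rule e_cong)
  also have "neg_arg (h mod p) mod op_poly p = neg_arg (h mod p)"
  proof (rule mod_poly_less)
    have "degree (h mod p) < degree p" using irreducible_degree[OF p] degree_mod_less[of p h] p by (cases "h mod p = 0") auto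
    then show "degree (neg_arg (h mod p)) < degree (op_poly p)" by (simp add: op_poly_def)
  qed
  finally show ?thesis by (simp add: neg_arg_def poly_0_coeff_0[symmetric] poly_pcompose)
qed

context selfadjoint_endo
begin

section \<open>The quadratic invariants\<close>

abbreviation "Vs \<equiv> invariant_space scale u"

abbreviation "Vf \<equiv> invariant_form scale b u"

abbreviation "Bs \<equiv> base_space scale u"

abbreviation "Bf \<equiv> base_form scale b u"

lemma kernel_eq: "primary_kernel scale u p k = {x. P (p ^ k) x = 0}" by (simp add: primary_kernel_def P_power)

lemma denominator_eq: "invariant_denominator scale u p k = Nk UNIV p k"
  by (auto simp: invariant_denominator_def Nk_def kernel_eq)

abbreviation co :: "'a poly \<Rightarrow> nat \<Rightarrow> 'v \<Rightarrow> 'v set" where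
  "co p k \<equiv> coset (Nk UNIV p k)"

lemma Nk_sub: "0 \<in> Nk UNIV p k" "x \<in> Nk UNIV p k \<Longrightarrow> y \<in> Nk UNIV p k \<Longrightarrow> x + y \<in> Nk UNIV p k"
  "x \<in> Nk UNIV p k \<Longrightarrow> - x \<in> Nk UNIV p k" "x \<in> Nk UNIV p k \<Longrightarrow> P q x \<in> Nk UNIV p k"
  "x \<in> Nk UNIV p k \<Longrightarrow> a *s x \<in> Nk UNIV p k"
proof -
  have N: "subspace (Nk UNIV p k)" by (rule subspace_Nk[OF subspace_UNIV])
  show "0 \<in> Nk UNIV p k" "x \<in> Nk UNIV p k \<Longrightarrow> y \<in> Nk UNIV p k \<Longrightarrow> x + y \<in> Nk UNIV p k"
    "x \<in> Nk UNIV p k \<Longrightarrow> - x \<in> Nk UNIV p k" "x \<in> Nk UNIV p k \<Longrightarrow> a *s x \<in> Nk UNIV p k"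
    using subspace_0[OF N] subspace_add[OF N] subspace_neg[OF N] subspace_scale[OF N] by auto
  show "x \<in> Nk UNIV p k \<Longrightarrow> P q x \<in> Nk UNIV p k" by (rule Nk_P[OF subspace_UNIV]) (auto simp: stable_def)
qed

lemma co_eq_iff: "co p k x = co p k y \<longleftrightarrow> x - y \<in> Nk UNIV p k" by (rule coset_eq_iff) (auto intro: Nk_sub)

lemma co_0: "co p k 0 = Nk UNIV p k" by (auto simp: coset_def)

lemma co_zero_iff: "co p k x = Nk UNIV p k \<longleftrightarrow> x \<in> Nk UNIV p k" using co_eq_iff[of p k x 0] by (simp add: co_0)

lemma inv_simps:
  "carrier (Vs p k) = co p k ` {x. P (p ^ k) x = 0}"
  "\<zero>\<^bsub>Vs p k\<^esub> = Nk UNIV p k"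
  "co p k x \<oplus>\<^bsub>Vs p k\<^esub> co p k y = co p k (x + y)"
  "carrier (Bs p k) = co p k ` {x. P (p ^ k) x = 0}"
  "\<zero>\<^bsub>Bs p k\<^esub> = Nk UNIV p k"
  "co p k x \<oplus>\<^bsub>Bs p k\<^esub> co p k y = co p k (x + y)" using coset_add[of "Nk UNIV p k" x y] Nk_sub
  by (simp_all add: invariant_space_def base_space_def quotient_space_def denominator_eq kernel_eq Let_def coset_def[abs_def])

text \<open>Two polynomials of one class differ by a multiple of \<open>p\<close>, which sends
  \<open>x\<close> into both the image of \<open>P p\<close> and the kernel of
  \<open>P (p ^ k)\<close>, hence into the denominator.\<close>

lemma inv_smult:
  assumes x: "P (p ^ k) x = 0" and k: "k \<ge> 1"
  shows "cls p q \<odot>\<^bsub>Vs p k\<^esub> co p k x = co p k (P q x)"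
proof -
  let ?N = "Nk UNIV p k"
  have "{P q' x' + n | q' x' n. q' \<in> cls p q \<and> x' \<in> co p k x \<and> n \<in> ?N} = co p k (P q x)"
  proof
    show "{P q' x' + n | q' x' n. q' \<in> cls p q \<and> x' \<in> co p k x \<and> n \<in> ?N} \<subseteq> co p k (P q x)"
    proof
      fix z assume "z \<in> {P q' x' + n | q' x' n. q' \<in> cls p q \<and> x' \<in> co p k x \<and> n \<in> ?N}"
      then obtain q' x' n where z: "z = P q' x' + n" "q' \<in> cls p q" "x' - x \<in> ?N" "n \<in> ?N" by (auto simp: coset_mem)
      obtain s where s: "q' - q = p * s" using z(2) by (auto simp: cls_def elim: dvdE)
      have "P (q' - q) x = P p (P s x)" unfolding s P_mult ..
      moreover have "P (p ^ k) (P p (P s x)) = 0" using x by (simp add: P_commute[of "p ^ k"] P_linE)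
      ultimately have "P (q' - q) x = 0 + P p (P s x)" "P (p ^ k) (P p (P s x)) = 0" by simp_all
      then have 1: "P (q' - q) x \<in> ?N" unfolding Nk_def using P_linE(3) by blast
      have 2: "P q' (x' - x) \<in> ?N" by (rule Nk_sub(4)[OF z(3)])
      have "z - P q x = P (q' - q) x + (P q' (x' - x) + n)" using z(1) by (simp add: P_diff P_linE)
      then show "z \<in> co p k (P q x)" unfolding coset_mem using 1 2 z(4) Nk_sub(2) by metis
    qed
    show "co p k (P q x) \<subseteq> {P q' x' + n | q' x' n. q' \<in> cls p q \<and> x' \<in> co p k x \<and> n \<in> ?N}"
      using self_in_cls[of q p] self_in_coset[OF Nk_sub(1), of x p k] unfolding coset_def by blast
  qed
  then show ?thesis by (simp add: invariant_space_def quotient_space_def denominator_eq Let_def)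
qed

lemma base_smult: "a \<odot>\<^bsub>Bs p k\<^esub> co p k x = co p k (a *s x)"
proof -
  let ?N = "Nk UNIV p k"
  have "{a *s x' + n | x' n. x' \<in> co p k x \<and> n \<in> ?N} = co p k (a *s x)"
  proof
    show "{a *s x' + n | x' n. x' \<in> co p k x \<and> n \<in> ?N} \<subseteq> co p k (a *s x)"
    proof
      fix z assume "z \<in> {a *s x' + n | x' n. x' \<in> co p k x \<and> n \<in> ?N}"
      then obtain x' n where z: "z = a *s x' + n" "x' - x \<in> ?N" "n \<in> ?N" by (auto simp: coset_mem)
      have "z - a *s x = a *s (x' - x) + n" using z(1) by (simp add: scale_right_diff_distrib)
      then show "z \<in> co p k (a *s x)" unfolding coset_mem using z Nk_sub(2,5) by metis
    qed
    show "co p k (a *s x) \<subseteq> {a *s x' + n | x' n. x' \<in> co p k x \<and> n \<in> ?N}"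
      using self_in_coset[OF Nk_sub(1), of x p k] unfolding coset_def by blast
  qed
  then show ?thesis by (simp add: base_space_def quotient_space_def denominator_eq Let_def)
qed

lemma rep_inv:
  assumes p: "irreducible p" and k: "k \<ge> 1"
  shows "represented (residue_field p) (Vs p k) (cls p) {x. P (p ^ k) x = 0} P (co p k)"
proof (rule represented.intro, goal_cases)
  case 1 show ?case by (rule residue_is_field[OF p])
qed (use residue_is_field[OF p] in \<open>auto simp: residue_carrier residue_add residue_mult residue_one residue_zero
    P_linE P_commute[of "p ^ k"] P_add P_mult inv_simps co_0 inv_smult[OF _ k]\<close>)

lemma rep_base: "represented class_ring (Bs p k) (\<lambda>a. a) {x. P (p ^ k) x = 0} scale (co p k)"
proof (rule represented.intro, goal_cases)
  case 1 show ?case by (rule class_field)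
qed (auto simp: P_linE inv_simps co_0 base_smult scale_right_distrib scale_left_distrib)

lemma base_form_co:
  assumes x: "P (p ^ k) x = 0" and y: "P (p ^ k) y = 0" and k: "k \<ge> 1"
  shows "Bf p k (co p k x) (co p k y) = b x (P (p ^ (k - 1)) y)"
proof -
  have eq: "b x' (P (p ^ (k - 1)) y') = b x (P (p ^ (k - 1)) y)" if "x' \<in> co p k x" "y' \<in> co p k y" for x' y'
  proof -
    have n: "x' - x \<in> Nk UNIV p k" "y' - y \<in> Nk UNIV p k" using that by (auto simp: coset_mem)
    have x': "P (p ^ k) x' = 0" using Nk_kernel[OF n(1) k] x by (simp add: P_linE)
    have 1: "b (x' - x) (P (p ^ (k - 1)) y) = 0" using Nk_orth[OF n(1) y k, of 1] by simp
    have "b (y' - y) (P (p ^ (k - 1)) x') = 0" using Nk_orth[OF n(2) x' k, of 1] by simp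
    then have 2: "b x' (P (p ^ (k - 1)) (y' - y)) = 0" by (metis b_P b_sym)
    show ?thesis using 1 2 by (simp add: bl P_linE)
  qed
  have "{b x' (P (p ^ (k - 1)) y') | x' y'. x' \<in> co p k x \<and> y' \<in> co p k y} = {b x (P (p ^ (k - 1)) y)}"
    using eq self_in_coset[OF Nk_sub(1), of x p k] self_in_coset[OF Nk_sub(1), of y p k] by blast
  then show ?thesis by (simp add: base_form_def P_power)
qed

text \<open>The class of \<open>c\<close> is the value of \<open>(b,u)\<^sub>p\<^sub>,\<^sub>k\<close> at the classes of \<open>x\<close> and \<open>y\<close>.\<close>

definition form_val :: "'a poly \<Rightarrow> nat \<Rightarrow> 'v \<Rightarrow> 'v \<Rightarrow> 'a poly \<Rightarrow> bool" where
  "form_val p k x y c \<longleftrightarrow> (\<forall>q. b x (P (p ^ (k - 1) * q) y) = coeff ((q * c) mod p) 0)"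

text \<open>With \<open>z = P (p ^ (k - 1)) y\<close>, the functional sending \<open>q\<close> to
  \<open>b x (P q z)\<close> factors through the residue field, since \<open>P p z = 0\<close>. The
  form (q, r) -> e_p(q r) is nondegenerate there, so it represents this functional. To apply
  \<open>riesz\<close>, it is transported to the cyclic space of \<open>z\<close>.\<close>

lemma form_val_exists:
  assumes p: "irreducible p" and k: "k \<ge> 1" and y: "P (p ^ k) y = 0"
  shows "\<exists>c. form_val p k x y c"
proof -
  define z where "z = P (p ^ (k - 1)) y"
  have bz: "b x (P (p ^ (k - 1) * q) y) = b x (P q z)" for q by (simp add: z_def P_mult P_commute)
  have pz: "P p z = 0"
  proof -
    have "p ^ k = p * p ^ (k - 1)" using k by (simp add: power_eq_if)
    then show ?thesis using y by (simp add: z_def P_mult)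
  qed
  show ?thesis
  proof (cases "z = 0")
    case True
    then show ?thesis unfolding form_val_def bz by (intro exI[of _ 0]) (simp add: P_linE bl)
  next
    case False
    have ann: "p dvd h" if "P h z = 0" for h
    proof (rule ccontr)
      assume "\<not> p dvd h"
      then obtain r s where rs: "r * h + s * p ^ 1 = 1" using irreducible_bezout[OF p] by blast
      have "z = P (r * h + s * p ^ 1) z" unfolding rs by simp
      also have "\<dots> = 0" using that pz by (simp add: P_add P_mult P_linE)
      finally show False using False by simp
    qed
    define S where "S = cyc z"
    have S: "subspace S" unfolding S_def by (rule subspace_cyc)
    define qq where "qq w = (SOME q. P q z = w)" for w
    have qq: "p dvd qq (P q z) - q" for q
    proof -
      have "P (qq (P q z)) z = P q z" unfolding qq_def by (rule someI[of _ q]) simp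
      then have "P (qq (P q z) - q) z = 0" by (simp add: P_diff)
      then show ?thesis by (rule ann)
    qed
    define m where "m v w = coeff ((qq v * qq w) mod p) 0" for v w
    have m: "m (P q z) (P r z) = coeff ((q * r) mod p) 0" for q r unfolding m_def
    proof (rule e_cong)
      have "qq (P q z) * qq (P r z) - q * r = (qq (P q z) - q) * qq (P r z) + q * (qq (P r z) - r)"
        by (simp add: algebra_simps)
      then show "p dvd qq (P q z) * qq (P r z) - q * r" using qq[of q] qq[of r] by simp
    qed
    obtain B where B: "B \<subseteq> S" "independent B" "S \<subseteq> span B" "card B = dim S" by (rule basis_exists[of S])
    have sB: "span B = S" using B S span_subspace by blast
    have vp: "vector_space_pair scale scale" by unfold_locales
    obtain g where g: "lin g" "\<And>x. x \<in> B \<Longrightarrow> g x = id x" "range g = span (id ` B)"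
      using vector_space_pair.linear_independent_extend_subspace[OF vp B(2), of id] by blast
    have gS: "g x \<in> S" for x using g(3) sB by auto
    have gid: "g x = x" if "x \<in> S" for x
    proof -
      have "x \<in> span B" using that B(3) by blast
      then show ?thesis by (induct rule: span_induct_alt) (auto simp: linE[OF g(1)] g(2))
    qed
    \<comment> \<open>\<open>riesz\<close> speaks of forms on the whole of V, so \<open>m\<close> is
      extended by the linear projection \<open>g\<close> onto \<open>S\<close>.\<close>
    define \<beta> where "\<beta> v w = m (g v) (g w)" for v w
    have SE: "\<exists>q. v = P q z" if "v \<in> S" for v using that by (auto simp: S_def cyc_def)
    have \<beta>b: "bilinear_form scale \<beta>"
    proof (rule bilinI)
      fix v w t a
      obtain q r s where q: "g v = P q z" "g w = P r z" "g t = P s z" using SE[OF gS] by metis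
      show "\<beta> (v + w) t = \<beta> v t + \<beta> w t"
        unfolding \<beta>_def lin_add[OF g(1)] q P_add[symmetric] m by (simp add: distrib_right e_add)
      show "\<beta> v (w + t) = \<beta> v w + \<beta> v t"
        unfolding \<beta>_def lin_add[OF g(1)] q P_add[symmetric] m by (simp add: distrib_left e_add)
      show "\<beta> (a *s v) w = a * \<beta> v w" unfolding \<beta>_def lin_scale[OF g(1)] q P_smult[symmetric] m by (simp add: e_smult)
      show "\<beta> v (a *s w) = a * \<beta> v w" unfolding \<beta>_def lin_scale[OF g(1)] q P_smult[symmetric] m by (simp add: e_smult)
    qed
    have \<beta>s: "symmetric_form \<beta>" unfolding symmetric_form_def \<beta>_def m_def by (simp add: mult.commute)
    have \<beta>v: "\<beta> (P q z) (P r z) = coeff ((q * r) mod p) 0" for q r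
      unfolding \<beta>_def using gid P_in_cyc m by (simp add: S_def)
    have \<beta>n: "perp \<beta> S S = {0}"
    proof -
      have "w = 0" if w: "w \<in> perp \<beta> S S" for w
      proof -
        obtain r where r: "w = P r z" using SE w by (auto simp: perp_def)
        have "coeff ((q * r) mod p) 0 = 0" for q using w \<beta>v[of q r] P_in_cyc[of q z] by (simp add: perp_def r S_def)
        then have "p dvd r" by (rule e_nondeg[OF p])
        then obtain s where "r = s * p" by (metis dvdE mult.commute)
        then show ?thesis using r pz by (simp add: P_mult P_linE)
      qed
      moreover have "0 \<in> perp \<beta> S S" using subspace_0[OF S] by (auto simp: perp_def bil[OF \<beta>b])
      ultimately show ?thesis by blast
    qed
    obtain w where w: "w \<in> S" "\<And>v. v \<in> S \<Longrightarrow> b x v = \<beta> w v" by (rule riesz[OF \<beta>b \<beta>s S \<beta>n, of "b x"]) (auto simp: bl)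
    obtain c where c: "w = P c z" using SE[OF w(1)] by blast
    have "b x (P q z) = coeff ((q * c) mod p) 0" for q
      using w(2)[of "P q z"] P_in_cyc[of q z] \<beta>v[of c q] c by (simp add: S_def mult.commute)
    then show ?thesis unfolding form_val_def bz by blast
  qed
qed

lemma form_val_unique: "irreducible p \<Longrightarrow> form_val p k x y c \<Longrightarrow> form_val p k x y c' \<Longrightarrow> cls p c = cls p c'"
proof -
  assume p: "irreducible p" and c: "form_val p k x y c" "form_val p k x y c'"
  have "coeff ((q * (c - c')) mod p) 0 = 0" for q
  proof -
    have "q * (c - c') + q * c' = q * c" by (simp add: algebra_simps)
    then show ?thesis using c e_add[of "q * (c - c')" "q * c'" p] by (simp add: form_val_def)
  qed
  then show ?thesis unfolding cls_eq_iff by (rule e_nondeg[OF p])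
qed

lemma invariant_form_co:
  assumes p: "irreducible p" and k: "k \<ge> 1" and x: "P (p ^ k) x = 0" and y: "P (p ^ k) y = 0" and c: "form_val p k x y c"
  shows "Vf p k (co p k x) (co p k y) = cls p c"
proof -
  have base: "Bf p k (co p k x) (cls p q \<odot>\<^bsub>Vs p k\<^esub> co p k y) =
      b x (P (p ^ (k - 1) * q) y)" for q
  proof -
    have "P (p ^ k) (P q y) = 0" using y by (simp add: P_commute[of _ q] P_linE)
    then show ?thesis unfolding inv_smult[OF y k] by (subst base_form_co[OF x _ k]) (auto simp: P_mult)
  qed
  have char: "(\<forall>l \<in> carrier (residue_field p).
           Bf p k (co p k x) (l \<odot>\<^bsub>Vs p k\<^esub> co p k y)
             = residue_form p (l \<otimes>\<^bsub>residue_field p\<^esub> cls p d)) \<longleftrightarrow> form_val p k x y d" for d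
    unfolding residue_carrier form_val_def by (auto simp: base residue_mult residue_form_cls)
  show ?thesis unfolding invariant_form_def
  proof (rule the_equality)
    show "cls p c \<in> carrier (residue_field p) \<and> (\<forall>l \<in> carrier (residue_field p).
           Bf p k (co p k x) (l \<odot>\<^bsub>Vs p k\<^esub> co p k y)
             = residue_form p (l \<otimes>\<^bsub>residue_field p\<^esub> cls p c))" using char c by simp
    fix d assume d: "d \<in> carrier (residue_field p) \<and> (\<forall>l \<in> carrier (residue_field p).
           Bf p k (co p k x) (l \<odot>\<^bsub>Vs p k\<^esub> co p k y)
             = residue_form p (l \<otimes>\<^bsub>residue_field p\<^esub> d))"
    then obtain d' where d': "d = cls p d'" by (auto simp: residue_carrier)
    then have "form_val p k x y d'" using char d by blast
    then show "d = cls p c" unfolding d' using form_val_unique[OF p] c by blast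
  qed
qed

lemma form_val_add_left: "form_val p k x y c \<Longrightarrow> form_val p k x' y c' \<Longrightarrow> form_val p k (x + x') y (c + c')"
  by (simp add: form_val_def bl distrib_left e_add)

lemma form_val_sym: "form_val p k x y c \<Longrightarrow> form_val p k y x c" unfolding form_val_def by (metis b_P b_sym)

lemma form_val_0_iff:
  assumes p: "irreducible p" and c: "form_val p k x y c"
  shows "cls p c = cls p 0 \<longleftrightarrow> (\<forall>q. b x (P (p ^ (k - 1) * q) y) = 0)"
proof
  assume "cls p c = cls p 0"
  then have "p dvd c" by (simp add: cls_eq_iff)
  then show "\<forall>q. b x (P (p ^ (k - 1) * q) y) = 0" using c by (auto simp: form_val_def elim!: dvdE)
next
  assume "\<forall>q. b x (P (p ^ (k - 1) * q) y) = 0"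
  then have "p dvd c" using c by (intro e_nondeg[OF p]) (simp add: form_val_def)
  then show "cls p c = cls p 0" by (simp add: cls_eq_iff)
qed

subsection \<open>Condition (i)\<close>

text \<open>The polar form of \<open>C x x\<close> is twice \<open>C\<close>, and 2 is
  invertible.\<close>

lemma polar_zero_iff:
  assumes p: "irreducible p" and k: "k \<ge> 1" and x: "P (p ^ k) x = 0" and y: "P (p ^ k) y = 0"
  shows "polar_form (residue_field p) (Vs p k)
      (quadratic_form_of (Vf p k)) (co p k x) (co p k y) = \<zero>\<^bsub>residue_field p\<^esub> \<longleftrightarrow>
    (\<forall>q. b x (P (p ^ (k - 1) * q) y) = 0)"
proof -
  obtain cx where cx: "form_val p k x x cx" using form_val_exists[OF p k x] by blast
  obtain cy where cy: "form_val p k y y cy" using form_val_exists[OF p k y] by blast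
  obtain c where c: "form_val p k x y c" using form_val_exists[OF p k y] by blast
  have xy: "P (p ^ k) (x + y) = 0" using x y by (simp add: P_linE)
  have "form_val p k (x + y) x (cx + c)" by (rule form_val_add_left[OF cx form_val_sym[OF c]])
  moreover have "form_val p k (x + y) y (c + cy)" by (rule form_val_add_left[OF c cy])
  ultimately have s: "form_val p k (x + y) (x + y) ((cx + c) + (c + cy))"
    by (intro form_val_add_left[of p k x "x + y" _ y]) (auto dest: form_val_sym)
  have e: "(cx + c) + (c + cy) - cx - cy = Polynomial.smult 2 c"
    using smult_add_left[of 1 1 c] by (simp only: one_add_one smult_1_left) simp
  have "polar_form (residue_field p) (Vs p k)
      (quadratic_form_of (Vf p k)) (co p k x) (co p k y) = cls p (Polynomial.smult 2 c)"
    unfolding polar_form_def quadratic_form_of_def inv_simps invariant_form_co[OF p k xy xy s]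
      invariant_form_co[OF p k x x cx] invariant_form_co[OF p k y y cy] residue_minus[OF p] e ..
  moreover have "cls p (Polynomial.smult 2 c) = cls p 0 \<longleftrightarrow> cls p c = cls p 0"
    using two by (simp add: cls_eq_iff dvd_smult_iff)
  ultimately show ?thesis using form_val_0_iff[OF p c] by (simp add: residue_zero)
qed

text \<open>Equality of two classes is tested with \<open>e_nondeg\<close>, and
  \<open>e_neg_arg\<close> moves the involution from the value to the test polynomial.\<close>

lemma skew_iff:
  assumes p: "p \<in> Irr0" and k: "k \<ge> 1" and x: "P (p ^ k) x = 0"
  shows "residue_neg (quadratic_form_of (Vf p k) (co p k x)) =
      \<ominus>\<^bsub>residue_field p\<^esub> quadratic_form_of (Vf p k) (co p k x) \<longleftrightarrow>
    (\<forall>h. b x (P (p ^ (k - 1) * neg_arg h) x) = - b x (P (p ^ (k - 1) * h) x))"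
proof -
  note n = Irr0_neg_arg[OF p]
  have irr: "irreducible p" using p by (simp add: Irr0_def Irr_def)
  obtain c where c: "form_val p k x x c" using form_val_exists[OF irr k x] by blast
  have e: "coeff ((neg_arg h * c) mod p) 0 = coeff ((h * neg_arg c) mod p) 0" for h
    using e_neg_arg[OF irr, of "h * neg_arg c"] by (simp add: n neg_arg_simps)
  have "residue_neg (quadratic_form_of (Vf p k) (co p k x)) =
      \<ominus>\<^bsub>residue_field p\<^esub> quadratic_form_of (Vf p k) (co p k x) \<longleftrightarrow> p dvd neg_arg c + c"
    unfolding quadratic_form_of_def invariant_form_co[OF irr k x x c] residue_neg_cls residue_uminus[OF irr] n cls_eq_iff
    by simp
  also have "\<dots> \<longleftrightarrow> (\<forall>h. coeff ((h * (neg_arg c + c)) mod p) 0 = 0)"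
  proof
    assume "p dvd neg_arg c + c"
    then show "\<forall>h. coeff ((h * (neg_arg c + c)) mod p) 0 = 0" by (auto elim!: dvdE)
  next
    assume "\<forall>h. coeff ((h * (neg_arg c + c)) mod p) 0 = 0"
    then show "p dvd neg_arg c + c" by (intro e_nondeg[OF irr]) blast
  qed
  also have "\<dots> \<longleftrightarrow> (\<forall>h. b x (P (p ^ (k - 1) * neg_arg h) x) = - b x (P (p ^ (k - 1) * h) x))"
    using c by (simp add: form_val_def e distrib_left e_add eq_neg_iff_add_eq_0)
  finally show ?thesis .
qed

lemma condition_i_iff:
  assumes p: "p \<in> Irr0" and k: "k \<ge> 1"
  shows "skew_representable (residue_field p) residue_neg (Vs p k)
            (quadratic_form_of (Vf p k)) \<longleftrightarrow>
    (\<exists>E. obasis p k E \<and> (\<forall>e\<in>E. \<forall>h. b e (P (p ^ (k - 1) * neg_arg h) e) = - b e (P (p ^ (k - 1) * h) e)))"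
  (is "?L \<longleftrightarrow> ?R")
proof -
  have irr: "irreducible p" using p by (simp add: Irr0_def Irr_def)
  interpret R: represented "residue_field p" "Vs p k" "cls p" "{x. P (p ^ k) x = 0}" P "co p k"
    by (rule rep_inv[OF irr k])
  show ?thesis
  proof
    assume ?L
    then obtain B where B: "finite B" "vectorspace.basis (residue_field p) (Vs p k) B"
      "\<forall>x \<in> B. \<forall>y \<in> B. x \<noteq> y \<longrightarrow> polar_form (residue_field p) (Vs p k)
          (quadratic_form_of (Vf p k)) x y = \<zero>\<^bsub>residue_field p\<^esub>"
      "\<forall>x \<in> B. residue_neg (quadratic_form_of (Vf p k) x) =
          \<ominus>\<^bsub>residue_field p\<^esub> quadratic_form_of (Vf p k) x" unfolding skew_representable_def by blast
    obtain E where E: "finite E" "E \<subseteq> {x. P (p ^ k) x = 0}" "inj_on (co p k) E" "B = co p k ` E"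
      "\<And>y. y \<in> {x. P (p ^ k) x = 0} \<Longrightarrow> \<exists>r. co p k (y - (\<Sum>e\<in>E. P (r e) e)) = \<zero>\<^bsub>Vs p k\<^esub>"
      "\<And>e. e \<in> E \<Longrightarrow> co p k e \<noteq> \<zero>\<^bsub>Vs p k\<^esub>" using R.basis_preimage[OF B(1,2)] by blast
    have Ek: "P (p ^ k) e = 0" if "e \<in> E" for e using E(2) that by blast
    have orth: "b e (P (p ^ (k - 1) * q) e') = 0" if "e \<in> E" "e' \<in> E" "e \<noteq> e'" for e e' q
    proof -
      have "co p k e \<noteq> co p k e'" using E(3) that by (auto simp: inj_on_def)
      then have "polar_form (residue_field p) (Vs p k)
          (quadratic_form_of (Vf p k)) (co p k e) (co p k e') = \<zero>\<^bsub>residue_field p\<^esub>" using B(3) E(4) that by blast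
      then show ?thesis using polar_zero_iff[OF irr k Ek[OF that(1)] Ek[OF that(2)]] by blast
    qed
    have span: "\<exists>c. y - (\<Sum>e\<in>E. P (c e) e) \<in> Nk UNIV p k" if "P (p ^ k) y = 0" for y
      using E(5)[of y] that by (simp add: inv_simps co_zero_iff)
    \<comment> \<open>A basis vector of value zero would be orthogonal to the whole basis, hence to
      V_{p,k}, and its class would vanish by nondegeneracy.\<close>
    have nd: "\<exists>q. b e (P (p ^ (k - 1) * q) e) \<noteq> 0" if e: "e \<in> E" for e
    proof (rule ccontr)
      assume n: "\<not> ?thesis"
      have "e \<in> Nk UNIV p k"
      proof (rule Nk_nondeg[OF Ek[OF e] k])
        fix y assume y: "P (p ^ k) y = 0"
        obtain c where c: "y - (\<Sum>e\<in>E. P (c e) e) \<in> Nk UNIV p k" using span[OF y] by blast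
        have "b (y - (\<Sum>e\<in>E. P (c e) e)) (P (p ^ (k - 1) * 1) e) = 0" by (rule Nk_orth[OF c Ek[OF e] k])
        then have "b e (P (p ^ (k - 1)) (y - (\<Sum>e\<in>E. P (c e) e))) = 0" using b_P b_sym by (simp only: mult_1_right)
        moreover have "b e (P (p ^ (k - 1)) (P (c e') e')) = 0" if "e' \<in> E" for e'
          unfolding P_mult[symmetric] using orth[OF e that] n by (cases "e = e'") auto
        ultimately show "b e (P (p ^ (k - 1)) y) = 0" by (simp add: P_linE bl bil_sum_right[OF b])
      qed
      then show False using E(6)[OF e] by (simp add: inv_simps co_zero_iff)
    qed
    have "obasis p k E" unfolding obasis_def using E(1) Ek nd orth span by blast
    moreover have "\<forall>e\<in>E. \<forall>h. b e (P (p ^ (k - 1) * neg_arg h) e) = - b e (P (p ^ (k - 1) * h) e)"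
      using B(4) E(4) skew_iff[OF p k Ek] by blast
    ultimately show ?R by blast
  next
    assume ?R
    then obtain E where E: "obasis p k E" and sk: "\<forall>e\<in>E. \<forall>h. b e (P (p ^ (k - 1) * neg_arg h) e) = - b e (P (p ^ (k - 1) * h) e)"
      by blast
    have E': "finite E" "\<And>e. e \<in> E \<Longrightarrow> P (p ^ k) e = 0" "\<And>e. e \<in> E \<Longrightarrow> \<exists>q. b e (P (p ^ (k - 1) * q) e) \<noteq> 0"
      "\<And>e e' q. e \<in> E \<Longrightarrow> e' \<in> E \<Longrightarrow> e \<noteq> e' \<Longrightarrow> b e (P (p ^ (k - 1) * q) e') = 0"
      "\<And>y. P (p ^ k) y = 0 \<Longrightarrow> \<exists>c. y - (\<Sum>e\<in>E. P (c e) e) \<in> Nk UNIV p k" using E by (auto simp: obasis_def)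
    have bas: "vectorspace.basis (residue_field p) (Vs p k) (co p k ` E)"
    proof (rule R.basis_image(2)[OF E'(1)])
      show "E \<subseteq> {x. P (p ^ k) x = 0}" using E'(2) by blast
      show "\<exists>r. co p k (y - (\<Sum>e\<in>E. P (r e) e)) = \<zero>\<^bsub>Vs p k\<^esub>" if "y \<in> {x. P (p ^ k) x = 0}" for y
        using E'(5)[of y] that by (simp add: inv_simps co_zero_iff)
      fix r assume "co p k (\<Sum>e\<in>E. P (r e) e) = \<zero>\<^bsub>Vs p k\<^esub>"
      then have n: "(\<Sum>e\<in>E. P (r e) e) \<in> Nk UNIV p k" by (simp add: inv_simps co_zero_iff)
      \<comment> \<open>Pairing a relation with \<open>e\<close> isolates its coefficient
        \<open>r e\<close>; if \<open>p\<close> did not divide it, it could be inverted modulo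
        \<open>p\<close>, and all values at \<open>e\<close> would vanish.\<close>
      show "\<forall>e\<in>E. cls p (r e) = \<zero>\<^bsub>residue_field p\<^esub>"
      proof
        fix e assume e: "e \<in> E"
        have z: "b e (P (p ^ (k - 1) * q * r e) e) = 0" for q
        proof -
          have "b (\<Sum>e\<in>E. P (r e) e) (P (p ^ (k - 1) * q) e) = 0" by (rule Nk_orth[OF n E'(2)[OF e] k])
          moreover have "b (\<Sum>e\<in>E. P (r e) e) (P (p ^ (k - 1) * q) e) = (\<Sum>e'\<in>E. b e' (P (p ^ (k - 1) * (q * r e')) e))"
            by (simp add: bil_sum_left[OF b] b_P_mult mult_ac)
          moreover have "\<dots> = (\<Sum>e'\<in>{e}. b e' (P (p ^ (k - 1) * (q * r e')) e))"
            by (rule sum.mono_neutral_right) (use E'(1,4) e in auto)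
          ultimately show ?thesis by (simp add: mult.assoc)
        qed
        have "p dvd r e"
        proof (rule ccontr)
          assume "\<not> p dvd r e"
          then obtain r' s where rs: "r' * r e + s * p ^ 1 = 1" using irreducible_bezout[OF irr] by blast
          obtain q where q: "b e (P (p ^ (k - 1) * q) e) \<noteq> 0" using E'(3)[OF e] by blast
          have pk: "p ^ (k - 1) * p = p ^ k" using k by (simp add: power_eq_if mult.commute)
          have "p ^ (k - 1) * q = p ^ (k - 1) * q * (r' * r e + s * p ^ 1)" using rs by simp
          also have "\<dots> = p ^ (k - 1) * (q * r') * r e + (q * s) * (p ^ (k - 1) * p)" by (simp add: algebra_simps)
          finally have "b e (P (p ^ (k - 1) * q) e) = b e (P (p ^ (k - 1) * (q * r') * r e + (q * s) * p ^ k) e)"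
            unfolding pk by simp
          also have "\<dots> = 0" using z[of "q * r'"] E'(2)[OF e] by (simp add: P_add P_mult[of "q * s"] P_linE bl)
          finally show False using q by simp
        qed
        then show "cls p (r e) = \<zero>\<^bsub>residue_field p\<^esub>" by (simp add: residue_zero cls_eq_iff)
      qed
    qed
    show ?L unfolding skew_representable_def
    proof (intro exI[of _ "co p k ` E"] conjI bas ballI impI)
      show "finite (co p k ` E)" using E'(1) by simp
      fix X assume "X \<in> co p k ` E"
      then obtain e where e: "X = co p k e" "e \<in> E" by blast
      show "residue_neg (quadratic_form_of (Vf p k) X) =
          \<ominus>\<^bsub>residue_field p\<^esub> quadratic_form_of (Vf p k) X"
        unfolding e(1) using skew_iff[OF p k E'(2)[OF e(2)]] sk e(2) by blast
      fix Y assume "Y \<in> co p k ` E" "X \<noteq> Y"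
      then obtain e' where e': "Y = co p k e'" "e' \<in> E" "e \<noteq> e'" using e by blast
      show "polar_form (residue_field p) (Vs p k)
          (quadratic_form_of (Vf p k)) X Y = \<zero>\<^bsub>residue_field p\<^esub>"
        unfolding e(1) e'(1) using polar_zero_iff[OF irr k E'(2)[OF e(2)] E'(2)[OF e'(2)]] E'(4)[OF e(2) e'(2,3)] by blast
    qed
  qed
qed

text \<open>The map is u^-1 z. The inverse of \<open>u\<close> is given by an odd polynomial
  \<open>r\<close> with \<open>r * T\<close> congruent to 1 modulo \<open>?m\<close>: the Bezout
  coefficient \<open>s0\<close> is antisymmetrized, which is possible because \<open>?m\<close> is
  invariant under \<open>-t\<close>. Oddness makes the map skew-adjoint and gives
  \<open>w (w x) = x\<close> from \<open>z (z x) = - u (u x)\<close>.\<close>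

lemma anticommuting_involution:
  assumes p: "p \<in> Irr" and nT: "\<not> T dvd p"
    and z: "lin z" "selfadjoint b z" "\<And>x. z (u x) = - u (z x)" "\<And>x. z (z x) = - u (u x)"
  shows "\<exists>w. lin w \<and> (\<forall>x. w (u x) = - u (w x)) \<and> (\<forall>x y. b (w x) y = - b x (w y)) \<and>
    (\<forall>x\<in>prim p \<union> prim (op_poly p). w (w x) = x)"
proof -
  let ?p' = "op_poly p"
  let ?m = "(p * ?p') ^ dimension"
  have irr: "irreducible p" "irreducible ?p'" using p op_poly_Irr[OF p] by (auto simp: Irr_def)
  have nT': "\<not> T dvd ?p'"
  proof
    assume "T dvd ?p'"
    then have "neg_arg T dvd neg_arg ?p'" by (simp only: neg_arg_dvd_iff)
    moreover have "p dvd neg_arg ?p' \<and> neg_arg ?p' dvd p"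
      using neg_arg_eq_op_poly[of ?p'] op_poly_op_poly[of p] by (simp add: smult_dvd_iff dvd_smult)
    ultimately have "- T dvd p" unfolding neg_arg_simps(9) using dvd_trans by blast
    then show False using nT by (simp only: minus_dvd_iff)
  qed
  have "\<not> T dvd p * ?p'"
  proof
    assume d: "T dvd p * ?p'"
    obtain r s where rs: "r * p + s * T ^ 1 = 1" using irreducible_bezout[OF irreducible_T nT] by blast
    have "?p' = (r * p + s * T ^ 1) * ?p'" unfolding rs by simp
    also have "\<dots> = r * (p * ?p') + (s * ?p') * T" by (simp add: algebra_simps)
    finally have "T dvd ?p'" using d by (metis dvd_add dvd_mult dvd_triv_right)
    then show False using nT' by blast
  qed
  then have "\<not> T dvd ?m" by (rule irreducible_not_dvd_power[OF irreducible_T])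
  then obtain r0 s0 where rs: "r0 * ?m + s0 * T ^ 1 = 1" using irreducible_bezout[OF irreducible_T] by blast
  have mm: "neg_arg ?m = ?m"
  proof -
    have "neg_arg (p * ?p') = p * ?p'"
    proof -
      have "neg_arg (p * ?p') = Polynomial.smult ((- 1) ^ degree p * (- 1) ^ degree ?p') (?p' * p)"
        unfolding neg_arg_simps(2) neg_arg_eq_op_poly[of p] neg_arg_eq_op_poly[of ?p'] op_poly_op_poly
        by (simp add: mult.commute)
      moreover have "degree ?p' = degree p" by (simp add: op_poly_def)
      moreover have "(- 1 :: 'a) ^ degree p * (- 1) ^ degree p = 1" by (simp flip: power_add)
      ultimately show ?thesis by (simp add: mult.commute)
    qed
    then show ?thesis by (simp add: neg_arg_simps(8))
  qed
  have sT: "s0 * T = 1 - r0 * ?m" using rs by (simp add: algebra_simps)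
  have "neg_arg (s0 * T) = 1 - neg_arg r0 * ?m" unfolding sT by (simp only: neg_arg_simps(2,3,6) mm)
  then have nsT: "neg_arg s0 * T = neg_arg r0 * ?m - 1" by (simp only: neg_arg_simps(2,9) mult_minus_right) (metis minus_diff_eq minus_minus)
  define r where "r = Polynomial.smult (1/2) (s0 - neg_arg s0)"
  have rodd: "neg_arg r = - r" by (simp add: r_def neg_arg_simps smult_diff_right)
  have rT: "?m dvd r * T - 1"
  proof -
    have "(s0 - neg_arg s0) * T = (1 + 1) - (r0 + neg_arg r0) * ?m"
      unfolding left_diff_distrib sT nsT by (simp add: algebra_simps)
    then have "r * T = Polynomial.smult (1/2) ((1 + 1) - (r0 + neg_arg r0) * ?m)" by (simp only: r_def mult_smult_left)
    have tw: "Polynomial.smult 2 (1 :: 'a poly) = 1 + 1"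
      using smult_add_left[of 1 1 "1 :: 'a poly"] by (simp only: one_add_one smult_1_left)
    note \<open>r * T = _\<close>
    also have "Polynomial.smult (1/2) ((1 + 1) - (r0 + neg_arg r0) * ?m) = Polynomial.smult (1/2) (Polynomial.smult 2 1) - Polynomial.smult (1/2) (r0 + neg_arg r0) * ?m"
      by (simp only: smult_diff_right mult_smult_left tw)
    also have "Polynomial.smult (1/2) (Polynomial.smult 2 1) = (1 :: 'a poly)" using two by simp
    finally have "r * T - 1 = - Polynomial.smult (1/2) (r0 + neg_arg r0) * ?m" by (simp add: algebra_simps)
    then show ?thesis by (metis dvd_triv_right)
  qed
  have rTx: "P (r * T) x = x" if "x \<in> prim p \<union> prim ?p'" for x
  proof -
    obtain h where h: "r * T - 1 = ?m * h" using rT by (rule dvdE)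
    have "P (r * T) x - x = P (?m * h) x" unfolding h[symmetric] P_diff by simp
    also have "\<dots> = 0" using that
    proof
      assume "x \<in> prim p"
      moreover have "?m * h = (?p' ^ dimension * h) * p ^ dimension" by (simp add: power_mult_distrib mult_ac)
      ultimately show ?thesis by (simp only: P_mult prim_def mem_Collect_eq P_linE)
    next
      assume "x \<in> prim ?p'"
      moreover have "?m * h = (p ^ dimension * h) * ?p' ^ dimension" by (simp add: power_mult_distrib mult_ac)
      ultimately show ?thesis by (simp only: P_mult prim_def mem_Collect_eq P_linE)
    qed
    finally show ?thesis by simp
  qed
  note zl = linE[OF z(1)]
  have zP: "z (P q x) = P (neg_arg q) (z x)" for q x by (rule P_anticommute[OF z(1,3)])
  let ?w = "\<lambda>x. P r (z x)"
  show ?thesis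
  proof (intro exI[of _ ?w] conjI allI ballI)
    show "lin ?w" by (rule linI) (auto simp: zl P_linE)
    show "?w (u x) = - u (?w x)" for x by (simp add: z(3) P_linE P_u)
    show "b (?w x) y = - b x (?w y)" for x y
    proof -
      have "b (?w x) y = b x (z (P r y))" using z(2) by (simp add: b_P selfadjoint_def)
      then show ?thesis by (simp add: zP rodd P_uminus bl)
    qed
    fix x assume x: "x \<in> prim p \<union> prim ?p'"
    have "?w (?w x) = P r (P (- r) (z (z x)))" by (simp add: zP rodd)
    also have "\<dots> = P (r * T) (P (r * T) x)" by (simp only: z(4) P_uminus P_linE u_lin P_mult P_T P_u minus_minus)
    also have "\<dots> = x" using rTx[OF x] by simp
    finally show "?w (?w x) = x" .
  qed
qed

text \<open>\<open>obasis_exists\<close> is applied to the vectors \<open>G\<close> fixed by the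
  involution \<open>w\<close>: since \<open>w\<close> is skew-adjoint and anticommutes with
  \<open>u\<close>, the value at a fixed vector changes sign under the involution of the residue
  field.\<close>

lemma condition_i_necessary:
  assumes p: "p \<in> Irr0" and k: "k \<ge> 1"
    and z: "lin z" "selfadjoint b z" "\<And>x. z (u x) = - u (z x)" "\<And>x. z (z x) = - u (u x)"
  shows "\<exists>E. obasis p k E \<and> (\<forall>e\<in>E. \<forall>h. b e (P (p ^ (k - 1) * neg_arg h) e) = - b e (P (p ^ (k - 1) * h) e))"
proof -
  note n = Irr0_neg_arg[OF p]
  have pI: "p \<in> Irr" and irr: "irreducible p" using p by (auto simp: Irr0_def Irr_def)
  have nT: "\<not> T dvd p"
  proof
    assume "T dvd p"
    then have "T = p" using Irr_dvd_imp_eq[OF _ pI] irreducible_T by (auto simp: Irr_def)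
    then have "neg_arg T = T" using n(1) by simp
    then have "- T = T" by (simp only: neg_arg_simps(9))
    then have "(- 1 :: 'a) = 1" by simp
    then have "(1 :: 'a) + 1 = 0" by (metis add.right_inverse)
    then have "(2 :: 'a) = 0" by (simp only: one_add_one)
    then show False using two by simp
  qed
  obtain w where w: "lin w" "\<And>x. w (u x) = - u (w x)" "\<And>x y. b (w x) y = - b x (w y)"
    "\<And>x. x \<in> prim p \<union> prim (op_poly p) \<Longrightarrow> w (w x) = x" using anticommuting_involution[OF pI nT z] by metis
  have wP: "w (P q x) = P (neg_arg q) (w x)" for q x by (rule P_anticommute[OF w(1,2)])
  have npk: "neg_arg (p ^ j) = p ^ j" for j by (simp add: neg_arg_simps n)
  have wk: "P (p ^ k) (w x) = 0" if "P (p ^ k) x = 0" for x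
    using wP[of "p ^ k" x] that by (simp add: npk linE[OF w(1)])
  define G where "G = {x. P (p ^ k) x = 0 \<and> w x = x}"
  have "\<exists>E\<subseteq>G. obasis p k E"
  proof (rule obasis_exists[OF irr k])
    show "P (p ^ k) g = 0" if "g \<in> G" for g using that by (simp add: G_def)
    show "g + h \<in> G" if "g \<in> G" "h \<in> G" for g h using that by (simp add: G_def P_linE linE[OF w(1)])
    fix E y assume E: "E \<subseteq> G" and y: "P (p ^ k) y = 0" and o: "\<And>e q. e \<in> E \<Longrightarrow> b e (P (p ^ (k - 1) * q) y) = 0"
    have ow: "b e (P (p ^ (k - 1) * q) (w y)) = 0" if e: "e \<in> E" for e q
    proof -
      have "b e (P (p ^ (k - 1) * q) (w y)) = b e (w (P (p ^ (k - 1) * neg_arg q) y))"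
        by (simp add: wP neg_arg_simps(2) npk neg_arg_simps(7))
      also have "\<dots> = - b (w e) (P (p ^ (k - 1) * neg_arg q) y)" by (simp add: w(3))
      also have "\<dots> = 0" using E e o[OF e] by (auto simp: G_def subset_iff)
      finally show ?thesis .
    qed
    \<comment> \<open>Twice the fixed part of \<open>y\<close>, and \<open>u\<close> applied to
      twice its anti-fixed part. The latter vector is fixed because \<open>w\<close> anticommutes
      with \<open>u\<close>, and \<open>r\<close> inverts \<open>u\<close> to recover
      \<open>y\<close>.\<close>
    let ?g1 = "y + w y" and ?g2 = "u (y - w y)"
    have wwy: "w (w y) = y" using w(4)[OF UnI1[OF in_prim[OF y]]] .
    have "\<not> T dvd p ^ k" by (rule irreducible_not_dvd_power[OF irreducible_T nT])
    then obtain r0 r where rr: "r0 * p ^ k + r * T ^ 1 = 1" using irreducible_bezout[OF irreducible_T] by blast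
    have rTy: "P r (u v) = v" if v: "P (p ^ k) v = 0" for v
    proof -
      have "v = P (r0 * p ^ k + r * T ^ 1) v" unfolding rr by simp
      also have "\<dots> = P r (u v)" by (simp only: P_add P_mult v P_linE power_one_right P_T) simp
      finally show ?thesis by simp
    qed
    have k1: "P (p ^ k) ?g1 = 0" "P (p ^ k) (y - w y) = 0" using y wk[OF y] by (simp_all add: P_linE)
    have g1: "?g1 \<in> G" using k1 wwy by (simp add: G_def linE[OF w(1)] add.commute)
    have g2: "?g2 \<in> G" using y wk[OF y] wwy by (simp add: G_def linE[OF w(1)] P_linE P_u u_lin w(2))
    have "P [:1/2:] ?g1 + P (Polynomial.smult (1/2) r) ?g2 = (1/2) *s (?g1 + (y - w y))"
      using rTy[OF k1(2)] by (simp add: P_smult scale_right_distrib scale_right_diff_distrib)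
    also have "?g1 + (y - w y) = 2 *s y" using scale_left_distrib[of 1 1 y] by simp
    also have "(1/2) *s (2 *s y) = y" using two by simp
    finally have "y = P [:1/2:] ?g1 + P (Polynomial.smult (1/2) r) ?g2" by simp
    moreover have "b e (P (p ^ (k - 1) * q) ?g1) = 0" if "e \<in> E" for e q
      using o[OF that] ow[OF that] by (simp add: P_linE bl)
    moreover have "b e (P (p ^ (k - 1) * q) ?g2) = 0" if "e \<in> E" for e q
    proof -
      have "P (p ^ (k - 1) * q) ?g2 = P (p ^ (k - 1) * (q * T)) (y - w y)" by (simp only: P_mult P_T)
      then show ?thesis using o[OF that, of "q * T"] ow[OF that, of "q * T"] by (simp only: P_linE bl diff_self)
    qed
    ultimately show "\<exists>g1\<in>G. \<exists>g2\<in>G. \<exists>r1 r2. y = P r1 g1 + P r2 g2 \<and>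
         (\<forall>e\<in>E. \<forall>q. b e (P (p ^ (k - 1) * q) g1) = 0 \<and> b e (P (p ^ (k - 1) * q) g2) = 0)" using g1 g2 by blast
  qed
  then obtain E where E: "E \<subseteq> G" "obasis p k E" by blast
  have "b e (P (p ^ (k - 1) * neg_arg h) e) = - b e (P (p ^ (k - 1) * h) e)" if e: "e \<in> E" for e h
  proof -
    have we: "w e = e" using E(1) e by (auto simp: G_def)
    have "b e (P (p ^ (k - 1) * neg_arg h) e) = b e (P (p ^ (k - 1) * neg_arg h) (w e))" using we by simp
    also have "\<dots> = b e (w (P (p ^ (k - 1) * h) e))" by (simp add: wP neg_arg_simps(2) npk)
    also have "\<dots> = - b (w e) (P (p ^ (k - 1) * h) e)" by (simp add: w(3))
    finally show ?thesis using we by simp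
  qed
  then show ?thesis using E(2) by blast
qed

end

lemma cls_eq_iff_form:
  fixes p c d :: "'a::field poly"
  assumes p: "irreducible p"
  shows "cls p c = cls p d \<longleftrightarrow> (\<forall>q. coeff ((q * c) mod p) 0 = coeff ((q * d) mod p) 0)"
proof
  assume "cls p c = cls p d"
  then have "p dvd q * (c - d)" for q by (simp add: cls_eq_iff)
  then show "\<forall>q. coeff ((q * c) mod p) 0 = coeff ((q * d) mod p) 0"
    by (intro allI e_cong) (simp add: right_diff_distrib)
next
  assume e: "\<forall>q. coeff ((q * c) mod p) 0 = coeff ((q * d) mod p) 0"
  have "coeff ((q * (c - d)) mod p) 0 = 0" for q
  proof -
    have "q * (c - d) + q * d = q * c" by (simp add: algebra_simps)
    then show ?thesis using e e_add[of "q * (c - d)" "q * d" p] by simp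
  qed
  then show "cls p c = cls p d" unfolding cls_eq_iff by (rule e_nondeg[OF p])
qed

lemma neg_arg_power:
  "neg_arg (p ^ j) = Polynomial.smult ((- 1) ^ (j * degree p)) (op_poly p ^ j)"
  "neg_arg (op_poly p ^ j) = Polynomial.smult ((- 1) ^ (j * degree p)) (p ^ j)" for p :: "'a::field poly"
proof -
  have *: "neg_arg (p ^ j) = Polynomial.smult ((- 1) ^ (j * degree p)) (op_poly p ^ j)" for p :: "'a poly"
    unfolding neg_arg_simps(8) neg_arg_eq_op_poly[of p] smult_power by (simp only: mult.commute[of j] power_mult)
  show "neg_arg (p ^ j) = Polynomial.smult ((- 1) ^ (j * degree p)) (op_poly p ^ j)" by (rule *)
  have "degree (op_poly p) = degree p" by (simp add: op_poly_def)
  then show "neg_arg (op_poly p ^ j) = Polynomial.smult ((- 1) ^ (j * degree p)) (p ^ j)"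
    using *[of "op_poly p"] by (simp add: op_poly_op_poly)
qed

context selfadjoint_endo
begin

subsection \<open>Condition (ii)\<close>

lemma op_space_simps:
  "carrier (op_space p M) = carrier M" "\<zero>\<^bsub>op_space p M\<^esub> = \<zero>\<^bsub>M\<^esub>"
  "X \<oplus>\<^bsub>op_space p M\<^esub> Y = X \<oplus>\<^bsub>M\<^esub> Y" by (simp_all add: op_space_def)

lemma op_smult:
  assumes x: "P (op_poly p ^ k) x = 0" and k: "k \<ge> 1"
  shows "cls p q \<odot>\<^bsub>op_space p (Vs (op_poly p) k)\<^esub> co (op_poly p) k x =
    co (op_poly p) k (P (neg_arg q) x)"
proof -
  have "inv_into (carrier (residue_field (op_poly p))) residue_neg (cls p q) = cls (op_poly p) (neg_arg q)"
  proof (rule inv_into_f_eq)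
    show "inj_on residue_neg (carrier (residue_field (op_poly p)))"
    proof (rule inj_onI)
      fix X Y assume "X \<in> carrier (residue_field (op_poly p))" "Y \<in> carrier (residue_field (op_poly p))"
      then obtain r s where rs: "X = cls (op_poly p) r" "Y = cls (op_poly p) s" unfolding residue_carrier by blast
      assume "residue_neg X = residue_neg Y"
      then have "p dvd neg_arg (r - s)"
        unfolding rs residue_neg_cls op_poly_op_poly cls_eq_iff by (simp only: neg_arg_simps(3))
      then have "neg_arg p dvd r - s" using neg_arg_dvd_iff[of p "neg_arg (r - s)"] by (simp add: neg_arg_simps(7))
      then show "X = Y" unfolding rs cls_eq_iff op_poly_def by (simp add: smult_dvd_iff)
    qed
    show "residue_neg (cls (op_poly p) (neg_arg q)) = cls p q"
      unfolding residue_neg_cls op_poly_op_poly neg_arg_simps(7) ..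
  qed simp
  then show ?thesis using inv_smult[OF x k, of "neg_arg q"] by (simp add: op_space_def)
qed

lemma op_form_eq_iff:
  assumes p: "p \<in> Irr" and k: "k \<ge> 1" and x: "P (p ^ k) x = 0" and y: "P (p ^ k) y = 0"
    and x': "P (op_poly p ^ k) x' = 0" and y': "P (op_poly p ^ k) y' = 0"
  shows "sign_scaled (residue_field p) n (op_form (Vf (op_poly p) k))
      (co (op_poly p) k x') (co (op_poly p) k y') = Vf p k (co p k x) (co p k y) \<longleftrightarrow>
    (\<forall>q. (- 1) ^ n * b x' (P (op_poly p ^ (k - 1) * neg_arg q) y') = b x (P (p ^ (k - 1) * q) y))"
proof -
  have irr: "irreducible p" "irreducible (op_poly p)" using p op_poly_Irr[OF p] by (auto simp: Irr_def)
  obtain c where c: "form_val p k x y c" using form_val_exists[OF irr(1) k y] by blast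
  obtain c' where c': "form_val (op_poly p) k x' y' c'" using form_val_exists[OF irr(2) k y'] by blast
  have pw: "(- 1) ^ n * c = Polynomial.smult ((- 1) ^ n) c" for c :: "'a poly" by (cases "even n") auto
  have "sign_scaled (residue_field p) n (op_form (Vf (op_poly p) k))
      (co (op_poly p) k x') (co (op_poly p) k y') = cls p (Polynomial.smult ((- 1) ^ n) (neg_arg c'))"
    unfolding sign_scaled_def op_form_def invariant_form_co[OF irr(2) k x' y' c'] residue_neg_cls op_poly_op_poly
      residue_one residue_uminus[OF irr(1)] residue_pow[OF irr(1)] residue_mult pw ..
  moreover have "coeff ((q * Polynomial.smult ((- 1) ^ n) (neg_arg c')) mod p) 0 =
      (- 1) ^ n * b x' (P (op_poly p ^ (k - 1) * neg_arg q) y')" for q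
  proof -
    have "coeff ((q * neg_arg c') mod p) 0 = coeff ((neg_arg q * c') mod op_poly p) 0"
      using e_neg_arg[OF irr(2), of "neg_arg q * c'"] by (simp only: neg_arg_simps op_poly_op_poly)
    also have "\<dots> = b x' (P (op_poly p ^ (k - 1) * neg_arg q) y')" using c' by (simp only: form_val_def)
    finally show ?thesis by (simp only: mult_smult_right e_smult)
  qed
  moreover have "coeff ((q * c) mod p) 0 = b x (P (p ^ (k - 1) * q) y)" for q using c by (simp only: form_val_def)
  ultimately show ?thesis by (simp only: invariant_form_co[OF irr(1) k x y c] cls_eq_iff_form[OF irr(1)])
qed

lemma anticommuting_kernel:
  assumes w: "lin w" "\<And>x. w (u x) = - u (w x)" and x: "P (p ^ j) x = 0"
  shows "P (op_poly p ^ j) (w x) = 0"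
proof -
  have "0 = w (P (p ^ j) x)" by (simp add: x linE[OF w(1)])
  also have "\<dots> = (- 1) ^ (j * degree p) *s P (op_poly p ^ j) (w x)"
    by (simp only: P_anticommute[OF w] neg_arg_power P_smult)
  finally show ?thesis by simp
qed

lemma anticommuting_Nk:
  assumes w: "lin w" "\<And>x. w (u x) = - u (w x)" and x: "x \<in> Nk UNIV p k"
  shows "w x \<in> Nk UNIV (op_poly p) k"
proof -
  obtain y s where x: "x = y + P p s" "P (p ^ (k - 1)) y = 0" "P (p ^ k) (P p s) = 0" using x by (auto simp: Nk_def)
  have "w (P p s) = P (op_poly p) ((- 1) ^ degree p *s w s)"
    by (simp only: P_anticommute[OF w] neg_arg_eq_op_poly P_smult P_linE)
  then have "w x = w y + P (op_poly p) ((- 1) ^ degree p *s w s)"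
      "P (op_poly p ^ k) (P (op_poly p) ((- 1) ^ degree p *s w s)) = 0"
    using x(1) anticommuting_kernel[OF w x(3)] by (simp_all add: linE[OF w(1)])
  then show ?thesis unfolding Nk_def using anticommuting_kernel[OF w x(2)] by blast
qed

abbreviation op_equivalent :: "'a poly \<Rightarrow> nat \<Rightarrow> bool" where
  "op_equivalent p k \<equiv> forms_equivalent (residue_field p) (Vs p k) (Vf p k) (op_space p (Vs (op_poly p) k))
     (sign_scaled (residue_field p) (1 + (k - 1) * degree p) (op_form (Vf (op_poly p) k)))"

text \<open>The involution \<open>w\<close> maps kernels and denominators of \<open>p\<close> onto
  those of its opposite, and \<open>P_anticommute\<close> makes it linear once scalars are
  transported along \<phi>.\<close>

lemma condition_ii_necessary:
  assumes p: "p \<in> Irr" "\<not> T dvd p" and k: "k \<ge> 1"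
    and z: "lin z" "selfadjoint b z" "\<And>x. z (u x) = - u (z x)" "\<And>x. z (z x) = - u (u x)"
  shows "op_equivalent p k"
proof -
  obtain w where w: "lin w" "\<And>x. w (u x) = - u (w x)" and wb: "\<And>x y. b (w x) y = - b x (w y)"
    and ww: "\<And>x. x \<in> prim p \<union> prim (op_poly p) \<Longrightarrow> w (w x) = x" using anticommuting_involution[OF p z] by metis
  have image: "w ` co p k x = co (op_poly p) k (w x)"
    if w2: "\<And>x. x \<in> prim (op_poly p) \<Longrightarrow> w (w x) = x" for p x
  proof
    show "w ` co p k x \<subseteq> co (op_poly p) k (w x)"
      using anticommuting_Nk[OF w] by (auto simp: coset_mem linE[OF w(1)] simp flip: lin_diff[OF w(1)])
    show "co (op_poly p) k (w x) \<subseteq> w ` co p k x"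
    proof
      fix y assume "y \<in> co (op_poly p) k (w x)"
      then have n: "y - w x \<in> Nk UNIV (op_poly p) k" by (simp add: coset_mem)
      have "w (y - w x) \<in> Nk UNIV p k" using anticommuting_Nk[OF w n] by (simp only: op_poly_op_poly)
      moreover have "w (w (y - w x)) = y - w x" using w2 in_prim[OF Nk_kernel[OF n k]] by blast
      then have "y = w (x + w (y - w x))" by (simp add: linE[OF w(1)])
      ultimately show "y \<in> w ` co p k x" by (intro image_eqI[of _ _ "x + w (y - w x)"]) (auto simp: coset_mem)
    qed
  qed
  have im: "w ` co p k x = co (op_poly p) k (w x)" for x by (rule image) (use ww in blast)
  have im': "w ` co (op_poly p) k x = co p k (w x)" for x
    using image[of "op_poly p" x] ww unfolding op_poly_op_poly by blast
  have kr: "P (op_poly p ^ k) (w x) = 0" if "P (p ^ k) x = 0" for x by (rule anticommuting_kernel[OF w that])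
  have kr': "P (p ^ k) (w x) = 0" if "P (op_poly p ^ k) x = 0" for x
    using anticommuting_kernel[OF w that] by (simp only: op_poly_op_poly)
  let ?M = "Vs p k" and ?N = "op_space p (Vs (op_poly p) k)"
  have "image w \<in> LinearCombinations.module_hom (residue_field p) ?M ?N" unfolding LinearCombinations.module_hom_def
  proof (intro CollectI conjI allI impI)
    show "image w \<in> carrier ?M \<rightarrow> carrier ?N" using kr by (auto simp: inv_simps op_space_simps im)
    show "w ` (X \<oplus>\<^bsub>?M\<^esub> Y) = w ` X \<oplus>\<^bsub>?N\<^esub> w ` Y" if XY: "X \<in> carrier ?M \<and> Y \<in> carrier ?M" for X Y
    proof -
      obtain x y where "X = co p k x" "Y = co p k y" using XY unfolding inv_simps by blast
      then show ?thesis by (simp only: inv_simps op_space_simps im linE[OF w(1)])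
    qed
    show "w ` (L \<odot>\<^bsub>?M\<^esub> X) = L \<odot>\<^bsub>?N\<^esub> w ` X" if LX: "L \<in> carrier (residue_field p) \<and> X \<in> carrier ?M" for L X
    proof -
      obtain q x where x: "L = cls p q" "X = co p k x" "P (p ^ k) x = 0" using LX by (auto simp: residue_carrier inv_simps)
      show ?thesis unfolding x(1,2) inv_smult[OF x(3) k] im op_smult[OF kr[OF x(3)] k] P_anticommute[OF w] ..
    qed
  qed
  moreover have "bij_betw (image w) (carrier ?M) (carrier ?N)"
  proof (rule bij_betw_byWitness[of _ "image w"])
    show "\<forall>X\<in>carrier ?M. w ` w ` X = X" "\<forall>X\<in>carrier ?N. w ` w ` X = X"
      using ww in_prim by (auto simp: inv_simps op_space_simps im im' simp del: image_image)
    show "image w ` carrier ?M \<subseteq> carrier ?N" "image w ` carrier ?N \<subseteq> carrier ?M"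
      using kr kr' by (auto simp: inv_simps op_space_simps im im')
  qed
  moreover have "sign_scaled (residue_field p) (1 + (k - 1) * degree p)
               (op_form (Vf (op_poly p) k)) (w ` X) (w ` Y) = Vf p k X Y"
    if XY: "X \<in> carrier ?M" "Y \<in> carrier ?M" for X Y
  proof -
    obtain x y where x: "X = co p k x" "P (p ^ k) x = 0" and y: "Y = co p k y" "P (p ^ k) y = 0"
      using XY by (auto simp: inv_simps)
    \<comment> \<open>This sign appears when \<open>w\<close> moves across
      \<open>P (p ^ (k - 1))\<close>; the remaining factor -1 is the skew-adjointness of
      \<open>w\<close>.\<close>
    let ?s = "(- 1 :: 'a) ^ ((k - 1) * degree p)"
    have ss: "?s * ?s = 1" by (simp flip: power_add)
    have "(- 1) ^ (1 + (k - 1) * degree p) * b (w x) (P (op_poly p ^ (k - 1) * neg_arg q) (w y)) =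
        b x (P (p ^ (k - 1) * q) y)" for q
    proof -
      let ?Y = "P (p ^ (k - 1) * q) y"
      have "P (p ^ k) ?Y = 0" using y(2) by (simp only: P_commute[of "p ^ k"] P_linE)
      then have Y: "w (w ?Y) = ?Y" using ww in_prim by blast
      have "w ?Y = ?s *s P (op_poly p ^ (k - 1) * neg_arg q) (w y)"
        by (simp only: P_anticommute[OF w] neg_arg_simps(2) neg_arg_power mult_smult_left P_smult)
      then have "?s *s w ?Y = P (op_poly p ^ (k - 1) * neg_arg q) (w y)" using ss by simp
      then have "b (w x) (P (op_poly p ^ (k - 1) * neg_arg q) (w y)) = ?s * b (w x) (w ?Y)" by (metis bl(4))
      also have "b (w x) (w ?Y) = - b x ?Y" by (simp only: wb Y)
      finally have "(- 1) ^ (1 + (k - 1) * degree p) * b (w x) (P (op_poly p ^ (k - 1) * neg_arg q) (w y)) =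
        (?s * ?s) * b x ?Y" by (simp add: algebra_simps)
      then show ?thesis unfolding ss by simp
    qed
    then show ?thesis unfolding x y im op_form_eq_iff[OF p(1) k x(2) y(2) kr[OF x(2)] kr[OF y(2)]] by blast
  qed
  ultimately show ?thesis unfolding forms_equivalent_def by (intro bexI[of _ "image w"]) auto
qed

text \<open>The isometry sends an orthogonal basis of V_{p,k} to one for the opposite polynomial;
  \<open>g\<close> chooses representatives of the images. The sign in \<open>op_form_eq_iff\<close>
  and that in \<open>neg_arg_power\<close> combine to -1.\<close>

lemma condition_ii_sufficient:
  assumes p: "p \<in> Irr" and k: "k \<ge> 1"
    and eq: "op_equivalent p k"
  shows "\<exists>E f. obasis p k E \<and> inj_on f E \<and> obasis (op_poly p) k (f ` E) \<and>
       (\<forall>e\<in>E. \<forall>h. b (f e) (P (op_poly p ^ (k - 1) * h) (f e)) = - b e (P (neg_arg (op_poly p ^ (k - 1) * h)) e))"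
proof -
  let ?M = "Vs p k" and ?N = "op_space p (Vs (op_poly p) k)"
  let ?p' = "op_poly p" and ?n = "1 + (k - 1) * degree p"
  have irr: "irreducible p" using p by (simp add: Irr_def)
  obtain h where h: "h \<in> LinearCombinations.module_hom (residue_field p) ?M ?N" "bij_betw h (carrier ?M) (carrier ?N)"
    "\<And>X Y. X \<in> carrier ?M \<Longrightarrow> Y \<in> carrier ?M \<Longrightarrow> sign_scaled (residue_field p) ?n
               (op_form (Vf ?p' k)) (h X) (h Y) = Vf p k X Y" using eq unfolding forms_equivalent_def by blast
  obtain E where ob: "obasis p k E" using obasis_exists'[OF irr k] by blast
  then have E: "finite E" "\<And>e. e \<in> E \<Longrightarrow> P (p ^ k) e = 0" "\<And>e. e \<in> E \<Longrightarrow> \<exists>q. b e (P (p ^ (k - 1) * q) e) \<noteq> 0"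
      "\<And>e e' q. e \<in> E \<Longrightarrow> e' \<in> E \<Longrightarrow> e \<noteq> e' \<Longrightarrow> b e (P (p ^ (k - 1) * q) e') = 0"
      "\<And>y. P (p ^ k) y = 0 \<Longrightarrow> \<exists>c. y - (\<Sum>e\<in>E. P (c e) e) \<in> Nk UNIV p k" by (auto simp: obasis_def)
  have "\<exists>g. P (?p' ^ k) g = 0 \<and> h (co p k e) = co ?p' k g" if "P (p ^ k) e = 0" for e
  proof -
    have "h (co p k e) \<in> carrier ?N" using bij_betwE[OF h(2)] that by (auto simp: inv_simps)
    then show ?thesis by (auto simp: inv_simps op_space_simps)
  qed
  then obtain g where g: "\<And>e. P (p ^ k) e = 0 \<Longrightarrow> P (?p' ^ k) (g e) = 0"
    "\<And>e. P (p ^ k) e = 0 \<Longrightarrow> h (co p k e) = co ?p' k (g e)" by metis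
  have match: "(- 1) ^ ?n * b (g e) (P (?p' ^ (k - 1) * q) (g e')) = b e (P (p ^ (k - 1) * neg_arg q) e')"
    if e: "e \<in> E" and e': "e' \<in> E" for e e' q
  proof -
    have "sign_scaled (residue_field p) ?n (op_form (Vf ?p' k)) (co ?p' k (g e)) (co ?p' k (g e')) =
        Vf p k (co p k e) (co p k e')" using h(3)[of "co p k e" "co p k e'"] g(2) E(2) e e' by (auto simp: inv_simps)
    then show ?thesis unfolding op_form_eq_iff[OF p k E(2)[OF e] E(2)[OF e'] g(1)[OF E(2)[OF e]] g(1)[OF E(2)[OF e']]]
      using neg_arg_simps(7)[of q] by metis
  qed
  have nd: "\<exists>q. b (g e) (P (?p' ^ (k - 1) * q) (g e)) \<noteq> 0" if e: "e \<in> E" for e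
  proof -
    obtain q where "b e (P (p ^ (k - 1) * q) e) \<noteq> 0" using E(3)[OF e] by blast
    then have "(- 1) ^ ?n * b (g e) (P (?p' ^ (k - 1) * neg_arg q) (g e)) \<noteq> 0"
      unfolding match[OF e e] neg_arg_simps(7) .
    then show ?thesis by (metis mult_zero_right)
  qed
  have orth: "b (g e) (P (?p' ^ (k - 1) * q) (g e')) = 0" if e: "e \<in> E" "e' \<in> E" "e \<noteq> e'" for e e' q
    using match[OF e(1,2), of q] E(4)[OF e, of "neg_arg q"] by simp
  have inj: "inj_on g E" using nd orth by (metis inj_onI)
  have hsum: "h (co p k (\<Sum>e\<in>F. P (c e) e)) = co ?p' k (\<Sum>e\<in>F. P (neg_arg (c e)) (g e))" if "finite F" "F \<subseteq> E" for F c
    using that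
  proof (induct F rule: finite_induct)
    case empty
    have z: "co p k 0 \<in> carrier ?M" by (auto simp: inv_simps P_linE)
    have "h (co p k (P 0 0)) = co ?p' k (P (neg_arg 0) (g 0))"
      using LinearCombinations.module_hom_smult[OF h(1) cls_carrier[of p 0] z] inv_smult[of p k 0 0] op_smult[of p k "g 0" 0] k
        g[of 0] by (simp add: P_linE)
    then show ?case by (simp add: neg_arg_simps)
  next
    case (insert e F)
    have e: "P (p ^ k) e = 0" using insert E(2) by blast
    have k1: "P (p ^ k) (P (c e) e) = 0" using e by (simp add: P_commute[of "p ^ k"] P_linE)
    have k2: "P (p ^ k) (\<Sum>e\<in>F. P (c e) e) = 0"
    proof -
      have "P (p ^ k) (\<Sum>e\<in>F. P (c e) e) = (\<Sum>e\<in>F. P (p ^ k) (P (c e) e))" by (simp add: P_linE lin_sum[OF P_lin])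
      also have "\<dots> = 0" by (rule sum.neutral) (use insert E(2) in \<open>auto simp: P_commute[of "p ^ k"] P_linE subset_iff\<close>)
      finally show ?thesis .
    qed
    have "h (co p k (P (c e) e)) = co ?p' k (P (neg_arg (c e)) (g e))"
      using LinearCombinations.module_hom_smult[OF h(1) cls_carrier[of p "c e"], of "co p k e"] inv_smult[OF e k, of "c e"]
        op_smult[OF g(1)[OF e] k, of "c e"] g(2)[OF e] e by (auto simp: inv_simps)
    moreover have "h (co p k (P (c e) e + (\<Sum>e\<in>F. P (c e) e))) =
        h (co p k (P (c e) e)) \<oplus>\<^bsub>?N\<^esub> h (co p k (\<Sum>e\<in>F. P (c e) e))" unfolding inv_simps(3)[symmetric]
      by (rule LinearCombinations.module_hom_add[OF h(1)]) (use k1 k2 in \<open>auto simp: inv_simps\<close>)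
    ultimately show ?case using insert by (simp add: op_space_simps inv_simps)
  qed
  have span: "\<exists>c. y' - (\<Sum>e\<in>g ` E. P (c e) e) \<in> Nk UNIV ?p' k" if y': "P (?p' ^ k) y' = 0" for y'
  proof -
    have "co ?p' k y' \<in> h ` carrier ?M"
      using y' bij_betw_imp_surj_on[OF h(2)] by (auto simp: inv_simps op_space_simps)
    then obtain y where y: "P (p ^ k) y = 0" "co ?p' k y' = h (co p k y)" by (auto simp: inv_simps)
    obtain c where "y - (\<Sum>e\<in>E. P (c e) e) \<in> Nk UNIV p k" using E(5)[OF y(1)] by blast
    then have "co ?p' k y' = h (co p k (\<Sum>e\<in>E. P (c e) e))" unfolding y(2) co_eq_iff[symmetric] by simp
    also have "\<dots> = co ?p' k (\<Sum>e\<in>E. P (neg_arg (c e)) (g e))" by (rule hsum[OF E(1)]) simp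
    also have "(\<Sum>e\<in>E. P (neg_arg (c e)) (g e)) = (\<Sum>e\<in>g ` E. P (neg_arg (c (inv_into E g e))) e)"
      using inj by (simp add: sum.reindex)
    finally show ?thesis unfolding co_eq_iff by (rule exI[of _ "\<lambda>e. neg_arg (c (inv_into E g e))"])
  qed
  have "obasis ?p' k (g ` E)" unfolding obasis_def using E(1) nd orth span g(1)[OF E(2)] by auto
  moreover have "b (g e) (P (?p' ^ (k - 1) * q) (g e)) = - b e (P (neg_arg (?p' ^ (k - 1) * q)) e)" if e: "e \<in> E" for e q
  proof -
    let ?s = "(- 1 :: 'a) ^ ((k - 1) * degree p)"
    have ss: "?s * ?s = 1" by (simp flip: power_add)
    have "P (neg_arg (?p' ^ (k - 1) * q)) e = ?s *s P (p ^ (k - 1) * neg_arg q) e"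
      by (simp only: neg_arg_simps(2) neg_arg_power(2) mult_smult_left P_smult)
    then have "- b e (P (neg_arg (?p' ^ (k - 1) * q)) e) = - ?s * ((- 1) ^ ?n * b (g e) (P (?p' ^ (k - 1) * q) (g e)))"
      unfolding match[OF e e] by (simp add: bl)
    also have "\<dots> = (?s * ?s) * b (g e) (P (?p' ^ (k - 1) * q) (g e))" by (simp add: algebra_simps)
    finally show ?thesis unfolding ss by simp
  qed
  ultimately show ?thesis using ob inj by blast
qed

end

section \<open>Forms on quotient spaces\<close>

text \<open>A space \<open>M\<close> given as \<open>A\<close> modulo the kernel \<open>Z\<close> of
  \<phi>, with the form \<open>C\<close> induced by \<open>c\<close>. It serves both V_{t,2k+1} and
  the infinite orthogonal sum in (iii), so that the notions of Witt theory are translated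
  once.\<close>

locale quotient_form = selfadjoint_endo scale Basis b u +
    represented "class_ring :: 'a ring" M "\<lambda>a. a" A scale \<phi>
  for scale :: "'a::field \<Rightarrow> 'v::ab_group_add \<Rightarrow> 'v" (infixr "*s" 75) and Basis :: "'v set"
    and b :: "'v \<Rightarrow> 'v \<Rightarrow> 'a" and u :: "'v \<Rightarrow> 'v"
    and M :: "('a, 'm) module" and A :: "'v set" and \<phi> :: "'v \<Rightarrow> 'm" +
  fixes C :: "'m \<Rightarrow> 'm \<Rightarrow> 'a" and c :: "'v \<Rightarrow> 'v \<Rightarrow> 'a"
  assumes cb: "bilinear_form scale c" and cs: "symmetric_form c"
    and C: "x \<in> A \<Longrightarrow> y \<in> A \<Longrightarrow> C (\<phi> x) (\<phi> y) = c x y"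
begin

lemmas ccl = bil[OF cb]

lemma c_sym: "c x y = c y x" using cs by (simp add: symmetric_form_def)

lemma span_left: "s \<in> span S \<Longrightarrow> (\<And>x. x \<in> S \<Longrightarrow> c x t = 0) \<Longrightarrow> c s t = 0" by (induct rule: span_induct_alt) (auto simp: ccl)

lemma span_right: "t \<in> span S \<Longrightarrow> (\<And>x. x \<in> S \<Longrightarrow> c s x = 0) \<Longrightarrow> c s t = 0"
  by (induct rule: span_induct_alt) (auto simp: ccl)

lemma subspace_A: "subspace A" by (rule subspaceI) (auto simp: A_0 A_add A_act)

definition Z :: "'v set" where "Z = {x \<in> A. \<phi> x = \<zero>\<^bsub>M\<^esub>}"

lemma \<phi>_ZI: "x \<in> A \<Longrightarrow> y \<in> A \<Longrightarrow> \<phi> x = \<phi> y \<longleftrightarrow> x - y \<in> Z" using \<phi>_eq_iff[of x y] A_diff[of x y] by (simp add: Z_def)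

lemma subspace_Z: "subspace Z"
proof (rule subspaceI)
  show "0 \<in> Z" by (simp add: Z_def A_0 \<phi>_zero)
  fix x y a assume x: "x \<in> Z"
  then have x0: "\<phi> x = \<phi> 0" "x \<in> A" by (auto simp: Z_def \<phi>_zero)
  have "\<phi> (a *s x) = a \<odot>\<^bsub>M\<^esub> \<phi> 0" using \<phi>_smult[OF x0(2), of a] x0(1) by simp
  also have "\<dots> = \<phi> 0" using \<phi>_smult[OF A_0, of a] by simp
  finally show "a *s x \<in> Z" using x0 A_act by (simp add: Z_def \<phi>_zero)
  assume y: "y \<in> Z"
  then have y0: "\<phi> y = \<phi> 0" "y \<in> A" by (auto simp: Z_def \<phi>_zero)
  have "\<phi> (x + y) = \<phi> 0 \<oplus>\<^bsub>M\<^esub> \<phi> 0" using \<phi>_add[OF x0(2) y0(2)] x0(1) y0(1) by simp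
  also have "\<dots> = \<phi> 0" using \<phi>_add[OF A_0 A_0] by simp
  finally show "x + y \<in> Z" using x0 y0 A_add by (simp add: Z_def \<phi>_zero)
qed

lemma Z_A: "Z \<subseteq> A" by (auto simp: Z_def)

lemma c_Z: "z \<in> Z \<Longrightarrow> x \<in> A \<Longrightarrow> c z x = 0" "z \<in> Z \<Longrightarrow> x \<in> A \<Longrightarrow> c x z = 0"
proof -
  show *: "c z x = 0" if "z \<in> Z" "x \<in> A" for z x
  proof -
    have "c z x = C (\<phi> 0) (\<phi> x)" using that C[of z x] by (simp add: Z_def \<phi>_zero)
    then show ?thesis using C[OF A_0 that(2)] by (simp add: ccl)
  qed
  show "z \<in> Z \<Longrightarrow> x \<in> A \<Longrightarrow> c x z = 0" using * c_sym by metis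
qed

lemma iso_ssum_Z:
  assumes D: "D \<subseteq> A" "\<And>x y. x \<in> D \<Longrightarrow> y \<in> D \<Longrightarrow> c x y = 0"
  shows "iso c (ssum Z D)" unfolding iso_def
proof (intro ballI)
  fix x y assume "x \<in> ssum Z D" "y \<in> ssum Z D"
  then obtain z s z' s' where "x = z + s" "z \<in> Z" "s \<in> D" "y = z' + s'" "z' \<in> Z" "s' \<in> D" by (auto simp: ssum_def)
  moreover from this have "s \<in> A" "s' \<in> A" "z \<in> A" using D(1) Z_A by auto
  ultimately show "c x y = 0" using c_Z D(2) by (simp add: ccl)
qed

lemma restrict:
  assumes W: "subspace W" "W \<subseteq> A"
  shows "quotient_form scale Basis b u (M\<lparr>carrier := \<phi> ` W\<rparr>) W \<phi> C c"
proof (intro quotient_form.intro quotient_form_axioms.intro represented.intro)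
  show "selfadjoint_endo scale Basis b u" by (rule selfadjoint_endo_axioms)
  show "bilinear_form scale c" "symmetric_form c" using cb cs by auto
qed (use K k_add k_mult act_add act_add_left act_mult act_1 W(2) in \<open>auto simp: subspace_add[OF W(1)] subspace_0[OF W(1)]
       subspace_scale[OF W(1)] \<phi>_add \<phi>_zero \<phi>_smult C subset_iff\<close>)

lemma subspace_imp:
  assumes W: "subspace W" "W \<subseteq> A"
  shows "VectorSpace.subspace class_ring (\<phi> ` W) M"
proof (rule VectorSpace.subspace.intro[OF vs], rule LinearCombinations.submodule.intro)
  show "Module.module class_ring M" by (rule V.module_axioms)
  show "\<phi> ` W \<subseteq> carrier M" using W(2) \<phi>_in by auto
  show "v \<oplus>\<^bsub>M\<^esub> w \<in> \<phi> ` W" if "v \<in> \<phi> ` W" "w \<in> \<phi> ` W" for v w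
    using that W(2) by (auto simp: \<phi>_add subset_iff intro: subspace_add[OF W(1)])
  show "\<zero>\<^bsub>M\<^esub> \<in> \<phi> ` W" unfolding \<phi>_zero using subspace_0[OF W(1)] by blast
  show "a \<odot>\<^bsub>M\<^esub> v \<in> \<phi> ` W" if "v \<in> \<phi> ` W" for a v
    using that W(2) \<phi>_smult[of _ a] by (auto simp: subset_iff intro: subspace_scale[OF W(1)])
qed

lemma subspace_preimage:
  assumes S: "VectorSpace.subspace class_ring S M"
  shows "subspace {x \<in> A. \<phi> x \<in> S}" "\<phi> ` {x \<in> A. \<phi> x \<in> S} = S" "Z \<subseteq> {x \<in> A. \<phi> x \<in> S}"
    "y \<in> S \<Longrightarrow> \<exists>x. x \<in> A \<and> \<phi> x = y"
proof -
  have sm: "LinearCombinations.submodule class_ring S M" using S by (simp add: VectorSpace.subspace_def)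
  note s = LinearCombinations.submodule.subset[OF sm] LinearCombinations.submodule.m_closed[OF sm]
    LinearCombinations.submodule.zero_closed[OF sm]
  have sc: "v \<in> S \<Longrightarrow> a \<odot>\<^bsub>M\<^esub> v \<in> S" for a v using LinearCombinations.submodule.smult_closed[OF sm, of a v] by simp
  show "subspace {x \<in> A. \<phi> x \<in> S}"
  proof (rule subspaceI)
    show "0 \<in> {x \<in> A. \<phi> x \<in> S}" using s(3) A_0 by (simp add: \<phi>_zero)
    show "x + y \<in> {x \<in> A. \<phi> x \<in> S}" if "x \<in> {x \<in> A. \<phi> x \<in> S}" "y \<in> {x \<in> A. \<phi> x \<in> S}" for x y
      using that s(2)[of "\<phi> x" "\<phi> y"] A_add by (simp add: \<phi>_add)
    show "a *s x \<in> {x \<in> A. \<phi> x \<in> S}" if "x \<in> {x \<in> A. \<phi> x \<in> S}" for x a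
      using that sc[of "\<phi> x" a] A_act \<phi>_smult[of x a] by simp
  qed
  show "\<phi> ` {x \<in> A. \<phi> x \<in> S} = S" using s(1) by (auto simp: \<phi>_carrier)
  show "Z \<subseteq> {x \<in> A. \<phi> x \<in> S}" using s(3) by (auto simp: Z_def)
  show "y \<in> S \<Longrightarrow> \<exists>x. x \<in> A \<and> \<phi> x = y" using s(1) by (auto simp: \<phi>_carrier)
qed

lemma span_image:
  assumes S: "S \<subseteq> A"
  shows "V.span (\<phi> ` S) = \<phi> ` span S"
proof
  have sA: "span S \<subseteq> A" using S subspace_A by (rule span_minimal)
  have car: "\<phi> ` S \<subseteq> carrier M" using S \<phi>_in by auto
  have "LinearCombinations.submodule class_ring (\<phi> ` span S) M"
    using subspace_imp[OF subspace_span sA] by (simp add: VectorSpace.subspace_def)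
  then show "V.span (\<phi> ` S) \<subseteq> \<phi> ` span S" by (intro V.span_is_subset) (auto intro: span_base)
  have "VectorSpace.subspace class_ring (V.span (\<phi> ` S)) M"
    using V.span_is_submodule[OF car] vs by (simp add: VectorSpace.subspace_def)
  note sp = subspace_preimage[OF this]
  have "S \<subseteq> {x \<in> A. \<phi> x \<in> V.span (\<phi> ` S)}" using S V.in_own_span[OF car] by auto
  then have "span S \<subseteq> {x \<in> A. \<phi> x \<in> V.span (\<phi> ` S)}" by (rule span_minimal[OF _ sp(1)])
  then show "\<phi> ` span S \<subseteq> V.span (\<phi> ` S)" by blast
qed

lemma dim_carrier: "V.dim + dim Z = dim A"
proof -
  obtain D where D: "subspace D" "D \<subseteq> A" "Z \<inter> D = {0}" "ssum Z D = A" "dim Z + dim D = dim A"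
    by (rule complement_exists[OF subspace_Z subspace_A Z_A])
  obtain B where B: "B \<subseteq> D" "independent B" "D \<subseteq> span B" "card B = dim D" by (rule basis_exists[of D])
  have fin: "finite B" by (rule finiteI_independent[OF B(2)])
  have sB: "span B = D" using B D(1) span_subspace by blast
  have BA: "B \<subseteq> A" using B D by blast
  have ind: "\<forall>e\<in>B. r e = \<zero>\<^bsub>class_ring\<^esub>" if 1: "\<phi> (\<Sum>e\<in>B. r e *s e) = \<zero>\<^bsub>M\<^esub>" for r
  proof -
    have "(\<Sum>e\<in>B. r e *s e) \<in> span B" by (intro span_sum span_scale span_base)
    then have "(\<Sum>e\<in>B. r e *s e) \<in> Z \<inter> D" using 1 D(2) unfolding sB by (auto simp: Z_def)
    then have z: "(\<Sum>e\<in>B. r e *s e) = 0" using D(3) by blast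
    have "r e = 0" if "e \<in> B" for e using independentD[OF B(2) fin order_refl z that] .
    then show ?thesis by simp
  qed
  have gen: "\<exists>r. \<phi> (y - (\<Sum>e\<in>B. r e *s e)) = \<zero>\<^bsub>M\<^esub>" if y: "y \<in> A" for y
  proof -
    have "y \<in> ssum Z D" using D(4) y by simp
    then obtain z d where zd: "y = z + d" "z \<in> Z" "d \<in> D" by (auto simp: ssum_def)
    obtain r where "d = (\<Sum>e\<in>B. r e *s e)" using zd(3) span_finite[OF fin] unfolding sB[symmetric] by auto
    then have "y - (\<Sum>e\<in>B. r e *s e) = z" using zd(1) by simp
    then show ?thesis using zd(2) by (intro exI[of _ r]) (simp add: Z_def)
  qed
  note bas = basis_image[OF fin BA ind gen]
  have "V.dim = card (\<phi> ` B)" by (rule V.dim_basis[OF _ bas(2)]) (use fin in simp)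
  also have "\<dots> = dim D" using card_image[OF bas(1)] B(4) by simp
  finally show ?thesis using D(5) by simp
qed

lemma dim_image:
  assumes W: "subspace W" "W \<subseteq> A"
  shows "vectorspace.dim class_ring (M\<lparr>carrier := \<phi> ` W\<rparr>) + dim (W \<inter> Z) = dim W"
proof -
  interpret R: quotient_form scale Basis b u "M\<lparr>carrier := \<phi> ` W\<rparr>" W \<phi> C c by (rule restrict[OF W])
  have "R.Z = W \<inter> Z" unfolding R.Z_def Z_def using W(2) by auto
  then show ?thesis using R.dim_carrier by simp
qed

text \<open>One half of a hyperbolic basis, lifted to \<open>A\<close> and added to
  \<open>Z\<close>, spans a totally isotropic \<open>L\<close>; its orthogonal is \<open>L\<close>
  plus a lift \<open>W\<close> of the anisotropic part. This is the input of
  \<open>embedding\<close>.\<close>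

lemma nonisotropic_part_preimage:
  assumes np: "nonisotropic_part class_ring M C Wr"
  obtains L W where "subspace L" "Z \<subseteq> L" "L \<subseteq> A" "iso c L" "subspace W" "W \<subseteq> A" "\<phi> ` W = Wr"
    "perp c A L = ssum L W" "aniso c W" "W \<inter> Z = {0}"
proof -
  obtain H where sW: "VectorSpace.subspace class_ring Wr M" and ni: "nonisotropic class_ring (M\<lparr>carrier := Wr\<rparr>) C"
    and sH: "VectorSpace.subspace class_ring H M" and hH: "hyperbolic class_ring (M\<lparr>carrier := H\<rparr>) C"
    and HW: "H <+>\<^bsub>M\<^esub> Wr = carrier M" and oHW: "\<And>x y. x \<in> H \<Longrightarrow> y \<in> Wr \<Longrightarrow> C x y = 0"
    using np unfolding nonisotropic_part_def by auto
  note pW = subspace_preimage[OF sW] and pH = subspace_preimage[OF sH]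
  have "\<exists>(n::nat) e f. e ` {..<n} \<union> f ` {..<n} \<subseteq> H \<and>
      LinearCombinations.module.span class_ring (M\<lparr>carrier := H\<rparr>) (e ` {..<n} \<union> f ` {..<n}) = H \<and>
      (\<forall>i<n. \<forall>j<n. C (e i) (e j) = 0 \<and> C (f i) (f j) = 0 \<and> C (e i) (f j) = (if i = j then 1 else 0) \<and>
        C (f j) (e i) = (if i = j then 1 else 0))" using hH unfolding hyperbolic_def by (simp cong: if_cong)
  then obtain n :: nat and e f where ef: "e ` {..<n} \<union> f ` {..<n} \<subseteq> H"
      "LinearCombinations.module.span class_ring (M\<lparr>carrier := H\<rparr>) (e ` {..<n} \<union> f ` {..<n}) = H"
      "\<forall>i<n. \<forall>j<n. C (e i) (e j) = 0 \<and> C (f i) (f j) = 0 \<and> C (e i) (f j) = (if i = j then 1 else 0) \<and>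
        C (f j) (e i) = (if i = j then 1 else 0)" by (elim exE conjE) (rule that)
  obtain \<psi> where \<psi>: "\<And>y. y \<in> H \<Longrightarrow> \<psi> y \<in> A" "\<And>y. y \<in> H \<Longrightarrow> \<phi> (\<psi> y) = y" using pH(4) by metis
  define E where "E = (\<lambda>i. \<psi> (e i))"
  define F where "F = (\<lambda>i. \<psi> (f i))"
  have EA: "E i \<in> A" "F i \<in> A" "\<phi> (E i) = e i" "\<phi> (F i) = f i" if "i < n" for i
    using \<psi> ef(1) that by (auto simp: E_def F_def)
  have cE: "c (E i) (E j) = 0" "c (E i) (F j) = (if i = j then 1 else 0)" if "i < n" "j < n" for i j
    using C[of "E i" "E j"] C[of "E i" "F j"] EA that ef(3) by simp_all
  let ?EF = "E ` {..<n} \<union> F ` {..<n}"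
  have EFH: "?EF \<subseteq> {x \<in> A. \<phi> x \<in> H}" using EA ef(1) by auto
  have HEF: "\<phi> ` span ?EF = H"
  proof -
    interpret R: quotient_form scale Basis b u "M\<lparr>carrier := H\<rparr>" "{x \<in> A. \<phi> x \<in> H}" \<phi> C c
      using restrict[OF pH(1)] pH(2) by simp
    have "\<phi> ` ?EF = e ` {..<n} \<union> f ` {..<n}" using EA by (auto simp: image_Un image_image)
    then show ?thesis using R.span_image[OF EFH] ef(2) by simp
  qed
  have spA: "span ?EF \<subseteq> A" using EFH by (intro span_minimal[OF _ subspace_A]) auto
  define L where "L = ssum Z (span (E ` {..<n}))"
  have sE: "span (E ` {..<n}) \<subseteq> A" using EA by (intro span_minimal[OF _ subspace_A]) auto
  have L: "subspace L" "Z \<subseteq> L" "L \<subseteq> A"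
    unfolding L_def using subspace_ssum[OF subspace_Z subspace_span] ssum_left[OF subspace_span]
      ssum_subset[OF subspace_A Z_A sE] by auto
  obtain W where W: "subspace W" "W \<subseteq> {x \<in> A. \<phi> x \<in> Wr}" "Z \<inter> W = {0}" "ssum Z W = {x \<in> A. \<phi> x \<in> Wr}"
    by (rule complement_exists[OF subspace_Z pW(1,3)])
  have WA: "W \<subseteq> A" using W(2) by blast
  have \<phi>W: "\<phi> ` W = Wr"
  proof
    show "\<phi> ` W \<subseteq> Wr" using W(2) by blast
    show "Wr \<subseteq> \<phi> ` W"
    proof
      fix y assume "y \<in> Wr"
      then obtain x where x: "x \<in> A" "\<phi> x \<in> Wr" "y = \<phi> x" using pW(4) by blast
      then have "x \<in> ssum Z W" using W(4) by simp
      then obtain z w where zw: "x = z + w" "z \<in> Z" "w \<in> W" by (auto simp: ssum_def)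
      have "\<phi> x = \<phi> w" using \<phi>_ZI[of x w] zw x(1) WA by auto
      then show "y \<in> \<phi> ` W" using x(3) zw(3) by blast
    qed
  qed
  have cEW: "c (E i) w = 0" if "i < n" "w \<in> W" for i w
  proof -
    have w: "w \<in> A" "\<phi> w \<in> Wr" using that(2) WA \<phi>W by auto
    have "e i \<in> H" using ef(1) that(1) by auto
    then show ?thesis using C[of "E i" w] EA[OF that(1)] w oHW[of "e i" "\<phi> w"] by simp
  qed
  have "iso c L" unfolding L_def
  proof (rule iso_ssum_Z[OF sE])
    fix s s' assume s: "s \<in> span (E ` {..<n})" "s' \<in> span (E ` {..<n})"
    show "c s s' = 0" by (rule span_left[OF s(1)], rule span_right[OF s(2)]) (use cE in auto)
  qed
  moreover have "perp c A L = ssum L W"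
  proof
    show "ssum L W \<subseteq> perp c A L"
    proof (rule ssum_subset[OF subspace_perp[OF cb subspace_A]])
      show "L \<subseteq> perp c A L" using \<open>iso c L\<close> L(3) by (auto simp: iso_def perp_def)
      show "W \<subseteq> perp c A L"
      proof
        fix w assume w: "w \<in> W"
        have "c x w = 0" if "x \<in> L" for x
        proof -
          obtain z s where x: "x = z + s" "z \<in> Z" "s \<in> span (E ` {..<n})" using \<open>x \<in> L\<close> by (auto simp: L_def ssum_def)
          have "c s w = 0" by (rule span_left[OF x(3)]) (use w cEW in auto)
          then show ?thesis using x c_Z(1)[OF x(2)] w WA by (auto simp: ccl)
        qed
        then show "w \<in> perp c A L" using w WA by (auto simp: perp_def)
      qed
    qed
    show "perp c A L \<subseteq> ssum L W"
    proof
      fix x assume "x \<in> perp c A L"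
      then have x: "x \<in> A" "\<And>l. l \<in> L \<Longrightarrow> c l x = 0" by (auto simp: perp_def)
      have "\<phi> x \<in> H <+>\<^bsub>M\<^esub> Wr" using HW \<phi>_in[OF x(1)] by simp
      then obtain s w where sw: "s \<in> span ?EF" "w \<in> W" "\<phi> x = \<phi> s \<oplus>\<^bsub>M\<^esub> \<phi> w"
        using HEF \<phi>W by (auto simp: set_add_def' dest!: equalityD2)
      have sA: "s \<in> A" "w \<in> A" using sw spA WA by auto
      have z: "x - (s + w) \<in> Z" using sw(3) sA x(1) A_add \<phi>_ZI[of x "s + w"] by (simp add: \<phi>_add)
      have s0: "c (E i) s = 0" if i: "i < n" for i
      proof -
        have "E i \<in> L" unfolding L_def using ssum_right[OF subspace_Z, of "span (E ` {..<n})"] span_base[of "E i" "E ` {..<n}"] i by auto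
        then have "c (E i) x = 0" by (rule x(2))
        moreover have "c (E i) (x - (s + w)) = 0" by (rule c_Z(2)[OF z EA(1)[OF i]])
        ultimately show ?thesis using cEW[OF i sw(2)] by (simp add: ccl)
      qed
      \<comment> \<open>The coordinate of \<open>s\<close> along \<open>F i\<close> is its pairing
        with \<open>E i\<close>.\<close>
      have "s - (\<Sum>i<n. c (E i) s *s F i) \<in> span (E ` {..<n})" using sw(1)
      proof (induct rule: span_induct_alt)
        case base then show ?case by (simp add: ccl span_zero)
      next
        case (step a x y)
        have "x - (\<Sum>i<n. c (E i) x *s F i) \<in> span (E ` {..<n})"
        proof (cases "x \<in> E ` {..<n}")
          case True
          then have "(\<Sum>i<n. c (E i) x *s F i) = 0" by (intro sum.neutral) (auto simp: cE)
          then show ?thesis using True by (simp add: span_base)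
        next
          case False
          then obtain j where j: "x = F j" "j < n" using step(1) by auto
          have "(\<Sum>i<n. c (E i) x *s F i) = (\<Sum>i<n. if i = j then F i else 0)" by (rule sum.cong) (use j cE in auto)
          then have "(\<Sum>i<n. c (E i) x *s F i) = x" using j by simp
          then show ?thesis by (simp add: span_zero)
        qed
        moreover have eq: "a *s x + y - (\<Sum>i<n. c (E i) (a *s x + y) *s F i) =
            a *s (x - (\<Sum>i<n. c (E i) x *s F i)) + (y - (\<Sum>i<n. c (E i) y *s F i))"
          by (simp add: ccl scale_left_distrib sum.distrib scale_right_diff_distrib scale_sum_right algebra_simps)
        ultimately show ?case using step(2) unfolding eq by (intro span_add span_scale)
      qed
      then have "s \<in> span (E ` {..<n})" by (simp add: s0)
      then have "(x - (s + w)) + s \<in> L" unfolding L_def by (rule ssumI[OF z])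
      then have "((x - (s + w)) + s) + w \<in> ssum L W" using sw(2) by (rule ssumI)
      then show "x \<in> ssum L W" by (simp add: algebra_simps)
    qed
  qed
  moreover have "aniso c W" unfolding aniso_def
  proof (intro ballI impI)
    fix w assume w: "w \<in> W" "c w w = 0"
    then have "C (\<phi> w) (\<phi> w) = 0" using C WA by auto
    then have "\<phi> w = \<zero>\<^bsub>M\<^esub>" using ni w(1) \<phi>W by (auto simp: nonisotropic_def)
    then have "w \<in> Z \<inter> W" using w WA by (auto simp: Z_def)
    then show "w = 0" using W(3) by blast
  qed
  ultimately show ?thesis using that[OF L _ W(1) WA \<phi>W] W(3) by (simp add: Int_commute)
qed

text \<open>The converse translation. Each pair of \<open>Q\<close> gives a hyperbolic plane. The
  sums \<open>fst p + snd p\<close> span a totally isotropic half of the span of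
  \<open>vecs Q\<close>, and this half together with \<open>Z\<close> is maximal because
  \<open>span N\<close> is anisotropic; this computes the Witt index.\<close>

lemma nonisotropic_part_image:
  assumes Q: "hyp c Q" "vecs Q \<subseteq> A" and N: "ortho c N" "N \<subseteq> A" "\<And>x y. x \<in> vecs Q \<Longrightarrow> y \<in> N \<Longrightarrow> c x y = 0"
    and an: "aniso c (span N)" and sp: "A \<subseteq> ssum (span (vecs Q \<union> N)) Z"
  shows "nonisotropic_part class_ring M C (\<phi> ` span N)"
proof -
  let ?X = "span (vecs Q)" and ?D = "(\<lambda>p. fst p + snd p) ` Q"
  note bc = ccl
  have XA: "?X \<subseteq> A" and NA: "span N \<subseteq> A" using Q(2) N(2) by (auto intro!: span_minimal subspace_A del: subsetI)
  have oQ: "ortho c (vecs Q)" by (rule hyp_ortho[OF Q(1) cs])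
  have Qp: "c (fst p) (fst p) \<noteq> 0" "c (snd p) (snd p) = - c (fst p) (fst p)" "c (fst p) (snd p) = 0" "c (snd p) (fst p) = 0"
    if "p \<in> Q" for p using Q(1) that c_sym[of "snd p" "fst p"] by (auto simp: hyp_def)
  have Qo: "c x y = 0" if "p \<in> Q" "q \<in> Q" "p \<noteq> q" "x \<in> {fst p, snd p}" "y \<in> {fst q, snd q}" for p q x y
    using Q(1) that unfolding hyp_def by blast
  have vQ: "fst p \<in> vecs Q" "snd p \<in> vecs Q" if "p \<in> Q" for p using that by (auto simp: vecs_def)
  have DX: "span ?D \<subseteq> ?X"
  proof (rule span_minimal[OF _ subspace_span], rule image_subsetI)
    show "fst p + snd p \<in> ?X" if "p \<in> Q" for p by (intro span_add span_base vQ that)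
  qed
  have X0: "s = 0" if s: "s \<in> ?X" "\<And>x. x \<in> vecs Q \<Longrightarrow> c x s = 0" for s using ortho_expand[OF cb oQ s(1)] s(2) by simp
  have XN: "c s t = 0" if "s \<in> ?X" "t \<in> span N" for s t
    by (rule span_left[OF that(1)], rule span_right[OF that(2)]) (rule N(3))
  have Dc: "c x y = 0" if "x \<in> span ?D" "y \<in> span ?D" for x y
  proof -
    have "c (fst p + snd p) (fst q + snd q) = 0" if "p \<in> Q" "q \<in> Q" for p q
      using Qp[OF that(1)] Qo[OF that] by (cases "p = q") (auto simp: bc)
    then have "c d d' = 0" if "d \<in> ?D" "d' \<in> ?D" for d d' using that by blast
    then show ?thesis using span_left[OF that(1)] span_right[OF that(2)] by meson
  qed
  have DP: "s \<in> span ?D" if s: "s \<in> ?X" "\<And>d. d \<in> span ?D \<Longrightarrow> c d s = 0" for s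
  proof -
    let ?s = "\<Sum>p\<in>Q. (c (fst p) s / c (fst p) (fst p)) *s (fst p + snd p)"
    have fQ: "finite Q" using Q(1) by (simp add: hyp_def)
    have D: "?s \<in> span ?D" by (intro span_sum span_scale span_base) auto
    have "s - ?s = 0"
    proof (rule X0)
      show "s - ?s \<in> ?X" using s(1) D DX by (intro span_diff) auto
      have g: "c x ?s = (c (fst p) s / c (fst p) (fst p)) * c x (fst p + snd p)" if p: "p \<in> Q" "x \<in> {fst p, snd p}" for p x
      proof -
        have "c x ?s = (\<Sum>q\<in>Q. (c (fst q) s / c (fst q) (fst q)) * c x (fst q + snd q))"
          by (simp only: bil_sum_right[OF cb] bc)
        also have "\<dots> = (\<Sum>q\<in>{p}. (c (fst q) s / c (fst q) (fst q)) * c x (fst q + snd q))"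
        proof (rule sum.mono_neutral_right)
          have "c x (fst q) = 0" "c x (snd q) = 0" if "q \<in> Q - {p}" for q using Qo[of p q x] p that by auto
          then show "\<forall>q\<in>Q - {p}. (c (fst q) s / c (fst q) (fst q)) * c x (fst q + snd q) = 0" by (simp add: bc)
        qed (use fQ p in auto)
        finally show ?thesis by simp
      qed
      fix x assume "x \<in> vecs Q"
      then obtain p where p: "p \<in> Q" "x \<in> {fst p, snd p}" unfolding vecs_def by blast
      have "c (fst p + snd p) s = 0" by (rule s(2)[OF span_base]) (use p in auto)
      then have "c (snd p) s = - c (fst p) s" by (simp add: bc eq_neg_iff_add_eq_0 add.commute)
      then show "c x (s - ?s) = 0" using p(2) g[OF p] Qp[OF p(1)] by (auto simp: bc)
    qed
    then show ?thesis using D by simp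
  qed
  have XZ: "?X \<inter> Z = {0}" using X0 c_Z(2) Q(2) subspace_0[OF subspace_span] subspace_0[OF subspace_Z] by fastforce
  have dX: "2 * dim (span ?D) = dim ?X"
  proof -
    have "perp c ?X (span ?D) = span ?D" using DP DX Dc by (auto simp: perp_def)
    moreover have "perp c ?X ?X = {0}" using X0 by (auto simp: perp_def bc span_zero intro: span_base)
    moreover have "span ?D \<inter> {0} = {0}" using span_zero by auto
    ultimately show ?thesis using dim_perp[OF cb cs subspace_span subspace_span DX] by simp
  qed
  have dec: "\<exists>s\<in>?X. \<exists>t\<in>span N. \<exists>z\<in>Z. a = (s + t) + z" if a: "a \<in> A" for a
  proof -
    have "a \<in> ssum (span (vecs Q \<union> N)) Z" using sp a by blast
    then show ?thesis unfolding span_Un ssum_def by blast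
  qed
  define L where "L = ssum Z (span ?D)"
  have DA: "span ?D \<subseteq> A" using DX XA by blast
  have L: "subspace L" "Z \<subseteq> L" "L \<subseteq> A" "span ?D \<subseteq> L"
    unfolding L_def using subspace_ssum[OF subspace_Z subspace_span] ssum_left[OF subspace_span]
      ssum_subset[OF subspace_A Z_A DA] ssum_right[OF subspace_Z] by auto
  have isoL: "iso c L" unfolding L_def using DA Dc by (rule iso_ssum_Z)
  have dL: "dim L = dim Z + dim (span ?D)"
    unfolding L_def by (rule dim_direct_sum[OF subspace_Z subspace_span]) (use XZ DX span_zero subspace_0[OF subspace_Z] in auto)
  have wi: "witt_index class_ring M C = dim (span ?D)"
  proof -
    let ?S = "{vectorspace.dim class_ring (M\<lparr>carrier := W\<rparr>) | W.
            VectorSpace.subspace class_ring W M \<and> totally_isotropic class_ring C W}"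
    have le: "d \<le> dim (span ?D)" if "d \<in> ?S" for d
    proof -
      obtain W' where W': "VectorSpace.subspace class_ring W' M" "totally_isotropic class_ring C W'"
        "d = vectorspace.dim class_ring (M\<lparr>carrier := W'\<rparr>)" using \<open>d \<in> ?S\<close> by blast
      note pW = subspace_preimage[OF W'(1)]
      let ?W = "{x \<in> A. \<phi> x \<in> W'}"
      have isoW: "iso c ?W" using W'(2) C by (fastforce simp: iso_def totally_isotropic_def)
      have "dim ?W \<le> dim L"
      proof (rule iso_dim_le[OF cb cs pW(1) isoW L(1) isoL])
        show "perp c ?W L \<subseteq> L"
        proof
          fix x assume "x \<in> perp c ?W L"
          then have x: "x \<in> A" "x \<in> ?W" "\<And>l. l \<in> L \<Longrightarrow> c l x = 0" by (auto simp: perp_def)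
          obtain s t z where stz: "s \<in> ?X" "t \<in> span N" "z \<in> Z" "x = (s + t) + z" using dec[OF x(1)] by blast
          have A: "s \<in> A" "t \<in> A" "z \<in> A" using stz XA NA Z_A by auto
          have "s \<in> span ?D"
          proof (rule DP[OF stz(1)])
            fix d assume d: "d \<in> span ?D"
            have "c d x = 0" using x(3) d L(4) by blast
            then show "c d s = 0" using stz(4) c_Z(2)[OF stz(3)] XN[OF _ stz(2)] d DX DA by (auto simp: bc subset_iff)
          qed
          have "c x x = 0" using isoW x(2) by (auto simp: iso_def)
          moreover have "c t s = 0" using XN[OF stz(1,2)] c_sym by metis
          ultimately have "c t t = 0"
            using stz(4) XN[OF stz(1,2)] c_Z[OF stz(3)] A Dc[OF \<open>s \<in> span ?D\<close> \<open>s \<in> span ?D\<close>] by (simp add: bc)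
          then have "t = 0" using an stz(2) by (auto simp: aniso_def)
          then have "x = z + s" using stz(4) by (simp add: add.commute)
          then show "x \<in> L" unfolding L_def using stz(3) \<open>s \<in> span ?D\<close> by (simp add: ssumI)
        qed
      qed
      moreover have "d + dim Z = dim ?W"
      proof -
        have "?W \<inter> Z = Z" using pW(3) by auto
        moreover have "?W \<subseteq> A" by auto
        ultimately show ?thesis using dim_image[OF pW(1)] W'(3) pW(2) by simp
      qed
      ultimately show ?thesis using dL by simp
    qed
    have "dim (span ?D) \<in> ?S"
    proof (intro CollectI exI conjI)
      show "VectorSpace.subspace class_ring (\<phi> ` span ?D) M" by (rule subspace_imp[OF subspace_span DA])
      show "totally_isotropic class_ring C (\<phi> ` span ?D)"
        unfolding totally_isotropic_def using C Dc DA by (auto simp: subset_iff)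
      have "span ?D \<inter> Z = {0}" using XZ DX span_zero subspace_0[OF subspace_Z] by auto
      then show "dim (span ?D) = vectorspace.dim class_ring (M\<lparr>carrier := \<phi> ` span ?D\<rparr>)"
        using dim_image[OF subspace_span DA] by simp
    qed
    moreover have "finite ?S" using le by (intro finite_subset[of ?S "{..dim (span ?D)}"]) auto
    ultimately show ?thesis unfolding witt_index_def using le by (intro Max_eqI) auto
  qed
  interpret H: quotient_form scale Basis b u "M\<lparr>carrier := \<phi> ` ?X\<rparr>" ?X \<phi> C c by (rule restrict[OF subspace_span XA])
  have hypb: "hyperbolic class_ring (M\<lparr>carrier := \<phi> ` ?X\<rparr>) C"
  proof -
    have fQ: "finite Q" using Q(1) by (simp add: hyp_def)
    obtain q where q: "bij_betw q {..<card Q} Q" using ex_bij_betw_nat_finite[OF fQ] by (auto simp: atLeast0LessThan)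
    define g where "g i = fst (q i)" for i
    define h where "h i = snd (q i)" for i
    define a where "a i = c (g i) (g i)" for i
    have qi: "q i \<in> Q" if "i < card Q" for i using q that by (auto simp: bij_betw_def)
    have gh: "a i \<noteq> 0" "c (h i) (h i) = - a i" "c (g i) (h i) = 0" "c (h i) (g i) = 0" "g i \<in> vecs Q" "h i \<in> vecs Q"
      if "i < card Q" for i using Qp[OF qi[OF that]] vQ[OF qi[OF that]] by (auto simp: g_def h_def a_def)
    have gho: "c (g i) (g j) = 0" "c (g i) (h j) = 0" "c (h i) (g j) = 0" "c (h i) (h j) = 0"
      if "i < card Q" "j < card Q" "i \<noteq> j" for i j
    proof -
      have "q i \<noteq> q j" using q that by (auto simp: bij_betw_def inj_on_def)
      note Qo[OF qi[OF that(1)] qi[OF that(2)] this]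
      then show "c (g i) (g j) = 0" "c (g i) (h j) = 0" "c (h i) (g j) = 0" "c (h i) (h j) = 0"
        by (auto simp: g_def h_def)
    qed
    \<comment> \<open>The values \<open>a i\<close> and \<open>- a i\<close> of an orthogonal pair
      make \<open>g i + h i\<close> and \<open>g i - h i\<close> isotropic, and their pairing
      \<open>2 * a i\<close> is normalized to 1.\<close>
    define e where "e i = g i + h i" for i
    define f where "f i = (1 / (2 * a i)) *s (g i - h i)" for i
    have efX: "e i \<in> ?X" "f i \<in> ?X" if "i < card Q" for i
      unfolding e_def f_def by (intro span_add span_diff span_scale span_base gh(5,6) that)+
    have cef: "c (e i) (e j) = 0" "c (f i) (f j) = 0" "c (e i) (f j) = (if i = j then 1 else 0)"
      if "i < card Q" "j < card Q" for i j
    proof -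
      have t: "a i + a i = 2 * a i" by simp
      show "c (e i) (e j) = 0" "c (f i) (f j) = 0" "c (e i) (f j) = (if i = j then 1 else 0)"
        using gh[OF that(1)] gho[OF that] two by (cases "i = j"; simp add: e_def f_def bc a_def[symmetric])+
    qed
    let ?n = "card Q"
    let ?EF = "e ` {..<?n} \<union> f ` {..<?n}"
    have EFX: "?EF \<subseteq> ?X" using efX by auto
    have "vecs Q \<subseteq> span ?EF"
    proof
      fix x assume "x \<in> vecs Q"
      then obtain p where p: "p \<in> Q" "x = fst p \<or> x = snd p" by (auto simp: vecs_def)
      then obtain i where i: "i < ?n" "p = q i" using q by (auto simp: bij_betw_def)
      have ef: "e i \<in> span ?EF" "(2 * a i) *s f i \<in> span ?EF" using i(1) by (auto intro: span_base span_scale)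
      have d: "(2 * a i) *s f i = g i - h i" using gh(1)[OF i(1)] two by (simp add: f_def)
      have half: "(1/2) *s (y + y) = y" for y
        using two scale_left_distrib[of "1/2" "1/2" y] by (simp add: scale_right_distrib add_divide_distrib[symmetric])
      have "g i = (1/2) *s (e i + (2 * a i) *s f i)" "h i = (1/2) *s (e i - (2 * a i) *s f i)"
        unfolding d e_def using half[of "g i"] half[of "h i"] by (simp_all add: algebra_simps)
      then have "g i \<in> span ?EF" "h i \<in> span ?EF" using ef by (metis span_add span_diff span_scale)+
      then show "x \<in> span ?EF" using p(2) i(2) by (auto simp: g_def h_def)
    qed
    then have spEF: "span ?EF = ?X" using EFX by (simp add: span_eq)
    have im: "(\<lambda>i. \<phi> (e i)) ` {..<?n} \<union> (\<lambda>i. \<phi> (f i)) ` {..<?n} = \<phi> ` ?EF" by auto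
    show ?thesis unfolding hyperbolic_def
    proof (rule exI[of _ ?n], rule exI[of _ "\<lambda>i. \<phi> (e i)"], rule exI[of _ "\<lambda>i. \<phi> (f i)"], intro conjI allI impI)
      show "(\<lambda>i. \<phi> (e i)) ` {..<?n} \<union> (\<lambda>i. \<phi> (f i)) ` {..<?n} \<subseteq> carrier (M\<lparr>carrier := \<phi> ` ?X\<rparr>)" using efX by auto
      show "LinearCombinations.module.span class_ring (M\<lparr>carrier := \<phi> ` ?X\<rparr>)
          ((\<lambda>i. \<phi> (e i)) ` {..<?n} \<union> (\<lambda>i. \<phi> (f i)) ` {..<?n}) = carrier (M\<lparr>carrier := \<phi> ` ?X\<rparr>)"
        unfolding im H.span_image[OF EFX] spEF by simp
      fix i j assume ij: "i < ?n" "j < ?n"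
      have A: "e i \<in> A" "f i \<in> A" "e j \<in> A" "f j \<in> A" using efX ij XA by auto
      show "C (\<phi> (e i)) (\<phi> (e j)) = \<zero>\<^bsub>class_ring\<^esub>" "C (\<phi> (f i)) (\<phi> (f j)) = \<zero>\<^bsub>class_ring\<^esub>"
        "C (\<phi> (e i)) (\<phi> (f j)) = (if i = j then \<one>\<^bsub>class_ring\<^esub> else \<zero>\<^bsub>class_ring\<^esub>)"
        and "C (\<phi> (f j)) (\<phi> (e i)) = (if i = j then \<one>\<^bsub>class_ring\<^esub> else \<zero>\<^bsub>class_ring\<^esub>)"
        using cef[OF ij] c_sym[of "f j" "e i"] by (simp_all add: C A)
    qed
  qed
  show ?thesis unfolding nonisotropic_part_def
  proof (intro conjI exI[of _ "\<phi> ` ?X"] hypb ballI)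
    show "VectorSpace.subspace class_ring (\<phi> ` span N) M" by (rule subspace_imp[OF subspace_span NA])
    show "VectorSpace.subspace class_ring (\<phi> ` ?X) M" by (rule subspace_imp[OF subspace_span XA])
    show "nonisotropic class_ring (M\<lparr>carrier := \<phi> ` span N\<rparr>) C" unfolding nonisotropic_def
    proof (intro ballI impI)
      fix x assume "x \<in> carrier (M\<lparr>carrier := \<phi> ` span N\<rparr>)" and x0: "C x x = \<zero>\<^bsub>class_ring\<^esub>"
      then obtain t where t: "x = \<phi> t" "t \<in> span N" by auto
      then have "c t t = 0" using x0 C[of t t] NA by auto
      then have "t = 0" using an t(2) by (auto simp: aniso_def)
      then show "x = \<zero>\<^bsub>M\<lparr>carrier := \<phi> ` span N\<rparr>\<^esub>" using t(1) by (simp add: \<phi>_zero)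
    qed
    show "vectorspace.dim class_ring (M\<lparr>carrier := \<phi> ` ?X\<rparr>) = 2 * witt_index class_ring M C"
      using dim_image[OF subspace_span XA] XZ dX wi by simp
    show "\<phi> ` ?X <+>\<^bsub>M\<^esub> \<phi> ` span N = carrier M"
    proof
      show "\<phi> ` ?X <+>\<^bsub>M\<^esub> \<phi> ` span N \<subseteq> carrier M"
        using XA NA A_add by (auto simp: set_add_def' \<phi>_add \<phi>_carrier subset_iff)
      show "carrier M \<subseteq> \<phi> ` ?X <+>\<^bsub>M\<^esub> \<phi> ` span N"
      proof
        fix y assume "y \<in> carrier M"
        then obtain x where x: "x \<in> A" "y = \<phi> x" by (auto simp: \<phi>_carrier)
        obtain s t z where stz: "s \<in> ?X" "t \<in> span N" "z \<in> Z" "x = (s + t) + z" using dec[OF x(1)] by blast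
        have A: "s \<in> A" "t \<in> A" using stz XA NA by auto
        have "\<phi> x = \<phi> (s + t)" using \<phi>_ZI[OF x(1) A_add[OF A]] stz(3,4) by simp
        then have "y = \<phi> s \<oplus>\<^bsub>M\<^esub> \<phi> t" using x(2) A by (simp add: \<phi>_add)
        then show "y \<in> \<phi> ` ?X <+>\<^bsub>M\<^esub> \<phi> ` span N" using stz by (auto simp: set_add_def')
      qed
    qed
    show "\<phi> ` ?X \<inter> \<phi> ` span N = {\<zero>\<^bsub>M\<^esub>}"
    proof
      show "{\<zero>\<^bsub>M\<^esub>} \<subseteq> \<phi> ` ?X \<inter> \<phi> ` span N" unfolding \<phi>_zero using span_zero by blast
      show "\<phi> ` ?X \<inter> \<phi> ` span N \<subseteq> {\<zero>\<^bsub>M\<^esub>}"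
      proof
        fix y assume "y \<in> \<phi> ` ?X \<inter> \<phi> ` span N"
        then obtain s t where st: "s \<in> ?X" "t \<in> span N" "y = \<phi> s" "\<phi> s = \<phi> t" by auto
        have z: "s - t \<in> Z" using \<phi>_ZI[of s t] st XA NA by auto
        have "s = 0"
        proof (rule X0[OF st(1)])
          fix x assume x: "x \<in> vecs Q"
          have "c x (s - t) = 0" using c_Z(2)[OF z] x Q(2) by blast
          then show "c x s = 0" using XN[OF span_base[OF x] st(2)] by (simp add: bc)
        qed
        then show "y \<in> {\<zero>\<^bsub>M\<^esub>}" using st(3) by (simp add: \<phi>_zero)
      qed
    qed
    fix x y assume "x \<in> \<phi> ` ?X" "y \<in> \<phi> ` span N"
    then show "C x y = \<zero>\<^bsub>class_ring\<^esub>" using XN C XA NA by (auto simp: subset_iff)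
  qed
qed

text \<open>Representatives of the images are taken in a complement \<open>D0\<close> of
  \<open>Z\<close>. They are unique there, which makes the choice linear on
  \<open>W\<close>.\<close>

lemma equivalent_imp_linear:
  fixes N :: "('a, 'n) module"
  assumes W: "subspace W"
    and \<psi>: "\<And>w w'. w \<in> W \<Longrightarrow> w' \<in> W \<Longrightarrow> \<psi> w \<oplus>\<^bsub>N\<^esub> \<psi> w' = \<psi> (w + w')" "\<And>a w. w \<in> W \<Longrightarrow> a \<odot>\<^bsub>N\<^esub> \<psi> w = \<psi> (a *s w)"
    and S: "VectorSpace.subspace class_ring S M"
    and eq: "forms_equivalent class_ring (N\<lparr>carrier := \<psi> ` W\<rparr>) D (M\<lparr>carrier := S\<rparr>) (\<lambda>x y. \<ominus>\<^bsub>class_ring\<^esub> C x y)"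
  shows "\<exists>f. lin f \<and> (\<forall>w\<in>W. f w \<in> A) \<and> (\<forall>w\<in>W. \<forall>w'\<in>W. c (f w) (f w') = - D (\<psi> w) (\<psi> w'))"
proof -
  obtain h where h: "h \<in> LinearCombinations.module_hom class_ring (N\<lparr>carrier := \<psi> ` W\<rparr>) (M\<lparr>carrier := S\<rparr>)"
    "\<forall>x\<in>\<psi> ` W. \<forall>y\<in>\<psi> ` W. - C (h x) (h y) = D x y" using eq unfolding forms_equivalent_def class_ring_simps by auto
  have hS: "h (\<psi> w) \<in> S" if "w \<in> W" for w using LinearCombinations.module_hom_closed[OF h(1)] that by auto
  have hadd: "h (\<psi> (w + w')) = h (\<psi> w) \<oplus>\<^bsub>M\<^esub> h (\<psi> w')" if "w \<in> W" "w' \<in> W" for w w'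
    using LinearCombinations.module_hom_add[OF h(1), of "\<psi> w" "\<psi> w'"] that \<psi>(1) by simp
  have hsc: "h (\<psi> (a *s w)) = a \<odot>\<^bsub>M\<^esub> h (\<psi> w)" if "w \<in> W" for a w
    using LinearCombinations.module_hom_smult[OF h(1), of a "\<psi> w"] that \<psi>(2) by simp
  obtain D0 where D0: "subspace D0" "D0 \<subseteq> A" "Z \<inter> D0 = {0}" "ssum Z D0 = A"
    by (rule complement_exists[OF subspace_Z subspace_A Z_A])
  have "\<exists>d. d \<in> D0 \<and> \<phi> d = h (\<psi> w)" if w: "w \<in> W" for w
  proof -
    obtain x where x: "x \<in> A" "\<phi> x = h (\<psi> w)" using subspace_preimage(4)[OF S hS[OF w]] by blast
    then have "x \<in> ssum Z D0" using D0(4) by simp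
    then obtain z d where zd: "x = z + d" "z \<in> Z" "d \<in> D0" by (auto simp: ssum_def)
    then have "\<phi> x = \<phi> d" using \<phi>_ZI[of x d] x(1) D0(2) by auto
    then show ?thesis using x zd by auto
  qed
  then obtain g where g: "\<And>w. w \<in> W \<Longrightarrow> g w \<in> D0" "\<And>w. w \<in> W \<Longrightarrow> \<phi> (g w) = h (\<psi> w)" by metis
  have uniq: "d = d'" if "d \<in> D0" "d' \<in> D0" "\<phi> d = \<phi> d'" for d d'
  proof -
    have "d - d' \<in> Z \<inter> D0" using that \<phi>_ZI[of d d'] D0(2) subspace_diff[OF D0(1)] by auto
    then show ?thesis using D0(3) by simp
  qed
  have gA: "g w \<in> A" if "w \<in> W" for w using g(1)[OF that] D0(2) by blast
  have gadd: "g (w + w') = g w + g w'" if "w \<in> W" "w' \<in> W" for w w'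
      by (rule uniq) (use g gA that hadd subspace_add[OF D0(1)] subspace_add[OF W] in \<open>auto simp flip: \<phi>_add\<close>)
  have gsc: "g (a *s w) = a *s g w" if "w \<in> W" for a w
      by (rule uniq) (use g gA that hsc subspace_scale[OF D0(1)] subspace_scale[OF W] in \<open>auto simp flip: \<phi>_smult\<close>)
  obtain f where f: "lin f" "\<And>w. w \<in> W \<Longrightarrow> f w = g w"
  proof (rule extend_linear[OF W, of g])
    fix f assume "lin f" "\<And>w. w \<in> W \<Longrightarrow> f w = g w"
    then show thesis by (rule that)
  qed (use gadd gsc in auto)
  have "c (f w) (f w') = - D (\<psi> w) (\<psi> w')" if "w \<in> W" "w' \<in> W" for w w'
  proof -
    have "- C (h (\<psi> w)) (h (\<psi> w')) = D (\<psi> w) (\<psi> w')" using h(2) that by blast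
    then have "- c (g w) (g w') = D (\<psi> w) (\<psi> w')" using g(2) C[OF gA gA] that by simp
    then show ?thesis using f(2) that by (metis minus_minus)
  qed
  then show ?thesis using f gA by auto
qed

text \<open>A vector of \<open>W\<close> sent into \<open>Z\<close> has value zero, and so is zero
  by \<open>an\<close>; hence the induced map on classes is injective.\<close>

lemma linear_imp_equivalent:
  fixes N :: "('a, 'n) module"
  assumes W: "subspace W"
    and \<psi>: "\<And>w w'. w \<in> W \<Longrightarrow> w' \<in> W \<Longrightarrow> \<psi> w \<oplus>\<^bsub>N\<^esub> \<psi> w' = \<psi> (w + w')" "\<And>a w. w \<in> W \<Longrightarrow> a \<odot>\<^bsub>N\<^esub> \<psi> w = \<psi> (a *s w)"
    and inj: "inj_on \<psi> W" and an: "\<And>w. w \<in> W \<Longrightarrow> D (\<psi> w) (\<psi> w) = 0 \<Longrightarrow> w = 0"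
    and f: "lin f" "\<And>w. w \<in> W \<Longrightarrow> f w \<in> A" "\<And>w w'. w \<in> W \<Longrightarrow> w' \<in> W \<Longrightarrow> c (f w) (f w') = - D (\<psi> w) (\<psi> w')"
  shows "\<exists>S. VectorSpace.subspace class_ring S M \<and>
    forms_equivalent class_ring (N\<lparr>carrier := \<psi> ` W\<rparr>) D (M\<lparr>carrier := S\<rparr>) (\<lambda>x y. \<ominus>\<^bsub>class_ring\<^esub> C x y)"
proof (intro exI conjI)
  let ?S = "\<phi> ` f ` W" and ?h = "\<lambda>X. \<phi> (f (inv_into W \<psi> X))"
  show "VectorSpace.subspace class_ring ?S M" by (rule subspace_imp[OF subspace_image[OF f(1) W]]) (use f(2) in auto)
  have i: "inv_into W \<psi> (\<psi> w) = w" if "w \<in> W" for w using inv_into_f_f[OF inj that] .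
  have "?h \<in> LinearCombinations.module_hom class_ring (N\<lparr>carrier := \<psi> ` W\<rparr>) (M\<lparr>carrier := ?S\<rparr>)"
    unfolding LinearCombinations.module_hom_def using i f(2) subspace_add[OF W] subspace_scale[OF W]
    by (auto simp: \<psi> \<phi>_add \<phi>_smult linE[OF f(1)])
  moreover have "bij_betw ?h (\<psi> ` W) ?S" unfolding bij_betw_def
  proof
    show "inj_on ?h (\<psi> ` W)"
    proof (rule inj_onI)
      fix X Y assume "X \<in> \<psi> ` W" "Y \<in> \<psi> ` W" and e: "?h X = ?h Y"
      then obtain w w' where w: "X = \<psi> w" "w \<in> W" "Y = \<psi> w'" "w' \<in> W" by blast
      have d: "w - w' \<in> W" using w subspace_diff[OF W] by blast
      have "f w - f w' \<in> Z" using e w i \<phi>_ZI[of "f w" "f w'"] f(2) by simp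
      then have "f (w - w') \<in> Z" by (simp add: linE[OF f(1)])
      then have "c (f (w - w')) (f (w - w')) = 0" using c_Z f(2)[OF d] by blast
      then have "w - w' = 0" using an[OF d] f(3)[OF d d] by simp
      then show "X = Y" using w by simp
    qed
    show "?h ` \<psi> ` W = ?S" using i by (auto simp: image_image)
  qed
  moreover have "- C (?h X) (?h Y) = D X Y" if "X \<in> \<psi> ` W" "Y \<in> \<psi> ` W" for X Y using that i f(2,3) by (auto simp: C)
  ultimately show "forms_equivalent class_ring (N\<lparr>carrier := \<psi> ` W\<rparr>) D (M\<lparr>carrier := ?S\<rparr>) (\<lambda>x y. \<ominus>\<^bsub>class_ring\<^esub> C x y)"
    unfolding forms_equivalent_def class_ring_simps by (intro bexI[of _ ?h]) simp_all
qed

end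

context selfadjoint_endo
begin

section \<open>Condition (iii)\<close>

text \<open>The pairing involves \<open>T\<close> to the power \<open>s + m + r\<close>, which is at
  least the exponent killing the vector with the smaller index.\<close>

lemma shifted_pairing:
  assumes x: "P (T ^ (m + 2 * s + 1)) x = 0" and y: "P (T ^ (m + 2 * r + 1)) y = 0" and sr: "s \<noteq> r"
  shows "cq (T ^ m) (P (T ^ s) x) (P (T ^ r) y) = 0"
proof -
  have e: "cq (T ^ m) (P (T ^ s) x) (P (T ^ r) y) = b x (P (T ^ (s + m + r)) y)"
    by (simp only: cq_def b_P power_add P_mult)
  show ?thesis
  proof (cases "r < s")
    case True
    then have "s + m + r = (s - r - 1) + (m + 2 * r + 1)" by simp
    then have "T ^ (s + m + r) = T ^ (s - r - 1) * T ^ (m + 2 * r + 1)" by (metis power_add)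
    then show ?thesis using y unfolding e by (simp only: P_mult P_linE bl)
  next
    case False
    then have "s + m + r = (r - s - 1) + (m + 2 * s + 1)" using sr by simp
    then have "T ^ (s + m + r) = T ^ (r - s - 1) * T ^ (m + 2 * s + 1)" by (metis power_add)
    then have "b x (P (T ^ (s + m + r)) y) = b (P (T ^ (r - s - 1)) (P (T ^ (m + 2 * s + 1)) x)) y"
      by (simp only: P_mult b_P P_commute)
    then show ?thesis unfolding e x by (simp add: P_linE bl)
  qed
qed

text \<open>
  The sum of the \<open>u\<^sup>s x\<^sub>s\<close> represents the family of the classes of the \<open>x\<^sub>s\<close> in \<open>V\<^sub>t\<^sub>,\<^sub>2\<^sub>i\<^sub>+\<^sub>1\<close>, \<open>i = k + 1 + s\<close>.
\<close>

definition decomp :: "nat \<Rightarrow> nat \<Rightarrow> 'v \<Rightarrow> (nat \<Rightarrow> 'v) \<Rightarrow> bool" where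
  "decomp k n d x \<longleftrightarrow> (\<forall>s. P (T ^ (2 * k + 2 + 2 * s + 1)) (x s) = 0) \<and> (\<forall>s\<ge>n. x s = 0) \<and> d = (\<Sum>s<n. P (T ^ s) (x s))"

text \<open>The choice of a decomposition matters only up to the denominators, by
  \<open>decomp_unique\<close>; \<open>components_eq\<close> allows any other one.\<close>

definition components :: "nat \<Rightarrow> nat \<Rightarrow> 'v \<Rightarrow> nat \<Rightarrow> 'v set" where
  "components k n d = (\<lambda>i\<in>{i. i > k}. co T (2 * i + 1) ((SOME x. decomp k n d x) (i - k - 1)))"

lemma decomp_exists: "d \<in> Dset (2 * k + 2) n \<longleftrightarrow> (\<exists>x. decomp k n d x)"
proof
  assume "d \<in> Dset (2 * k + 2) n"
  then obtain x where x: "\<forall>s<n. P (T ^ (2 * k + 2 + 2 * s + 1)) (x s) = 0" "d = (\<Sum>s<n. P (T ^ s) (x s))"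
    by (auto simp: Dset_def)
  have "decomp k n d (\<lambda>s. if s < n then x s else 0)" using x by (simp add: decomp_def P_linE)
  then show "\<exists>x. decomp k n d x" by blast
qed (auto simp: decomp_def Dset_def)

lemma decomp_lin:
  "decomp k n d x \<Longrightarrow> decomp k n d' x' \<Longrightarrow> decomp k n (d + d') (\<lambda>s. x s + x' s)"
  "decomp k n d x \<Longrightarrow> decomp k n (a *s d) (\<lambda>s. a *s x s)"
  "decomp k n 0 (\<lambda>s. 0)" by (simp_all add: decomp_def P_linE sum.distrib scale_sum_right)

text \<open>By \<open>shifted_pairing\<close>, pairing \<open>d\<close> with
  \<open>P (T ^ s) y\<close> isolates the term of index \<open>s\<close>.\<close>

lemma decomp_pairing:
  assumes x: "decomp k n d x" and y: "P (T ^ (2 * k + 2 + 2 * s + 1)) y = 0"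
  shows "cq (T ^ (2 * k + 2)) d (P (T ^ s) y) = cq (T ^ (2 * k + 2 + 2 * s)) (x s) y"
proof -
  have "cq (T ^ (2 * k + 2)) d (P (T ^ s) y) = (\<Sum>r<n. cq (T ^ (2 * k + 2)) (P (T ^ r) (x r)) (P (T ^ s) y))"
    using x by (simp add: decomp_def bil_sum_left[OF cq_bil])
  also have "\<dots> = (\<Sum>r<n. if r = s then cq (T ^ (2 * k + 2)) (P (T ^ s) (x s)) (P (T ^ s) y) else 0)"
    by (rule sum.cong) (use x shifted_pairing[OF _ y] in \<open>auto simp: decomp_def\<close>)
  also have "\<dots> = cq (T ^ (2 * k + 2)) (P (T ^ s) (x s)) (P (T ^ s) y)" using x by (simp add: decomp_def P_linE cql)
  also have "\<dots> = cq (T ^ (2 * k + 2 + 2 * s)) (x s) y"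
    by (simp only: cq_def b_P P_mult[symmetric] power_add[symmetric]) (simp add: mult_2 add.commute add.left_commute)
  finally show ?thesis .
qed

text \<open>By \<open>decomp_pairing\<close> the vector \<open>d\<close> determines all pairings of
  \<open>x s\<close> at its level, and the induced form is nondegenerate.\<close>

lemma decomp_unique:
  assumes x: "decomp k n d x" and x': "decomp k n d x'"
  shows "x s - x' s \<in> Nk UNIV T (2 * k + 2 + 2 * s + 1)"
proof (rule Nk_nondeg)
  have k: "P (T ^ (2 * k + 2 + 2 * s + 1)) (x s) = 0" "P (T ^ (2 * k + 2 + 2 * s + 1)) (x' s) = 0"
    using x x' by (simp_all only: decomp_def)
  then show "P (T ^ (2 * k + 2 + 2 * s + 1)) (x s - x' s) = 0" by (simp only: P_linE diff_self)
  fix z assume z: "P (T ^ (2 * k + 2 + 2 * s + 1)) z = 0"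
  show "b (x s - x' s) (P (T ^ (2 * k + 2 + 2 * s + 1 - 1)) z) = 0"
    using decomp_pairing[OF x z] decomp_pairing[OF x' z] by (simp add: cq_def bl)
qed simp

lemma components_eq:
  assumes x: "decomp k n d x"
  shows "components k n d = (\<lambda>i\<in>{i. i > k}. co T (2 * i + 1) (x (i - k - 1)))" unfolding components_def
proof (rule restrict_ext)
  fix i assume "i \<in> {i. i > k}"
  then have i: "2 * k + 2 + 2 * (i - k - 1) + 1 = 2 * i + 1" by simp
  have "decomp k n d (SOME x. decomp k n d x)" by (rule someI[of "decomp k n d", OF x])
  then show "co T (2 * i + 1) ((SOME x. decomp k n d x) (i - k - 1)) = co T (2 * i + 1) (x (i - k - 1))"
    unfolding co_eq_iff using decomp_unique[OF _ x, of _ "i - k - 1"] unfolding i by blast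
qed

abbreviation sum_space :: "nat \<Rightarrow> ('a, nat \<Rightarrow> 'v set) module" where
  "sum_space k \<equiv> orthogonal_sum_space {i. i > k} (\<lambda>i. Bs T (2 * i + 1))"

abbreviation sum_form :: "nat \<Rightarrow> (nat \<Rightarrow> 'v set) \<Rightarrow> (nat \<Rightarrow> 'v set) \<Rightarrow> 'a" where
  "sum_form k \<equiv> orthogonal_sum_form class_ring {i. i > k} (\<lambda>i. Bs T (2 * i + 1))
     (\<lambda>i. Bf T (2 * i + 1))"

lemma decomp_kernel: "decomp k n d x \<Longrightarrow> i > k \<Longrightarrow> P (T ^ (2 * i + 1)) (x (i - k - 1)) = 0"
proof -
  assume "decomp k n d x" "i > k"
  moreover from this have "2 * k + 2 + 2 * (i - k - 1) + 1 = 2 * i + 1" by simp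
  ultimately show ?thesis unfolding decomp_def by metis
qed

text \<open>The infinite sum is exhausted by \<open>n\<close> terms: beyond them
  \<open>2 * i\<close> is at least \<open>dimension\<close>, so \<open>T ^ (2 * i)\<close> kills the
  nilpotent part and V_{t,2i+1} is zero.\<close>

lemma sum_carrier:
  assumes n: "2 * k + 2 * n \<ge> dimension"
  shows "carrier (sum_space k) = components k n ` Dset (2 * k + 2) n"
proof
  show "components k n ` Dset (2 * k + 2) n \<subseteq> carrier (sum_space k)"
  proof
    fix f assume "f \<in> components k n ` Dset (2 * k + 2) n"
    then obtain d x where d: "f = components k n d" "decomp k n d x" using decomp_exists by blast
    have z: "x s = 0" if "s \<ge> n" for s using d(2) that by (simp only: decomp_def)
    have "f i = Nk UNIV T (2 * i + 1)" if "i \<ge> k + 1 + n" for i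
      unfolding d(1) components_eq[OF d(2)] using that z[of "i - k - 1"] by (simp add: co_0)
    then have "{i \<in> {i. i > k}. f i \<noteq> Nk UNIV T (2 * i + 1)} \<subseteq> {..<k + 1 + n}" by (auto simp: not_le[symmetric])
    then have "finite {i \<in> {i. i > k}. f i \<noteq> Nk UNIV T (2 * i + 1)}" by (rule finite_subset) simp
    moreover have "f \<in> (\<Pi>\<^sub>E i\<in>{i. i > k}. co T (2 * i + 1) ` {x. P (T ^ (2 * i + 1)) x = 0})"
      unfolding d(1) components_eq[OF d(2)] using decomp_kernel[OF d(2)] by auto
    ultimately show "f \<in> carrier (sum_space k)" by (simp add: orthogonal_sum_space_def inv_simps)
  qed
  show "carrier (sum_space k) \<subseteq> components k n ` Dset (2 * k + 2) n"
  proof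
    fix f assume "f \<in> carrier (sum_space k)"
    then have f: "f \<in> (\<Pi>\<^sub>E i\<in>{i. i > k}. co T (2 * i + 1) ` {x. P (T ^ (2 * i + 1)) x = 0})"
      by (simp add: orthogonal_sum_space_def inv_simps)
    then have "\<forall>i. \<exists>y. i > k \<longrightarrow> P (T ^ (2 * i + 1)) y = 0 \<and> f i = co T (2 * i + 1) y"
      by (fastforce simp: PiE_def Pi_def)
    then obtain y where y: "\<And>i. i > k \<Longrightarrow> P (T ^ (2 * i + 1)) (y i) = 0" "\<And>i. i > k \<Longrightarrow> f i = co T (2 * i + 1) (y i)"
      by metis
    define x where "x s = (if s < n then y (k + 1 + s) else 0)" for s
    have e: "2 * k + 2 + 2 * s + 1 = 2 * (k + 1 + s) + 1" for s by simp
    have d: "decomp k n (\<Sum>s<n. P (T ^ s) (x s)) x" unfolding decomp_def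
    proof (intro conjI allI impI)
      show "P (T ^ (2 * k + 2 + 2 * s + 1)) (x s) = 0" for s
      proof (cases "s < n")
        case True
        have "P (T ^ (2 * (k + 1 + s) + 1)) (y (k + 1 + s)) = 0" by (rule y(1)) simp
        then show ?thesis unfolding e by (simp only: x_def True if_True)
      qed (simp add: x_def P_linE)
    qed (simp_all add: x_def)
    have "co T (2 * i + 1) (x (i - k - 1)) = f i" if i: "i > k" for i
    proof (cases "i - k - 1 < n")
      case True then show ?thesis using i y(2)[OF i] by (simp add: x_def)
    next
      case False
      have "y i \<in> prim T" using y(1)[OF i] by (rule in_prim)
      moreover have "T ^ (2 * i) = T ^ (2 * i - dimension) * T ^ dimension" using False n i by (simp flip: power_add)
      ultimately have "P (T ^ (2 * i)) (y i) = 0" by (simp only: prim_def mem_Collect_eq P_mult P_linE)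
      then have "y i = y i + P T 0 \<and> P (T ^ (2 * i + 1 - 1)) (y i) = 0 \<and> P (T ^ (2 * i + 1)) (P T 0) = 0" by (simp add: P_linE)
      then have "y i \<in> Nk UNIV T (2 * i + 1)" unfolding Nk_def by blast
      then show ?thesis using False y(2)[OF i] co_zero_iff[of T "2 * i + 1" "y i"] by (simp add: x_def co_0)
    qed
    then have "components k n (\<Sum>s<n. P (T ^ s) (x s)) = f"
      unfolding components_eq[OF d] using PiE_arb[OF f] by (auto simp: restrict_def fun_eq_iff)
    then show "f \<in> components k n ` Dset (2 * k + 2) n" using d decomp_exists by blast
  qed
qed

lemma sum_form_components:
  assumes d: "d \<in> Dset (2 * k + 2) n" and d': "d' \<in> Dset (2 * k + 2) n"
  shows "sum_form k (components k n d) (components k n d') = cq (T ^ (2 * k + 2)) d d'"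
proof -
  obtain x x' where x: "decomp k n d x" and x': "decomp k n d' x'" using d d' decomp_exists by blast
  let ?f = "components k n d" and ?f' = "components k n d'"
  let ?I = "{i \<in> {i. i > k}. ?f i \<noteq> Nk UNIV T (2 * i + 1) \<and> ?f' i \<noteq> Nk UNIV T (2 * i + 1)}"
  define F where "F i = cq (T ^ (2 * i)) (x (i - k - 1)) (x' (i - k - 1))" for i
  have bf: "Bf T (2 * i + 1) (?f i) (?f' i) = F i" if "i > k" for i
    using base_form_co[OF decomp_kernel[OF x that] decomp_kernel[OF x' that]] that
    by (simp add: components_eq[OF x] components_eq[OF x'] F_def cq_def)
  have fx: "?f i = co T (2 * i + 1) (x (i - k - 1))" "?f' i = co T (2 * i + 1) (x' (i - k - 1))" if "i > k" for i
    using that by (simp_all add: components_eq[OF x] components_eq[OF x'])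
  \<comment> \<open>The form of the sum skips the indices where an argument is zero; by
    \<open>Nk_orth\<close> their terms would vanish.\<close>
  have F0: "F i = 0" if i: "i > k" "i \<notin> ?I" for i
  proof -
    have "x (i - k - 1) \<in> Nk UNIV T (2 * i + 1) \<or> x' (i - k - 1) \<in> Nk UNIV T (2 * i + 1)"
      using i fx[OF i(1)] by (auto simp: co_zero_iff)
    then show ?thesis
    proof
      assume "x (i - k - 1) \<in> Nk UNIV T (2 * i + 1)"
      from Nk_orth[OF this decomp_kernel[OF x' i(1)], of 1] show ?thesis by (simp add: F_def cq_def)
    next
      assume "x' (i - k - 1) \<in> Nk UNIV T (2 * i + 1)"
      from Nk_orth[OF this decomp_kernel[OF x i(1)], of 1] show ?thesis
        using cq_comm[of "T ^ (2 * i)"] by (simp add: F_def) (simp add: cq_def)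
    qed
  qed
  have xn: "x s = 0" if "s \<ge> n" for s using x that by (simp only: decomp_def)
  have form_val: "?I \<subseteq> (\<lambda>s. k + 1 + s) ` {..<n}"
  proof
    fix i assume i: "i \<in> ?I"
    have "i - k - 1 < n"
    proof (rule ccontr)
      assume "\<not> i - k - 1 < n"
      then have "?f i = Nk UNIV T (2 * i + 1)" using fx(1)[of i] xn[of "i - k - 1"] i by (simp add: co_0)
      then show False using i by simp
    qed
    then show "i \<in> (\<lambda>s. k + 1 + s) ` {..<n}" using i by (intro image_eqI[of _ _ "i - k - 1"]) auto
  qed
  have "sum_form k ?f ?f' = (\<Sum>i\<in>?I. Bf T (2 * i + 1) (?f i) (?f' i))"
    unfolding orthogonal_sum_form_def inv_simps class_ring_simps ..
  also have "\<dots> = (\<Sum>i\<in>?I. F i)" by (rule sum.cong) (use bf in auto)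
  also have "\<dots> = (\<Sum>i\<in>(\<lambda>s. k + 1 + s) ` {..<n}. F i)" by (rule sum.mono_neutral_left) (use form_val F0 in auto)
  also have "\<dots> = (\<Sum>s<n. F (k + 1 + s))" by (rule sum.reindex_cong[of "\<lambda>s. k + 1 + s"]) (auto simp: inj_on_def)
  also have "\<dots> = (\<Sum>s<n. cq (T ^ (2 * k + 2)) d (P (T ^ s) (x' s)))"
  proof (rule sum.cong[OF refl])
    fix s
    have e: "2 * k + 2 + 2 * s = 2 * (k + 1 + s)" by simp
    have "P (T ^ (2 * k + 2 + 2 * s + 1)) (x' s) = 0" using x' by (simp only: decomp_def)
    from decomp_pairing[OF x this] show "F (k + 1 + s) = cq (T ^ (2 * k + 2)) d (P (T ^ s) (x' s))"
      unfolding F_def e by simp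
  qed
  also have "\<dots> = cq (T ^ (2 * k + 2)) d d'" using x' by (simp add: decomp_def bil_sum_right[OF cq_bil])
  finally show ?thesis .
qed

lemma sum_quotient_form:
  assumes n: "2 * k + 2 * n \<ge> dimension"
  shows "quotient_form scale Basis b u (sum_space k) (Dset (2 * k + 2) n) (components k n) (sum_form k) (cq (T ^ (2 * k + 2)))"
proof (intro quotient_form.intro quotient_form_axioms.intro represented.intro)
  show "selfadjoint_endo scale Basis b u" by (rule selfadjoint_endo_axioms)
  show "field (class_ring :: 'a ring)" by (rule class_field)
  show "bilinear_form scale (cq (T ^ (2 * k + 2)))" "symmetric_form (cq (T ^ (2 * k + 2)))" by (rule cq_bil, rule cq_sym)
  show "carrier (sum_space k) = components k n ` Dset (2 * k + 2) n" by (rule sum_carrier[OF n])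
  show "sum_form k (components k n x) (components k n y) = cq (T ^ (2 * k + 2)) x y"
    if "x \<in> Dset (2 * k + 2) n" "y \<in> Dset (2 * k + 2) n" for x y by (rule sum_form_components[OF that])
  show "components k n d \<oplus>\<^bsub>sum_space k\<^esub> components k n d' = components k n (d + d')"
    if d: "d \<in> Dset (2 * k + 2) n" "d' \<in> Dset (2 * k + 2) n" for d d'
  proof -
    obtain x x' where x: "decomp k n d x" and x': "decomp k n d' x'" using d decomp_exists by blast
    show ?thesis unfolding components_eq[OF x] components_eq[OF x'] components_eq[OF decomp_lin(1)[OF x x']]
      by (auto simp: orthogonal_sum_space_def inv_simps restrict_def fun_eq_iff)
  qed
  show "\<zero>\<^bsub>sum_space k\<^esub> = components k n 0"
    unfolding components_eq[OF decomp_lin(3)] by (simp add: orthogonal_sum_space_def inv_simps co_0)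
  show "a \<odot>\<^bsub>sum_space k\<^esub> components k n d = components k n (a *s d)" if d: "d \<in> Dset (2 * k + 2) n" for a d
  proof -
    obtain x where x: "decomp k n d x" using d decomp_exists by blast
    show ?thesis unfolding components_eq[OF x] components_eq[OF decomp_lin(2)[OF x]]
      by (auto simp: orthogonal_sum_space_def base_smult restrict_def fun_eq_iff)
  qed
qed (auto simp: subspace_add[OF subspace_Dset] subspace_0[OF subspace_Dset] subspace_scale[OF subspace_Dset]
       scale_right_distrib scale_left_distrib)

lemma base_quotient_form:
  assumes k: "k \<ge> 1"
  shows "quotient_form scale Basis b u (Bs p k) {x. P (p ^ k) x = 0} (co p k)
    (Bf p k) (cq (p ^ (k - 1)))"
proof (intro quotient_form.intro quotient_form_axioms.intro rep_base cq_bil cq_sym)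
  show "selfadjoint_endo scale Basis b u" by (rule selfadjoint_endo_axioms)
  show "Bf p k (co p k x) (co p k y) = cq (p ^ (k - 1)) x y"
    if "x \<in> {x. P (p ^ k) x = 0}" "y \<in> {x. P (p ^ k) x = 0}" for x y
    using base_form_co[of p k x y] that k by (simp add: cq_def)
qed

lemma Rset_components:
  assumes n: "2 * k + 2 * n \<ge> dimension" and d: "d \<in> Rset (2 * k + 2) n"
  shows "components k n d = \<zero>\<^bsub>sum_space k\<^esub>"
proof -
  obtain x where x: "\<forall>s<n. P (T ^ (2 * k + 2 + 2 * s)) (x s) = 0" "d = (\<Sum>s<n. P (T ^ s) (x s))"
    using d by (auto simp: Rset_def)
  define x' where "x' s = (if s < n then x s else 0)" for s
  have x0: "P (T ^ (2 * k + 2 + 2 * s)) (x' s) = 0" for s using x(1) by (simp add: x'_def P_linE)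
  have dx: "decomp k n d x'" unfolding decomp_def
  proof (intro conjI allI impI)
    show "P (T ^ (2 * k + 2 + 2 * s + 1)) (x' s) = 0" for s
      using x0[of s] by (simp only: power_add[of _ _ 1] mult.commute[of _ "T ^ 1"] P_mult P_linE)
  qed (auto simp: x'_def x(2))
  have "co T (2 * i + 1) (x' (i - k - 1)) = Nk UNIV T (2 * i + 1)" if i: "i > k" for i
  proof -
    have "2 * k + 2 + 2 * (i - k - 1) = 2 * i + 1 - 1" using i by simp
    then have "P (T ^ (2 * i + 1 - 1)) (x' (i - k - 1)) = 0" using x0 by metis
    then have "x' (i - k - 1) = x' (i - k - 1) + P T 0 \<and> P (T ^ (2 * i + 1 - 1)) (x' (i - k - 1)) = 0 \<and>
      P (T ^ (2 * i + 1)) (P T 0) = 0" by (simp add: P_linE)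
    then have "x' (i - k - 1) \<in> Nk UNIV T (2 * i + 1)" unfolding Nk_def by blast
    then show ?thesis by (simp add: co_zero_iff)
  qed
  then show ?thesis
    unfolding components_eq[OF dx] by (auto simp: orthogonal_sum_space_def inv_simps restrict_def fun_eq_iff)
qed

text \<open>\<open>nonisotropic_part_image\<close> shows that \<open>span N\<close> represents a
  nonisotropic part of the sum, and the isometry provided by (iii) is lifted to vectors by
  \<open>equivalent_imp_linear\<close>.\<close>

lemma condition_iii_sufficient:
  assumes witt_condition: "\<And>k. witt_simplifies class_ring (Bs T (2 * k + 1)) (Bf T (2 * k + 1))
    (sum_space k) (sum_form k)"
  shows witt_condition unfolding witt_condition_def
proof (intro allI impI)
  fix k n N Q
  assume n: "2 * k + 2 * n \<ge> dimension" "n \<ge> 1" and witt_split: "witt_split (2 * k + 2) n N Q"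
  interpret S: quotient_form scale Basis b u "sum_space k" "Dset (2 * k + 2) n" "components k n" "sum_form k" "cq (T ^ (2 * k + 2))"
    by (rule sum_quotient_form[OF n(1)])
  interpret B: quotient_form scale Basis b u "Bs T (2 * k + 1)" "{x. P (T ^ (2 * k + 1)) x = 0}"
    "co T (2 * k + 1)" "Bf T (2 * k + 1)" "cq (T ^ (2 * k + 1 - 1))" by (rule base_quotient_form) simp
  have t: "hyp (cq (T ^ (2 * k + 2))) Q" "vecs Q \<subseteq> Dset (2 * k + 2) n" "ortho (cq (T ^ (2 * k + 2))) N" "N \<subseteq> Dset (2 * k + 2) n"
    "\<And>x y. x \<in> vecs Q \<Longrightarrow> y \<in> N \<Longrightarrow> cq (T ^ (2 * k + 2)) x y = 0" "aniso (cq (T ^ (2 * k + 2))) (span N)"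
    "Dset (2 * k + 2) n \<subseteq> ssum (span (vecs Q \<union> N)) (Rset (2 * k + 2) n)" using witt_split by (auto simp: witt_split_def)
  have RZ: "Rset (2 * k + 2) n \<subseteq> S.Z" unfolding S.Z_def using Rset_Dset Rset_components[OF n(1)] by blast
  have "Dset (2 * k + 2) n \<subseteq> ssum (span (vecs Q \<union> N)) S.Z" using t(7) RZ by (fastforce simp: ssum_def)
  from S.nonisotropic_part_image[OF t(1-4) t(5) t(6) this]
  have "nonisotropic_part class_ring (sum_space k) (sum_form k) (components k n ` span N)" .
  then obtain W' where W': "VectorSpace.subspace class_ring W' (Bs T (2 * k + 1))"
    "forms_equivalent class_ring (subspace_module (sum_space k) (components k n ` span N)) (sum_form k)
      (subspace_module (Bs T (2 * k + 1)) W') (\<lambda>x y. \<ominus>\<^bsub>class_ring\<^esub> Bf T (2 * k + 1) x y)"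
    using witt_condition[of k] unfolding witt_simplifies_def by metis
  have ND: "span N \<subseteq> Dset (2 * k + 2) n" using t(4) subspace_Dset by (rule span_minimal)
  have "\<exists>f. lin f \<and> (\<forall>w\<in>span N. f w \<in> {x. P (T ^ (2 * k + 1)) x = 0}) \<and>
     (\<forall>w\<in>span N. \<forall>w'\<in>span N. cq (T ^ (2 * k + 1 - 1)) (f w) (f w') = - sum_form k (components k n w) (components k n w'))"
    by (rule B.equivalent_imp_linear[OF subspace_span _ _ W'])
       (use ND S.\<phi>_add S.\<phi>_smult in \<open>auto simp: subset_iff\<close>)
  then obtain f where f: "lin f" "\<And>w. w \<in> span N \<Longrightarrow> P (T ^ (2 * k + 1)) (f w) = 0"
    "\<And>w w'. w \<in> span N \<Longrightarrow> w' \<in> span N \<Longrightarrow> cq (T ^ (2 * k + 1 - 1)) (f w) (f w') = - sum_form k (components k n w) (components k n w')"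
    by blast
  have "cq (T ^ (2 * k)) (f w) (f w') = - cq (T ^ (2 * k + 2)) w w'" if "w \<in> span N" "w' \<in> span N" for w w'
    using f(3)[OF that] S.C[of w w'] ND that by auto
  then show "\<exists>f. lin f \<and> (\<forall>w\<in>span N. P (T ^ (2 * k + 1)) (f w) = 0) \<and>
        (\<forall>w\<in>span N. \<forall>w'\<in>span N. cq (T ^ (2 * k)) (f w) (f w') = - cq (T ^ (2 * k + 2)) w w')" using f(1,2) by blast
qed

text \<open>\<open>isotropic_pair\<close> is used with \<open>q = T ^ (2 * k)\<close>: its
  hypotheses hold because \<open>v\<close> and \<open>w\<close> commute with \<open>u^2\<close>,
  though in general not with \<open>u\<close>. The resulting inequality feeds
  \<open>embedding\<close>, whose map is read as an isometry of quotients by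
  \<open>linear_imp_equivalent\<close>.\<close>

lemma condition_iii_necessary:
  assumes v: "lin v" "selfadjoint b v" "\<And>x. v (v x) = 0" and w: "lin w" "selfadjoint b w" "\<And>x. w (w x) = 0"
    and uvw: "\<And>x. u x = v x + w x"
  shows "witt_simplifies class_ring (Bs T (2 * k + 1)) (Bf T (2 * k + 1))
    (sum_space k) (sum_form k)" unfolding witt_simplifies_def
proof (intro allI impI)
  fix Wr assume np: "nonisotropic_part class_ring (sum_space k) (sum_form k) Wr"
  \<comment> \<open>Large enough for \<open>sum_carrier\<close> and \<open>perp_Rset\<close>,
    whatever \<open>k\<close> is.\<close>
  define n where "n = dimension + 1"
  have n: "2 * k + 2 * n \<ge> dimension" "n \<ge> 1" "2 * k + 2 + 2 * n \<ge> dimension + 2" by (auto simp: n_def)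
  let ?m = "2 * k + 2"
  interpret S: quotient_form scale Basis b u "sum_space k" "Dset ?m n" "components k n" "sum_form k" "cq (T ^ ?m)"
    by (rule sum_quotient_form[OF n(1)])
  interpret B: quotient_form scale Basis b u "Bs T (2 * k + 1)" "{x. P (T ^ (2 * k + 1)) x = 0}"
    "co T (2 * k + 1)" "Bf T (2 * k + 1)" "cq (T ^ (2 * k + 1 - 1))" by (rule base_quotient_form) simp
  obtain L W where LW: "subspace L" "S.Z \<subseteq> L" "L \<subseteq> Dset ?m n" "iso (cq (T ^ ?m)) L" "subspace W" "W \<subseteq> Dset ?m n"
    "components k n ` W = Wr" "perp (cq (T ^ ?m)) (Dset ?m n) L = ssum L W" "aniso (cq (T ^ ?m)) W" "W \<inter> S.Z = {0}"
    by (rule S.nonisotropic_part_preimage[OF np])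
  have qT: "T ^ (2 * k) * (T * T) = T ^ ?m" by (simp only: power_add power2_eq_square)
  have comm: "g (P (T ^ (2 * j)) x) = P (T ^ (2 * j)) (g x)" if g: "lin g" "\<And>x. g (u (u x)) = u (u (g x))" for g j x
  proof (induct j)
    case (Suc j)
    have "P (T ^ (2 * Suc j)) y = u (u (P (T ^ (2 * j)) y))" for y
      by (simp only: mult_Suc_right power_add power2_eq_square P_mult P_T)
    then show ?case using Suc g(2) by simp
  qed simp
  \<comment> \<open>As \<open>v\<close> and \<open>w\<close> square to zero, \<open>u^2\<close> is
    \<open>v w + w v\<close>, which commutes with both.\<close>
  have vu: "v (u (u x)) = u (u (v x))" "w (u (u x)) = u (u (w x))" for x
    by (simp_all add: uvw linE[OF v(1)] linE[OF w(1)] v(3) w(3))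
  have prim: "g x \<in> prim T" if g: "lin g" "\<And>x. g (u (u x)) = u (u (g x))" and x: "x \<in> prim T" for g x
  proof -
    have "P (T ^ (2 * dimension)) x = 0" using x by (simp only: prim_def mem_Collect_eq mult_2 power_add P_mult P_linE)
    then have "P (T ^ (2 * dimension)) (g x) = 0" using comm[OF g, of dimension x] by (simp add: linE[OF g(1)])
    then show ?thesis by (rule in_prim)
  qed
  note Sp = subspace_prim[of T] stable_prim[of T] nondeg_prim[of T]
  obtain U X where UX: "subspace U" "U \<subseteq> prim T" "iso (cq (T ^ (2 * k))) U" "subspace X" "X \<subseteq> prim T"
    "iso (cq (T ^ (2 * k) * (T * T))) X"
    "dim (P (T ^ (2 * k) * T) ` prim T) \<le> dim (P (T ^ (2 * k)) ` U) + dim (P (T ^ (2 * k) * (T * T)) ` X)"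
    by (rule isotropic_pair[OF Sp(1,3) v prim[OF v(1) vu(1)] w prim[OF w(1) vu(2)] uvw
          comm[OF v(1) vu(1)] comm[OF w(1) vu(2)]])
  have "Rset ?m n \<subseteq> S.Z" unfolding S.Z_def using Rset_Dset Rset_components[OF n(1)] by blast
  then have RL: "Rset ?m n \<subseteq> L" using LW(2) by (rule order_trans)
  obtain f where f: "lin f" "\<And>x. x \<in> W \<Longrightarrow> f x \<in> prim T \<and> P (T ^ (2 * k) * T) (f x) = 0"
    "\<And>x y. x \<in> W \<Longrightarrow> y \<in> W \<Longrightarrow> cq (T ^ (2 * k)) (f x) (f y) = - cq (T ^ (2 * k) * (T * T)) x y"
  proof (rule embedding[OF Sp LW(1) _ _ _ LW(5) _ _ _ UX, unfolded qT])
    show "L \<subseteq> prim T" "W \<subseteq> prim T" by (rule order_trans[OF LW(3) Dset_prim], rule order_trans[OF LW(6) Dset_prim])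
    show "{x \<in> prim T. P (T ^ ?m) x = 0} \<subseteq> L" using Rset_ker[OF n(2)] RL by auto
    show "iso (cq (T ^ ?m)) L" by (rule LW(4))
    show "x = 0" if "x \<in> W" "cq (T ^ ?m) x x = 0" for x using LW(9) that by (simp add: aniso_def)
    \<comment> \<open>Since \<open>L\<close> contains \<open>Rset\<close>, its orthogonal in
      \<open>prim T\<close> already lies in \<open>Dset\<close>.\<close>
    have "perp (cq (T ^ ?m)) (prim T) L = perp (cq (T ^ ?m)) (Dset ?m n) L"
      using perp_antimono[OF RL, of "cq (T ^ ?m)" "prim T"] perp_Rset[OF n(3,2)] Dset_prim by (auto simp: perp_def)
    then show "perp (cq (T ^ ?m)) (prim T) L = ssum L W" using LW(8) by simp
    fix f assume "lin f" "\<And>x. x \<in> W \<Longrightarrow> f x \<in> prim T \<and> P (T ^ (2 * k) * T) (f x) = 0"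
    "\<And>x y. x \<in> W \<Longrightarrow> y \<in> W \<Longrightarrow> cq (T ^ (2 * k)) (f x) (f y) = - cq (T ^ ?m) x y"
    then show thesis using that unfolding qT by blast
  qed
  have WD: "w \<in> Dset ?m n" if "w \<in> W" for w using that LW(6) by blast
  show "\<exists>S'. VectorSpace.subspace class_ring S' (Bs T (2 * k + 1)) \<and>
     forms_equivalent class_ring (subspace_module (sum_space k) Wr) (sum_form k)
      (subspace_module (Bs T (2 * k + 1)) S') (\<lambda>x y. \<ominus>\<^bsub>class_ring\<^esub> Bf T (2 * k + 1) x y)" unfolding LW(7)[symmetric]
  proof (rule B.linear_imp_equivalent[OF LW(5)])
    show "components k n x \<oplus>\<^bsub>sum_space k\<^esub> components k n y = components k n (x + y)" if "x \<in> W" "y \<in> W" for x y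
      by (rule S.\<phi>_add[OF WD WD, OF that])
    show "a \<odot>\<^bsub>sum_space k\<^esub> components k n x = components k n (a *s x)" if "x \<in> W" for a x
      by (rule S.\<phi>_smult[OF WD, OF that])
    show "inj_on (components k n) W"
    proof (rule inj_onI)
      fix x y assume "x \<in> W" "y \<in> W" "components k n x = components k n y"
      then have "x - y \<in> W \<inter> S.Z" using S.\<phi>_ZI[OF WD WD] subspace_diff[OF LW(5)] by auto
      then have "x - y \<in> {0}" unfolding LW(10) .
      then show "x = y" by simp
    qed
    show "x = 0" if "x \<in> W" "sum_form k (components k n x) (components k n x) = 0" for x
      using LW(9) that S.C[OF WD WD] by (simp add: aniso_def)
    show "lin f" by (rule f(1))
    show "f x \<in> {x. P (T ^ (2 * k + 1)) x = 0}" if "x \<in> W" for x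
      using f(2)[OF that] by (simp only: power_add power_one_right mem_Collect_eq)
    show "cq (T ^ (2 * k + 1 - 1)) (f x) (f y) = - sum_form k (components k n x) (components k n y)" if "x \<in> W" "y \<in> W" for x y
      using f(3)[OF that] S.C[OF WD WD, OF that] by (simp only: qT add_diff_cancel_right')
  qed
qed

lemma condition_ii_prim:
  assumes p: "p \<in> Irr" "\<not> p dvd op_poly p"
    and eq: "\<And>k. k \<ge> 1 \<Longrightarrow> op_equivalent p k"
  shows "good (ssum (prim p) (prim (op_poly p)))"
proof (rule good_prim_pair[OF _ neg_arg_eq_op_poly _ p(2)])
  show "irreducible p" using p by (simp add: Irr_def)
  show "(- 1 :: 'a) ^ degree p \<noteq> 0" by simp
qed (rule condition_ii_sufficient[OF p(1) _ eq])

end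

theorem theorem1p15:
  fixes scale :: "'a::field \<Rightarrow> 'v::ab_group_add \<Rightarrow> 'v"
    and Basis :: "'v set"
    and b :: "'v \<Rightarrow> 'v \<Rightarrow> 'a"
    and u :: "'v \<Rightarrow> 'v"
  assumes "CHAR('a) \<noteq> 2"
    and "finite_dimensional_vector_space scale Basis"
    and "bilinear_form scale b" and "symmetric_form b" and "nondegenerate_form b"
    and "Vector_Spaces.linear scale scale u" and "selfadjoint b u"
  shows
    "(\<exists>v w. Vector_Spaces.linear scale scale v \<and> selfadjoint b v \<and> square_zero v \<and>
            Vector_Spaces.linear scale scale w \<and> selfadjoint b w \<and> square_zero w \<and>
            (\<forall>x. u x = v x + w x))
     \<longleftrightarrow>
       (\<forall>p \<in> Irr0. \<forall>r \<ge> 1.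
          skew_representable (residue_field p) residue_neg (invariant_space scale u p r)
            (quadratic_form_of (invariant_form scale b u p r))) \<and>
       (\<forall>p \<in> Irr - (Irr0 \<union> {[:0, 1:]}). \<forall>k \<ge> 1.
          forms_equivalent (residue_field p)
            (invariant_space scale u p k)
            (invariant_form scale b u p k)
            (op_space p (invariant_space scale u (op_poly p) k))
            (sign_scaled (residue_field p) (1 + (k - 1) * degree p)
               (op_form (invariant_form scale b u (op_poly p) k)))) \<and>
       (\<forall>k::nat.
          witt_simplifies class_ring
            (base_space scale u [:0, 1:] (2 * k + 1))
            (base_form scale b u [:0, 1:] (2 * k + 1))
            (orthogonal_sum_space {i. i > k} (\<lambda>i. base_space scale u [:0, 1:] (2 * i + 1)))
            (orthogonal_sum_form class_ring {i. i > k}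
               (\<lambda>i. base_space scale u [:0, 1:] (2 * i + 1))
               (\<lambda>i. base_form scale b u [:0, 1:] (2 * i + 1))))"
proof -
  have two: "(2 :: 'a) \<noteq> 0"
  proof
    assume "(2 :: 'a) = 0"
    then have "of_nat 2 = (0 :: 'a)" by simp
    then have "CHAR('a) dvd 2" by (simp only: of_nat_eq_0_iff_char_dvd)
    then have "CHAR('a) = 1 \<or> CHAR('a) = 2" by (rule prime_nat_iff[THEN iffD1, OF two_is_prime_nat, THEN conjunct2, rule_format])
    then show False using assms(1) CHAR_not_1 by auto
  qed
  interpret finite_dimensional_vector_space scale Basis by (rule assms(2))
  interpret selfadjoint_endo scale Basis b u
    by (rule selfadjoint_endo.intro[OF assms(2) selfadjoint_endo_axioms.intro[OF two assms(3-7)]])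
  show ?thesis (is "?L \<longleftrightarrow> ?I \<and> ?II \<and> ?III")
  proof
    assume ?L
    then obtain v w where v: "lin v" "selfadjoint b v" "square_zero v" and w: "lin w" "selfadjoint b w" "square_zero w"
      and uvw: "\<And>x. u x = v x + w x" by blast
    have "good UNIV" unfolding good_UNIV_iff using \<open>?L\<close> .
    then obtain z where z: "lin z" "selfadjoint b z" "\<And>x. z (u x) = - u (z x)" "\<And>x. z (z x) = - u (u x)"
      by (elim goodE) simp
    have ?I using condition_i_iff condition_i_necessary[OF _ _ z] by blast
    moreover have ?II using condition_ii_necessary[OF _ _ _ z] op_poly_not_dvd(2)[OF two] by blast
    moreover have ?III
      using condition_iii_necessary[OF v(1,2) _ w(1,2) _ uvw] v(3) w(3) by (simp add: square_zero_def)
    ultimately show "?I \<and> ?II \<and> ?III" by blast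
  next
    assume R: "?I \<and> ?II \<and> ?III"
    have "good UNIV"
    proof (rule good_UNIV_if_primary)
      fix p :: "'a poly" assume p: "p \<in> Irr"
      consider "p = T" | "p \<in> Irr0" "p \<noteq> T" | "p \<notin> Irr0" "p \<noteq> T" by blast
      \<comment> \<open>For \<open>T\<close> and for \<open>Irr0\<close> the polynomial is its own
        opposite, and the two components coincide.\<close>
      then show "good (ssum (prim p) (prim (op_poly p)))"
      proof cases
        case 1
        have "op_poly T = T" by (simp add: op_poly_def neg_arg_simps(9))
        moreover have witt_condition by (rule condition_iii_sufficient) (use R in blast)
        ultimately show ?thesis using good_prim_T 1 ssum_self[OF subspace_prim] by simp
      next
        case 2
        have "good (prim p)"
        proof (rule good_prim_skew)
          show "irreducible p" using p by (simp add: Irr_def)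
          show "neg_arg p = p" by (rule Irr0_neg_arg(1)[OF 2(1)])
          fix k :: nat assume k: "k \<ge> 1"
          have "skew_representable (residue_field p) residue_neg (invariant_space scale u p k)
            (quadratic_form_of (invariant_form scale b u p k))" using R 2(1) k by blast
          then show "\<exists>E. obasis p k E \<and> (\<forall>e\<in>E. \<forall>h. b e (P (p ^ (k - 1) * neg_arg h) e) = - b e (P (p ^ (k - 1) * h) e))"
            unfolding condition_i_iff[OF 2(1) k] .
        qed
        then show ?thesis using Irr0_neg_arg(2)[OF 2(1)] ssum_self[OF subspace_prim] by simp
      next
        case 3
        show ?thesis by (rule condition_ii_prim[OF p op_poly_not_dvd(1)[OF two p 3]]) (use R p 3 in blast)
      qed
    qed
    then show ?L unfolding good_UNIV_iff .
  qed
qed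

end
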